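(* Let $q\ge1$ be squarefree, $f\in S_2(\Gamma_0(q))$ nonzero, $\alpha=\Re(f(z)dz)$, $\langle r\rangle=2\pi i\int_{i\infty}^r\alpha$ for $r\in\mathbb Q$, and $C_f=-16\pi^2\|f\|^2/\mathrm{vol}(\Gamma_0(q)\backslash\mathbb H)$. Let $d\mid q$, let $I\subseteq\mathbb R/\mathbb Z$ be an interval of positive length, and let $Q_d=\{a/c\in\mathbb Q/\mathbb Z:\ c\ge1,\ (a,c)=1,\ (c,q)=d\}$. Then for every $-\infty\le a_0\le b_0\le\infty$, $$\frac{\#\{a/c\in Q_d\cap I:\ c\le M,\ \langle a/c\rangle/(C_f\log c)^{1/2}\in[a_0,b_0]\}}{\#\{a/c\in Q_d\cap I:\ c\le M\}}\longrightarrow\frac1{\sqrt{2\pi}}\int_{a_0}^{b_0}e^{-t^2/2}\,dt\qquad(M\to\infty).$$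
   Context: $\|f\|^2=\int_{\Gamma_0(q)\backslash\mathbb H}y^2|f(z)|^2\,d\mu(z)$ with $d\mu=dx\,dy/y^2$, and $\mathrm{vol}$ is hyperbolic area. Since $\langle r\rangle\in i\mathbb R$ and $C_f<0$, the ratio $\langle a/c\rangle/(C_f\log c)^{1/2}$ is real (take $(C_f\log c)^{1/2}=i(|C_f|\log c)^{1/2}$). For $f$ a normalized newform, $C_f=-\frac6{\pi^2}\prod_{p\mid q}(1+p^{-1})^{-1}L(\mathrm{sym}^2f,1)$. *)

theory Defs
  imports "HOL-Analysis.Analysis" "HOL-Computational_Algebra.Squarefree"
begin

definition UHP :: "complex set" where
  "UHP = {z. Im z > 0}"

definition SL2Z :: "(int \<times> int \<times> int \<times> int) set" where
  "SL2Z = {(a,b,c,d). a*d - b*c = 1}"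

definition Gamma0 :: "nat \<Rightarrow> (int \<times> int \<times> int \<times> int) set" where
  "Gamma0 q = {(a,b,c,d). (a,b,c,d) \<in> SL2Z \<and> int q dvd c}"

definition moeb :: "int \<times> int \<times> int \<times> int \<Rightarrow> complex \<Rightarrow> complex" where
  "moeb g z = (case g of (a,b,c,d) \<Rightarrow> (of_int a * z + of_int b) / (of_int c * z + of_int d))"

definition jfac :: "int \<times> int \<times> int \<times> int \<Rightarrow> complex \<Rightarrow> complex" where
  "jfac g z = (case g of (a,b,c,d) \<Rightarrow> of_int c * z + of_int d)"

definition cusp_form2 :: "nat \<Rightarrow> (complex \<Rightarrow> complex) \<Rightarrow> bool" where
  "cusp_form2 q f \<longleftrightarrow>
     f holomorphic_on UHP \<and>
     (\<forall>g\<in>Gamma0 q. \<forall>z\<in>UHP. f (moeb g z) = (jfac g z)^2 * f z) \<and>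
     (\<forall>g\<in>SL2Z. \<forall>\<epsilon>>0. \<exists>Y. \<forall>z. Im z > Y \<longrightarrow> norm (f (moeb g z) / (jfac g z)^2) < \<epsilon>)"

definition fund_domain :: "nat \<Rightarrow> complex set \<Rightarrow> bool" where
  "fund_domain q D \<longleftrightarrow>
     D \<subseteq> UHP \<and> D \<in> sets lborel \<and>
     (AE z in lborel. z \<in> UHP \<longrightarrow> (\<exists>g\<in>Gamma0 q. moeb g z \<in> D)) \<and>
     (\<forall>g\<in>Gamma0 q. g \<noteq> (1,0,0,1) \<and> g \<noteq> (-1,0,0,-1) \<longrightarrow> D \<inter> moeb g ` D \<in> null_sets lborel)"

text \<open>Petersson norm squared: integral over D of y^2 |f|^2 d\<mu>, d\<mu> = dx dy / y^2.\<close>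
definition petersson_sq :: "complex set \<Rightarrow> (complex \<Rightarrow> complex) \<Rightarrow> real" where
  "petersson_sq D f = (LINT z:D|lborel. (Im z)^2 * (norm (f z))^2 / (Im z)^2)"

definition hyp_vol :: "complex set \<Rightarrow> real" where
  "hyp_vol D = (LINT z:D|lborel. 1 / (Im z)^2)"

definition C_const :: "complex set \<Rightarrow> (complex \<Rightarrow> complex) \<Rightarrow> real" where
  "C_const D f = - 16 * pi^2 * petersson_sq D f / hyp_vol D"

text \<open>Modular symbol <r> = 2 \<pi> i \<integral>_{i\<infinity>}^r Re(f(z) dz), integrated along the vertical
  path z = r + i t, t from \<infinity> down to 0 (path-independent since f(z)dz is closed).
  On this path Re(f(z)dz) = Re(i f(r+it)) dt = - Im f(r+it) dt, whence
  \<integral>_{\<infinity>}^0 (- Im f(r+it)) dt = \<integral>_0^\<infinity> Im f(r+it) dt.\<close>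
definition modsym :: "(complex \<Rightarrow> complex) \<Rightarrow> real \<Rightarrow> complex" where
  "modsym f r = 2 * pi * \<i> * complex_of_real (LINT t:{0<..}|lborel. Im (f (complex_of_real r + \<i> * complex_of_real t)))"

text \<open>The real number <a/c>/(C_f log c)^(1/2), with (C_f log c)^(1/2) = i (|C_f| log c)^(1/2).\<close>
definition normalized_symbol :: "real \<Rightarrow> (complex \<Rightarrow> complex) \<Rightarrow> real \<Rightarrow> int \<Rightarrow> real" where
  "normalized_symbol C f r c =
     Re (modsym f r / (\<i> * complex_of_real (sqrt (\<bar>C\<bar> * ln (real_of_int c)))))"

text \<open>Q_d \<inter> I with c \<le> M: reduced fractions a/c in Q/Z, represented by 0 \<le> a < c,
  with gcd(c,q) = d and a/c lying in the arc I = J + Z.\<close>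
definition QdI :: "nat \<Rightarrow> nat \<Rightarrow> real set \<Rightarrow> nat \<Rightarrow> (int \<times> int) set" where
  "QdI q d J M = {(a,c). 1 \<le> c \<and> c \<le> int M \<and> 0 \<le> a \<and> a < c \<and> gcd a c = 1 \<and>
       gcd c (int q) = int d \<and> (\<exists>n::int. real_of_int a / real_of_int c + real_of_int n \<in> J)}"

end

theory Submission
 imports Defs "HOL-Probability.Probability" "HOL-Complex_Analysis.Complex_Analysis"
  "HOL-Real_Asymp.Real_Asymp" "HOL-Number_Theory.Cong"
begin

text \<open>
The real symbol of \<open>a/c\<close> is the boundary value at \<open>a/c\<close> of the harmonic function \<open>F = 2 \<pi> Re G\<close>, where \<open>G' = f\<close>
and \<open>G(i\<infinity>) = 0\<close>, and \<open>y |f|\<close> is bounded. For \<open>u = exp(i \<xi> F)\<close> and a smooth weight \<open>\<psi>\<close> the horocycle average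
\<open>\<Phi>(y) = \<integral>\<psi>(x) u(x + iy) dx\<close> satisfies \<open>y\<^sup>2 \<Phi>'' = - 4 \<pi>\<^sup>2 \<xi>\<^sup>2 \<integral>\<psi> y\<^sup>2|f|\<^sup>2 u\<close> up to a harmless term. Since \<open>u\<close> varies slowly
when \<open>\<xi>\<close> is small, the invariant function \<open>y\<^sup>2|f|\<^sup>2\<close> may be replaced by its mean \<open>V\<close> over the fundamental domain,
whence \<open>\<Phi>(y)\<close> is close to \<open>y\<close> to the power \<open>4 \<pi>\<^sup>2 \<xi>\<^sup>2 V\<close> times \<open>\<integral>\<psi>\<close>. At height \<open>y = R/M\<^sup>2\<close> nearly every point \<open>x\<close> is within \<open>y\<close> of
the expected number of reduced fractions with denominator at most \<open>M\<close>, and there \<open>F(x + iy)\<close> differs from the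
symbol by \<open>O(1)\<close>. With \<open>\<xi> = t / sqrt(log M)\<close> this gives the characteristic function of the normal law, and
Levy's continuity theorem applies.
\<close>

text \<open>The step with content is the passage from \<open>y\<^sup>2|f|\<^sup>2\<close> to its
  mean. The height range \<open>y1 <= y <= 1\<close> is integrated against \<open>dy / y\<close>, so
  the relevant weight on the half plane is \<open>Im z\<close> times a slowly varying function. Put
  T = ln(1/y1). Its periodization over the group has size O(T), by counting orbit points in
  horizontal strips. As \<open>Im\<close> satisfies the mean value property on hyperbolic balls, the
  weight violates it only through the slow factor and at the two edges, by O(1 + \<xi> T) in total
  mass. Hence the Dirichlet form of the periodization on the quotient is O(T (1 + \<xi> T)), far
  below the T^2 that its size would permit, and the periodization is close to a constant. With \<xi>
  of order T^(-1/2) the deviation has order T^(3/4), up to \<epsilon> T from the cuspidal part of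
  the domain; the equation multiplies it by \<xi>^2, of order 1/T, so the error can be made as small
  as desired. Balls of one large radius, chosen after a compact part of the domain is fixed, take
  the place of a spectral gap.\<close>

abbreviation cor :: "real => complex" where "cor == complex_of_real"
abbreviation ind :: "'a set => 'a => 'b::zero_neq_one" where "ind == indicator"
abbreviation BM :: "('a::topological_space => 'b::topological_space) set" where "BM == borel_measurable borel"
abbreviation nn_lborel :: "('a::euclidean_space => ennreal) => ennreal" (binder "NL " 10) where "nn_lborel g == nn_integral lborel g"
abbreviation en :: "real => ennreal" where "en == ennreal"
abbreviation Cx :: "real => real => complex" where "Cx == Complex"
abbreviation roi :: "int => real" where "roi == real_of_int"
abbreviation lb :: "'a::euclidean_space measure" where "lb == lborel"
abbreviation evseq :: "(nat => bool) => bool" (binder "EV " 10) where "evseq P == eventually P sequentially"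

section \<open>Integer matrices acting on the upper half plane\<close>

fun mmul :: "int \<times> int \<times> int \<times> int => int \<times> int \<times> int \<times> int => int \<times> int \<times> int \<times> int" where
 "mmul (a,b,c,d) (a',b',c',d') = (a*a'+b*c', a*b'+b*d', c*a'+d*c', c*b'+d*d')"

fun minv :: "int \<times> int \<times> int \<times> int => int \<times> int \<times> int \<times> int" where
 "minv (a,b,c,d) = (d,-b,-c,a)"

fun mneg :: "int \<times> int \<times> int \<times> int => int \<times> int \<times> int \<times> int" where
 "mneg (a,b,c,d) = (-a,-b,-c,-d)"

lemma Gamma0_subset_SL2Z: "Gamma0 q <= SL2Z"
 by (auto simp: Gamma0_def)

lemma SL2Z_mmul: "g : SL2Z ==> h : SL2Z ==> mmul g h : SL2Z"
proof (cases g, cases h)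
 fix a b c d a' b' c' d'
 assume *: "g : SL2Z" "h : SL2Z" "g = (a,b,c,d)" "h = (a',b',c',d')"
 have "(a*a'+b*c') * (c*b'+d*d') - (a*b'+b*d') * (c*a'+d*c') = (a*d-b*c)*(a'*d'-b'*c')"
  by (simp add: algebra_simps)
 also have "... = 1" using * by (simp add: SL2Z_def)
 finally show ?thesis using * by (simp add: SL2Z_def)
qed

lemma SL2Z_minv: "g : SL2Z ==> minv g : SL2Z"
 by (cases g) (simp add: SL2Z_def algebra_simps)

lemma SL2Z_mneg: "g : SL2Z ==> mneg g : SL2Z"
 by (cases g) (simp add: SL2Z_def algebra_simps)

lemma Gamma0_mmul: "g : Gamma0 q ==> h : Gamma0 q ==> mmul g h : Gamma0 q"
 using SL2Z_mmul[of g h] by (cases g; cases h) (auto simp: Gamma0_def)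

lemma Gamma0_minv: "g : Gamma0 q ==> minv g : Gamma0 q"
 using SL2Z_minv[of g] by (cases g) (auto simp: Gamma0_def)

lemma Gamma0_mneg: "g : Gamma0 q ==> mneg g : Gamma0 q"
 using SL2Z_mneg[of g] by (cases g) (auto simp: Gamma0_def)

lemma minv_minv [simp]: "minv (minv g) = g"
 by (cases g) simp

lemma mneg_neq: "g : SL2Z ==> mneg g ~= g"
 by (cases g) (auto simp: SL2Z_def)

lemma mmul_assoc: "mmul (mmul g h) k = mmul g (mmul h k)"
 by (cases g; cases h; cases k) (simp add: algebra_simps)

lemma mmul_one [simp]: "mmul (1,0,0,1) g = g" "mmul g (1,0,0,1) = g"
 by (cases g; simp)+

lemma mmul_minv: "g : SL2Z ==> mmul g (minv g) = (1,0,0,1)" "g : SL2Z ==> mmul (minv g) g = (1,0,0,1)"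
 by (cases g; simp add: SL2Z_def algebra_simps)+

lemma bij_minv: "bij_betw minv (Gamma0 q) (Gamma0 q)"
 by (rule bij_betwI[where g=minv]) (auto intro: Gamma0_minv)

lemma jfac_nz:
 assumes "g : SL2Z" "z : UHP"
 shows "jfac g z ~= 0"
proof (cases g)
 case (fields a b c d)
 show ?thesis
 proof
  assume "jfac g z = 0"
  hence "of_int c * z + of_int d = 0" by (simp add: jfac_def fields)
  hence "Im (of_int c * z + of_int d) = 0" "Re (of_int c * z + of_int d) = 0" by simp_all
  hence "c = 0" "d = 0" using assms by (auto simp: UHP_def)
  thus False using assms by (simp add: SL2Z_def fields)
 qed
qed

lemma moeb_jfac: "moeb (a,b,c,d) z = (of_int a * z + of_int b) / jfac (a,b,c,d) z"
 by (simp add: moeb_def jfac_def)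

lemma moeb_diff:
 assumes "g : SL2Z" "z : UHP" "w : UHP"
 shows "moeb g z - moeb g w = (z - w) / (jfac g z * jfac g w)"
proof (cases g)
 case (fields a b c d)
 have nz: "of_int c * z + of_int d ~= 0" "of_int c * w + of_int d ~= 0"
  using jfac_nz[OF assms(1)] assms(2,3) by (simp_all add: jfac_def fields)
 have "a * d - b * c = 1" using assms(1) by (simp add: SL2Z_def fields)
 hence *: "of_int a * of_int d - of_int b * of_int c = (1::complex)"
  by (metis of_int_1 of_int_diff of_int_mult)
 have "(of_int a * z + of_int b) * (of_int c * w + of_int d) - (of_int a * w + of_int b) * (of_int c * z + of_int d)
  = (of_int a * of_int d - of_int b * of_int c) * (z - w)"
  by (simp add: algebra_simps)
 thus ?thesis using nz * by (simp add: moeb_def jfac_def fields divide_simps)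
qed

lemma Im_moeb:
 assumes "g : SL2Z" "z : UHP"
 shows "Im (moeb g z) = Im z / (norm (jfac g z))^2"
proof (cases g)
 case (fields a b c d)
 have det: "roi a * roi d - roi b * roi c = 1"
  using assms(1) unfolding SL2Z_def fields by (metis (mono_tags, lifting) case_prod_conv mem_Collect_eq of_int_1 of_int_diff of_int_mult)
 have "Im (moeb g z) = (roi a * Im z * (roi c * Re z + roi d) - (roi a * Re z + roi b) * (roi c * Im z)) / (norm (jfac g z))^2"
  by (simp add: fields moeb_def jfac_def Im_divide cmod_power2)
 also have "roi a * Im z * (roi c * Re z + roi d) - (roi a * Re z + roi b) * (roi c * Im z)
  = (roi a * roi d - roi b * roi c) * Im z"
  by (simp add: algebra_simps)
 finally show ?thesis by (simp add: det)
qed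

lemma moeb_UHP: "g : SL2Z ==> z : UHP ==> moeb g z : UHP"
 using Im_moeb[of g z] jfac_nz[of g z] by (simp add: UHP_def)

lemma jfac_mmul:
 assumes "h : SL2Z" "z : UHP"
 shows "jfac (mmul g h) z = jfac g (moeb h z) * jfac h z"
 using jfac_nz[OF assms] by (cases g; cases h) (simp add: jfac_def moeb_def field_simps)

lemma moeb_mmul:
 assumes "g : SL2Z" "h : SL2Z" "z : UHP"
 shows "moeb (mmul g h) z = moeb g (moeb h z)"
proof -
 have n: "jfac h z ~= 0" "jfac g (moeb h z) ~= 0" "jfac (mmul g h) z ~= 0"
  using jfac_nz assms moeb_UHP SL2Z_mmul by blast+
 obtain a b c d a' b' c' d' where gh: "g = (a,b,c,d)" "h = (a',b',c',d')" by (cases g; cases h) auto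
 have "moeb g (moeb h z) = (of_int a * moeb h z + of_int b) * jfac h z / (jfac g (moeb h z) * jfac h z)"
  using n by (simp add: gh moeb_jfac)
 also have "(of_int a * moeb h z + of_int b) * jfac h z = of_int a * (of_int a' * z + of_int b') + of_int b * jfac h z"
  using n by (simp add: gh moeb_jfac field_simps)
 also have "... = of_int (a*a'+b*c') * z + of_int (a*b'+b*d')"
  by (simp add: gh jfac_def algebra_simps)
 also have "jfac g (moeb h z) * jfac h z = jfac (mmul g h) z"
  by (rule jfac_mmul[symmetric]) fact+
 finally show ?thesis by (simp add: gh moeb_jfac)
qed

lemma moeb_one [simp]: "moeb (1,0,0,1) z = z"
 by (simp add: moeb_def)

lemma moeb_minv [simp]:
 assumes "g : SL2Z" "z : UHP"
 shows "moeb g (moeb (minv g) z) = z" "moeb (minv g) (moeb g z) = z"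
 using assms moeb_mmul[of g "minv g" z] moeb_mmul[of "minv g" g z] by (simp_all add: SL2Z_minv mmul_minv)

lemma moeb_mneg: "moeb (mneg g) z = moeb g z"
proof (cases g)
 case (fields a b c d)
 have "moeb (mneg g) z = (- (of_int a * z + of_int b)) / (- (of_int c * z + of_int d))"
  by (simp add: moeb_def fields add.commute)
 thus ?thesis by (simp only: minus_divide_divide) (simp add: moeb_def fields)
qed

text \<open>The condition \<open>|z - w|\<^sup>2 < \<rho> Im z Im w\<close> bounds the hyperbolic distance of \<open>z\<close> and \<open>w\<close>.\<close>
definition hnear :: "real => complex => complex => bool" where
 "hnear \<rho> z w \<longleftrightarrow> (norm (z - w))^2 < \<rho> * Im z * Im w"

abbreviation kn :: "real => complex => complex => 'b::zero_neq_one" where "kn r z w == indicator {w. hnear r z w} w"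

lemma hnear_sym: "hnear \<rho> z w = hnear \<rho> w z"
 by (simp add: hnear_def norm_minus_commute mult_ac)

text \<open>Both sides of the defining inequality acquire the factor
  \<open>1 / (|jfac g z|\<^sup>2 |jfac g w|\<^sup>2)\<close>, so the condition is invariant under
  the group.\<close>

lemma hnear_moeb:
 assumes "g : SL2Z" "z : UHP" "w : UHP"
 shows "hnear \<rho> (moeb g z) (moeb g w) = hnear \<rho> z w"
proof -
 have n: "jfac g z ~= 0" "jfac g w ~= 0" using jfac_nz assms by blast+
 have "(norm (moeb g z - moeb g w))^2 = (norm (z - w))^2 / ((norm (jfac g z))^2 * (norm (jfac g w))^2)"
  by (simp add: moeb_diff[OF assms] norm_divide norm_mult power_divide power_mult_distrib)
 moreover have "\<rho> * Im (moeb g z) * Im (moeb g w) = \<rho> * Im z * Im w / ((norm (jfac g z))^2 * (norm (jfac g w))^2)"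
  by (simp add: Im_moeb assms)
 moreover have "(norm (jfac g z))^2 * (norm (jfac g w))^2 > 0" using n by simp
 ultimately show ?thesis unfolding hnear_def
  by (simp only: divide_less_cancel) auto
qed

text \<open>Dropping the real parts leaves
  \<open>(Im z - Im w)\<^sup>2 < \<rho> * Im z * Im w\<close>; expanding the square and dividing by
  one height bounds the ratio of the heights. Inserting that ratio into the full inequality bounds
  the Euclidean distance.\<close>

lemma hnear_bounds:
 assumes "hnear \<rho> z w" "z : UHP" "w : UHP" "\<rho> > 0"
 shows "Im w < (2 + \<rho>) * Im z" "Im z < (2 + \<rho>) * Im w" "abs (Re z - Re w) <= (2 + \<rho>) * Im z"
  "norm (z - w) <= (2 + \<rho>) * Im z"
proof -
 have p: "Im z > 0" "Im w > 0" using assms by (auto simp: UHP_def)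
 have eq: "(norm (z - w))^2 = (Re z - Re w)^2 + (Im z - Im w)^2" by (simp add: cmod_power2)
 have a: "(Im z - Im w)^2 < \<rho> * Im z * Im w" using assms(1) eq unfolding hnear_def
  by (smt (verit) zero_le_power2)
 have "Im w * Im w < (2 + \<rho>) * Im z * Im w"
  using a p by (simp add: power2_eq_square algebra_simps) (smt (verit) mult_pos_pos)
 thus b: "Im w < (2 + \<rho>) * Im z" using p by simp
 have "Im z * Im z < (2 + \<rho>) * Im w * Im z"
  using a p by (simp add: power2_eq_square algebra_simps) (smt (verit) mult_pos_pos)
 thus "Im z < (2 + \<rho>) * Im w" using p by simp
 have "(norm (z - w))^2 <= \<rho> * Im z * Im w" using assms(1) unfolding hnear_def by simp
 also have "... <= \<rho> * Im z * ((2 + \<rho>) * Im z)" using b p assms(4) by (intro mult_left_mono) auto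
 also have "... <= ((2 + \<rho>) * Im z)^2" using p assms(4)
  by (simp add: power2_eq_square algebra_simps)
 finally show c: "norm (z - w) <= (2 + \<rho>) * Im z"
  using p assms(4) by - (rule power2_le_imp_le, auto)
 thus "abs (Re z - Re w) <= (2 + \<rho>) * Im z"
  using abs_Re_le_cmod[of "z - w"] by simp
qed

section \<open>Reduction and orbit counting\<close>

text \<open>Allowing \<open>a\<close> to exceed \<open>b\<close> by up to 1 keeps the bound
  nonnegative, which is all that the empty case asks for.\<close>

lemma finite_int_interval_card:
 fixes a b :: real
 shows "finite {n::int. a <= of_int n & of_int n <= b}"
  and "a <= b + 1 ==> real (card {n::int. a <= of_int n & of_int n <= b}) <= b - a + 1"
proof -
 have eq: "{n::int. a <= of_int n & of_int n <= b} = {\<lceil>a\<rceil>..\<lfloor>b\<rfloor>}"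
  by (auto simp: ceiling_le_iff le_floor_iff)
 show "finite {n::int. a <= of_int n & of_int n <= b}" by (simp add: eq)
 assume "a <= b + 1"
 have "real (card {\<lceil>a\<rceil>..\<lfloor>b\<rfloor>}) = real (nat (\<lfloor>b\<rfloor> - \<lceil>a\<rceil> + 1))" by simp
 also have "... <= b - a + 1"
 proof (cases "\<lfloor>b\<rfloor> - \<lceil>a\<rceil> + 1 >= 0")
  case True
  hence "real (nat (\<lfloor>b\<rfloor> - \<lceil>a\<rceil> + 1)) = roi (\<lfloor>b\<rfloor> - \<lceil>a\<rceil> + 1)" by simp
  thus ?thesis using of_int_floor_le[of b] le_of_int_ceiling[of a] by linarith
 next
  case False
  thus ?thesis using \<open>a <= b + 1\<close> by simp
 qed
 finally show "real (card {n::int. a <= of_int n & of_int n <= b}) <= b - a + 1" by (simp add: eq)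
qed

lemma finite_lattice_disc:
 assumes "z : UHP"
 shows "finite {(c::int,d::int). norm (of_int c * z + of_int d) <= R}"
proof -
 let ?A = "{c::int. -(R / Im z) <= of_int c & of_int c <= R / Im z}"
 let ?B = "{d::int. -(R + R / Im z * norm z) <= of_int d & of_int d <= R + R / Im z * norm z}"
 have y: "Im z > 0" using assms by (simp add: UHP_def)
 have "{(c::int,d::int). norm (of_int c * z + of_int d) <= R} <= ?A \<times> ?B"
 proof
  fix p assume "p : {(c::int,d::int). norm (of_int c * z + of_int d) <= R}"
  then obtain c d where p: "p = (c,d)" and *: "norm (of_int c * z + of_int d) <= R" by auto
  have "abs (Im (of_int c * z + of_int d)) <= R" using * abs_Im_le_cmod order_trans by blast
  hence "abs (of_int c) * Im z <= R" using y by (simp add: abs_mult)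
  hence c: "abs (of_int c) <= R / Im z" using y by (simp add: field_simps)
  have "norm (of_int d :: complex) <= norm (of_int c * z + of_int d) + norm (of_int c * z)"
   by (metis add_diff_cancel_left' norm_triangle_ineq4)
  also have "... <= R + R / Im z * norm z"
   using * mult_right_mono[OF c norm_ge_zero[of z]] by (simp add: norm_mult)
  finally have "abs (of_int d) <= R + R / Im z * norm z" by simp
  thus "p : ?A \<times> ?B" using c p by (auto simp: abs_le_iff)
 qed
 thus ?thesis using finite_int_interval_card(1) by (meson finite_SigmaI finite_subset)
qed

text \<open>A matrix minimising \<open>|cz + d|\<close> maximises the height of the image. After a
  translation into \<open>|Re| <= 1/2\<close>, minimality against one further inversion forces
  modulus at least 1, hence height at least sqrt(3)/2; the rounder bound 1/2 suffices for the
  counting.\<close>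

lemma reduction:
 assumes "z : UHP"
 shows "EX g:SL2Z. abs (Re (moeb g z)) <= 1/2 & Im (moeb g z) >= 1/2"
proof -
 let ?cd = "%g::int \<times> int \<times> int \<times> int. case g of (a,b,c,d) => (c,d)"
 \<comment> \<open>Keeping only values at most 1 makes the set finite; the identity matrix
   contributes the value 1, so the minimum over \<open>J\<close> is the minimum over the whole
   group.\<close>
 define J where "J = {norm (jfac g z) | g. g : SL2Z & norm (jfac g z) <= 1}"
 have "J <= (%(c,d). norm (of_int c * z + of_int d)) ` {(c::int,d::int). norm (of_int c * z + of_int d) <= 1}"
  by (auto simp: J_def jfac_def)
 hence "finite J" using finite_lattice_disc[OF assms, of 1] finite_surj by blast
 have one: "(1,0,0,1) : SL2Z" by (simp add: SL2Z_def)
 have "1 : J" using one by (force simp: J_def jfac_def)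
 hence ne: "J ~= {}" by blast
 obtain g where g: "g : SL2Z" "norm (jfac g z) <= 1" "norm (jfac g z) = Min J"
  using Min_in[OF \<open>finite J\<close> ne] by (auto simp: J_def)
 have min: "norm (jfac g z) <= norm (jfac h z)" if "h : SL2Z" for h
 proof (cases "norm (jfac h z) <= 1")
  case True thus ?thesis using that g \<open>finite J\<close> by (metis (mono_tags, lifting) J_def Min_le mem_Collect_eq)
 next
  case False thus ?thesis using g(2) by simp
 qed
 define n where "n = - round (Re (moeb g z))"
 define h where "h = mmul (1,n,0,1) g"
 have T: "(1,n,0,1) : SL2Z" by (simp add: SL2Z_def)
 have h: "h : SL2Z" using SL2Z_mmul[OF T g(1)] by (simp add: h_def)
 have gz: "moeb g z : UHP" using g assms moeb_UHP by blast
 have hz: "moeb h z = moeb g z + of_int n"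
  using moeb_mmul[OF T g(1) assms] by (simp add: h_def moeb_def[of "(1,n,0,1)"])
 have re: "abs (Re (moeb h z)) <= 1/2"
  using of_int_round_abs_le[of "Re (moeb g z)"] by (simp add: hz n_def abs_minus_commute)
 have hzU: "moeb h z : UHP" using h assms moeb_UHP by blast
 have S: "(0,-1,1,0) : SL2Z" by (simp add: SL2Z_def)
 have "norm (jfac g z) = norm (jfac h z)"
  using jfac_mmul[OF g(1) assms, of "(1,n,0,1)"] by (simp add: h_def jfac_def[of "(1,n,0,1)"])
 hence "norm (jfac h z) <= norm (jfac (mmul (0,-1,1,0) h) z)"
  using min SL2Z_mmul[OF S h] by simp
 also have "... = norm (moeb h z) * norm (jfac h z)"
  using jfac_mmul[OF h assms, of "(0,-1,1,0)"] by (simp add: jfac_def[of "(0,-1,1,0)"] norm_mult)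
 finally have "norm (moeb h z) >= 1" using jfac_nz[OF h assms] by simp
 hence "1 <= (Re (moeb h z))^2 + (Im (moeb h z))^2"
  by (metis cmod_power2 one_le_power)
 moreover have "(Re (moeb h z))^2 <= (1/2)^2" using re by (metis abs_le_square_iff abs_numeral abs_divide abs_one)
 ultimately have "(1/2)^2 <= (Im (moeb h z))^2" by (simp add: power2_eq_square)
 hence "Im (moeb h z) >= 1/2" using hzU by - (rule power2_le_imp_le, auto simp: UHP_def)
 thus ?thesis using h re by blast
qed

lemma same_bottom_row:
 assumes "(a,b,c,d) : SL2Z" "(a',b',c,d) : SL2Z"
 obtains n where "a' = a + n * c" "b' = b + n * d"
proof -
 have d1: "a*d - b*c = 1" "a'*d - b'*c = 1" using assms by (auto simp: SL2Z_def)
 have e: "(a'-a)*d = (b'-b)*c" using d1 by (simp add: algebra_simps)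
 define n where "n = a * (b'-b) - b * (a'-a)"
 have "n * c = a * ((b'-b)*c) - b*c*(a'-a)" by (simp add: n_def algebra_simps)
 also have "... = a * ((a'-a)*d) - b*c*(a'-a)" by (simp only: e)
 also have "... = (a'-a) * (a*d-b*c)" by (simp add: algebra_simps)
 finally have 1: "n * c = a' - a" using d1 by simp
 have "n * d = a*d*(b'-b) - b * ((a'-a)*d)" by (simp add: n_def algebra_simps)
 also have "... = a*d*(b'-b) - b * ((b'-b)*c)" by (simp only: e)
 also have "... = (b'-b) * (a*d-b*c)" by (simp add: algebra_simps)
 finally have "n * d = b' - b" using d1 by simp
 with 1 show ?thesis using that[of n] by simp
qed

text \<open>Height at least \<open>Y\<close> means
  \<open>|cz + d|\<^sup>2 <= Im z / Y = r\<^sup>2\<close>, so it suffices to count bottom rows: the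
  rows with \<open>c = 0\<close> are two in number, otherwise \<open>|c| <= r / Im z\<close> and
  \<open>d\<close> lies in an interval of length \<open>2 r\<close>. Matrices with a common bottom
  row differ by integer translations, at most \<open>X1 - X0 + 1\<close> of which stay in the
  strip.\<close>

lemma orbit_count_reduced:
 assumes z: "Im z >= 1/2" and Y: "0 < Y" "Y <= 1" and X: "X0 <= X1"
 shows "finite {g\<in>SL2Z. X0 <= Re (moeb g z) & Re (moeb g z) <= X1 & Im (moeb g z) >= Y}"
  (is "finite ?A")
  and "real (card {g\<in>SL2Z. X0 <= Re (moeb g z) & Re (moeb g z) <= X1 & Im (moeb g z) >= Y}) <= 30 * (X1 - X0 + 1) / Y"
proof -
 have zU: "z : UHP" using z by (simp add: UHP_def)
 let ?y = "Im z"
 define r where "r = sqrt (?y / Y)"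
 have r: "r > 0" "r^2 = ?y / Y" using z Y by (auto simp: r_def)
 define cs where "cs = {c::int. -(r/?y) <= of_int c & of_int c <= r/?y} - {0}"
 define ds where "ds = (%c::int. {d::int. - r - of_int c * Re z <= of_int d & of_int d <= r - of_int c * Re z})"
 define P where "P = {(0::int,1::int),(0,-1)} \<union> (SIGMA c:cs. ds c)"
 have fin: "finite cs" "!!c. finite (ds c)" using finite_int_interval_card(1) by (auto simp: cs_def ds_def)
 have finP: "finite P" using fin by (auto simp: P_def)
 define bot where "bot = (%g::int \<times> int \<times> int \<times> int. case g of (a,b,c,d) => (c,d))"
 have botP: "bot g : P" if "g : ?A" for g
 proof (cases g)
  case (fields a b c d)
  have g: "g : SL2Z" and "Im (moeb g z) >= Y" using that by auto
  hence "?y / (norm (jfac g z))^2 >= Y" using Im_moeb[OF g zU] by simp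
  hence "(norm (jfac g z))^2 <= ?y / Y" using jfac_nz[OF g zU] Y by (simp add: field_simps)
  hence "norm (jfac g z) <= r" using r by (metis power2_le_imp_le less_imp_le)
  hence j: "norm (of_int c * z + of_int d) <= r" by (simp add: jfac_def fields)
  have "abs (Im (of_int c * z + of_int d)) <= r" using j abs_Im_le_cmod order_trans by blast
  hence "abs (of_int c) * ?y <= r" using z by (simp add: abs_mult)
  hence c: "abs (of_int c) <= r / ?y" using z by (simp add: field_simps)
  have "abs (Re (of_int c * z + of_int d)) <= r" using j abs_Re_le_cmod order_trans by blast
  hence d: "abs (of_int c * Re z + of_int d) <= r" by simp
  show ?thesis
  proof (cases "c = 0")
   case True
   hence "a * d = 1" using g by (simp add: SL2Z_def fields)
   hence "d = 1 \<or> d = -1" by (metis mult.commute zmult_eq_1_iff)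
   thus ?thesis using True by (auto simp: P_def bot_def fields)
  next
   case False
   thus ?thesis using c d by (auto simp: P_def bot_def fields cs_def ds_def abs_le_iff)
  qed
 qed
 have fib: "finite {g\<in>?A. bot g = p} & real (card {g\<in>?A. bot g = p}) <= X1 - X0 + 1" for p
 proof (cases "{g\<in>?A. bot g = p} = {}")
  case True thus ?thesis using X unfolding True by simp
 next
  case False
  then obtain g0 where g0: "g0 : ?A" "bot g0 = p" by blast
  obtain a0 b0 c d where f0: "g0 = (a0,b0,c,d)" by (cases g0)
  have g0S: "(a0,b0,c,d) : SL2Z" using g0 f0 by simp
  let ?x = "Re (moeb g0 z)"
  let ?N = "{n::int. X0 - ?x <= of_int n & of_int n <= X1 - ?x}"
  have sub: "{g\<in>?A. bot g = p} <= (%n. mmul (1,n,0,1) g0) ` ?N"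
  proof
   fix g assume g: "g : {g\<in>?A. bot g = p}"
   obtain a b where f: "g = (a,b,c,d)" using g g0 f0 by (cases g) (auto simp: bot_def)
   have gS: "(a,b,c,d) : SL2Z" using g f by simp
   obtain n where n: "a = a0 + n * c" "b = b0 + n * d" using same_bottom_row[OF g0S gS] .
   have e: "g = mmul (1,n,0,1) g0" by (simp add: f f0 n)
   have T: "(1,n,0,1) : SL2Z" by (simp add: SL2Z_def)
   have "moeb g z = moeb g0 z + of_int n"
    unfolding e using moeb_mmul[OF T _ zU, of g0] g0S f0 by (simp add: moeb_def[of "(1,n,0,1)"])
   hence "n : ?N" using g by auto
   thus "g : (%n. mmul (1,n,0,1) g0) ` ?N" using e by blast
  qed
  have fN: "finite ?N" by (rule finite_int_interval_card)
  have "real (card {g\<in>?A. bot g = p}) <= real (card ?N)"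
   using card_mono[OF finite_imageI[OF fN] sub] card_image_le[OF fN, of "%n. mmul (1,n,0,1) g0"] by linarith
  also have "... <= X1 - X0 + 1" using finite_int_interval_card(2)[of "X0 - ?x" "X1 - ?x"] X by simp
  finally show ?thesis using finite_subset[OF sub] fN by blast
 qed
 have AU: "?A = (\<Union>p\<in>P. {g\<in>?A. bot g = p})" using botP by blast
 define fb where "fb = (%p. {g\<in>?A. bot g = p})"
 have fb: "finite (fb p)" "real (card (fb p)) <= X1 - X0 + 1" for p
  using fib[of p] unfolding fb_def by blast+
 have AU': "?A = (\<Union>p\<in>P. fb p)" using AU unfolding fb_def .
 show "finite ?A" unfolding AU' using finP fb by blast
 have "card ?A <= (\<Sum>p\<in>P. card (fb p))"
  unfolding AU' by (rule card_UN_le[OF finP])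
 hence "real (card ?A) <= real (\<Sum>p\<in>P. card (fb p))" by (rule of_nat_mono)
 also have "... = (\<Sum>p\<in>P. real (card (fb p)))" by (rule of_nat_sum)
 also have "... <= real (card P) * (X1 - X0 + 1)"
  by (rule sum_bounded_above) (rule fb)
 finally have A: "real (card ?A) <= real (card P) * (X1 - X0 + 1)" .
 have "real (card P) <= 2 + real (card (SIGMA c:cs. ds c))"
  unfolding P_def using card_Un_le[of "{(0::int,1::int),(0,-1)}" "SIGMA c:cs. ds c"] by (simp add: card_insert_if)
 also have "card (SIGMA c:cs. ds c) = (\<Sum>c\<in>cs. card (ds c))" using fin by simp
 also have "real (\<Sum>c\<in>cs. card (ds c)) <= real (card cs) * (2 * r + 1)"
 proof -
  have "real (card (ds c)) <= 2 * r + 1" for c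
   unfolding ds_def using finite_int_interval_card(2)[of "- r - of_int c * Re z" "r - of_int c * Re z"] r by simp
  thus ?thesis unfolding of_nat_sum by (intro sum_bounded_above)
 qed
 also have "real (card cs) * (2 * r + 1) <= 28 / Y"
 proof (cases "cs = {}")
  case True thus ?thesis using Y by simp
 next
  case False
  then obtain c where c: "c : cs" by blast
  hence "1 <= abs (roi c)" by (auto simp: cs_def)
  \<comment> \<open>Once some \<open>c\<close> is nonzero, \<open>r >= Im z >= 1/2\<close>. This
    absorbs the rounding terms: \<open>2 (r/y) + 1 <= 3 r/y\<close> and
    \<open>2 r + 1 <= 4 r\<close>, whose product is
    \<open>12 r\<^sup>2 / y = 12 / Y\<close>.\<close>
  hence ry: "r / ?y >= 1" using c by (auto simp: cs_def abs_if split: if_splits)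
  have "card cs <= card {c::int. -(r/?y) <= of_int c & of_int c <= r/?y}"
   unfolding cs_def by (intro card_mono finite_int_interval_card) auto
  hence "real (card cs) <= 2 * (r / ?y) + 1"
   using finite_int_interval_card(2)[of "-(r/?y)" "r/?y"] ry by linarith
  hence c1: "real (card cs) <= 3 * (r / ?y)" using ry by linarith
  have "r >= ?y" using ry z by (simp add: field_simps)
  hence r2: "1 <= 2 * r" using z by linarith
  have "real (card cs) * (2 * r + 1) <= (3 * (r / ?y)) * (4 * r)"
   using c1 r2 r z by (intro mult_mono) auto
  also have "... = 12 * r^2 / ?y" by (simp add: power2_eq_square)
  also have "... = 12 / Y" using r z by (simp add: field_simps)
  also have "... <= 28 / Y" using Y by (simp add: divide_right_mono)
  finally show ?thesis .
 qed
 finally have "real (card P) <= 2 + 28 / Y" by simp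
 also have "... <= 30 / Y" using Y by (simp add: field_simps)
 finally have "real (card P) * (X1 - X0 + 1) <= 30 / Y * (X1 - X0 + 1)" using X by (intro mult_right_mono) auto
 thus "real (card ?A) <= 30 * (X1 - X0 + 1) / Y" using A by simp
qed

text \<open>Right multiplication by the reducing matrix is a bijection between the sets counted for
  \<open>z\<close> and for its reduced image, so the bound holds uniformly in
  \<open>z\<close>.\<close>

lemma orbit_count:
 assumes z: "z : UHP" and Y: "0 < Y" "Y <= 1" and X: "X0 <= X1"
 shows "finite {g\<in>SL2Z. X0 <= Re (moeb g z) & Re (moeb g z) <= X1 & Im (moeb g z) >= Y}"
  and "real (card {g\<in>SL2Z. X0 <= Re (moeb g z) & Re (moeb g z) <= X1 & Im (moeb g z) >= Y}) <= 30 * (X1 - X0 + 1) / Y"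
proof -
 obtain s where s: "s : SL2Z" "Im (moeb s z) >= 1/2" using reduction[OF z] by blast
 define w where "w = moeb s z"
 have zw: "z = moeb (minv s) w" using s z by (simp add: w_def)
 have wU: "w : UHP" using s z moeb_UHP by (simp add: w_def)
 let ?A = "%z. {g\<in>SL2Z. X0 <= Re (moeb g z) & Re (moeb g z) <= X1 & Im (moeb g z) >= Y}"
 have eq: "?A z = (%g. mmul g s) ` ?A w"
 proof (intro set_eqI iffI)
  fix g assume g: "g : ?A z"
  have "g = mmul (mmul g (minv s)) s" using s by (simp add: mmul_assoc mmul_minv)
  moreover have "mmul g (minv s) : ?A w"
   using g moeb_mmul[of g "minv s" w] SL2Z_minv[OF s(1)] wU zw SL2Z_mmul by auto
  ultimately show "g : (%g. mmul g s) ` ?A w" by blast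
 next
  fix g assume "g : (%g. mmul g s) ` ?A w"
  then obtain h where h: "h : ?A w" "g = mmul h s" by blast
  thus "g : ?A z" using moeb_mmul[of h s z] s z SL2Z_mmul by (auto simp: w_def)
 qed
 note c = orbit_count_reduced[OF s(2) Y X, folded w_def]
 show "finite (?A z)" unfolding eq using c(1) by blast
 have "card (?A z) <= card (?A w)" unfolding eq by (rule card_image_le[OF c(1)])
 thus "real (card (?A z)) <= 30 * (X1 - X0 + 1) / Y" using c(2) by linarith
qed

text \<open>The coset \<open>\<Gamma>\<^sub>0(q) g\<close> is determined by the bottom row of \<open>g\<close> modulo \<open>q\<close>.\<close>
definition ckey :: "nat => int \<times> int \<times> int \<times> int => int \<times> int" where
 "ckey q g = (case g of (a,b,c,d) => (c mod int q, d mod int q))"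

lemma ckey_coset:
 assumes "q >= 1" "g : SL2Z" "h : SL2Z" "ckey q g = ckey q h"
 shows "mmul g (minv h) : Gamma0 q"
proof -
 obtain a b c d a' b' c' d' where gh: "g = (a,b,c,d)" "h = (a',b',c',d')" by (cases g; cases h) auto
 have "c mod int q = c' mod int q" "d mod int q = d' mod int q" using assms(4) by (auto simp: ckey_def gh)
 hence "int q dvd c - c'" "int q dvd d - d'" by (metis mod_eq_dvd_iff)+
 hence "int q dvd (c - c') * d' - (d - d') * c'" by simp
 also have "(c - c') * d' - (d - d') * c' = c*d' - d*c'" by (simp add: algebra_simps)
 finally have "int q dvd c*d' - d*c'" .
 thus ?thesis using SL2Z_mmul[OF assms(2) SL2Z_minv[OF assms(3)]] by (simp add: gh Gamma0_def)
qed

lemma finite_ckey: "q >= 1 ==> finite (ckey q ` A)"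
proof -
 assume q: "q >= 1"
 have "ckey q ` A <= {0..<int q} \<times> {0..<int q}"
  using q by (auto simp: ckey_def)
 thus ?thesis by (rule finite_subset) simp
qed

lemma finite_coset_reps:
 assumes "q >= 1"
 obtains R where "finite R" "R <= SL2Z" "!!g. g : SL2Z ==> EX r:R. mmul g (minv r) : Gamma0 q"
proof -
 define rep where "rep = (%k. SOME g. g : SL2Z & ckey q g = k)"
 have rep: "rep k : SL2Z & ckey q (rep k) = k" if "k : ckey q ` SL2Z" for k
  unfolding rep_def by (rule someI_ex) (use that in blast)
 show ?thesis
 proof (rule that[of "rep ` ckey q ` SL2Z"])
  show "finite (rep ` ckey q ` SL2Z)" using finite_ckey[OF assms] by blast
  show "rep ` ckey q ` SL2Z <= SL2Z" using rep by blast
  fix g assume "g : SL2Z"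
  thus "EX r:rep ` ckey q ` SL2Z. mmul g (minv r) : Gamma0 q"
   using rep ckey_coset[OF assms] by (intro bexI[of _ "rep (ckey q g)"]) auto
 qed
qed

section \<open>Hyperbolic measure\<close>

text \<open>The indicator removes all mass off the half plane, so facts about points of
  \<open>UHP\<close> hold almost everywhere and integrands may be arbitrary elsewhere.\<close>

definition hyp :: "complex measure" where
 "hyp = density lb (%z. ind UHP z * en (1 / (Im z)^2))"

abbreviation nn_hyp :: "(complex => ennreal) => ennreal" (binder "NN " 10) where "nn_hyp g == nn_integral hyp g"

lemma UHP_borel [measurable]: "UHP : sets borel"
proof -
 have "{z\<in>space borel. 0 < Im z} : sets borel" by measurable
 thus ?thesis by (simp add: UHP_def)
qed

lemma sets_hyp [simp, measurable_cong]: "sets hyp = sets borel"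
 by (simp add: hyp_def)

lemma space_hyp [simp]: "space hyp = UNIV"
 by (simp add: hyp_def)

lemma Re_Im_measurable [measurable]:
 "Re : BM" "Im : BM"
 by (intro borel_measurable_continuous_onI continuous_intros)+

lemma nn_integral_hyp_lborel:
 "P : BM ==> nn_integral hyp P = (NL z. ind UHP z * en (1 / (Im z)^2) * P z)"
 unfolding hyp_def by (rule nn_integral_density) simp_all

lemma lborel_complex: "distr (lb \<Otimes>\<^sub>M lb) borel (%(x,y). Cx x y) = (lb :: complex measure)"
proof (rule lborel_eqI[symmetric])
 have meas [measurable]: "(%(x,y). Cx x y) : borel_measurable (lb \<Otimes>\<^sub>M lb)"
  unfolding Complex_eq by measurable
 fix l u :: complex assume lu: "!!b. b : Basis ==> l \<bullet> b <= u \<bullet> b"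
 have l: "Re l <= Re u" "Im l <= Im u" using lu[of 1] lu[of \<i>] by (auto simp: Basis_complex_def)
 have pre: "(%(x,y). Cx x y) -` box l u \<inter> space (lb \<Otimes>\<^sub>M lb) = {Re l<..<Re u} \<times> {Im l<..<Im u}"
  by (auto simp: in_box_complex_iff space_pair_measure)
 have "emeasure (distr (lb \<Otimes>\<^sub>M lb) borel (%(x,y). Cx x y)) (box l u)
   = emeasure (lb \<Otimes>\<^sub>M lb) ({Re l<..<Re u} \<times> {Im l<..<Im u})"
  by (subst emeasure_distr) (simp_all add: pre)
 also have "... = emeasure lb {Re l<..<Re u} * emeasure lb {Im l<..<Im u}"
  by (rule lborel.emeasure_pair_measure_Times) auto
 also have "... = en (Re u - Re l) * en (Im u - Im l)" using l by simp
 also have "... = en (\<Prod>b\<in>Basis. (u - l) \<bullet> b)"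
  using l by (simp add: Basis_complex_def ennreal_mult)
 finally show "emeasure (distr (lb \<Otimes>\<^sub>M lb) borel (%(x,y). Cx x y)) (box l u) = en (\<Prod>b\<in>Basis. (u - l) \<bullet> b)" .
qed simp

lemma Complex_measurable [measurable (raw)]:
 assumes [measurable]: "f : borel_measurable M" "g : borel_measurable M"
 shows "(%x. Cx (f x) (g x)) : borel_measurable M"
 unfolding Complex_eq by measurable

lemma nn_integral_lborel_complex:
 assumes [measurable]: "P : BM"
 shows "nn_integral lb P = (NL y. \<integral>\<^sup>+x. P (Cx x y) \<partial>lb)"
proof -
 have meas [measurable]: "(%(x,y). Cx x y) : measurable (lb \<Otimes>\<^sub>M lb) borel"
  unfolding Complex_eq by measurable
 have "nn_integral lb P = nn_integral (distr (lb \<Otimes>\<^sub>M lb) borel (%(x,y). Cx x y)) P"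
  by (simp add: lborel_complex)
 also have "... = (\<integral>\<^sup>+p. P (case p of (x,y) => Cx x y) \<partial>(lb \<Otimes>\<^sub>M lb))"
  by (rule nn_integral_distr[OF meas]) measurable
 also have "... = (NL y. \<integral>\<^sup>+x. P (case (x,y) of (x,y) => Cx x y) \<partial>lb)"
  by (rule lborel_pair.nn_integral_snd[symmetric]) measurable
 finally show ?thesis by simp
qed

lemma nn_integral_hyp:
 assumes [measurable]: "P : BM"
 shows "nn_integral hyp P = (NL y. ind {0<..} y * en (1 / y^2) * (NL x. P (Cx x y)))"
proof -
 have "nn_integral hyp P = (NL y. \<integral>\<^sup>+x. ind UHP (Cx x y) * en (1 / (Im (Cx x y))^2) * P (Cx x y) \<partial>lb)"
  by (subst nn_integral_hyp_lborel, simp, rule nn_integral_lborel_complex) measurable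
 also have "... = (NL y. ind {0<..} y * en (1 / y^2) * (NL x. P (Cx x y)))"
 proof (intro nn_integral_cong)
  fix y :: real
  have "ind UHP (Cx x y) = (ind {0<..} y :: ennreal)" for x by (simp add: UHP_def indicator_def)
  hence "(NL x. ind UHP (Cx x y) * en (1 / (Im (Cx x y))^2) * P (Cx x y))
   = (NL x. (ind {0<..} y * en (1 / y^2)) * P (Cx x y))" by simp
  also have "... = (ind {0<..} y * en (1 / y^2)) * (NL x. P (Cx x y))"
   by (rule nn_integral_cmult) measurable
  finally show "(NL x. ind UHP (Cx x y) * en (1 / (Im (Cx x y))^2) * P (Cx x y))
   = ind {0<..} y * en (1 / y^2) * (NL x. P (Cx x y))" .
 qed
 finally show ?thesis .
qed

text \<open>Substitution is available on compact intervals; the sets \<open>I n\<close> exhaust the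
  positive axis and both sides are continuous along increasing unions. The density
  \<open>dy / y\<close> is what turns dilations into translations.\<close>

lemma distr_exp_lborel: "distr lb borel exp = density lb (%y::real. ind {0<..} y * en (1 / y))"
proof (rule measure_eqI)
 let ?D = "(density lb (%y::real. ind {0<..} y * en (1 / y)))"
 fix A :: "real set" assume "A : sets (distr lb borel exp)"
 hence A [measurable]: "A : sets borel" by simp
 define I where "I = (%n::nat. {exp (- real n)..exp (real n)})"
 have step: "(NL y. ind (A \<inter> I n) y * en (1 / y)) = emeasure lb (exp -` A \<inter> {- real n..real n})" for n
 proof -
  have "(NL y. ind (A \<inter> I n) y * en (1 / y))
    = (NL y. en (ind A y * (1 / y)) * ind {exp (- real n)..exp (real n)} y)"
   by (intro nn_integral_cong) (auto simp: I_def indicator_def)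
  also have "... = (NL y. en (ind A y * (1 / y) * ind {exp (- real n)..exp (real n)} y))"
   by (intro nn_integral_cong) (auto simp: indicator_def)
  also have "... = (NL x. en (ind A (exp x) * (1 / exp x) * exp x * ind {- real n..real n} x))"
   by (rule nn_integral_substitution) (auto simp: set_borel_measurable_def intro!: derivative_eq_intros continuous_intros)
  also have "... = (NL x. ind (exp -` A \<inter> {- real n..real n}) x)"
   by (intro nn_integral_cong) (auto simp: indicator_def)
  also have "... = emeasure lb (exp -` A \<inter> {- real n..real n})"
  proof (rule nn_integral_indicator)
   have "exp -` A \<inter> space borel : sets (borel :: real measure)" by measurable
   thus "exp -` A \<inter> {- real n..real n} : sets lb" by (auto intro: sets.Int)
  qed
  finally show ?thesis .
 qed
 have eA: "exp -` A : sets (lb :: real measure)"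
 proof -
  have "exp -` A \<inter> space borel : sets (borel :: real measure)" by measurable
  thus ?thesis by simp
 qed
 have incI: "incseq I" unfolding I_def incseq_def by auto
 have UI: "(\<Union>n. I n) = {0<..}"
 proof (intro equalityI subsetI)
  fix y assume "y : (\<Union>n. I n)" thus "y : {0<..}" by (auto simp: I_def intro: less_le_trans[OF exp_gt_zero])
 next
  fix y :: real assume y: "y : {0<..}"
  obtain n :: nat where n: "abs (ln y) <= real n" using real_arch_simple by blast
  hence "exp (- real n) <= exp (ln y)" "exp (ln y) <= exp (real n)" by (auto simp: abs_le_iff)
  hence "y : I n" using y by (simp only: I_def exp_ln greaterThan_iff atLeastAtMost_iff)
  thus "y : (\<Union>n. I n)" by blast
 qed
 have "emeasure ?D A
   = emeasure ?D (\<Union>n. A \<inter> I n)"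
 proof -
  have "emeasure ?D A = (NL y. ind {0<..} y * en (1 / y) * ind A y)"
   by (rule emeasure_density) auto
  also have "... = (NL y. ind {0<..} y * en (1 / y) * ind (\<Union>n. A \<inter> I n) y)"
   using UI by (intro nn_integral_cong) (auto simp: indicator_def)
  also have "... = emeasure ?D (\<Union>n. A \<inter> I n)"
   by (rule emeasure_density[symmetric]) (auto simp: I_def)
  finally show ?thesis .
 qed
 also have "... = (SUP n. emeasure ?D (A \<inter> I n))"
 proof (intro SUP_emeasure_incseq[symmetric])
  show "incseq (%n. A \<inter> I n)" using incI unfolding incseq_def by blast
 qed (auto simp: I_def)
 also have "... = (SUP n. emeasure lb (exp -` A \<inter> {- real n..real n}))"
 proof (intro SUP_cong refl)
  fix n
  have "emeasure ?D (A \<inter> I n)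
   = (NL y. ind {0<..} y * en (1 / y) * ind (A \<inter> I n) y)"
   by (rule emeasure_density) (auto simp: I_def)
  also have "... = (NL y. ind (A \<inter> I n) y * en (1 / y))"
   using UI by (intro nn_integral_cong) (auto simp: indicator_def)
  finally show "emeasure ?D (A \<inter> I n)
   = emeasure lb (exp -` A \<inter> {- real n..real n})" using step by simp
 qed
 also have "... = emeasure lb (\<Union>n. exp -` A \<inter> {- real n..real n})"
  using eA by (intro SUP_emeasure_incseq) (auto simp: incseq_def)
 also have "(\<Union>n. exp -` A \<inter> {- real n..real n}) = exp -` A"
 proof -
  have "EX n::nat. - real n <= x & x <= real n" for x :: real
   using real_arch_simple[of "abs x"] by (smt (verit))
  thus ?thesis by auto
 qed
 also have "emeasure lb (exp -` A) = emeasure (distr lb borel exp) A"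
  by (subst emeasure_distr) auto
 finally show "emeasure (distr lb borel exp) A = emeasure ?D A" ..
qed simp

lemma nn_integral_exp:
 assumes [measurable]: "h : BM"
 shows "(NL y. ind {0<..} y * en (1 / y) * h y) = (NL l. h (exp l :: real))"
proof -
 have "(NL l. h (exp l)) = nn_integral (distr lb borel exp) h"
  by (rule nn_integral_distr[symmetric]) auto
 also have "... = (NL y. ind {0<..} y * en (1 / y) * h y)"
  unfolding distr_exp_lborel by (rule nn_integral_density) auto
 finally show ?thesis ..
qed

text \<open>In the coordinates z = e^l (m + i) the measure dx dy / y^2 becomes dm dl, so dilations
  act as translations of l and the invariance of hyperbolic measure reduces to that of Lebesgue
  measure.\<close>

lemma nn_integral_hyp_ml:
 assumes [measurable]: "P : BM"
 shows "nn_integral hyp P = (NL l. \<integral>\<^sup>+m. P (Cx (exp l * m) (exp l)) \<partial>lb)"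
proof -
 have "nn_integral hyp P = (NL y. ind {0<..} y * en (1 / y^2) * (NL x. P (Cx x y)))"
  by (rule nn_integral_hyp) fact
 also have "... = (NL y. ind {0<..} y * en (1 / y) * (NL m. P (Cx (y * m) y)))"
 proof (intro nn_integral_cong)
  fix y :: real
  show "ind {0<..} y * en (1 / y^2) * (NL x. P (Cx x y))
    = ind {0<..} y * en (1 / y) * (NL m. P (Cx (y * m) y))"
  proof (cases "y > 0")
   case True
   have "(NL x. P (Cx x y)) = en (abs y) * (NL m. P (Cx (0 + y * m) y))"
    by (rule nn_integral_real_affine) (use True in auto)
   moreover have "en (1 / y^2) * en y = en (1 / y)"
    using True by (subst ennreal_mult[symmetric]) (auto simp: power2_eq_square)
   ultimately show ?thesis using True by (simp add: mult.assoc[symmetric])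
  qed simp
 qed
 also have "... = (NL l. \<integral>\<^sup>+m. P (Cx (exp l * m) (exp l)) \<partial>lb)"
  by (rule nn_integral_exp) measurable
 finally show ?thesis .
qed

lemma nn_integral_lborel_reflect:
 fixes h :: "real => ennreal"
 assumes "h : BM"
 shows "(NL x. h (t - x)) = nn_integral lb h" "(NL x. h (x + t)) = nn_integral lb h"
 using nn_integral_real_affine[OF assms, of "-1" t] nn_integral_real_affine[OF assms, of 1 t]
 by (simp_all add: add.commute)

lemma hyp_translate:
 assumes [measurable]: "P : BM"
 shows "(NN z. P (z + cor b)) = nn_integral hyp P"
proof -
 have "Cx x y + cor b = Cx (x + b) y" for x y by (simp add: complex_eq_iff)
 thus ?thesis
  by (simp add: nn_integral_hyp nn_integral_lborel_reflect(2)[of "%x. P (Cx x _)"])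
qed

lemma hyp_scale:
 assumes [measurable]: "P : BM" and "k > 0"
 shows "(NN z. P (cor k * z)) = nn_integral hyp P"
proof -
 have "cor k * Cx (exp l * m) (exp l) = Cx (exp (l + ln k) * m) (exp (l + ln k))" for l m
  using assms(2) by (simp add: complex_eq_iff exp_add)
 thus ?thesis
  by (simp add: nn_integral_hyp_ml nn_integral_lborel_reflect(2)[of "%l. \<integral>\<^sup>+m. P (Cx (exp l * m) (exp l)) \<partial>lb"])
qed

text \<open>In the coordinates \<open>z = e\<^sup>l (m + i)\<close> the inversion is the shear
  \<open>(m, l) \<mapsto> (-m, -l - ln (1 + m\<^sup>2))\<close>.\<close>
lemma hyp_inversion:
 assumes [measurable]: "P : BM"
 shows "(NN z. P (- 1 / z)) = nn_integral hyp P"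
proof -
 define H where "H = (%m l. P (Cx (exp l * m) (exp l)))"
 have [measurable]: "(%p. H (fst p) (snd p)) : borel_measurable (lb \<Otimes>\<^sub>M lb)"
  "(%p. H (snd p) (fst p)) : borel_measurable (lb \<Otimes>\<^sub>M lb)"
  unfolding H_def by measurable
 have [measurable]: "(%l. H m l) : BM" "(%m. \<integral>\<^sup>+l. H m l \<partial>lb) : BM" for m
  unfolding H_def by measurable
 have e: "P (- 1 / Cx (exp l * m) (exp l)) = H (-m) (- ln (1 + m^2) - l)" for m l
 proof -
  have p: "1 + m^2 > 0" by (simp add: add_pos_nonneg)
  hence p': "1 + m^2 ~= 0" by simp
  have E: "exp (- ln (1 + m^2) - l) = 1 / ((1 + m^2) * exp l)"
   using p by (simp add: exp_diff exp_minus field_simps)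
  have nz: "(exp l * m)^2 + (exp l)^2 = (exp l)^2 * (1 + m^2)" by (simp add: algebra_simps power_mult_distrib)
  have "- 1 / Cx (exp l * m) (exp l) = Cx (exp (- ln (1 + m^2) - l) * (-m)) (exp (- ln (1 + m^2) - l))"
  proof -
   have "exp l * m / ((exp l)^2 * (1 + m^2)) = m / ((1 + m^2) * exp l)" "exp l / ((exp l)^2 * (1 + m^2)) = 1 / ((1 + m^2) * exp l)"
    using p' by (simp_all add: power2_eq_square[of "exp l"])
   thus ?thesis unfolding E by (simp add: complex_eq_iff Re_divide Im_divide nz)
  qed
  thus ?thesis by (simp add: H_def)
 qed
 have "(NN z. P (- 1 / z)) = (NL l. \<integral>\<^sup>+m. H (-m) (- ln (1 + m^2) - l) \<partial>lb)"
  by (subst nn_integral_hyp_ml) (measurable, simp only: e)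
 also have "... = (NL m. \<integral>\<^sup>+l. H (-m) (- ln (1 + m^2) - l) \<partial>lb)"
  unfolding H_def by (intro lborel_pair.Fubini') measurable
 also have "... = (NL m. \<integral>\<^sup>+l. H (0 - m) l \<partial>lb)"
 proof (rule nn_integral_cong)
  fix m :: real
  show "(NL l. H (-m) (- ln (1 + m^2) - l)) = (NL l. H (0 - m) l)"
   by (subst nn_integral_lborel_reflect(1)[of "%l. H (-m) l"]) auto
 qed
 also have "... = (NL m. \<integral>\<^sup>+l. H m l \<partial>lb)"
  by (rule nn_integral_lborel_reflect(1)[of "%m. \<integral>\<^sup>+l. H m l \<partial>lb"]) measurable
 also have "... = (NL l. \<integral>\<^sup>+m. H m l \<partial>lb)"
  unfolding H_def by (intro lborel_pair.Fubini') measurable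
 also have "... = nn_integral hyp P"
  by (subst nn_integral_hyp_ml) (simp_all add: H_def)
 finally show ?thesis .
qed

lemma moeb_measurable [measurable]: "moeb g : BM"
 by (cases g) (simp add: moeb_def[abs_def])

lemma AE_hyp_UHP: "AE z in hyp. z : UHP"
 unfolding hyp_def by (subst AE_density) (auto simp: indicator_def)

text \<open>For nonzero \<open>c\<close> the decomposition
  \<open>gz = a/c - 1 / (c\<^sup>2 (z + d/c))\<close> is a translation, the inversion, a dilation
  and a translation, each of which preserves the measure. For \<open>c = 0\<close> the map is a
  translation.\<close>

lemma hyp_moeb:
 assumes g: "g : SL2Z" and P [measurable]: "P : BM"
 shows "(NN z. P (moeb g z)) = nn_integral hyp P"
proof (cases g)
 case (fields a b c d)
 have det: "a * d - b * c = 1" using g by (simp add: SL2Z_def fields)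
 show ?thesis
 proof (cases "c = 0")
  case True
  hence ad: "a * d = 1" using det by simp
  hence "a = 1 & d = 1 \<or> a = -1 & d = -1" by (rule zmult_eq_1_iff[THEN iffD1])
  hence "moeb g z = z + cor (roi (a*b))" for z
   using True by (auto simp: moeb_def fields)
  thus ?thesis using hyp_translate[OF P, of "roi (a*b)"] by simp
 next
  case False
  define P1 where "P1 = (%w. P (w + cor (roi a / roi c)))"
  define P2 where "P2 = (%w. P1 (cor (1 / (roi c)^2) * w))"
  define P3 where "P3 = (%w. P2 (-1 / w))"
  have [measurable]: "P1 : BM" unfolding P1_def by measurable
  have [measurable]: "P2 : BM" unfolding P2_def by measurable
  have [measurable]: "P3 : BM" unfolding P3_def by measurable
  have e: "P (moeb g z) = P3 (z + cor (roi d / roi c))" if z: "z : UHP" for z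
  proof -
   have nz: "of_int c * z + of_int d ~= 0" using jfac_nz[OF g z] by (simp add: jfac_def fields)
   have dd: "of_int a * of_int d - of_int b * of_int c = (1::complex)"
    using det by (metis of_int_1 of_int_diff of_int_mult)
   have c0: "(of_int c :: complex) ~= 0" using False by simp
   have s: "z + of_int d / of_int c = (of_int c * z + of_int d) / of_int c" using c0 by (simp add: field_simps)
   have "cor (1 / (roi c)^2) * (-1 / (z + cor (roi d / roi c))) + cor (roi a / roi c)
    = of_int a / of_int c - 1 / (of_int c * (of_int c * z + of_int d))"
    using c0 nz by (simp add: s power2_eq_square)
   also have "... = (of_int a * (of_int c * z + of_int d) - 1) / (of_int c * (of_int c * z + of_int d))"
    using c0 nz by (simp add: diff_divide_distrib)
   also have "of_int a * (of_int c * z + of_int d) - 1 = of_int c * (of_int a * z + of_int b)"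
    using dd by (simp add: algebra_simps)
   also have "of_int c * (of_int a * z + of_int b) / (of_int c * (of_int c * z + of_int d)) = moeb g z"
    using c0 by (simp add: moeb_def fields)
   finally show ?thesis unfolding P3_def P2_def P1_def by (rule arg_cong[where f=P, OF sym])
  qed
  have "(NN z. P (moeb g z)) = (NN z. P3 (z + cor (roi d / roi c)))"
   by (rule nn_integral_cong_AE) (use AE_hyp_UHP e in \<open>auto elim: eventually_mono\<close>)
  also have "... = nn_integral hyp P3" by (rule hyp_translate) measurable
  also have "... = nn_integral hyp P2" unfolding P3_def by (rule hyp_inversion) measurable
  also have "... = nn_integral hyp P1" unfolding P2_def by (rule hyp_scale) (use False in auto)
  also have "... = nn_integral hyp P" unfolding P1_def by (rule hyp_translate) measurable
  finally show ?thesis .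
 qed
qed

lemma sigma_finite_hyp: "sigma_finite_measure hyp"
 unfolding hyp_def
 by (subst sigma_finite_measure.sigma_finite_iff_density_finite'[OF sigma_finite_lborel]) (auto simp: indicator_def)

interpretation hyp: sigma_finite_measure hyp
 by (rule sigma_finite_hyp)

interpretation hyp_pair: pair_sigma_finite hyp hyp ..

lemma hyp_strip_nn_integral:
 fixes w :: "real => ennreal"
 assumes [measurable]: "w : BM" and X: "X0 <= X1"
 shows "(NN z. ind {X0..X1} (Re z) * w (Im z))
  = en (X1 - X0) * (NL y. ind {0<..} y * en (1 / y^2) * w y)"
proof -
 have m: "(%z. ind {X0..X1} (Re z) * w (Im z)) : BM" by measurable
 have "(NN z. ind {X0..X1} (Re z) * w (Im z))
  = (NL y. ind {0<..} y * en (1 / y^2) * (NL x. ind {X0..X1} x * w y))"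
  using nn_integral_hyp[OF m] by simp
 also have "... = (NL y. en (X1 - X0) * (ind {0<..} y * en (1 / y^2) * w y))"
  using X by (intro nn_integral_cong, subst nn_integral_multc) (auto simp: mult_ac)
 also have "... = en (X1 - X0) * (NL y. ind {0<..} y * en (1 / y^2) * w y)"
  by (rule nn_integral_cmult) measurable
 finally show ?thesis .
qed

lemma hyp_strip_finite:
 assumes "X0 <= X1" "Y > 0"
 shows "emeasure hyp {z. X0 <= Re z & Re z <= X1 & Y <= Im z} < \<infinity>"
proof -
 have [measurable]: "{z. X0 <= Re z & Re z <= X1 & Y <= Im z} : sets borel"
 proof -
  have "{z\<in>space borel. X0 <= Re z & Re z <= X1 & Y <= Im z} : sets borel" by measurable
  thus ?thesis by simp
 qed
 have "emeasure hyp {z. X0 <= Re z & Re z <= X1 & Y <= Im z} = (NN z. ind {X0..X1} (Re z) * ind {Y..} (Im z))"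
  by (subst nn_integral_indicator[symmetric], simp, intro nn_integral_cong) (auto simp: indicator_def)
 also have "... = en (X1 - X0) * (NL y. ind {0<..} y * en (1 / y^2) * ind {Y..} y)"
  by (rule hyp_strip_nn_integral) (use assms in auto)
 also have "(NL y. ind {0<..} y * en (1 / y^2) * ind {Y..} y) = (NL y. en (1 / y^2) * ind {Y..} y)"
  using assms by (intro nn_integral_cong) (auto simp: indicator_def)
 also have "... = en (0 - (- 1 / Y))"
 proof (rule nn_integral_FTC_atLeast)
  show "((%y. - 1 / y) has_real_derivative 1 / y^2) (at y)" if "Y <= y" for y
   using that assms(2) by (auto intro!: derivative_eq_intros simp: power2_eq_square)
  show "((%y::real. - 1 / y) \<longlongrightarrow> 0) at_top"
   by (rule tendsto_divide_0[OF tendsto_const filterlim_at_top_imp_at_infinity[OF filterlim_ident]])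
 qed auto
 finally show ?thesis by (simp add: ennreal_mult_less_top)
qed

definition ballc :: "real => ennreal" where
 "ballc \<rho> = (NN w. ind {w. hnear \<rho> \<i> w} w)"

lemma hnear_measurable [measurable (raw)]:
 assumes [measurable]: "f : borel_measurable M" "g : borel_measurable M"
 shows "Measurable.pred M (%x. hnear \<rho> (f x) (g x))"
 unfolding hnear_def by measurable

lemma hnear_set_measurable [measurable]: "{w. hnear \<rho> z w} : sets borel"
proof -
 have "{w\<in>space borel. hnear \<rho> z w} : sets borel" by measurable
 thus ?thesis by simp
qed

text \<open>The affine isometry sending the point i to \<open>z\<close> reduces every ball to one
  about i.\<close>

lemma hnear_affine:
 assumes "z : UHP"
 shows "hnear \<rho> z (cor (Im z) * w + cor (Re z)) = hnear \<rho> \<i> w"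
proof -
 have y: "Im z > 0" using assms by (simp add: UHP_def)
 have "z - (cor (Im z) * w + cor (Re z)) = cor (Im z) * (\<i> - w)"
  by (simp add: complex_eq_iff algebra_simps)
 hence "(norm (z - (cor (Im z) * w + cor (Re z))))^2 = (Im z)^2 * (norm (\<i> - w))^2"
  by (simp add: norm_mult power_mult_distrib)
 thus ?thesis using y unfolding hnear_def
  by (simp add: power2_eq_square mult.assoc)
qed

lemma hyp_affine:
 assumes [measurable]: "P : BM" and "k > 0"
 shows "(NN w. P (cor k * w + cor x)) = nn_integral hyp P"
 using hyp_scale[of "%w. P (w + cor x)" k] hyp_translate[of P x] assms by simp

lemma ball_volume:
 assumes "z : UHP"
 shows "(NN w. kn \<rho> z w) = ballc \<rho>"
proof -
 have y: "Im z > 0" using assms by (simp add: UHP_def)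
 have "(NN w. kn \<rho> z w) = (NN w. ind {w. hnear \<rho> z w} (cor (Im z) * w + cor (Re z)))"
  by (rule hyp_affine[symmetric]) (use y in measurable)
 thus ?thesis by (simp add: ballc_def indicator_def hnear_affine[OF assms])
qed

text \<open>The involution x + iy -> (x + i)/y maps the ball about i to itself and carries the
  measure dx dy / y to dx dy / y^2. In the logarithmic coordinate it is the reflection of l followed
  by a change of the horizontal coordinate.\<close>

lemma ball_mean_Im_i:
 "(NN w. ind {w. hnear \<rho> \<i> w} w * en (Im w)) = ballc \<rho>"
proof -
 let ?Q = "%x y. (ind {w. hnear \<rho> \<i> w} (Cx x y) :: ennreal)"
 have m: "(%w. ind {w. hnear \<rho> \<i> w} w * en (Im w)) : BM" by measurable
 have h: "hnear \<rho> \<i> (Cx x y) \<longleftrightarrow> x^2 + (1 - y)^2 < \<rho> * y" for x y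
  by (simp add: hnear_def cmod_power2)
 have "(NN w. ind {w. hnear \<rho> \<i> w} w * en (Im w))
  = (NL y. ind {0<..} y * en (1 / y^2) * (NL x. ?Q x y * en y))"
  using nn_integral_hyp[OF m] by simp
 also have "... = (NL y. ind {0<..} y * en (1 / y) * (NL x. ?Q x y))"
 proof (intro nn_integral_cong)
  fix y :: real
  have "(NL x. ?Q x y * en y) = (NL x. ?Q x y) * en y"
   by (rule nn_integral_multc) measurable
  moreover have "en (1 / y^2) * en y = en (1 / y)" if "y > 0"
   using that by (subst ennreal_mult[symmetric]) (auto simp: power2_eq_square)
  ultimately show "ind {0<..} y * en (1 / y^2) * (NL x. ?Q x y * en y)
    = ind {0<..} y * en (1 / y) * (NL x. ?Q x y)"
   by (cases "y > 0") (simp_all add: mult.assoc mult.commute[of _ "en y"] flip: mult.assoc)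
 qed
 also have "... = (NL l. (NL x. ?Q x (exp l)))"
  by (rule nn_integral_exp) measurable
 also have "... = (NL l. (NL x. ?Q x (exp (0 - l))))"
  by (rule nn_integral_lborel_reflect(1)[symmetric]) measurable
 also have "... = (NL l. (NL m. ?Q (exp l * m) (exp l)))"
 proof (intro nn_integral_cong)
  fix l m :: real
  have "hnear \<rho> \<i> (Cx m (exp (0 - l))) \<longleftrightarrow> hnear \<rho> \<i> (Cx (exp l * m) (exp l))"
  proof -
   have "(m^2 + (1 - exp (-l))^2 < \<rho> * exp (-l)) \<longleftrightarrow> (exp l)^2 * (m^2 + (1 - exp (-l))^2) < (exp l)^2 * (\<rho> * exp (-l))"
    by simp
   also have "(exp l)^2 * (m^2 + (1 - exp (-l))^2) = (exp l * m)^2 + (exp l - 1)^2"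
    by (simp add: power2_eq_square exp_minus field_simps)
   also have "(exp l)^2 * (\<rho> * exp (-l)) = \<rho> * exp l" by (simp add: power2_eq_square exp_minus)
   also have "(exp l - 1)^2 = (1 - exp l)^2" by (rule power2_commute)
   finally show ?thesis by (simp add: h)
  qed
  thus "?Q m (exp (0 - l)) = ?Q (exp l * m) (exp l)" by (simp add: indicator_def)
 qed
 also have "... = ballc \<rho>" unfolding ballc_def
  by (rule nn_integral_hyp_ml[symmetric]) simp
 finally show ?thesis .
qed

text \<open>The mean value property of the harmonic function Im.\<close>
lemma ball_mean_Im:
 assumes "z : UHP"
 shows "(NN w. kn \<rho> z w * en (Im w)) = ballc \<rho> * en (Im z)"
proof -
 have y: "Im z > 0" using assms by (simp add: UHP_def)
 have "(NN w. kn \<rho> z w * en (Im w))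
  = (NN w. ind {w. hnear \<rho> z w} (cor (Im z) * w + cor (Re z))
    * en (Im (cor (Im z) * w + cor (Re z))))"
  by (rule hyp_affine[symmetric, where P="%w. kn \<rho> z w * en (Im w)"]) (use y in measurable)
 also have "... = (NN w. (ind {w. hnear \<rho> \<i> w} w * en (Im w)) * en (Im z))"
 proof (intro nn_integral_cong)
  fix w
  have "en (Im (cor (Im z) * w + cor (Re z))) = en (Im w) * en (Im z)"
   using y by (simp add: ennreal_mult''[symmetric] mult.commute)
  thus "ind {w. hnear \<rho> z w} (cor (Im z) * w + cor (Re z))
    * en (Im (cor (Im z) * w + cor (Re z)))
    = (ind {w. hnear \<rho> \<i> w} w * en (Im w)) * en (Im z)"
   by (simp add: indicator_def hnear_affine[OF assms])
 qed
 also have "... = ballc \<rho> * en (Im z)"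
  by (subst nn_integral_multc) (simp_all add: ball_mean_Im_i)
 finally show ?thesis .
qed

lemma ballc_finite:
 assumes "\<rho> > 0"
 shows "ballc \<rho> < \<infinity>"
proof -
 let ?S = "{z. -(2+\<rho>) <= Re z & Re z <= 2+\<rho> & 1/(2+\<rho>) <= Im z}"
 have i: "\<i> : UHP" by (simp add: UHP_def)
 have "ballc \<rho> <= (NN w. ind ?S w)" unfolding ballc_def
 proof (rule nn_integral_mono_AE, rule eventually_mono[OF AE_hyp_UHP])
  fix w assume w: "w : UHP"
  show "ind {w. hnear \<rho> \<i> w} w <= (ind ?S w :: ennreal)"
  proof (cases "hnear \<rho> \<i> w")
   case True
   have "w : ?S" using hnear_bounds[OF True i w assms] assms by (auto simp: field_simps abs_le_iff)
   thus ?thesis by (simp add: indicator_def)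
  qed (simp add: indicator_def)
 qed
 also have "... = emeasure hyp ?S"
 proof (rule nn_integral_indicator)
  have "{z\<in>space borel. -(2+\<rho>) <= Re z & Re z <= 2+\<rho> & 1/(2+\<rho>) <= Im z} : sets borel" by measurable
  thus "?S : sets hyp" by simp
 qed
 also have "... < \<infinity>" by (rule hyp_strip_finite) (use assms in auto)
 finally show ?thesis .
qed

section \<open>Unfolding over a fundamental domain\<close>

text \<open>Periodization over matrices, not over transformations: \<open>g\<close> and
  \<open>mneg g\<close> act alike, whence the factor 2 in every unfolding formula. Written as an
  integral over a counting measure it is subject to Tonelli without any summability
  condition.\<close>

definition Gsum :: "nat => (complex => ennreal) => complex => ennreal" where
 "Gsum q P z = (\<integral>\<^sup>+g. P (moeb g z) \<partial>count_space (Gamma0 q))"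

text \<open>Unnormalised average over hyperbolic balls; on constants it is multiplication by
  \<open>ballc \<rho>\<close>.\<close>

definition Aop :: "real => (complex => ennreal) => complex => ennreal" where
 "Aop \<rho> P z = (NN w. kn \<rho> z w * P w)"

text \<open>Polymorphic in the values, so that one notion covers real integrands and their
  \<open>ennreal\<close> versions.\<close>

definition Ginv :: "nat => (complex => 'a) => bool" where
 "Ginv q H \<longleftrightarrow> (ALL g:Gamma0 q. ALL z:UHP. H (moeb g z) = H z)"

lemma SL2Z_of_Gamma0: "g : Gamma0 q ==> g : SL2Z"
 using Gamma0_subset_SL2Z by blast

lemma nn_integral_count_space_measurable:
 fixes f :: "'a => 'i::countable => ennreal"
 assumes "!!g. g : I ==> (%z. f z g) : borel_measurable M"
 shows "(%z. \<integral>\<^sup>+g. f z g \<partial>count_space I) : borel_measurable M"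
proof -
 interpret c: sigma_finite_measure "count_space I"
  by (rule sigma_finite_measure_count_space_countable) simp
 have "(%(g,z). f z g) : borel_measurable (count_space I \<Otimes>\<^sub>M M)"
  by (rule measurable_pair_measure_countable1) (use assms in auto)
 from measurable_pair_swap[OF this]
 have "(%(z,g). f z g) : borel_measurable (M \<Otimes>\<^sub>M count_space I)" by simp
 from c.borel_measurable_nn_integral_fst[OF this] show ?thesis by simp
qed

lemma Gsum_measurable [measurable]:
 assumes [measurable]: "P : BM"
 shows "Gsum q P : BM"
 unfolding Gsum_def[abs_def] by (rule nn_integral_count_space_measurable) measurable

lemma Gsum_minv: "Gsum q P z = (\<integral>\<^sup>+g. P (moeb (minv g) z) \<partial>count_space (Gamma0 q))"
 unfolding Gsum_def using nn_integral_bij_count_space[OF bij_minv[of q], where f="%g. P (moeb g z)"] by simp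

lemma Gsum_inv:
 assumes "h : Gamma0 q" "z : UHP"
 shows "Gsum q P (moeb h z) = Gsum q P z"
proof -
 have "bij_betw (%g. mmul g h) (Gamma0 q) (Gamma0 q)"
 proof (rule bij_betwI[where g="%g. mmul g (minv h)"])
  show "(%g. mmul g h) : Gamma0 q \<rightarrow> Gamma0 q" using assms Gamma0_mmul by blast
  show "(%g. mmul g (minv h)) : Gamma0 q \<rightarrow> Gamma0 q" using assms Gamma0_mmul Gamma0_minv by blast
 qed (use assms SL2Z_of_Gamma0 in \<open>simp_all add: mmul_assoc mmul_minv\<close>)
 from nn_integral_bij_count_space[OF this, where f="%g. P (moeb g z)"]
 have "Gsum q P z = (\<integral>\<^sup>+g. P (moeb (mmul g h) z) \<partial>count_space (Gamma0 q))" by (simp add: Gsum_def)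
 also have "... = Gsum q P (moeb h z)" unfolding Gsum_def
  using assms by (intro nn_integral_cong) (simp add: moeb_mmul SL2Z_of_Gamma0)
 finally show ?thesis ..
qed

lemma Gsum_mult_inv:
 assumes "Ginv q H" "z : UHP"
 shows "Gsum q (%z. P z * H z) z = Gsum q P z * H z"
proof -
 have "Gsum q (%z. P z * H z) z = (\<integral>\<^sup>+g. P (moeb g z) * H z \<partial>count_space (Gamma0 q))"
  unfolding Gsum_def using assms by (intro nn_integral_cong) (simp add: Ginv_def)
 also have "... = Gsum q P z * H z" unfolding Gsum_def by (rule nn_integral_multc) simp
 finally show ?thesis .
qed

lemma Aop_measurable [measurable]:
 assumes [measurable]: "P : BM"
 shows "Aop \<rho> P : BM"
proof -
 have m: "(%(z,w). ind {p. hnear \<rho> (fst p) (snd p)} (z,w) * P w) : borel_measurable (borel \<Otimes>\<^sub>M hyp)"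
  by measurable
 have "(%z. \<integral>\<^sup>+w. (case (z,w) of (z,w) => ind {p. hnear \<rho> (fst p) (snd p)} (z,w) * P w) \<partial>hyp) : BM"
  by (rule hyp.borel_measurable_nn_integral_fst[OF m])
 thus ?thesis by (simp add: Aop_def[abs_def] indicator_def)
qed

lemma Aop_moeb:
 assumes g: "g : SL2Z" and z: "z : UHP" and [measurable]: "P : BM"
 shows "Aop \<rho> (%w. P (moeb g w)) z = Aop \<rho> P (moeb g z)"
proof -
 have "Aop \<rho> (%w. P (moeb g w)) z = (NN w. ind {w. hnear \<rho> (moeb g z) w} (moeb g w) * P (moeb g w))"
  unfolding Aop_def
  by (rule nn_integral_cong_AE, rule eventually_mono[OF AE_hyp_UHP]) (simp add: indicator_def hnear_moeb[OF g z])
 also have "... = Aop \<rho> P (moeb g z)" unfolding Aop_def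
  by (rule hyp_moeb[OF g, of "%w. ind {w. hnear \<rho> (moeb g z) w} w * P w"]) measurable
 finally show ?thesis .
qed

text \<open>The group moves balls to balls, so averaging commutes with each translate and, by
  Tonelli, with their sum.\<close>

lemma Aop_Gsum:
 assumes z: "z : UHP" and [measurable]: "P : BM"
 shows "Aop \<rho> (Gsum q P) z = Gsum q (Aop \<rho> P) z"
proof -
 have "Aop \<rho> (Gsum q P) z = (NN w. \<integral>\<^sup>+g. kn \<rho> z w * P (moeb g w) \<partial>count_space (Gamma0 q))"
  unfolding Aop_def Gsum_def by (intro nn_integral_cong nn_integral_cmult[symmetric]) simp
 also have "... = (\<integral>\<^sup>+g. \<integral>\<^sup>+w. kn \<rho> z w * P (moeb g w) \<partial>hyp \<partial>count_space (Gamma0 q))"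
  by (rule nn_integral_count_space_nn_integral) auto
 also have "... = (\<integral>\<^sup>+g. Aop \<rho> P (moeb g z) \<partial>count_space (Gamma0 q))"
 proof (rule nn_integral_cong)
  fix g assume "g : space (count_space (Gamma0 q))"
  hence "g : SL2Z" using SL2Z_of_Gamma0 by simp
  from Aop_moeb[OF this z assms(2)] show "(NN w. kn \<rho> z w * P (moeb g w)) = Aop \<rho> P (moeb g z)"
   by (simp only: Aop_def)
 qed
 finally show ?thesis by (simp add: Gsum_def)
qed

lemma hyp_null:
 assumes "N : null_sets lb"
 shows "AE z in hyp. z \<notin> N"
proof -
 have "AE z in lb. z \<notin> N" using assms by (rule AE_not_in)
 thus ?thesis unfolding hyp_def by (subst AE_density) (auto elim: eventually_mono)
qed

lemma hyp_null_moeb: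
 assumes g: "g : SL2Z" and N: "N : null_sets lb"
 shows "AE z in hyp. moeb g z \<notin> N"
proof -
 have [measurable]: "N : sets borel" using N by (auto simp: null_sets_def)
 have "(NN z. ind N (moeb g z)) = (NN z. ind N z)"
  by (rule hyp_moeb[OF g]) measurable
 also have "... = 0"
  by (subst nn_integral_0_iff_AE) (use hyp_null[OF N] in \<open>auto elim: eventually_mono\<close>)
 finally have "AE z in hyp. ind N (moeb g z) = (0::ennreal)"
  by (subst (asm) nn_integral_0_iff_AE) auto
 thus ?thesis by (rule eventually_mono) (auto simp: indicator_def split: if_splits)
qed

locale fdom =
 fixes q :: nat and D :: "complex set"
 assumes q1: "q >= 1" and fd: "fund_domain q D"
begin

lemma D_UHP: "D <= UHP" and D_borel [measurable]: "D : sets borel"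
 using fd by (auto simp: fund_domain_def)

lemma D_covers: "AE z in hyp. EX g:Gamma0 q. moeb g z : D"
proof -
 have "AE z in lb. z : UHP --> (EX g:Gamma0 q. moeb g z : D)"
  using fd by (simp add: fund_domain_def)
 hence "AE z in lb. 0 < ind UHP z * en (1 / (Im z)^2) --> (EX g:Gamma0 q. moeb g z : D)"
  by (rule eventually_mono) (auto simp: indicator_def split: if_splits)
 thus ?thesis unfolding hyp_def by (subst AE_density) auto
qed

lemma D_overlap: "g : Gamma0 q ==> g ~= (1,0,0,1) ==> g ~= (-1,0,0,-1) ==> D \<inter> moeb g ` D : null_sets lb"
 using fd by (simp add: fund_domain_def)

text \<open>If both \<open>g\<close> and \<open>g0\<close> move \<open>z\<close> into
  \<open>D\<close>, then \<open>h = g0 g\<^sup>-\<^sup>1\<close> places \<open>g0 z\<close> in the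
  overlap of \<open>D\<close> and \<open>hD\<close>, which is null unless \<open>h\<close> is plus
  or minus the identity. The group is countable, so all these overlaps can be avoided at once and
  only \<open>g0\<close> and \<open>mneg g0\<close> remain.\<close>

lemma two_translates: "AE z in hyp. Gsum q (ind D) z = 2"
proof -
 define B where "B = {(g,h). g : Gamma0 q & h : Gamma0 q & h ~= (1,0,0,1) & h ~= (-1,0,0,-1)}"
 have "AE z in hyp. ALL p:B. moeb (fst p) z \<notin> D \<inter> moeb (snd p) ` D"
 proof (subst AE_ball_countable)
  show "countable B" by simp
  show "ALL p:B. AE z in hyp. moeb (fst p) z \<notin> D \<inter> moeb (snd p) ` D"
  proof
   fix p assume "p : B"
   then obtain g h where p: "p = (g,h)" "g : Gamma0 q" "h : Gamma0 q" "h ~= (1,0,0,1)" "h ~= (-1,0,0,-1)"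
    unfolding B_def by blast
   have "fst p : SL2Z" "D \<inter> moeb (snd p) ` D : null_sets lb"
    using D_overlap[OF p(3-5)] SL2Z_of_Gamma0[OF p(2)] p(1) by simp_all
   thus "AE z in hyp. moeb (fst p) z \<notin> D \<inter> moeb (snd p) ` D" by (rule hyp_null_moeb)
  qed
 qed
 with D_covers AE_hyp_UHP show ?thesis
 proof eventually_elim
  case (elim z)
  then obtain g0 where g0: "g0 : Gamma0 q" "moeb g0 z : D" by blast
  have zU: "z : UHP" using elim by blast
  have "{g\<in>Gamma0 q. moeb g z : D} = {g0, mneg g0}"
  proof (intro equalityI subsetI)
   fix g assume "g : {g0, mneg g0}"
   thus "g : {g\<in>Gamma0 q. moeb g z : D}" using g0 Gamma0_mneg[OF g0(1)] by (auto simp: moeb_mneg)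
  next
   fix g assume "g : {g\<in>Gamma0 q. moeb g z : D}"
   hence g: "g : Gamma0 q" "moeb g z : D" by auto
   note S = SL2Z_of_Gamma0[OF g(1)] SL2Z_of_Gamma0[OF g0(1)]
   define h where "h = mmul g0 (minv g)"
   have h: "h : Gamma0 q" using g g0 Gamma0_mmul Gamma0_minv by (simp add: h_def)
   have hg: "mmul h g = g0" using S by (simp add: h_def mmul_assoc mmul_minv)
   have "moeb g0 z = moeb h (moeb g z)"
    using moeb_mmul[OF SL2Z_of_Gamma0[OF h] S(1) zU] hg by simp
   hence mem: "moeb g0 z : D \<inter> moeb h ` D" using g0 g by blast
   have "h = (1,0,0,1) \<or> h = (-1,0,0,-1)"
   proof (rule ccontr)
    assume "~ ?thesis"
    hence "(g0,h) : B" using g0 h by (simp add: B_def)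
    hence "moeb g0 z \<notin> D \<inter> moeb h ` D" using elim(3) by force
    thus False using mem by blast
   qed
   thus "g : {g0, mneg g0}"
   proof
    assume "h = (1,0,0,1)" thus ?thesis using hg by simp
   next
    assume "h = (-1,0,0,-1)"
    hence "g0 = mneg g" using hg by (cases g) auto
    hence "g = mneg g0" by (cases g) auto
    thus ?thesis by simp
   qed
  qed
  hence "Gsum q (ind D) z = (\<integral>\<^sup>+g. ind {g0, mneg g0} g \<partial>count_space (Gamma0 q))"
   unfolding Gsum_def by (intro nn_integral_cong) (auto simp: indicator_def)
  also have "... = emeasure (count_space (Gamma0 q)) {g0, mneg g0}"
   using g0 Gamma0_mneg[OF g0(1)] by (intro nn_integral_indicator) auto
  also have "... = 2"
   using g0 Gamma0_mneg[OF g0(1)] mneg_neq[OF SL2Z_of_Gamma0[OF g0(1)]]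
   by (subst emeasure_count_space_finite) auto
  finally show ?case .
 qed
qed

text \<open>Invariance of the measure shifts each group element from \<open>P\<close> to the
  indicator of \<open>D\<close>, and the translates of \<open>D\<close> cover almost every point
  twice.\<close>

lemma unfolding_nn:
 assumes [measurable]: "P : BM"
 shows "(NN z. ind D z * Gsum q P z) = 2 * nn_integral hyp P"
proof -
 have "(NN z. ind D z * Gsum q P z) = (NN z. \<integral>\<^sup>+g. ind D z * P (moeb g z) \<partial>count_space (Gamma0 q))"
  unfolding Gsum_def by (intro nn_integral_cong nn_integral_cmult[symmetric]) simp
 also have "... = (\<integral>\<^sup>+g. \<integral>\<^sup>+z. ind D z * P (moeb g z) \<partial>hyp \<partial>count_space (Gamma0 q))"
  by (rule nn_integral_count_space_nn_integral) auto
 also have "... = (\<integral>\<^sup>+g. \<integral>\<^sup>+z. ind D (moeb (minv g) z) * P z \<partial>hyp \<partial>count_space (Gamma0 q))"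
 proof (rule nn_integral_cong)
  fix g assume "g : space (count_space (Gamma0 q))"
  hence g: "g : SL2Z" using SL2Z_of_Gamma0 by simp
  have "(NN z. ind D z * P (moeb g z)) = (NN z. ind D (moeb (minv g) (moeb g z)) * P (moeb g z))"
   by (rule nn_integral_cong_AE, rule eventually_mono[OF AE_hyp_UHP]) (simp add: g)
  also have "... = (NN z. ind D (moeb (minv g) z) * P z)"
   by (rule hyp_moeb[OF g, of "%z. ind D (moeb (minv g) z) * P z"]) measurable
  finally show "(NN z. ind D z * P (moeb g z)) = (NN z. ind D (moeb (minv g) z) * P z)" .
 qed
 also have "... = (NN z. \<integral>\<^sup>+g. ind D (moeb (minv g) z) * P z \<partial>count_space (Gamma0 q))"
  by (rule nn_integral_count_space_nn_integral[symmetric]) auto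
 also have "... = (NN z. Gsum q (ind D) z * P z)"
  unfolding Gsum_minv by (intro nn_integral_cong nn_integral_multc) simp
 also have "... = (NN z. 2 * P z)"
  by (rule nn_integral_cong_AE, rule eventually_mono[OF two_translates]) simp
 also have "... = 2 * nn_integral hyp P" by (rule nn_integral_cmult) simp
 finally show ?thesis .
qed

lemma unfolding_nn_inv:
 assumes [measurable]: "P : BM" "H : BM" and "Ginv q H"
 shows "(NN z. ind D z * (Gsum q P z * H z)) = 2 * (NN z. P z * H z)"
proof -
 have "2 * (NN z. P z * H z) = (NN z. ind D z * Gsum q (%z. P z * H z) z)"
  by (rule unfolding_nn[symmetric]) measurable
 also have "... = (NN z. ind D z * (Gsum q P z * H z))"
  by (rule nn_integral_cong_AE, rule eventually_mono[OF AE_hyp_UHP]) (simp add: Gsum_mult_inv[OF assms(3)])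
 finally show ?thesis ..
qed

lemma Gsum_strip_bound:
 assumes z: "z : UHP" and Y: "0 < Y" "Y <= 1" and X: "X0 <= X1"
 shows "Gsum q (ind {z. X0 <= Re z & Re z <= X1 & Y <= Im z}) z <= en (30 * (X1 - X0 + 1) / Y)"
proof -
 let ?A = "{g\<in>SL2Z. X0 <= Re (moeb g z) & Re (moeb g z) <= X1 & Im (moeb g z) >= Y}"
 note c = orbit_count[OF z Y X]
 have "Gsum q (ind {z. X0 <= Re z & Re z <= X1 & Y <= Im z}) z = (\<integral>\<^sup>+g. ind (?A \<inter> Gamma0 q) g \<partial>count_space (Gamma0 q))"
  unfolding Gsum_def by (intro nn_integral_cong) (auto simp: indicator_def dest: SL2Z_of_Gamma0)
 also have "... = emeasure (count_space (Gamma0 q)) (?A \<inter> Gamma0 q)"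
  by (rule nn_integral_indicator) auto
 also have "... = of_nat (card (?A \<inter> Gamma0 q))"
  using c(1) by (subst emeasure_count_space_finite) auto
 also have "... <= of_nat (card ?A)" using c(1) by (intro of_nat_mono card_mono) auto
 also have "... = en (real (card ?A))" by (simp add: ennreal_of_nat_eq_real_of_nat)
 also have "... <= en (30 * (X1 - X0 + 1) / Y)" using c(2) by (rule ennreal_leI)
 finally show ?thesis .
qed

text \<open>Unfolding the indicator of the strip turns the left side into an integral over
  \<open>D\<close> whose density is the orbit count. It transfers an estimate on \<open>D\<close> to
  a region given by explicit coordinates, whatever \<open>D\<close> looks like.\<close>

lemma strip_integral_le:
 assumes [measurable]: "H : BM" and "Ginv q H"
  and Y: "0 < Y" "Y <= 1" and X: "X0 <= X1"
 shows "(NN z. ind {z. X0 <= Re z & Re z <= X1 & Y <= Im z} z * H z)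
  <= en (30 * (X1 - X0 + 1) / Y) * (NN z. ind D z * H z)"
proof -
 let ?U = "{z. X0 <= Re z & Re z <= X1 & Y <= Im z}"
 have [measurable]: "?U : sets borel"
 proof -
  have "{z\<in>space borel. X0 <= Re z & Re z <= X1 & Y <= Im z} : sets borel" by measurable
  thus ?thesis by simp
 qed
 have "(NN z. ind ?U z * H z) <= 2 * (NN z. ind ?U z * H z)"
  using mult_right_mono[of "1::ennreal" 2 "\<integral>\<^sup>+z. ind ?U z * H z \<partial>hyp"] by simp
 also have "... = (NN z. ind D z * (Gsum q (ind ?U) z * H z))"
  by (rule unfolding_nn_inv[symmetric]) (use assms in measurable)
 also have "... <= (NN z. en (30 * (X1 - X0 + 1) / Y) * (ind D z * H z))"
 proof (rule nn_integral_mono_AE, rule eventually_mono[OF AE_hyp_UHP])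
  fix z assume "z : UHP"
  from mult_right_mono[OF Gsum_strip_bound[OF this Y X], of "ind D z * H z"]
  show "ind D z * (Gsum q (ind ?U) z * H z) <= en (30 * (X1 - X0 + 1) / Y) * (ind D z * H z)"
   by (simp add: mult_ac)
 qed
 also have "... = en (30 * (X1 - X0 + 1) / Y) * (NN z. ind D z * H z)"
  by (rule nn_integral_cmult) measurable
 finally show ?thesis .
qed

text \<open>Finite area is not part of the definition of a fundamental domain. It follows by
  unfolding \<open>P\<close>, a finite sum of indicators of coset translates of the region
  \<open>?F\<close>: every orbit meets this sum, so its periodization is at least 1, while its
  integral is finite.\<close>

lemma D_finite: "emeasure hyp D < \<infinity>"
proof -
 obtain R where R: "finite R" "R <= SL2Z" "!!g. g : SL2Z ==> EX r:R. mmul g (minv r) : Gamma0 q"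
  using finite_coset_reps[OF q1] by blast
 let ?F = "{z. -1/2 <= Re z & Re z <= 1/2 & 1/2 <= Im z}"
 have [measurable]: "?F : sets borel"
 proof -
  have "{z\<in>space borel. -1/2 <= Re z & Re z <= 1/2 & 1/2 <= Im z} : sets borel" by measurable
  thus ?thesis by simp
 qed
 define P where "P = (%z. \<Sum>r\<in>R. ind ?F (moeb (minv r) z) :: ennreal)"
 have [measurable]: "P : BM" unfolding P_def by measurable
 have ge: "1 <= Gsum q P z" if z: "z : UHP" for z
 proof -
  obtain s where s: "s : SL2Z" "abs (Re (moeb s z)) <= 1/2" "Im (moeb s z) >= 1/2" using reduction[OF z] by blast
  obtain r where r: "r : R" "mmul (minv s) (minv r) : Gamma0 q" using R(3)[OF SL2Z_minv[OF s(1)]] by blast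
  have rS: "r : SL2Z" using r R by blast
  define h where "h = minv (mmul (minv s) (minv r))"
  have h: "h : Gamma0 q" unfolding h_def by (rule Gamma0_minv) fact
  have hS: "h : SL2Z" using h SL2Z_of_Gamma0 by blast
  have "h = mmul r s" unfolding h_def by (cases r; cases s) (simp add: algebra_simps)
  hence "mmul (minv r) h = s" using rS by (simp add: mmul_assoc[symmetric] mmul_minv)
  hence "moeb (minv r) (moeb h z) = moeb s z"
   using moeb_mmul[OF SL2Z_minv[OF rS] hS z] by simp
  hence "moeb (minv r) (moeb h z) : ?F" using s by (auto simp: abs_le_iff)
  hence "1 = (ind ?F (moeb (minv r) (moeb h z)) :: ennreal)" by (simp only: indicator_simps)
  also have "... <= P (moeb h z)" unfolding P_def
   by (rule member_le_sum[OF r(1) _ R(1)]) simp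
  also have "... <= Gsum q P z" unfolding Gsum_def
   by (rule nn_integral_ge_point) (use h in simp)
  finally show ?thesis .
 qed
 have "emeasure hyp D = (NN z. ind D z)" by simp
 also have "... <= (NN z. ind D z * Gsum q P z)"
  using ge D_UHP by (intro nn_integral_mono) (auto simp: indicator_def)
 also have "... = 2 * nn_integral hyp P" by (rule unfolding_nn) measurable
 also have "nn_integral hyp P = (\<Sum>r\<in>R. \<integral>\<^sup>+z. ind ?F (moeb (minv r) z) \<partial>hyp)"
  unfolding P_def by (rule nn_integral_sum) measurable
 also have "... = (\<Sum>r\<in>R. emeasure hyp ?F)"
 proof (rule sum.cong[OF refl])
  fix r assume "r : R"
  hence "minv r : SL2Z" using R SL2Z_minv by blast
  from hyp_moeb[OF this, of "ind ?F"] show "(NN z. ind ?F (moeb (minv r) z)) = emeasure hyp ?F"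
   by simp
 qed
 also have "2 * (\<Sum>r\<in>R. emeasure hyp ?F) < \<infinity>"
  using hyp_strip_finite[of "-1/2" "1/2" "1/2"] by (simp add: ennreal_mult_less_top of_nat_less_top)
 finally show ?thesis .
qed

text \<open>The periodized kernel is symmetric, since summing over \<open>g\<close> acting on one
  variable equals summing over the inverses acting on the other. Averaging is therefore self-adjoint
  on the quotient, and pairing it with the constant 1 gives the formula.\<close>

lemma kernel_swap:
 assumes [measurable]: "H : BM" and H: "Ginv q H"
 shows "(NN z. ind D z * Aop \<rho> H z) = ballc \<rho> * (NN z. ind D z * H z)"
proof -
 define k where "k = (%z w. ind {p. hnear \<rho> (fst p) (snd p)} (z,w) :: ennreal)"
 have k [measurable]: "(%p. k (fst p) (snd p)) : borel_measurable (borel \<Otimes>\<^sub>M borel)"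
  unfolding k_def by measurable
 have kz [measurable]: "k z : BM" for z
  using measurable_compose[OF measurable_Pair1' k, of z] by simp
 have ksym: "k z w = k w z" for z w unfolding k_def by (simp add: indicator_def hnear_sym)
 have kind: "kn \<rho> z w = k z w" for z w by (simp add: k_def indicator_def)
 have kinv: "Gsum q (k z) w = Gsum q (k w) z" if "z : UHP" "w : UHP" for z w
 proof -
  have "Gsum q (k z) w = (\<integral>\<^sup>+g. k w (moeb (minv g) z) \<partial>count_space (Gamma0 q))"
   unfolding Gsum_def
  proof (rule nn_integral_cong)
   fix g assume "g : space (count_space (Gamma0 q))"
   hence g: "g : SL2Z" using SL2Z_of_Gamma0 by simp
   have "hnear \<rho> z (moeb g w) = hnear \<rho> (moeb g (moeb (minv g) z)) (moeb g w)" using g that by simp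
   also have "... = hnear \<rho> (moeb (minv g) z) w"
    by (rule hnear_moeb) (use g that moeb_UHP SL2Z_minv in auto)
   finally show "k z (moeb g w) = k w (moeb (minv g) z)" by (simp add: k_def indicator_def hnear_sym)
  qed
  thus ?thesis by (simp add: Gsum_minv)
 qed
 have A2: "2 * Aop \<rho> H z = (NN w. ind D w * (Gsum q (k z) w * H w))" for z
  unfolding Aop_def kind by (rule unfolding_nn_inv[symmetric]) (use H in measurable)
 have G2 [measurable]: "(%p. Gsum q (k (fst p)) (snd p)) : borel_measurable (borel \<Otimes>\<^sub>M borel)"
  unfolding Gsum_def k_def by (rule nn_integral_count_space_measurable) measurable
 have "2 * (NN z. ind D z * Aop \<rho> H z) = (NN z. ind D z * (2 * Aop \<rho> H z))"
  by (subst nn_integral_cmult[symmetric]) (auto simp: mult_ac)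
 also have "... = (NN z. \<integral>\<^sup>+w. ind D z * (ind D w * (Gsum q (k z) w * H w)) \<partial>hyp)"
  unfolding A2 by (intro nn_integral_cong nn_integral_cmult[symmetric]) measurable
 also have "... = (NN w. \<integral>\<^sup>+z. ind D z * (ind D w * (Gsum q (k z) w * H w)) \<partial>hyp)"
  by (rule hyp_pair.Fubini'[symmetric]) measurable
 also have "... = (NN w. \<integral>\<^sup>+z. (ind D w * H w) * (ind D z * Gsum q (k w) z) \<partial>hyp)"
 proof (intro nn_integral_cong)
  fix w z :: complex
  show "ind D z * (ind D w * (Gsum q (k z) w * H w)) = (ind D w * H w) * (ind D z * Gsum q (k w) z)"
  proof (cases "z : D & w : D")
   case True
   hence "z : UHP" "w : UHP" using D_UHP by auto
   thus ?thesis by (simp add: kinv mult_ac)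
  qed (auto simp: indicator_def)
 qed
 also have "... = (NN w. (ind D w * H w) * (2 * ballc \<rho>))"
 proof (rule nn_integral_cong_AE, rule eventually_mono[OF AE_hyp_UHP])
  fix w assume w: "w : UHP"
  have "(NN z. (ind D w * H w) * (ind D z * Gsum q (k w) z))
   = (ind D w * H w) * (NN z. ind D z * Gsum q (k w) z)"
   by (rule nn_integral_cmult) measurable
  also have "(NN z. ind D z * Gsum q (k w) z) = 2 * nn_integral hyp (k w)"
   by (rule unfolding_nn) measurable
  also have "nn_integral hyp (k w) = ballc \<rho>"
   using ball_volume[OF w, of \<rho>] by (simp add: kind)
  finally show "(NN z. (ind D w * H w) * (ind D z * Gsum q (k w) z)) = (ind D w * H w) * (2 * ballc \<rho>)" .
 qed
 also have "... = 2 * (ballc \<rho> * (NN z. ind D z * H z))"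
  by (subst nn_integral_multc) (auto simp: mult_ac)
 finally show ?thesis by (simp add: ennreal_mult_cancel_left)
qed

end

section \<open>Decorrelation of invariant functions from slowly varying ones\<close>

text \<open>The two terms stand for two sources of variation on a hyperbolic ball: a Lipschitz
  cut-off in the real part moves by O(\<open>Im z\<close>), a phase proportional to
  \<open>\<xi>\<close> by O(\<open>\<xi>\<close>).\<close>

definition slow :: "(real => real) => real => (complex => real) => bool" where
 "slow K \<xi> v \<longleftrightarrow> (ALL \<rho>>0. ALL z:UHP. ALL w:UHP. hnear \<rho> z w --> abs (v z - v w) <= K \<rho> * (Im z + \<xi>))"

text \<open>The factor \<open>Im z\<close> turns the hyperbolic area into \<open>dx dy / y\<close>,
  and it obeys the mean value property, so only \<open>v\<close> and the edges at heights
  \<open>y1\<close> and 1 disturb that property.\<close>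

definition cutp :: "real => (complex => real) => complex => real" where
 "cutp y1 v z = ind {y1..1} (Im z) * Im z * v z"

lemma cutp_measurable [measurable]: "v : BM ==> cutp y1 v : BM"
 unfolding cutp_def[abs_def] by measurable

lemma nn_integral_inverse_Icc:
 assumes "0 < s" "s <= t"
 shows "(NL y. en (1 / y) * ind {s..t} y) = en (ln t - ln s)"
 using assms by (intro nn_integral_FTC_Icc) (auto intro!: derivative_eq_intros)

lemma ennreal_lin: "C >= 0 ==> L >= 0 ==> ennreal C + en C * en L = en (C + C * L)"
 by (simp add: ennreal_mult ennreal_plus)

context fdom
begin

text \<open>Layer cake in the height: \<open>Im w\<close> equals \<open>y1\<close> plus the integral
  of 1 over \<open>[y1, Im w]\<close>, so the periodization is bounded by strip counts. These are
  O(1/Y) at height \<open>Y\<close>, and integrating them over \<open>[y1, 1]\<close> produces the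
  logarithm.\<close>

lemma Gsum_cutp_bound:
 assumes v: "!!z. 0 <= v z" "!!z. v z <= 1" "!!z. Re z \<notin> {X0..X1} ==> v z = 0"
  and y1: "0 < y1" "y1 <= 1" and X: "X0 <= X1" and z: "z : UHP"
 shows "Gsum q (%z. en (cutp y1 v z)) z <= en (30 * (X1 - X0 + 1) * (1 + ln (1 / y1)))"
proof -
 let ?U = "%Y. {z. X0 <= Re z & Re z <= X1 & Y <= Im z}"
 let ?C = "30 * (X1 - X0 + 1)"
 have C: "?C >= 0" using X by simp
 have mY: "(%Y. ind {y1..1} Y * ind (?U Y) w :: ennreal) : BM" for w
 proof -
  have "ind (?U Y) w = (ind {X0..X1} (Re w) * ind {..Im w} Y :: ennreal)" for Y
   by (auto simp: indicator_def)
  thus ?thesis by simp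
 qed
 have pt: "en (cutp y1 v w) <= en y1 * ind (?U y1) w + (NL Y. ind {y1..1} Y * ind (?U Y) w)" for w
 proof (cases "y1 <= Im w & Im w <= 1 & X0 <= Re w & Re w <= X1")
  case True
  have "(NL Y. ind {y1..1} Y * ind (?U Y) w) = (NL Y. ind {y1..Im w} Y)"
   using True by (intro nn_integral_cong) (auto simp: indicator_def)
  also have "... = en (Im w - y1)" using True by simp
  finally have "en y1 * ind (?U y1) w + (NL Y. ind {y1..1} Y * ind (?U Y) w) = en (Im w)"
   using True y1 by (simp add: indicator_def ennreal_plus[symmetric] del: ennreal_plus)
  moreover have "cutp y1 v w <= Im w" using True v(1,2)[of w] y1 by (simp add: cutp_def mult_left_le)
  ultimately show ?thesis by (simp add: ennreal_leI)
 next
  case False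
  hence "cutp y1 v w = 0" using v(3)[of w] by (auto simp: cutp_def indicator_def)
  thus ?thesis by simp
 qed
 have "Gsum q (%z. en (cutp y1 v z)) z <= (\<integral>\<^sup>+g. en y1 * ind (?U y1) (moeb g z) + (NL Y. ind {y1..1} Y * ind (?U Y) (moeb g z)) \<partial>count_space (Gamma0 q))"
  unfolding Gsum_def by (intro nn_integral_mono pt)
 also have "... = en y1 * Gsum q (ind (?U y1)) z + (\<integral>\<^sup>+g. (NL Y. ind {y1..1} Y * ind (?U Y) (moeb g z)) \<partial>count_space (Gamma0 q))"
  unfolding Gsum_def by (subst nn_integral_add) (auto simp: nn_integral_cmult)
 also have "(\<integral>\<^sup>+g. (NL Y. ind {y1..1} Y * ind (?U Y) (moeb g z)) \<partial>count_space (Gamma0 q))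
   = (NL Y. (\<integral>\<^sup>+g. ind {y1..1} Y * ind (?U Y) (moeb g z) \<partial>count_space (Gamma0 q)))"
  by (rule nn_integral_count_space_nn_integral[symmetric]) (use mY in auto)
 also have "... <= (NL Y. en ?C * (en (1 / Y) * ind {y1..1} Y))"
 proof (rule nn_integral_mono)
  fix Y :: real
  show "(\<integral>\<^sup>+g. ind {y1..1} Y * ind (?U Y) (moeb g z) \<partial>count_space (Gamma0 q)) <= en ?C * (en (1 / Y) * ind {y1..1} Y)"
  proof (cases "Y : {y1..1}")
   case True
   hence "0 < Y" "Y <= 1" using y1 by auto
   from Gsum_strip_bound[OF z this X] show ?thesis using True C \<open>0 < Y\<close>
    by (simp add: Gsum_def ennreal_mult[symmetric])
  qed simp
 qed
 also have "... = en ?C * en (ln 1 - ln y1)"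
  using y1 by (subst nn_integral_cmult) (simp_all add: nn_integral_inverse_Icc)
 also have "en y1 * Gsum q (ind (?U y1)) z <= en y1 * en (?C / y1)"
  by (intro mult_left_mono Gsum_strip_bound[OF z y1 X]) simp
 also have "en y1 * en (?C / y1) = en ?C"
  using y1 C by (subst ennreal_mult[symmetric]) auto
 finally have "Gsum q (%z. en (cutp y1 v z)) z <= en ?C + en ?C * en (ln 1 - ln y1)"
  by (simp add: add_mono)
 also have "... = en (?C + ?C * (ln 1 - ln y1))"
  using ennreal_lin[of ?C "ln 1 - ln y1"] C y1 by simp
 also have "?C + ?C * (ln 1 - ln y1) = ?C * (1 + ln (1 / y1))" using y1 by (simp add: ln_div algebra_simps)
 finally show ?thesis .
qed

text \<open>Pointwise defect on a ball, with \<open>a = 2 + \<rho>\<close> the distortion of heights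
  from \<open>hnear_bounds\<close>: the first summand is the oscillation of \<open>v\<close>, the
  other two cover the points whose ball crosses height \<open>y1\<close> or height 1, where the
  cut-off jumps.\<close>

definition osc :: "real => real => real => real => real => real => complex => real" where
 "osc a k \<xi> y1 X0 X1 z = ind {X0 - a^2..X1 + a^2} (Re z) * (ind {y1/a..a} (Im z) * k * (Im z + \<xi>)
   + ind {y1/a..a * y1} (Im z) + ind {1/a..a} (Im z))"

text \<open>Only this one-sided comparison is claimed, because the Dirichlet estimate uses the mean
  value property as a subharmonicity with defect. Where \<open>v z\<close> vanishes it is trivial;
  otherwise \<open>w\<close> lies between the heights, below \<open>y1\<close> or above 1, one case
  for each summand of \<open>osc\<close>.\<close>

lemma osc_bound:
 assumes v: "!!z. 0 <= v z" "!!z. v z <= 1" "!!z. Re z \<notin> {X0..X1} ==> v z = 0"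
  and K: "!!\<rho>. K \<rho> >= 0" and sl: "slow K \<xi> v" and \<rho>: "\<rho> > 0" and \<xi>: "\<xi> >= 0"
  and y1: "0 < y1" "y1 <= 1" and z: "z : UHP" and w: "w : UHP" and n: "hnear \<rho> z w"
 shows "ind {y1..1} (Im z) * v z <= ind {y1..1} (Im w) * v w + osc (2 + \<rho>) (K \<rho>) \<xi> y1 X0 X1 z"
proof -
 define a where "a = 2 + \<rho>"
 have a: "a >= 1" "a > 0" using \<rho> by (auto simp: a_def)
 note hb = hnear_bounds[OF n z w \<rho>, folded a_def]
 have yz: "Im z > 0" and yw: "Im w > 0" using z w by (auto simp: UHP_def)
 have oscnn: "osc a (K \<rho>) \<xi> y1 X0 X1 z >= 0"
  using K[of \<rho>] yz \<xi> by (auto simp: osc_def indicator_def)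
 show ?thesis
 proof (cases "Im z : {y1..1} & v z ~= 0")
  case False
  thus ?thesis using v(1)[of w] oscnn unfolding a_def by (auto simp: indicator_def)
 next
  case True
  hence Re: "X0 <= Re z" "Re z <= X1" using v(3)[of z] by auto
  hence R1: "ind {X0 - a^2..X1 + a^2} (Re z) = (1::real)" using a by (auto simp: indicator_def intro: order_trans[OF _ Re(1)] order_trans[OF Re(2)])
  have "y1 / a <= y1" using a y1 by (simp add: field_simps)
  hence I1: "ind {y1/a..a} (Im z) = (1::real)" using True a by auto
  show ?thesis
  proof (cases "Im w : {y1..1}")
   case T2: True
   have "abs (v z - v w) <= K \<rho> * (Im z + \<xi>)" using sl \<rho> z w n by (auto simp: slow_def)
   also have "... <= osc a (K \<rho>) \<xi> y1 X0 X1 z" by (simp add: osc_def R1 I1)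
   finally show ?thesis using True T2 unfolding a_def by simp
  next
   case False
   have "1 <= ind {y1/a..a * y1} (Im z) + (ind {1/a..a} (Im z) :: real)"
   proof (cases "Im w < y1")
    case T3: True
    have "Im z < a * y1" using hb(2) mult_strict_left_mono[OF T3 a(2)] by linarith
    thus ?thesis using True \<open>y1 / a <= y1\<close> by (auto simp: indicator_def)
   next
    case F3: False
    hence "1 < Im w" using False by auto
    hence "1 < a * Im z" using hb(1) by linarith
    hence "1 / a <= Im z" using a by (simp add: field_simps)
    thus ?thesis using True a by (auto simp: indicator_def)
   qed
   also have "... <= osc a (K \<rho>) \<xi> y1 X0 X1 z" using K[of \<rho>] \<xi> yz by (simp add: osc_def R1 I1)
   finally have "1 <= osc a (K \<rho>) \<xi> y1 X0 X1 z" .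
   moreover have "ind {y1..1} (Im z) * v z <= 1" using v(1,2)[of z] by (auto simp: indicator_def)
   moreover have "0 <= ind {y1..1} (Im w) * v w" using v(1)[of w] by (auto simp: indicator_def)
   ultimately show ?thesis unfolding a_def by linarith
  qed
 qed
qed

text \<open>\<open>ballc \<rho> * Im z\<close> is the integral of \<open>Im w\<close> over the ball,
  so the mean value property is exact for the factor \<open>Im\<close>, and \<open>osc\<close> pays
  for moving the remaining factor from \<open>z\<close> to \<open>w\<close>.\<close>

lemma cutp_le_Aop:
 assumes v: "!!z. 0 <= v z" "!!z. v z <= 1" "!!z. Re z \<notin> {X0..X1} ==> v z = 0"
  and [measurable]: "v : BM"
  and K: "!!\<rho>. K \<rho> >= 0" and sl: "slow K \<xi> v" and \<rho>: "\<rho> > 0" and \<xi>: "\<xi> >= 0"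
  and y1: "0 < y1" "y1 <= 1" and z: "z : UHP"
 shows "ballc \<rho> * en (cutp y1 v z) <= Aop \<rho> (%w. en (cutp y1 v w)) z
  + ballc \<rho> * en (Im z * osc (2 + \<rho>) (K \<rho>) \<xi> y1 X0 X1 z)"
proof -
 define os where "os = osc (2 + \<rho>) (K \<rho>) \<xi> y1 X0 X1 z"
 have yz: "Im z > 0" using z by (simp add: UHP_def)
 have osnn: "os >= 0" using K[of \<rho>] yz \<xi> \<rho> by (auto simp: os_def osc_def indicator_def)
 let ?u = "%z. ind {y1..1} (Im z) * v z"
 have unn: "?u w >= 0" for w using v(1)[of w] by (simp add: indicator_def)
 have "ballc \<rho> * en (cutp y1 v z) = ballc \<rho> * en (Im z) * en (?u z)"
  using yz unn[of z] by (simp add: cutp_def ennreal_mult[symmetric] mult_ac)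
 also have "... = (NN w. (kn \<rho> z w * en (Im w)) * en (?u z))"
  by (subst nn_integral_multc) (simp_all add: ball_mean_Im[OF z])
 also have "... <= (NN w. kn \<rho> z w * en (cutp y1 v w) + (kn \<rho> z w * en (Im w)) * en os)"
 proof (rule nn_integral_mono_AE, rule eventually_mono[OF AE_hyp_UHP])
  fix w assume w: "w : UHP"
  have yw: "Im w > 0" using w by (simp add: UHP_def)
  show "(kn \<rho> z w * en (Im w)) * en (?u z)
   <= kn \<rho> z w * en (cutp y1 v w) + (kn \<rho> z w * en (Im w)) * en os"
  proof (cases "hnear \<rho> z w")
   case True
   have "?u z <= ?u w + os" unfolding os_def by (rule osc_bound[OF v K sl \<rho> \<xi> y1 z w True])
   hence "Im w * ?u z <= Im w * (?u w + os)" using yw by simp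
   hence le: "Im w * ?u z <= cutp y1 v w + Im w * os" by (simp add: cutp_def algebra_simps)
   have "en (Im w) * en (?u z) = en (Im w * ?u z)" using yw unn by (simp add: ennreal_mult)
   also have "... <= en (cutp y1 v w + Im w * os)" using le by (rule ennreal_leI)
   also have "... = en (cutp y1 v w) + en (Im w) * en os"
    using osnn yw v(1)[of w] by (simp add: ennreal_mult cutp_def)
   finally show ?thesis using True by simp
  qed simp
 qed
 also have "... = Aop \<rho> (%w. en (cutp y1 v w)) z + ballc \<rho> * en (Im z) * en os"
  unfolding Aop_def by (subst nn_integral_add) (simp_all add: nn_integral_multc ball_mean_Im[OF z])
 finally show ?thesis using yz osnn by (simp add: os_def ennreal_mult mult.assoc)
qed

lemma osc_measurable [measurable]: "osc a k \<xi> y1 X0 X1 : BM"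
 unfolding osc_def[abs_def] by measurable

text \<open>With measure \<open>dx dy / y\<close> the edge terms integrate to multiples of
  \<open>ln a\<close>, and \<open>k * y\<close> to at most \<open>k * a\<close>. The only
  contribution growing with \<open>1/y1\<close> comes from \<open>k * \<xi>\<close> and carries the
  small factor \<open>\<xi>\<close>.\<close>

lemma osc_integral:
 assumes a: "a >= 1" and k: "k >= 0" and \<xi>: "\<xi> >= 0" and y1: "0 < y1" "y1 <= 1" and X: "X0 <= X1"
 shows "(NN z. en (Im z * osc a k \<xi> y1 X0 X1 z))
  <= en ((X1 - X0 + 2 * a^2) * (k * a + 2 * k * ln a + k + 4 * ln a) * (1 + \<xi>) * (1 + \<xi> * ln (1 / y1)))"
proof -
 let ?k = "(k * a + k * \<xi> * (2 * ln a + ln (1 / y1)) + 4 * ln a)"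
 let ?w = "%y::real. ind {y1/a..a} y * k * (y + \<xi>) + ind {y1/a..a * y1} y + ind {1/a..a} y"
 have la: "ln a >= 0" using a by simp
 have y1a: "y1 / a <= y1" "y1 / a > 0" using a y1 by (auto simp: field_simps)
 have wnn: "?w y >= 0" if "y > 0" for y using that k \<xi> by (auto simp: indicator_def)
 have "(NN z. en (Im z * osc a k \<xi> y1 X0 X1 z)) = (NN z. ind {X0 - a^2..X1 + a^2} (Re z) * en (Im z * ?w (Im z)))"
  by (intro nn_integral_cong) (auto simp: osc_def indicator_def)
 also have "... = en ((X1 + a^2) - (X0 - a^2)) * (NL y. ind {0<..} y * en (1 / y^2) * en (y * ?w y))"
 proof (rule hyp_strip_nn_integral)
  show "X0 - a^2 <= X1 + a^2" using X zero_le_power2[of a] by linarith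
 qed measurable
 finally have main: "(NN z. en (Im z * osc a k \<xi> y1 X0 X1 z)) = ..." .
 have "(NL y. ind {0<..} y * en (1 / y^2) * en (y * ?w y))
  <= (NL y. en k * ind {0..a} y + en (k * \<xi>) * (en (1 / y) * ind {y1/a..a} y)
    + en (1 / y) * ind {y1/a..a * y1} y + en (1 / y) * ind {1/a..a} y)"
 proof (rule nn_integral_mono)
  fix y :: real
  show "ind {0<..} y * en (1 / y^2) * en (y * ?w y) <= en k * ind {0..a} y + en (k * \<xi>) * (en (1 / y) * ind {y1/a..a} y)
    + en (1 / y) * ind {y1/a..a * y1} y + en (1 / y) * ind {1/a..a} y"
  proof (cases "y > 0")
   case True
   have "ind {0<..} y * en (1 / y^2) * en (y * ?w y) = en (1 / y * ?w y)"
    using True wnn[OF True] by (simp add: ennreal_mult[symmetric] power2_eq_square)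
   also have "1 / y * ?w y <= k * ind {0..a} y + k * \<xi> * (1 / y * ind {y1/a..a} y) + 1 / y * ind {y1/a..a * y1} y + 1 / y * ind {1/a..a} y"
    using True k \<xi> by (auto simp: indicator_def field_simps)
   also have "en (k * ind {0..a} y + k * \<xi> * (1 / y * ind {y1/a..a} y) + 1 / y * ind {y1/a..a * y1} y + 1 / y * ind {1/a..a} y)
    = en k * ind {0..a} y + en (k * \<xi>) * (en (1 / y) * ind {y1/a..a} y)
    + en (1 / y) * ind {y1/a..a * y1} y + en (1 / y) * ind {1/a..a} y"
   proof -
    have i: "en (k * \<xi> / y) = en k * en \<xi> * en (1 / y)"
     using True k \<xi> by (simp add: ennreal_mult[symmetric])
    show ?thesis using True k \<xi> by (auto simp: i ennreal_plus ennreal_mult split: split_indicator)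
   qed
   finally show ?thesis by (simp add: ennreal_leI)
  qed simp
 qed
 also have "... = en (k * a) + en (k * \<xi> * (ln a - ln (y1 / a))) + en (ln (a * y1) - ln (y1 / a)) + en (ln a - ln (1 / a))"
 proof -
  have m: "(%y::real. en (1 / y) * ind {s..t} y) : borel_measurable lb" for s t by measurable
  have ge: "y1 / a <= a" "y1 / a <= a * y1" "1 / a <= a" "0 < 1 / a"
  proof -
   show "y1 / a <= a" using y1a y1 a by linarith
   have "1 * y1 <= a * y1" using a y1 by (intro mult_right_mono) auto
   thus "y1 / a <= a * y1" using y1a by linarith
   show "1 / a <= a" using a by (simp add: field_simps) (smt (verit) mult_le_cancel_left1)
  qed (use a in auto)
  have "ln a - ln (y1 / a) >= 0" using ge(1) y1a a by simp
  hence i2: "(NL y. en (k * \<xi>) * (en (1 / y) * ind {y1/a..a} y)) = en (k * \<xi> * (ln a - ln (y1 / a)))"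
   using nn_integral_cmult[OF m, of "en (k * \<xi>)" "y1/a" a] nn_integral_inverse_Icc[OF y1a(2) ge(1)] k \<xi>
   by (simp only: ennreal_mult[symmetric] mult_nonneg_nonneg)
  have i1: "(NL y. en k * ind {0..a} y) = en (k * a)"
   using a k by (simp add: nn_integral_cmult ennreal_mult)
  note i3 = nn_integral_inverse_Icc[OF y1a(2) ge(2)] and i4 = nn_integral_inverse_Icc[OF ge(4,3)]
  have "(NL y. en k * ind {0..a} y + en (k * \<xi>) * (en (1 / y) * ind {y1/a..a} y)
    + en (1 / y) * ind {y1/a..a * y1} y + en (1 / y) * ind {1/a..a} y)
   = (NL y. en k * ind {0..a} y) + (NL y. en (k * \<xi>) * (en (1 / y) * ind {y1/a..a} y))
    + (NL y. en (1 / y) * ind {y1/a..a * y1} y) + (NL y. en (1 / y) * ind {1/a..a} y)"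
  proof -
   have m1: "(%y::real. en k * ind {0..a} y) : borel_measurable lb"
    and m2: "(%y::real. en (k * \<xi>) * (en (1 / y) * ind {y1/a..a} y)) : borel_measurable lb" by measurable
   have m12: "(%y::real. en k * ind {0..a} y + en (k * \<xi>) * (en (1 / y) * ind {y1/a..a} y)) : borel_measurable lb"
    using m1 m2 by (rule borel_measurable_add)
   have m123: "(%y::real. en k * ind {0..a} y + en (k * \<xi>) * (en (1 / y) * ind {y1/a..a} y) + en (1 / y) * ind {y1/a..a * y1} y) : borel_measurable lb"
    using m12 m by (rule borel_measurable_add)
   show ?thesis by (simp only: nn_integral_add[OF m123 m] nn_integral_add[OF m12 m] nn_integral_add[OF m1 m2])
  qed
  thus ?thesis by (simp only: i1 i2 i3 i4)
 qed
 also have "... = en ?k"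
 proof -
  have e: "ln (y1 / a) = ln y1 - ln a" "ln (a * y1) = ln a + ln y1" "ln (1 / a) = - ln a" "ln (1 / y1) = - ln y1"
   using a y1 by (simp_all add: ln_div ln_mult)
  have "ln y1 <= 0" using y1 by simp
  hence "2 * ln a - ln y1 >= 0" using la by linarith
  hence n: "k * a >= 0" "k * \<xi> * (2 * ln a - ln y1) >= 0" "2 * ln a >= 0" using k \<xi> la a by (auto intro!: mult_nonneg_nonneg)
  have "ln a - (ln y1 - ln a) = 2 * ln a - ln y1" "ln a + ln y1 - (ln y1 - ln a) = 2 * ln a" "ln a - - ln a = 2 * ln a" by simp_all
  hence "en (k * a) + en (k * \<xi> * (ln a - ln (y1 / a))) + en (ln (a * y1) - ln (y1 / a)) + en (ln a - ln (1 / a))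
   = en (k * a) + en (k * \<xi> * (2 * ln a - ln y1)) + en (2 * ln a) + en (2 * ln a)"
   unfolding e by simp
  also have "... = en (k * a + k * \<xi> * (2 * ln a - ln y1) + 2 * ln a + 2 * ln a)"
   using n by (simp only: ennreal_plus[symmetric] add_nonneg_nonneg)
  finally show ?thesis by (simp add: e add_ac)
 qed
 finally have le: "(NL y. ind {0<..} y * en (1 / y^2) * en (y * ?w y)) <= en ?k" .
 have "(NN z. en (Im z * osc a k \<xi> y1 X0 X1 z)) <= en ((X1 + a^2) - (X0 - a^2)) * en ?k"
  unfolding main using le by (rule mult_left_mono) simp
 also have "en ((X1 + a^2) - (X0 - a^2)) * en ?k
  = en ((X1 - X0 + 2 * a^2) * ?k)"
 proof -
  have "ln (1 / y1) >= 0" using y1 by simp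
  moreover have "X0 <= X1 + 2 * a^2" using X zero_le_power2[of a] by linarith
  ultimately show ?thesis using k \<xi> la a X by (subst ennreal_mult[symmetric]) (auto simp: algebra_simps)
 qed
 also have "... <= en ((X1 - X0 + 2 * a^2) * (k * a + 2 * k * ln a + k + 4 * ln a) * (1 + \<xi>) * (1 + \<xi> * ln (1 / y1)))"
 proof (rule ennreal_leI)
  define T where "T = ln (1 / y1)"
  have T: "T >= 0" using y1 by (simp add: T_def)
  have n: "k * a >= 0" "k * ln a >= 0" "\<xi> * T >= 0" using k la a \<xi> T by auto
  have "k * a + k * \<xi> * (2 * ln a + T) + 4 * ln a = k * a + (2 * k * ln a) * \<xi> + k * (\<xi> * T) + 4 * ln a"
   by (simp add: algebra_simps)
  also have "... <= (k * a + 2 * k * ln a + k + 4 * ln a) * ((1 + \<xi>) * (1 + \<xi> * T))"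
  proof -
   have 1: "1 <= (1 + \<xi>) * (1 + \<xi> * T)" "\<xi> <= (1 + \<xi>) * (1 + \<xi> * T)" "\<xi> * T <= (1 + \<xi>) * (1 + \<xi> * T)"
    using n \<xi> mult_nonneg_nonneg[OF T mult_nonneg_nonneg[OF \<xi> \<xi>]] by (simp_all add: algebra_simps)
   have "k * a * 1 <= k * a * ((1 + \<xi>) * (1 + \<xi> * T))" "(2 * k * ln a) * \<xi> <= (2 * k * ln a) * ((1 + \<xi>) * (1 + \<xi> * T))"
    "k * (\<xi> * T) <= k * ((1 + \<xi>) * (1 + \<xi> * T))" "4 * ln a * 1 <= 4 * ln a * ((1 + \<xi>) * (1 + \<xi> * T))"
    using 1 n la k by (intro mult_left_mono; simp)+
   thus ?thesis by (simp add: distrib_right)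
  qed
  finally have "k * a + k * \<xi> * (2 * ln a + T) + 4 * ln a <= (k * a + 2 * k * ln a + k + 4 * ln a) * ((1 + \<xi>) * (1 + \<xi> * T))" .
  from mult_left_mono[OF this, of "X1 - X0 + 2 * a^2"] X
  show "(X1 - X0 + 2 * a^2) * ?k
   <= (X1 - X0 + 2 * a^2) * (k * a + 2 * k * ln a + k + 4 * ln a) * (1 + \<xi>) * (1 + \<xi> * ln (1 / y1))"
   by (simp add: T_def mult.assoc)
 qed
 finally show ?thesis .
qed

section \<open>The Dirichlet form of a periodization, and unfolding against signed functions\<close>

lemma Gsum_mono_UHP:
 assumes "!!z. z : UHP ==> P z <= Q z" "z : UHP"
 shows "Gsum q P z <= Gsum q Q z"
 unfolding Gsum_def using assms moeb_UHP SL2Z_of_Gamma0 by (intro nn_integral_mono) auto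

lemma Gsum_add:
 "Gsum q (%z. P z + Q z) z = Gsum q P z + Gsum q Q z"
 unfolding Gsum_def by (rule nn_integral_add) auto

lemma Gsum_cmult:
 "Gsum q (%z. c * P z) z = c * Gsum q P z"
 unfolding Gsum_def by (rule nn_integral_cmult) auto

text \<open>The Dirichlet form of the periodization \<open>S\<close> of \<open>p\<close> is controlled by the sup of \<open>S\<close> and
  by the \<open>L\<^sup>1\<close>-size of the defect of the mean value property of \<open>p\<close>.\<close>
lemma dirichlet_bound:
 assumes [measurable]: "p : BM" "r : BM"
  and \<rho>: "\<rho> > 0" and B: "B >= 0" and SB: "!!z. z : UHP ==> Gsum q p z <= en B"
  and pr: "!!z. z : UHP ==> ballc \<rho> * p z <= Aop \<rho> p z + r z"
 shows "(NN z. ind D z * Aop \<rho> (%w. en ((enn2real (Gsum q p z) - enn2real (Gsum q p w))^2)) z)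
  <= 4 * en B * nn_integral hyp r"
proof -
 let ?S = "Gsum q p"
 define Q where "Q = (%z. Aop \<rho> (%w. en ((enn2real (?S z) - enn2real (?S w))^2)) z)"
 have Qm [measurable]: "Q : BM"
 proof -
  have m: "(%(z,w). ind {p. hnear \<rho> (fst p) (snd p)} (z,w) * en ((enn2real (?S z) - enn2real (?S w))^2)) : borel_measurable (borel \<Otimes>\<^sub>M hyp)"
   by measurable
  have "(%z. \<integral>\<^sup>+w. (case (z,w) of (z,w) => ind {p. hnear \<rho> (fst p) (snd p)} (z,w) * en ((enn2real (?S z) - enn2real (?S w))^2)) \<partial>hyp) : BM"
   by (rule hyp.borel_measurable_nn_integral_fst[OF m])
  thus ?thesis by (simp add: Q_def Aop_def[abs_def] indicator_def)
 qed
 have fin: "?S z < \<infinity>" if "z : UHP" for z using SB[OF that] by (auto intro: le_less_trans)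
 \<comment> \<open>The expansion of the square is stated additively, since subtraction in
   \<open>ennreal\<close> is truncated.\<close>
 have sq: "en ((enn2real s - enn2real t)^2) + 2 * (s * t) = s^2 + t^2" if st: "s < \<infinity>" "t < \<infinity>" for s t :: ennreal
 proof -
  obtain x y where xy: "s = en x" "x >= 0" "t = en y" "y >= 0"
   using st by (metis ennreal_cases infinity_ennreal_def less_irrefl)
  have "en ((x - y)^2) + en (2 * (x * y)) = en ((x - y)^2 + 2 * (x * y))"
   using xy by (subst ennreal_plus) auto
  also have "(x - y)^2 + 2 * (x * y) = x^2 + y^2" by (simp add: power2_eq_square algebra_simps)
  also have "en (x^2 + y^2) = en x ^2 + en y ^2" using xy by (simp add: ennreal_power)
  finally show ?thesis using xy by (simp add: ennreal_mult)
 qed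
 have ptw: "Q z + 2 * (?S z * Aop \<rho> ?S z) = ballc \<rho> * (?S z)^2 + Aop \<rho> (%w. (?S w)^2) z" if z: "z : UHP" for z
 proof -
  have "Q z + 2 * (?S z * Aop \<rho> ?S z) = Q z + (NN w. (2 * ?S z) * (kn \<rho> z w * ?S w))"
   unfolding Aop_def by (subst nn_integral_cmult) (auto simp: mult_ac)
  also have "... = (NN w. kn \<rho> z w * en ((enn2real (?S z) - enn2real (?S w))^2) + (2 * ?S z) * (kn \<rho> z w * ?S w))"
   unfolding Q_def Aop_def by (rule nn_integral_add[symmetric]) measurable
  also have "... = (NN w. kn \<rho> z w * (?S z)^2 + kn \<rho> z w * (?S w)^2)"
  proof (rule nn_integral_cong_AE, rule eventually_mono[OF AE_hyp_UHP])
   fix w assume w: "w : UHP"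
   have "kn \<rho> z w * en ((enn2real (?S z) - enn2real (?S w))^2) + (2 * ?S z) * (kn \<rho> z w * ?S w)
    = kn \<rho> z w * (en ((enn2real (?S z) - enn2real (?S w))^2) + 2 * (?S z * ?S w))"
    by (simp add: distrib_left mult_ac)
   also have "... = kn \<rho> z w * ((?S z)^2 + (?S w)^2)" by (simp only: sq[OF fin[OF z] fin[OF w]])
   finally show "kn \<rho> z w * en ((enn2real (?S z) - enn2real (?S w))^2) + (2 * ?S z) * (kn \<rho> z w * ?S w)
    = kn \<rho> z w * (?S z)^2 + kn \<rho> z w * (?S w)^2" by (simp add: distrib_left)
  qed
  also have "... = ballc \<rho> * (?S z)^2 + Aop \<rho> (%w. (?S w)^2) z"
   unfolding Aop_def by (subst nn_integral_add) (simp_all add: nn_integral_multc ball_volume[OF z, simplified])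
  finally show ?thesis .
 qed
 have SA: "ballc \<rho> * ?S z <= Aop \<rho> ?S z + Gsum q r z" if z: "z : UHP" for z
 proof -
  have "ballc \<rho> * ?S z = Gsum q (%z. ballc \<rho> * p z) z" by (simp add: Gsum_cmult)
  also have "... <= Gsum q (%z. Aop \<rho> p z + r z) z" by (rule Gsum_mono_UHP[OF pr z])
  also have "... = Aop \<rho> ?S z + Gsum q r z" using z by (simp add: Gsum_add Aop_Gsum)
  finally show ?thesis .
 qed
 let ?I = "%f. \<integral>\<^sup>+z. ind D z * f z \<partial>hyp"
 have inv2: "Ginv q (%w. (?S w)^2)" by (simp add: Ginv_def Gsum_inv)
 \<comment> \<open>Finiteness of the mixed term allows it to be cancelled from both sides at the
   end; it holds because \<open>S\<close> is bounded and \<open>D\<close> has finite area.\<close>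
 have X: "?I (%z. 2 * (?S z * Aop \<rho> ?S z)) < \<infinity>"
 proof -
  have "?I (%z. 2 * (?S z * Aop \<rho> ?S z)) <= (NN z. (2 * (en B * (ballc \<rho> * en B))) * ind D z)"
  proof (rule nn_integral_mono_AE, rule eventually_mono[OF AE_hyp_UHP])
   fix z assume z: "z : UHP"
   have "Aop \<rho> ?S z <= (NN w. kn \<rho> z w * en B)" unfolding Aop_def
    by (rule nn_integral_mono_AE, rule eventually_mono[OF AE_hyp_UHP]) (simp add: SB mult_left_mono)
   also have "... = ballc \<rho> * en B" by (subst nn_integral_multc) (simp_all add: ball_volume[OF z, simplified])
   finally have "2 * (?S z * Aop \<rho> ?S z) <= 2 * (en B * (ballc \<rho> * en B))"
    using SB[OF z] by (intro mult_left_mono mult_mono) auto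
   from mult_right_mono[OF this, of "ind D z"]
   show "ind D z * (2 * (?S z * Aop \<rho> ?S z)) <= (2 * (en B * (ballc \<rho> * en B))) * ind D z"
    by (simp add: mult_ac)
  qed
  also have "... = (2 * (en B * (ballc \<rho> * en B))) * emeasure hyp D"
   by (rule nn_integral_cmult_indicator) simp
  also have "... < \<infinity>" using ballc_finite[OF \<rho>] D_finite by (simp add: ennreal_mult_less_top)
  finally show ?thesis .
 qed
 \<comment> \<open>Integrated over \<open>D\<close>, the two squares contribute equally by
   \<open>kernel_swap\<close>. The mean value inequality for \<open>S\<close> then bounds them by
   the mixed term plus the periodized defect, and unfolding turns the latter into an integral over
   the half plane.\<close>
 have "?I (%z. 2 * (?S z * Aop \<rho> ?S z)) + ?I Q = ?I (%z. Q z + 2 * (?S z * Aop \<rho> ?S z))"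
  by (simp add: distrib_left nn_integral_add add.commute)
 also have "... = ?I (%z. ballc \<rho> * (?S z)^2 + Aop \<rho> (%w. (?S w)^2) z)"
  by (rule nn_integral_cong_AE, rule eventually_mono[OF AE_hyp_UHP]) (simp add: ptw)
 also have "... = ?I (%z. ballc \<rho> * (?S z)^2) + ?I (Aop \<rho> (%w. (?S w)^2))"
  by (simp add: distrib_left nn_integral_add)
 also have "?I (Aop \<rho> (%w. (?S w)^2)) = ballc \<rho> * ?I (%w. (?S w)^2)"
  by (rule kernel_swap) (use inv2 in measurable)
 also have "... = ?I (%z. ballc \<rho> * (?S z)^2)"
  by (subst nn_integral_cmult[symmetric]) (auto simp: mult_ac)
 also have "?I (%z. ballc \<rho> * (?S z)^2) + ?I (%z. ballc \<rho> * (?S z)^2) = ?I (%z. 2 * (ballc \<rho> * (?S z)^2))"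
  by (subst nn_integral_add[symmetric]) (auto simp: mult_2 distrib_left)
 also have "... <= ?I (%z. 2 * (?S z * Aop \<rho> ?S z) + 2 * (en B * Gsum q r z))"
 proof (rule nn_integral_mono_AE, rule eventually_mono[OF AE_hyp_UHP])
  fix z assume z: "z : UHP"
  have "ballc \<rho> * (?S z)^2 = ?S z * (ballc \<rho> * ?S z)" by (simp add: power2_eq_square mult_ac)
  also have "... <= ?S z * (Aop \<rho> ?S z + Gsum q r z)" by (intro mult_left_mono SA[OF z]) simp
  also have "... = ?S z * Aop \<rho> ?S z + ?S z * Gsum q r z" by (rule distrib_left)
  also have "... <= ?S z * Aop \<rho> ?S z + en B * Gsum q r z"
   by (intro add_left_mono mult_right_mono SB[OF z]) simp
  finally have "2 * (ballc \<rho> * (?S z)^2) <= 2 * (?S z * Aop \<rho> ?S z + en B * Gsum q r z)"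
   by (intro mult_left_mono) simp_all
  hence "2 * (ballc \<rho> * (?S z)^2) <= 2 * (?S z * Aop \<rho> ?S z) + 2 * (en B * Gsum q r z)" by (simp only: distrib_left)
  thus "ind D z * (2 * (ballc \<rho> * (?S z)^2)) <= ind D z * (2 * (?S z * Aop \<rho> ?S z) + 2 * (en B * Gsum q r z))"
   by (intro mult_left_mono) simp_all
 qed
 also have "... = ?I (%z. 2 * (?S z * Aop \<rho> ?S z)) + ?I (%z. 2 * (en B * Gsum q r z))"
  by (simp add: distrib_left nn_integral_add)
 finally have "?I Q <= ?I (%z. 2 * (en B * Gsum q r z))"
  using X by (auto simp: ennreal_add_left_cancel_le)
 also have "... = (NN z. (2 * en B) * (ind D z * Gsum q r z))"
  by (intro nn_integral_cong) (simp add: mult_ac)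
 also have "... = (2 * en B) * (2 * nn_integral hyp r)"
  by (subst nn_integral_cmult) (simp_all add: unfolding_nn)
 also have "... = 4 * en B * nn_integral hyp r"
 proof -
  have "(2 * en B) * (2 * nn_integral hyp r) = (2 * 2) * (en B * nn_integral hyp r)" by (simp only: mult_ac)
  thus ?thesis by (simp add: mult.assoc)
 qed
 finally show ?thesis by (simp add: Q_def)
qed

lemma integrable_D:
 assumes [measurable]: "k : BM" and "!!z. z : D ==> abs (k z) <= c"
 shows "integrable hyp (%z. ind D z * k z :: real)"
 by (rule integrableI_bounded_set[of D _ _ c]) (use assms(2) D_finite in auto)

text \<open>A bounded signed \<open>h\<close> is the difference of \<open>h + Hb\<close> and the
  constant \<open>Hb\<close>, both nonnegative and invariant, to which unfolding in
  \<open>ennreal\<close> applies.\<close>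

lemma unfolding_real:
 assumes p [measurable]: "p : BM" and pnn: "!!z. p z >= 0"
  and h [measurable]: "h : BM" and hb: "!!z. abs (h z) <= Hb" and inv: "Ginv q h"
  and SB: "!!z. z : UHP ==> Gsum q (%z. en (p z)) z <= en B"
 shows "(LINT z|hyp. ind D z * (enn2real (Gsum q (%z. en (p z)) z) * h z)) = 2 * (LINT z|hyp. p z * h z)"
  and "integrable hyp (%z. p z * h z)"
proof -
 let ?P = "%z. en (p z)"
 let ?S = "%z. enn2real (Gsum q ?P z)"
 have fin: "Gsum q ?P z < \<infinity>" if "z : UHP" for z using SB[OF that] by (auto intro: le_less_trans)
 have Hb: "Hb >= 0" using hb[of 0] by linarith
 have B: "?S z <= max B 0" if "z : UHP" for z
  using SB[OF that] fin[OF that] by (metis enn2real_leI ennreal_max_0 max.cobounded2 max.commute)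
 have nn: "integrable hyp (%z. p z * k z) & (LINT z|hyp. ind D z * (?S z * k z)) = 2 * (LINT z|hyp. p z * k z)"
  if [measurable]: "k : BM" and knn: "!!z. k z >= 0" and kb: "!!z. k z <= c" and kinv: "Ginv q k" for k c
 proof -
  have "(NN z. en (ind D z * (?S z * k z))) = (NN z. ind D z * (Gsum q ?P z * en (k z)))"
  proof (rule nn_integral_cong_AE, rule eventually_mono[OF AE_hyp_UHP])
   fix z assume "z : UHP"
   hence "en (?S z) = Gsum q ?P z" using fin by simp
   thus "en (ind D z * (?S z * k z)) = ind D z * (Gsum q ?P z * en (k z))"
    using knn[of z] by (cases "z : D") (simp_all add: ennreal_mult)
  qed
  also have "... = 2 * (NN z. ?P z * en (k z))"
   by (rule unfolding_nn_inv) (use kinv in \<open>auto simp: Ginv_def\<close>)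
  also have "(NN z. ?P z * en (k z)) = (NN z. en (p z * k z))"
   using pnn knn by (simp add: ennreal_mult)
  finally have eq: "(NN z. en (ind D z * (?S z * k z))) = 2 * (NN z. en (p z * k z))" .
  have "integrable hyp (%z. ind D z * (?S z * k z))"
  proof (rule integrable_D)
   fix z assume "z : D"
   hence "z : UHP" using D_UHP by blast
   thus "abs (?S z * k z) <= max B 0 * c" using B knn[of z] kb[of z] by (simp add: abs_mult mult_mono)
  qed measurable
  hence "(NN z. en (ind D z * (?S z * k z))) < \<infinity>"
   using knn by (subst (asm) integrable_iff_bounded) (simp add: abs_mult)
  hence f: "(NN z. en (p z * k z)) < \<infinity>" unfolding eq
   by (auto simp: ennreal_mult_less_top)
  have i: "integrable hyp (%z. p z * k z)"
   by (rule integrableI_nonneg) (use f pnn knn in auto)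
  have "(LINT z|hyp. ind D z * (?S z * k z)) = enn2real (NN z. en (ind D z * (?S z * k z)))"
   using knn by (intro integral_eq_nn_integral) auto
  also have "... = 2 * enn2real (NN z. en (p z * k z))" unfolding eq by (simp add: enn2real_mult)
  also have "enn2real (NN z. en (p z * k z)) = (LINT z|hyp. p z * k z)"
   using pnn knn by (intro integral_eq_nn_integral[symmetric]) auto
  finally show ?thesis using i by simp
 qed
 have n1: "integrable hyp (%z. p z * (h z + Hb)) & (LINT z|hyp. ind D z * (?S z * (h z + Hb))) = 2 * (LINT z|hyp. p z * (h z + Hb))"
 proof (rule nn)
  show "h z + Hb >= 0" "h z + Hb <= 2 * Hb" for z using hb[of z] by (auto simp: abs_le_iff)
 qed (use inv in \<open>auto simp: Ginv_def\<close>)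
 have n2: "integrable hyp (%z. p z * Hb) & (LINT z|hyp. ind D z * (?S z * Hb)) = 2 * (LINT z|hyp. p z * Hb)"
  by (rule nn[of _ Hb]) (use Hb in \<open>auto simp: Ginv_def\<close>)
 have e: "p z * h z = p z * (h z + Hb) - p z * Hb" for z by (simp add: algebra_simps)
 show i: "integrable hyp (%z. p z * h z)" unfolding e using n1 n2 by (intro Bochner_Integration.integrable_diff) auto
 have iD: "integrable hyp (%z. ind D z * (?S z * k z))" if [measurable]: "k : BM" and kb: "!!z. abs (k z) <= c" for k c
 proof (rule integrable_D)
  fix z assume "z : D"
  hence "z : UHP" using D_UHP by blast
  thus "abs (?S z * k z) <= max B 0 * c" using B kb[of z] by (simp add: abs_mult mult_mono)
 qed measurable
 have e2: "ind D z * (?S z * h z) = ind D z * (?S z * (h z + Hb)) - ind D z * (?S z * Hb)" for z by (simp add: algebra_simps)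
 have "(LINT z|hyp. ind D z * (?S z * h z)) = (LINT z|hyp. ind D z * (?S z * (h z + Hb))) - (LINT z|hyp. ind D z * (?S z * Hb))"
  unfolding e2
 proof (rule Bochner_Integration.integral_diff)
  show "integrable hyp (%z. ind D z * (?S z * (h z + Hb)))"
  proof (rule iD)
   show "abs (h z + Hb) <= 2 * Hb" for z using hb[of z] by (auto simp: abs_le_iff)
  qed measurable
  show "integrable hyp (%z. ind D z * (?S z * Hb))" by (rule iD[of _ "abs Hb"]) auto
 qed
 also have "... = 2 * ((LINT z|hyp. p z * (h z + Hb)) - (LINT z|hyp. p z * Hb))" using n1 n2 by simp
 also have "(LINT z|hyp. p z * (h z + Hb)) - (LINT z|hyp. p z * Hb) = (LINT z|hyp. p z * h z)"
  unfolding e using n1 n2 by (intro Bochner_Integration.integral_diff[symmetric]) auto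
 finally show "(LINT z|hyp. ind D z * (?S z * h z)) = 2 * (LINT z|hyp. p z * h z)" .
qed

section \<open>Near constancy of the periodization on the domain\<close>

definition Kset :: "real => complex set" where
 "Kset N = {z. abs (Re z) <= N & 1 / N <= Im z & Im z <= N}"

lemma Kset_measurable [measurable]: "Kset N : sets borel"
proof -
 have "{z\<in>space borel. abs (Re z) <= N & 1 / N <= Im z & Im z <= N} : sets borel" by measurable
 thus ?thesis by (simp add: Kset_def)
qed

lemma Kset_finite: "N > 0 ==> emeasure hyp (Kset N) < \<infinity>"
proof -
 assume N: "N > 0"
 have "{z\<in>space borel. -N <= Re z & Re z <= N & 1 / N <= Im z} : sets borel" by measurable
 hence "emeasure hyp (Kset N) <= emeasure hyp {z. -N <= Re z & Re z <= N & 1 / N <= Im z}"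
  by (intro emeasure_mono) (auto simp: Kset_def abs_le_iff)
 also have "... < \<infinity>" by (rule hyp_strip_finite) (use N in auto)
 finally show ?thesis .
qed

text \<open>Continuity from above, available because \<open>D\<close> has finite area and lies in
  the union of the sets \<open>Kset N\<close>.\<close>

lemma D_minus_Kset_small:
 assumes "e > 0"
 shows "EX N>=1. measure hyp (D - Kset N) < e"
proof -
 define A where "A = (%n::nat. D - Kset (real n + 1))"
 have dec: "decseq A"
 proof (unfold decseq_def, intro allI impI)
  fix m n :: nat assume mn: "m <= n"
  have "1 / (real n + 1) <= 1 / (real m + 1)" using mn by (simp add: frac_le)
  thus "A n <= A m" using mn by (auto simp: A_def Kset_def)
 qed
 have "(%n. measure hyp (A n)) \<longlonglongrightarrow> measure hyp (\<Inter>i. A i)"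
 proof (rule Lim_measure_decseq[OF _ dec])
  show "range A <= sets hyp" by (auto simp: A_def)
  fix i
  have "emeasure hyp (A i) <= emeasure hyp D" by (intro emeasure_mono) (auto simp: A_def)
  thus "emeasure hyp (A i) ~= \<infinity>" using D_finite by (auto simp: top_unique)
 qed
 moreover have "(\<Inter>i. A i) = {}"
 proof (rule ccontr)
  assume "(\<Inter>i. A i) ~= {}"
  then obtain z where z: "!!i. z : A i" by blast
  hence "z : UHP" using z[of 0] D_UHP by (auto simp: A_def)
  hence y: "Im z > 0" by (simp add: UHP_def)
  obtain n :: nat where n: "abs (Re z) + Im z + 1 / Im z <= real n" using real_arch_simple by blast
  have "1 / Im z <= real n + 1" using n y by (smt (verit) abs_ge_zero)
  hence "1 / (real n + 1) <= Im z" using y by (simp add: field_simps)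
  moreover have "1 / Im z > 0" using y by simp
  ultimately have "z : Kset (real n + 1)" using n y unfolding Kset_def by (simp, smt (verit) abs_ge_zero)
  thus False using z[of n] by (simp add: A_def)
 qed
 ultimately have "(%n. measure hyp (A n)) \<longlonglongrightarrow> 0" by simp
 from order_tendstoD(2)[OF this assms] obtain n where "measure hyp (A n) < e"
  by (auto simp: eventually_sequentially)
 thus ?thesis by (intro exI[of _ "real n + 1"]) (simp add: A_def)
qed

text \<open>Area exactly 1 makes a lower bound on this box a lower bound for the integral over it,
  which is how a base point is selected below.\<close>

lemma hyp_U0: "emeasure hyp {z. -1/2 <= Re z & Re z <= 1/2 & 1/2 <= Im z & Im z <= 1} = 1"
proof -
 let ?U = "{z. -1/2 <= Re z & Re z <= 1/2 & 1/2 <= Im z & Im z <= 1}"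
 have "{z\<in>space borel. -1/2 <= Re z & Re z <= 1/2 & 1/2 <= Im z & Im z <= 1} : sets borel" by measurable
 hence [measurable]: "?U : sets borel" by simp
 have "emeasure hyp ?U = (NN z. ind {-1/2..1/2} (Re z) * ind {1/2..1} (Im z))"
  by (subst nn_integral_indicator[symmetric], simp, intro nn_integral_cong) (auto simp: indicator_def)
 also have "... = en (1/2 - (-1/2)) * (NL y. ind {0<..} y * en (1 / y^2) * ind {1/2..1} y)"
  by (rule hyp_strip_nn_integral) auto
 also have "(NL y. ind {0<..} y * en (1 / y^2) * ind {1/2..1} y) = (NL y. en (1 / y^2) * ind {1/2..1} y)"
  by (intro nn_integral_cong) (auto simp: indicator_def)
 also have "... = en ((- 1 / 1) - (- 1 / (1/2)))"
  by (rule nn_integral_FTC_Icc[where F="%y. - 1 / y"])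
   (auto intro!: derivative_eq_intros simp: power2_eq_square)
 finally show ?thesis by simp
qed

text \<open>By unfolding, the integral is half of that of \<open>S h\<close> over \<open>D\<close>,
  where \<open>S\<close> is the periodization. As \<open>h\<close> has mean zero, any constant
  \<open>m\<close> may be subtracted from \<open>S\<close>. On a compact part \<open>S - m\<close>
  is small in mean square by the Dirichlet bound; on the rest the trivial bound for \<open>S\<close>
  is multiplied by a small area. This gives the square root and the \<open>\<epsilon>\<close> term
  respectively.\<close>

lemma decorrelation:
 assumes h [measurable]: "h : BM" and hb: "!!z. abs (h z) <= Hb" and inv: "Ginv q h"
  and mean: "(LINT z|hyp. ind D z * h z) = 0"
  and X: "X0 <= X1" and K: "!!\<rho>. K \<rho> >= 0" and \<epsilon>: "\<epsilon> > 0"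
 shows "EX C>=0. ALL \<xi> y1 v. 0 <= \<xi> --> \<xi> <= 1 --> 0 < y1 --> y1 <= 1 --> v : BM -->
  (ALL z. 0 <= v z & v z <= 1) --> (ALL z. Re z \<notin> {X0..X1} --> v z = 0) --> slow K \<xi> v -->
  abs (LINT z|hyp. cutp y1 v z * h z) <= \<epsilon> * (1 + ln (1 / y1)) + C * sqrt ((1 + ln (1 / y1)) * (1 + \<xi> * ln (1 / y1)))"
proof -
 have Hb: "Hb >= 0" using hb[of 0] by linarith
 define C1 where "C1 = 30 * (X1 - X0 + 1)"
 have C1: "C1 > 0" using X by (simp add: C1_def)
 define e where "e = \<epsilon> / (Hb * C1 + 1)"
 have pos: "Hb * C1 + 1 > 0" using Hb C1 by (simp add: add_nonneg_pos)
 have e: "e > 0" using \<epsilon> pos by (simp add: e_def)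
 obtain N where N: "N >= 1" "measure hyp (D - Kset N) < e" using D_minus_Kset_small[OF e] by blast
 define \<rho> where "\<rho> = 8 * N * (N + 1)^2"
 have \<rho>: "\<rho> > 0" using N by (simp add: \<rho>_def)
 define a where "a = 2 + \<rho>"
 define c where "c = enn2real (ballc \<rho>)"
 have c: "ballc \<rho> = en c" "c >= 0" using ballc_finite[OF \<rho>] by (auto simp: c_def)
 define C2 where "C2 = c * ((X1 - X0 + 2 * a^2) * (K \<rho> * a + 2 * K \<rho> * ln a + K \<rho> + 4 * ln a) * 2)"
 have a: "a >= 1" using \<rho> by (simp add: a_def)
 have C2: "C2 >= 0" unfolding C2_def using c K[of \<rho>] a X by (intro mult_nonneg_nonneg add_nonneg_nonneg) auto
 define mK where "mK = measure hyp (Kset N)"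
 have mK: "emeasure hyp (Kset N) = en mK" using Kset_finite[of N] N by (simp add: mK_def emeasure_eq_ennreal_measure less_top)
 define C where "C = Hb * (mK + 1) * sqrt (480 * C1 * C2 + 1)"
 have C0: "C >= 0" unfolding C_def using Hb C1 C2 by (simp add: mK_def)
 show ?thesis
 proof (intro exI[of _ C] conjI C0 allI impI)
  fix \<xi> y1 :: real and v :: "complex => real"
  assume \<xi>: "0 <= \<xi>" "\<xi> <= 1" and y1: "0 < y1" "y1 <= 1" and v [measurable]: "v : BM"
   and v01: "ALL z. 0 <= v z & v z <= 1" and vs: "ALL z. Re z \<notin> {X0..X1} --> v z = 0" and sl: "slow K \<xi> v"
  have v': "!!z. 0 <= v z" "!!z. v z <= 1" "!!z. Re z \<notin> {X0..X1} ==> v z = 0" using v01 vs by auto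
  define T where "T = ln (1 / y1)"
  have T: "T >= 0" using y1 by (simp add: T_def)
  define B where "B = C1 * (1 + T)"
  have B: "B >= 0" using C1 T by (simp add: B_def)
  define p where "p = (%z. en (cutp y1 v z))"
  have [measurable]: "p : BM" unfolding p_def by measurable
  have SB: "Gsum q p z <= en B" if "z : UHP" for z
   unfolding p_def B_def C1_def T_def by (rule Gsum_cutp_bound[OF v' y1 X that])
  define r where "r = (%z. ballc \<rho> * en (Im z * osc a (K \<rho>) \<xi> y1 X0 X1 z))"
  have rm [measurable]: "r : BM" unfolding r_def by measurable
  have pr: "ballc \<rho> * p z <= Aop \<rho> p z + r z" if "z : UHP" for z
   unfolding p_def r_def a_def by (rule cutp_le_Aop[OF v' v K sl \<rho> \<xi>(1) y1 that])
  define R where "R = C2 * (1 + \<xi> * T)"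
  have R: "R >= 0" using C2 \<xi> T by (simp add: R_def)
  have "nn_integral hyp r = ballc \<rho> * (NN z. en (Im z * osc a (K \<rho>) \<xi> y1 X0 X1 z))"
   unfolding r_def by (rule nn_integral_cmult) measurable
  also have "... <= en c * en ((X1 - X0 + 2 * a^2) * (K \<rho> * a + 2 * K \<rho> * ln a + K \<rho> + 4 * ln a) * (1 + \<xi>) * (1 + \<xi> * ln (1 / y1)))"
   unfolding c(1) by (intro mult_left_mono osc_integral a K \<xi> y1 X) simp
  also have "... = en (c * ((X1 - X0 + 2 * a^2) * (K \<rho> * a + 2 * K \<rho> * ln a + K \<rho> + 4 * ln a) * (1 + \<xi>) * (1 + \<xi> * T)))"
   using c by (simp add: ennreal_mult'[symmetric] T_def)
  also have "... <= en R"
  proof (rule ennreal_leI)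
   have "c * ((X1 - X0 + 2 * a^2) * (K \<rho> * a + 2 * K \<rho> * ln a + K \<rho> + 4 * ln a) * (1 + \<xi>))
    <= c * ((X1 - X0 + 2 * a^2) * (K \<rho> * a + 2 * K \<rho> * ln a + K \<rho> + 4 * ln a) * 2)"
    using c K[of \<rho>] a X \<xi> by (intro mult_left_mono mult_nonneg_nonneg add_nonneg_nonneg) auto
   from mult_right_mono[OF this, of "1 + \<xi> * T"] \<xi> T
   show "c * ((X1 - X0 + 2 * a^2) * (K \<rho> * a + 2 * K \<rho> * ln a + K \<rho> + 4 * ln a) * (1 + \<xi>) * (1 + \<xi> * T)) <= R"
    by (simp add: R_def C2_def mult.assoc)
  qed
  finally have rR: "nn_integral hyp r <= en R" .
  let ?S = "Gsum q p"
  define s where "s = (%z. enn2real (?S z))"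
  have sm [measurable]: "s : BM" unfolding s_def by measurable
  have s0: "s z >= 0" for z by (simp add: s_def)
  have sB: "s z <= B" if "z : UHP" for z unfolding s_def by (rule enn2real_leI[OF _ SB[OF that]]) (use B in auto)
  define Q where "Q = (%z. Aop \<rho> (%w. en ((s z - s w)^2)) z)"
  have Qm [measurable]: "Q : BM"
  proof -
   have m: "(%(z,w). ind {p. hnear \<rho> (fst p) (snd p)} (z,w) * en ((s z - s w)^2)) : borel_measurable (borel \<Otimes>\<^sub>M hyp)"
    by measurable
   have "(%z. \<integral>\<^sup>+w. (case (z,w) of (z,w) => ind {p. hnear \<rho> (fst p) (snd p)} (z,w) * en ((s z - s w)^2)) \<partial>hyp) : BM"
    by (rule hyp.borel_measurable_nn_integral_fst[OF m])
   thus ?thesis by (simp add: Q_def Aop_def[abs_def] indicator_def)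
  qed
  have sinv: "s (moeb g z) = s z" if "g : Gamma0 q" "z : UHP" for g z
   using that by (simp add: s_def Gsum_inv)
  have Qinv: "Ginv q Q" unfolding Ginv_def
  proof (intro ballI)
   fix g z assume g: "g : Gamma0 q" and z: "z : UHP"
   have "Q (moeb g z) = Aop \<rho> (%w. en ((s z - s w)^2)) (moeb g z)" by (simp add: Q_def sinv[OF g z])
   also have "... = Aop \<rho> (%w. en ((s z - s (moeb g w))^2)) z"
    by (rule Aop_moeb[symmetric, OF SL2Z_of_Gamma0[OF g] z, of "%w. en ((s z - s w)^2)"]) measurable
   also have "... = Q z" unfolding Q_def Aop_def
    by (rule nn_integral_cong_AE, rule eventually_mono[OF AE_hyp_UHP]) (simp add: sinv[OF g])
   finally show "Q (moeb g z) = Q z" .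
  qed
  have "(NN z. ind D z * Q z) <= 4 * en B * nn_integral hyp r"
   unfolding Q_def s_def by (rule dirichlet_bound[OF _ _ \<rho> B SB pr]) measurable
  also have "... <= 4 * en B * en R" by (intro mult_left_mono rR) simp
  also have "... = en (4 * B * R)" using B R by (simp add: ennreal_mult)
  finally have QD: "(NN z. ind D z * Q z) <= en (4 * B * R)" .
  \<comment> \<open>The factor 480 is 120 from \<open>strip_integral_le\<close> for a strip of width
    1 above height 1/2, times 4 from the Dirichlet bound. The added 1 makes the contradiction below
    strict and keeps \<open>Q5\<close> away from 0.\<close>
  define Q5 where "Q5 = 480 * B * R + 1"
  have Q5: "Q5 >= 1" using B R by (simp add: Q5_def)
  let ?V = "{z. -1/2 <= Re z & Re z <= 1/2 & 1/2 <= Im z & Im z <= 1}"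
  let ?U = "{z. -1/2 <= Re z & Re z <= 1/2 & 1/2 <= Im z}"
  \<comment> \<open>A point with moderate \<open>Q\<close> exists by averaging over the box of area
    1. Its value of \<open>S\<close> serves as the constant, and \<open>Q z0\<close> controls the
    mean square deviation on the whole ball about it.\<close>
  have "EX z0:?V. Q z0 <= en Q5"
  proof (rule ccontr)
   assume "~ ?thesis"
   hence big: "Q z >= en Q5" if "z : ?V" for z using that by force
   have "{z\<in>space borel. -1/2 <= Re z & Re z <= 1/2 & 1/2 <= Im z & Im z <= 1} : sets borel" by measurable
   hence U0m: "?V : sets hyp" by simp
   have "en Q5 = en Q5 * emeasure hyp ?V" by (simp only: hyp_U0 mult_1_right)
   also have "... = (NN z. en Q5 * ind ?V z)" by (rule nn_integral_cmult_indicator[symmetric, OF U0m])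
   also have "... <= (NN z. ind ?U z * Q z)"
   proof (rule nn_integral_mono)
    fix z show "en Q5 * ind ?V z <= ind ?U z * Q z"
     using big[of z] by (cases "z : ?V") auto
   qed
   also have "... <= en (30 * (1/2 - (-1/2) + 1) / (1/2)) * (NN z. ind D z * Q z)"
    by (rule strip_integral_le[OF Qm Qinv]) auto
   also have "... <= en (30 * (1/2 - (-1/2) + 1) / (1/2)) * en (4 * B * R)" by (intro mult_left_mono QD) simp
   also have "... = en (480 * B * R)" using B R by (subst ennreal_mult[symmetric]) auto
   finally have "Q5 <= 480 * B * R" using B R by (subst (asm) ennreal_le_iff) auto
   thus False by (simp add: Q5_def)
  qed
  then obtain z0 where z0: "z0 : ?V" "Q z0 <= en Q5" by blast
  have z0U: "z0 : UHP" using z0 by (auto simp: UHP_def)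
  define m where "m = s z0"
  have near: "hnear \<rho> z0 w" if w: "w : Kset N" for w
  proof -
   have "abs (Re z0 - Re w) <= N + 1" "abs (Im z0 - Im w) <= N + 1"
   proof -
    have "abs (Re w) <= N" "1 / N <= Im w" "Im w <= N" "1 / N > 0" using w N by (auto simp: Kset_def)
    moreover have "abs (Re z0) <= 1/2" "0 <= Im z0" "Im z0 <= 1" using z0(1) by auto
    ultimately show "abs (Re z0 - Re w) <= N + 1" "abs (Im z0 - Im w) <= N + 1" by linarith+
   qed
   hence "(Re z0 - Re w)^2 <= (N+1)^2" "(Im z0 - Im w)^2 <= (N+1)^2"
    using N by (metis abs_le_square_iff abs_of_nonneg add_nonneg_nonneg order_trans zero_le_one)+
   hence 1: "(norm (z0 - w))^2 <= 2 * (N+1)^2" by (simp add: cmod_power2)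
   have "1 / 2 * (1 / N) <= Im z0 * Im w" using z0(1) w N by (intro mult_mono) (auto simp: Kset_def)
   hence "\<rho> * (1 / 2 * (1 / N)) <= \<rho> * (Im z0 * Im w)" using \<rho> by (intro mult_left_mono) auto
   moreover have "\<rho> * (1 / 2 * (1 / N)) = 4 * (N+1)^2" using N by (simp add: \<rho>_def)
   ultimately have "4 * (N+1)^2 <= \<rho> * Im z0 * Im w" by (simp add: mult.assoc)
   moreover have "(N+1)^2 > 0" using N by simp
   ultimately show ?thesis using 1 unfolding hnear_def by linarith
  qed
  have "(NN w. ind (Kset N) w * en ((m - s w)^2)) <= Q z0"
   unfolding Q_def Aop_def m_def using near by (intro nn_integral_mono) (auto simp: indicator_def)
  hence KQ: "(NN w. ind (Kset N) w * en ((m - s w)^2)) <= en Q5" using z0(2) by (rule order_trans)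
  define lam where "lam = sqrt Q5"
  have lam: "lam >= 1" "lam^2 = Q5" using Q5 by (auto simp: lam_def)
  \<comment> \<open>The inequality of arithmetic and geometric means with the optimal weight
    \<open>sqrt Q5\<close> does the work of Cauchy-Schwarz in passing from mean square to
    mean.\<close>
  have ab: "abs x <= lam / 2 + x^2 / (2 * lam)" for x :: real
  proof -
   have "0 <= (abs x - lam)^2" by simp
   hence "2 * lam * abs x <= lam^2 + x^2" by (simp add: power2_eq_square algebra_simps)
   thus ?thesis using lam(1) by (simp add: field_simps power2_eq_square)
  qed
  have mB: "0 <= m" "m <= B" using s0 sB[OF z0U] by (auto simp: m_def)
  have DmK: "emeasure hyp (D - Kset N) = en (measure hyp (D - Kset N))"
  proof -
   have "emeasure hyp (D - Kset N) <= emeasure hyp D" by (intro emeasure_mono) auto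
   thus ?thesis using D_finite by (intro emeasure_eq_ennreal_measure) (auto simp: top_unique)
  qed
  have "(NN z. en (ind D z * abs (s z - m)))
   <= (NN z. en (lam / 2) * ind (Kset N) z + en (1 / (2 * lam)) * (ind (Kset N) z * en ((m - s z)^2)) + en B * ind (D - Kset N) z)"
  proof (rule nn_integral_mono)
   fix z
   consider "z \<notin> D" | "z : D" "z : Kset N" | "z : D" "z \<notin> Kset N" by blast
   thus "en (ind D z * abs (s z - m)) <= en (lam / 2) * ind (Kset N) z + en (1 / (2 * lam)) * (ind (Kset N) z * en ((m - s z)^2)) + en B * ind (D - Kset N) z"
   proof cases
    case 2
    have "en (abs (s z - m)) <= en (lam / 2 + (s z - m)^2 / (2 * lam))" using ab by (intro ennreal_leI)
    also have "... = en (lam / 2) + en (1 / (2 * lam)) * en ((m - s z)^2)"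
     using lam by (simp add: ennreal_plus ennreal_mult[symmetric] power2_commute[of m])
    finally show ?thesis using 2 by simp
   next
    case 3
    hence "z : UHP" using D_UHP by blast
    hence "abs (s z - m) <= B" using s0[of z] sB[of z] mB by (auto simp: abs_le_iff)
    thus ?thesis using 3 by (simp add: ennreal_leI)
   qed simp
  qed
  also have "... = en (lam / 2) * emeasure hyp (Kset N) + en (1 / (2 * lam)) * (NN w. ind (Kset N) w * en ((m - s w)^2)) + en B * emeasure hyp (D - Kset N)"
   by (subst nn_integral_add, measurable, subst nn_integral_add, measurable)
    (simp add: nn_integral_cmult nn_integral_cmult_indicator)
  also have "... <= en (lam / 2) * en mK + en (1 / (2 * lam)) * en Q5 + en B * en e"
   unfolding mK DmK using KQ N(2) by (intro add_mono mult_left_mono order_refl ennreal_leI) auto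
  also have "... = en (lam / 2 * mK + Q5 / (2 * lam) + B * e)"
   using lam B e Q5 by (simp add: ennreal_plus ennreal_mult[symmetric] mK_def)
  also have "Q5 / (2 * lam) = lam / 2" using lam by (simp add: field_simps power2_eq_square)
  finally have L1: "(NN z. en (ind D z * abs (s z - m))) <= en (lam / 2 * mK + lam / 2 + B * e)" .
  have iS: "integrable hyp (%z. ind D z * (s z * h z))"
  proof (rule integrable_D)
   fix z assume "z : D"
   hence "z : UHP" using D_UHP by blast
   hence "s z * abs (h z) <= B * Hb" using sB[of z] s0[of z] hb[of z] B by (intro mult_mono) auto
   thus "abs (s z * h z) <= B * Hb" using s0[of z] by (simp add: abs_mult)
  qed measurable
  have ih: "integrable hyp (%z. ind D z * h z)" by (rule integrable_D[of _ Hb]) (use hb in auto)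
  have iA: "integrable hyp (%z. ind D z * abs (s z - m))"
  proof (rule integrable_D)
   fix z assume "z : D"
   hence "z : UHP" using D_UHP by blast
   thus "\<bar>\<bar>s z - m\<bar>\<bar> <= B" using s0[of z] sB[of z] mB by (auto simp: abs_le_iff)
  qed measurable
  have L1r: "(LINT z|hyp. ind D z * abs (s z - m)) <= lam / 2 * mK + lam / 2 + B * e"
  proof -
   have "(LINT z|hyp. ind D z * abs (s z - m)) = enn2real (NN z. en (ind D z * abs (s z - m)))"
    by (rule integral_eq_nn_integral) auto
   also have "... <= lam / 2 * mK + lam / 2 + B * e"
    by (rule enn2real_leI[OF _ L1]) (use lam B e in \<open>auto simp: mK_def\<close>)
   finally show ?thesis .
  qed
  have U: "(LINT z|hyp. ind D z * (s z * h z)) = 2 * (LINT z|hyp. cutp y1 v z * h z)"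
   unfolding s_def p_def
  proof (rule unfolding_real(1)[OF _ _ h hb inv, where B=B])
   show "cutp y1 v z >= 0" for z using v'(1)[of z] y1 by (auto simp: cutp_def indicator_def)
   show "Gsum q (%z. en (cutp y1 v z)) z <= en B" if "z : UHP" for z using SB[OF that] by (simp add: p_def)
  qed measurable
  \<comment> \<open>The mean-zero hypothesis enters here and allows \<open>s\<close> to be replaced
    by \<open>s - m\<close>.\<close>
  have "(LINT z|hyp. ind D z * (s z * h z)) = (LINT z|hyp. ind D z * (s z * h z)) - m * (LINT z|hyp. ind D z * h z)"
   using mean by simp
  also have "... = (LINT z|hyp. ind D z * (s z * h z) - m * (ind D z * h z))"
   using iS ih by simp
  finally have "abs (LINT z|hyp. ind D z * (s z * h z)) = abs (LINT z|hyp. ind D z * (s z * h z) - m * (ind D z * h z))" by simp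
  also have "... <= (LINT z|hyp. Hb * (ind D z * abs (s z - m)))"
  proof (rule integral_abs_bound_integral)
   show "integrable hyp (%z. ind D z * (s z * h z) - m * (ind D z * h z))" using iS ih by simp
   show "integrable hyp (%z. Hb * (ind D z * abs (s z - m)))" using iA by simp
   fix z
   have "abs ((s z - m) * h z) <= abs (s z - m) * Hb" using hb[of z] by (simp add: abs_mult mult_left_mono)
   thus "abs (ind D z * (s z * h z) - m * (ind D z * h z)) <= Hb * (ind D z * abs (s z - m))"
    by (cases "z : D") (auto simp: algebra_simps)
  qed
  also have "... = Hb * (LINT z|hyp. ind D z * abs (s z - m))" by simp
  also have "... <= Hb * (lam / 2 * mK + lam / 2 + B * e)" using L1r Hb by (rule mult_left_mono)
  finally have fin: "2 * abs (LINT z|hyp. cutp y1 v z * h z) <= Hb * (lam / 2 * mK + lam / 2 + B * e)" using U by simp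
  have "Q5 <= (480 * C1 * C2 + 1) * ((1 + T) * (1 + \<xi> * T))"
  proof -
   have "1 <= (1 + T) * (1 + \<xi> * T)" using T \<xi> by (simp add: algebra_simps)
   thus ?thesis by (simp add: Q5_def B_def R_def algebra_simps)
  qed
  hence "lam <= sqrt (480 * C1 * C2 + 1) * sqrt ((1 + T) * (1 + \<xi> * T))"
   unfolding lam_def real_sqrt_mult[symmetric] by (rule real_sqrt_le_mono)
  hence l: "Hb * (mK + 1) * lam <= C * sqrt ((1 + T) * (1 + \<xi> * T))"
   unfolding C_def using Hb mult_left_mono[of lam _ "Hb * (mK + 1)"] by (simp add: mK_def mult.assoc)
  have "Hb * (B * e) = \<epsilon> * (1 + T) * (Hb * C1 / (Hb * C1 + 1))" by (simp add: B_def e_def)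
  also have "... <= \<epsilon> * (1 + T) * 1"
   using \<epsilon> T pos by (intro mult_left_mono) (auto simp: divide_le_eq_1)
  finally have "Hb * (B * e) <= \<epsilon> * (1 + T)" by simp
  moreover have "Hb * (lam / 2 * mK + lam / 2 + B * e) = Hb * (mK + 1) * lam / 2 + Hb * (B * e)" by (simp add: field_simps)
  moreover have "C * sqrt ((1 + T) * (1 + \<xi> * T)) >= 0" using C0 T \<xi> by simp
  moreover have "\<epsilon> * (1 + T) >= 0" using \<epsilon> T by simp
  ultimately have "abs (LINT z|hyp. cutp y1 v z * h z) <= \<epsilon> * (1 + T) + C * sqrt ((1 + T) * (1 + \<xi> * T))"
   using fin l by linarith
  thus "abs (LINT z|hyp. cutp y1 v z * h z) <= \<epsilon> * (1 + ln (1 / y1)) + C * sqrt ((1 + ln (1 / y1)) * (1 + \<xi> * ln (1 / y1)))"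
   by (simp add: T_def)
 qed
qed

end

section \<open>Cusp forms of weight two\<close>

lemma open_UHP: "open UHP" and convex_UHP: "convex UHP"
 unfolding UHP_def by (simp_all add: open_halfspace_Im_gt convex_halfspace_Im_gt)

lemma convex_Im_eq: "convex {z. Im z = y}"
 by (rule convexI) (simp add: distrib_right[symmetric])

lemma UHP_primitive:
 assumes "\<phi> holomorphic_on UHP"
 shows "EX G. ALL z:UHP. (G has_field_derivative \<phi> z) (at z)"
proof (rule holomorphic_convex_primitive'[OF convex_UHP open_UHP assms])
 fix g assume g: "!!x. x : UHP ==> (g has_field_derivative \<phi> x) (at x within UHP)"
 show ?thesis
 proof (intro exI[of _ g] ballI)
  fix z assume z: "z : UHP"
  show "(g has_field_derivative \<phi> z) (at z)" using g[OF z] unfolding at_within_open[OF z open_UHP] .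
 qed
qed

lemma periodic_int:
 assumes per: "!!z. z : UHP ==> \<phi> (z + cor w) = \<phi> z" and z: "z : UHP"
 shows "\<phi> (z + of_int n * cor w) = \<phi> z"
proof (induction n rule: int_induct[where k=0])
 case (step1 i)
 have "z + of_int i * cor w : UHP" using z by (simp add: UHP_def)
 from per[OF this] step1 show ?case by (simp add: algebra_simps)
next
 case (step2 i)
 have "z + of_int (i - 1) * cor w : UHP" using z by (simp add: UHP_def)
 from per[OF this] step2 show ?case by (simp add: algebra_simps)
qed simp

text \<open>Above \<open>Y\<close> the function is below 1 in modulus; below \<open>Y\<close> one
  period of the strip is compact.\<close>

lemma periodic_bounded:
 assumes hol: "\<phi> holomorphic_on UHP" and w: "w > 0"
  and per: "!!z. z : UHP ==> \<phi> (z + cor w) = \<phi> z"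
  and van: "!!\<epsilon>. \<epsilon> > 0 ==> EX Y. ALL z. Im z > Y --> norm (\<phi> z) < \<epsilon>" and y0: "y0 > 0"
 shows "EX K>=0. ALL z. Im z >= y0 --> norm (\<phi> z) <= K"
proof -
 obtain Y where Y: "!!z. Im z > Y ==> norm (\<phi> z) < 1" using van[of 1] by auto
 let ?S = "cbox (Cx 0 y0) (Cx w Y)"
 have sub: "?S <= UHP" using y0 by (auto simp: in_cbox_complex_iff UHP_def)
 have "continuous_on ?S \<phi>" using holomorphic_on_imp_continuous_on[OF hol] sub continuous_on_subset by blast
 hence "bounded (\<phi> ` ?S)" by (intro compact_imp_bounded compact_continuous_image) auto
 then obtain K where K: "!!z. z : ?S ==> norm (\<phi> z) <= K" by (auto simp: bounded_iff)
 have "norm (\<phi> z) <= max K 1" if z: "Im z >= y0" for z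
 proof (cases "Im z > Y")
  case True thus ?thesis using Y[of z] by simp
 next
  case False
  have zU: "z : UHP" using z y0 by (simp add: UHP_def)
  define n where "n = - \<lfloor>Re z / w\<rfloor>"
  have "Re (z + of_int n * cor w) = Re z - of_int \<lfloor>Re z / w\<rfloor> * w" by (simp add: n_def)
  moreover have "of_int \<lfloor>Re z / w\<rfloor> * w <= Re z"
   using of_int_floor_le[of "Re z / w"] w by (simp only: pos_le_divide_eq)
  moreover have "Re z < (of_int \<lfloor>Re z / w\<rfloor> + 1) * w"
   using floor_correct[of "Re z / w"] w by (simp only: pos_divide_less_eq of_int_add of_int_1)
  ultimately have "z + of_int n * cor w : ?S"
   using z False by (simp add: in_cbox_complex_iff algebra_simps)
  from K[OF this] show ?thesis using periodic_int[where \<phi>=\<phi> and w=w and z=z and n=n, OF per zU] by simp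
 qed
 thus ?thesis by (intro exI[of _ "max K 1"]) auto
qed

text \<open>A periodic holomorphic function vanishing at \<open>i\<infinity>\<close> has mean zero over every horizontal period,
  so it is bounded by the oscillation, which Cauchy's estimate makes smaller by a factor \<open>1 / Im z\<close>.\<close>
lemma decay_step:
 assumes hol: "\<phi> holomorphic_on UHP" and w: "w > 0"
  and per: "!!z. z : UHP ==> \<phi> (z + cor w) = \<phi> z"
  and van: "!!\<epsilon>. \<epsilon> > 0 ==> EX Y. ALL z. Im z > Y --> norm (\<phi> z) < \<epsilon>" and y0: "y0 > 0" and K: "K >= 0"
  and b: "!!z. Im z >= y0 ==> norm (\<phi> z) <= K / (Im z)^k"
 shows "!!z. Im z >= 2 * y0 ==> norm (\<phi> z) <= (w * 2 * K * 2^k) / (Im z)^(k+1)"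
proof -
 obtain G where G0: "ALL z:UHP. (G has_field_derivative \<phi> z) (at z)"
  using UHP_primitive[OF hol] by blast
 have G': "(G has_field_derivative \<phi> z) (at z)" if "z : UHP" for z
  using G0 that by blast
 \<comment> \<open>The increment of the primitive over a period is the integral of
   \<open>\<phi>\<close> over that period. It does not depend on the point, and letting the height
   grow shows that it is 0.\<close>
 have "EX c. ALL z:UHP. G (z + cor w) - G z = c"
 proof (rule has_field_derivative_zero_constant[OF convex_UHP])
  fix z assume z: "z : UHP"
  hence zw: "z + cor w : UHP" by (simp add: UHP_def)
  have "((%z. G (z + cor w) - G z) has_field_derivative \<phi> (z + cor w) - \<phi> z) (at z)"
   by (rule DERIV_diff[OF DERIV_shift[THEN iffD1, OF G'[OF zw]] G'[OF z]])
  hence "((%z. G (z + cor w) - G z) has_field_derivative 0) (at z)" by (simp add: per[OF z])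
  thus "((%z. G (z + cor w) - G z) has_field_derivative 0) (at z within UHP)"
   by (rule has_field_derivative_at_within)
 qed
 then obtain c where c: "!!z. z : UHP ==> G (z + cor w) - G z = c" by blast
 have "norm c <= e" if e: "e > 0" for e
 proof -
  obtain Y where Y: "!!z. Im z > Y ==> norm (\<phi> z) < e / w" using van[of "e/w"] e w by auto
  define S where "S = {z. Im z > max Y 0}"
  have cS: "convex S" unfolding S_def by (rule convex_halfspace_Im_gt)
  have SU: "S <= UHP" by (auto simp: S_def UHP_def)
  define z where "z = Cx 0 (max Y 0 + 1)"
  have z: "z : S" "z + cor w : S" by (auto simp: S_def z_def)
  have "norm (G (z + cor w) - G z) <= e / w * norm (z + cor w - z)"
  proof (rule field_differentiable_bound[OF cS])
   show "(G has_field_derivative \<phi> u) (at u within S)" if "u : S" for u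
    using G'[of u] that SU has_field_derivative_at_within by blast
   show "norm (\<phi> u) <= e / w" if "u : S" for u using Y[of u] that by (simp add: S_def)
  qed (use z in auto)
  thus ?thesis using c[of z] z SU w by auto
 qed
 hence "norm c <= 0" by (meson dense_ge)
 hence c0: "c = 0" by simp
 fix z assume z: "Im z >= 2 * y0"
 have yz: "Im z > 0" using z y0 by linarith
 \<comment> \<open>Half the height: the disc of this radius about a point at the height of
   \<open>z\<close> stays above \<open>y0\<close> and above \<open>Im z / 2\<close>, where the
   hypothesis on \<open>\<phi>\<close> applies.\<close>
 define R where "R = Im z / 2"
 have R: "R > 0" using yz by (simp add: R_def)
 define M where "M = K / R^k"
 have M: "M >= 0" using K R by (simp add: M_def)
 define S where "S = {u. Im u = Im z}"
 have cS: "convex S" unfolding S_def by (rule convex_Im_eq)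
 have SU: "S <= UHP" using yz by (auto simp: S_def UHP_def)
 have der: "norm (deriv \<phi> u) <= M / R" if u: "u : S" for u
 proof -
  have cb: "cball u R <= {v. Im v >= y0 & Im v >= R}"
  proof
   fix v assume "v : cball u R"
   hence "abs (Im (u - v)) <= R" using abs_Im_le_cmod[of "u - v"] by (simp add: dist_norm)
   moreover have "Im u = Im z" using u by (simp add: S_def)
   ultimately have "Im v >= y0" "Im v >= R" using z unfolding R_def by (auto simp: abs_if split: if_splits)
   thus "v : {v. Im v >= y0 & Im v >= R}" by simp
  qed
  have cU: "cball u R <= UHP"
  proof
   fix v assume "v : cball u R"
   hence "Im v >= R" using cb by blast
   thus "v : UHP" using R by (simp add: UHP_def)
  qed
  have h1: "\<phi> holomorphic_on ball u R" using hol cU holomorphic_on_subset ball_subset_cball by blast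
  have h2: "continuous_on (cball u R) \<phi>" using holomorphic_on_imp_continuous_on[OF hol] cU continuous_on_subset by blast
  have h3: "norm (\<phi> v) <= M" if "norm (u - v) = R" for v
  proof -
   have "v : cball u R" using that by (simp add: dist_norm)
   hence v: "Im v >= y0" "Im v >= R" using cb by auto
   have "norm (\<phi> v) <= K / (Im v)^k" by (rule b[OF v(1)])
   also have "... <= M" unfolding M_def using v(2) R K by (intro divide_left_mono power_mono) auto
   finally show "norm (\<phi> v) <= M" .
  qed
  from Cauchy_inequality[OF h1 h2 R h3, of 1] show ?thesis by simp
 qed
 have osc: "norm (\<phi> u - \<phi> z) <= M / R * w" if u: "u : S" "norm (u - z) <= w" for u
 proof -
  have "norm (\<phi> u - \<phi> z) <= M / R * norm (u - z)"
  proof (rule field_differentiable_bound[OF cS _ der])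
   fix v assume "v : S"
   hence "(\<phi> has_field_derivative deriv \<phi> v) (at v)" using hol open_UHP SU holomorphic_derivI by blast
   thus "(\<phi> has_field_derivative deriv \<phi> v) (at v within S)" by (rule has_field_derivative_at_within)
  qed (use u in \<open>auto simp: S_def\<close>)
  also have "... <= M / R * w" using u M R by (intro mult_left_mono) auto
  finally show ?thesis .
 qed
 define S2 where "S2 = closed_segment z (z + cor w)"
 have S2: "u : S & norm (u - z) <= w" if "u : S2" for u
 proof -
  obtain t where t: "0 <= t" "t <= 1" "u = (1 - t) *\<^sub>R z + t *\<^sub>R (z + cor w)"
   using \<open>u : S2\<close> by (auto simp: S2_def in_segment)
  hence "u = z + cor (t * w)" by (simp add: scaleR_conv_of_real algebra_simps)
  moreover have "norm (cor (t * w)) <= w" unfolding norm_of_real using t w by (simp add: abs_mult mult_left_le_one_le)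
  ultimately show ?thesis by (simp add: S_def)
 qed
 have zU: "z : UHP" using yz by (simp add: UHP_def)
 \<comment> \<open>The derivative of this function is the oscillation of \<open>\<phi>\<close> about
   \<open>\<phi> z\<close>, and its increment over a period is \<open>- \<phi> z * w\<close>,
   because the primitive itself is periodic.\<close>
 let ?H = "%u. G u - \<phi> z * u"
 have "norm (?H (z + cor w) - ?H z) <= M / R * w * norm (z + cor w - z)"
 proof (rule field_differentiable_bound[where S=S2 and f="?H" and f'="%u. \<phi> u - \<phi> z"])
  show "convex S2" by (simp add: S2_def)
  show "(?H has_field_derivative \<phi> u - \<phi> z) (at u within S2)" if "u : S2" for u
  proof -
   have "u : UHP" using S2[OF that] SU by blast
   have "((%u. \<phi> z * u) has_field_derivative \<phi> z) (at u)" using DERIV_cmult_Id by blast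
   from DERIV_diff[OF G'[OF \<open>u : UHP\<close>] this] have "(?H has_field_derivative \<phi> u - \<phi> z) (at u)" .
   thus ?thesis by (rule has_field_derivative_at_within)
  qed
  show "norm (\<phi> u - \<phi> z) <= M / R * w" if "u : S2" for u using S2[OF that] osc by blast
 qed (auto simp: S2_def)
 moreover have "?H (z + cor w) - ?H z = - \<phi> z * cor w"
  using c[OF zU] c0 by (simp add: algebra_simps)
 ultimately have "norm (\<phi> z) * w <= M / R * w * w" using w by (simp add: norm_mult)
 hence "norm (\<phi> z) <= M / R * w" by (rule mult_right_le_imp_le) (rule w)
 also have "M / R * w = (w * 2 * K * 2^k) / (Im z)^(k+1)"
  using yz by (simp add: M_def R_def power_divide field_simps)
 finally show "norm (\<phi> z) <= (w * 2 * K * 2^k) / (Im z)^(k+1)" .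
qed

text \<open>Each decay step doubles the height from which it is valid, so two steps lead from a
  bound above 1/8 to quadratic decay above 1/2. The exponent 2 makes the primitive converge in the
  cusp.\<close>

lemma cusp_decay:
 assumes hol: "\<phi> holomorphic_on UHP" and w: "w > 0"
  and per: "!!z. z : UHP ==> \<phi> (z + cor w) = \<phi> z"
  and van: "!!\<epsilon>. \<epsilon> > 0 ==> EX Y. ALL z. Im z > Y --> norm (\<phi> z) < \<epsilon>"
 shows "EX C>=0. ALL z. Im z >= 1/2 --> norm (\<phi> z) <= C / (Im z)^2"
proof -
 obtain K where K: "K >= 0" "!!z. Im z >= 1/8 ==> norm (\<phi> z) <= K"
  using periodic_bounded[OF hol w per van, of "1/8"] by auto
 have 1: "norm (\<phi> z) <= (w * 2 * K * 2^0) / (Im z)^(0+1)" if "Im z >= 2 * (1/8)" for z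
  by (rule decay_step[OF hol w per van _ K(1) _ that]) (use K in auto)
 have K1: "w * 2 * K * 2^0 >= 0" using w K by simp
 have 2: "norm (\<phi> z) <= (w * 2 * (w * 2 * K * 2^0) * 2^1) / (Im z)^(1+1)" if "Im z >= 2 * (1/4)" for z
  by (rule decay_step[OF hol w per van _ K1 _ that]) (use 1 in auto)
 show ?thesis
  by (rule exI[of _ "w * 2 * (w * 2 * K * 2^0) * 2^1"]) (use 2 w K in \<open>auto simp: numeral_2_eq_2\<close>)
qed

text \<open>The weight-two slash operator: \<open>fs f s\<close> describes \<open>f\<close> near the
  cusp that is the image of infinity under \<open>s\<close>.\<close>

definition fs :: "(complex => complex) => int \<times> int \<times> int \<times> int => complex => complex" where
 "fs f s z = f (moeb s z) / (jfac s z)^2"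

lemma moeb_deriv:
 assumes "s : SL2Z" "z : UHP"
 shows "(moeb s has_field_derivative 1 / (jfac s z)^2) (at z)"
proof (cases s)
 case (fields a b c d)
 have nz: "of_int c * z + of_int d ~= 0" using jfac_nz[OF assms] by (simp add: jfac_def fields)
 have "a * d - b * c = 1" using assms(1) by (simp add: SL2Z_def fields)
 hence dd: "of_int a * of_int d - of_int b * of_int c = (1::complex)"
  by (metis of_int_1 of_int_diff of_int_mult)
 have "((%z. (of_int a * z + of_int b) / (of_int c * z + of_int d)) has_field_derivative
   (of_int a * (of_int c * z + of_int d) - (of_int a * z + of_int b) * of_int c) / ((of_int c * z + of_int d) * (of_int c * z + of_int d))) (at z)"
  by (rule derivative_eq_intros nz refl | simp)+
 moreover have "of_int a * (of_int c * z + of_int d) - (of_int a * z + of_int b) * of_int c = 1"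
  using dd by (simp add: algebra_simps)
 ultimately show ?thesis by (simp add: moeb_def[abs_def] jfac_def fields power2_eq_square)
qed

locale cusp =
 fixes q :: nat and f :: "complex => complex"
 assumes q1': "q >= 1" and cf: "cusp_form2 q f"
begin

lemma f_hol: "f holomorphic_on UHP"
 and f_aut: "!!g z. g : Gamma0 q ==> z : UHP ==> f (moeb g z) = (jfac g z)^2 * f z"
 and f_van: "!!g \<epsilon>. g : SL2Z ==> \<epsilon> > 0 ==> EX Y. ALL z. Im z > Y --> norm (f (moeb g z) / (jfac g z)^2) < \<epsilon>"
 using cf by (auto simp: cusp_form2_def)

lemma fs_hol: assumes "s : SL2Z" shows "fs f s holomorphic_on UHP"
proof -
 have "moeb s holomorphic_on UHP"
  using moeb_deriv[OF assms] holomorphic_on_open[OF open_UHP] by blast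
 moreover have "moeb s ` UHP <= UHP" using moeb_UHP[OF assms] by blast
 ultimately have "(f \<circ> moeb s) holomorphic_on UHP"
  using f_hol holomorphic_on_compose_gen by blast
 moreover have "jfac s holomorphic_on UHP"
  by (cases s) (auto simp: jfac_def[abs_def] intro!: holomorphic_intros)
 ultimately show ?thesis unfolding fs_def[abs_def]
  using jfac_nz[OF assms] by (intro holomorphic_intros) (auto simp: o_def)
qed

lemma fs_coset:
 assumes "g : Gamma0 q" "s : SL2Z" "z : UHP"
 shows "fs f (mmul g s) z = fs f s z"
proof -
 have g: "g : SL2Z" using assms SL2Z_of_Gamma0 by blast
 have U: "moeb s z : UHP" using assms moeb_UHP by blast
 show ?thesis
  using jfac_nz[OF g U] jfac_nz[OF assms(2,3)]
  by (simp add: fs_def moeb_mmul[OF g assms(2,3)] jfac_mmul[OF assms(2,3)] f_aut[OF assms(1) U] power_mult_distrib)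
qed

text \<open>Translation by \<open>q\<close> on the right leaves the bottom row unchanged modulo
  \<open>q\<close>, so conjugating it by \<open>s\<close> lands in \<open>Gamma0 q\<close>. The
  number \<open>q\<close> is thus a common period at all cusps, whatever their widths.\<close>

lemma fs_periodic:
 assumes "s : SL2Z" "z : UHP"
 shows "fs f s (z + cor (real q)) = fs f s z"
proof -
 define t where "t = (1::int, int q, 0::int, 1::int)"
 have t: "t : SL2Z" by (simp add: t_def SL2Z_def)
 have tz: "moeb t z = z + cor (real q)" "jfac t z = 1" by (simp_all add: t_def moeb_def jfac_def)
 have st: "mmul s t : SL2Z" using SL2Z_mmul[OF assms(1) t] .
 have "ckey q (mmul s t) = ckey q s" by (cases s) (simp add: t_def ckey_def)
 hence g: "mmul (mmul s t) (minv s) : Gamma0 q" using ckey_coset[OF q1' st assms(1)] by simp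
 have "fs f s (z + cor (real q)) = fs f (mmul s t) z"
  using moeb_mmul[OF assms(1) t assms(2)] jfac_mmul[OF t assms(2), of s] by (simp add: fs_def tz)
 also have "mmul s t = mmul (mmul (mmul s t) (minv s)) s"
  using assms(1) by (simp add: mmul_assoc mmul_minv)
 also have "fs f ... z = fs f s z" by (rule fs_coset[OF g assms])
 finally show ?thesis .
qed

text \<open>\<open>fs f s\<close> depends only on the coset of \<open>s\<close>, and there are
  finitely many cosets; the sum of the constants dominates each of them.\<close>

lemma fs_uniform: "EX C>=0. ALL s:SL2Z. ALL z. Im z >= 1/2 --> norm (fs f s z) <= C / (Im z)^2"
proof -
 obtain R where R: "finite R" "R <= SL2Z" "!!g. g : SL2Z ==> EX r:R. mmul g (minv r) : Gamma0 q"
  using finite_coset_reps[OF q1'] by blast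
 have "ALL r:R. EX C>=0. ALL z. Im z >= 1/2 --> norm (fs f r z) <= C / (Im z)^2"
 proof
  fix r assume "r : R"
  hence r: "r : SL2Z" using R by blast
  show "EX C>=0. ALL z. Im z >= 1/2 --> norm (fs f r z) <= C / (Im z)^2"
   by (rule cusp_decay[OF fs_hol[OF r] _ fs_periodic[OF r]]) (use q1' f_van[OF r] in \<open>auto simp: fs_def\<close>)
 qed
 then obtain C where C: "!!r. r : R ==> C r >= 0 & (ALL z. Im z >= 1/2 --> norm (fs f r z) <= C r / (Im z)^2)" by metis
 show ?thesis
 proof (intro exI[of _ "\<Sum>r\<in>R. C r"] conjI ballI allI impI)
  show "(\<Sum>r\<in>R. C r) >= 0" using C by (simp add: sum_nonneg)
  fix s z assume s: "s : SL2Z" and z: "Im z >= 1/2"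
  obtain r where r: "r : R" "mmul s (minv r) : Gamma0 q" using R(3)[OF s] by blast
  have rS: "r : SL2Z" and zU: "z : UHP" using r R z by (auto simp: UHP_def)
  have "s = mmul (mmul s (minv r)) r" using rS by (simp add: mmul_assoc mmul_minv)
  hence "fs f s z = fs f r z" using fs_coset[OF r(2) rS zU] by simp
  hence "norm (fs f s z) <= C r / (Im z)^2" using C[OF r(1)] z by simp
  also have "... <= (\<Sum>r\<in>R. C r) / (Im z)^2"
   by (intro divide_right_mono member_le_sum r R) (use C in auto)
  finally show "norm (fs f s z) <= (\<Sum>r\<in>R. C r) / (Im z)^2" .
 qed
qed

end

section \<open>The primitive of \<open>f\<close> and its boundary values at the cusps\<close>

lemma vertical_bound:
 assumes G: "!!z. z : UHP ==> (G has_field_derivative \<phi> z) (at z)"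
  and u: "!!t. a <= t ==> t <= b ==> (u has_real_derivative u' t) (at t)"
  and b: "!!t. a < t ==> t < b ==> norm (\<phi> (Cx x t)) <= u' t" and ab: "0 < a" "a <= b"
 shows "norm (G (Cx x b) - G (Cx x a)) <= u b - u a"
proof (cases "a = b")
 case False
 hence lt: "a < b" using ab by simp
 have d: "((%t. G (Cx x t)) has_vector_derivative \<i> * \<phi> (Cx x t)) (at t)" if "t > 0" for t
 proof -
  have U: "Cx x t : UHP" using that by (simp add: UHP_def)
  have e: "Cx x t = cor x + \<i> * cor t" for t by (simp add: complex_eq_iff)
  have "((%t. Cx x t) has_vector_derivative \<i>) (at t)"
   unfolding e by (auto intro!: derivative_eq_intros)
  from field_vector_diff_chain_at[OF this G[OF U]] show ?thesis by (simp add: o_def)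
 qed
 show ?thesis
 proof (rule differentiable_bound_general[OF lt])
  show "continuous_on {a..b} (%t. G (Cx x t))"
   by (intro continuous_at_imp_continuous_on ballI has_vector_derivative_continuous[OF d]) (use ab in auto)
  show "continuous_on {a..b} u"
   by (intro continuous_at_imp_continuous_on ballI DERIV_isCont[OF u]) auto
  fix t assume t: "a < t" "t < b"
  show "((%t. G (Cx x t)) has_vector_derivative \<i> * \<phi> (Cx x t)) (at t)" using d t ab by simp
  show "(u has_vector_derivative u' t) (at t)" using u[of t] t by (simp add: has_real_derivative_iff_has_vector_derivative)
  show "norm (\<i> * \<phi> (Cx x t)) <= u' t" using b[OF t] by (simp add: norm_mult)
 qed
qed simp

text \<open>Quadratic decay makes the primitive Cauchy along a vertical line. The limit is the same
  on all lines, because at height y a horizontal shift changes the primitive only by a multiple of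
  1/y^2.\<close>

lemma prim_limit:
 assumes G: "!!z. z : UHP ==> (G has_field_derivative \<phi> z) (at z)" and C: "C >= 0"
  and b: "!!z. Im z >= 1/2 ==> norm (\<phi> z) <= C / (Im z)^2"
 shows "EX L. ALL z. Im z >= 1/2 --> norm (G z - L) <= C / Im z"
proof -
 have v: "norm (G (Cx x t) - G (Cx x s)) <= C / s - C / t" if st: "1/2 <= s" "s <= t" for x s t
 proof -
  have "norm (G (Cx x t) - G (Cx x s)) <= - C / t - (- C / s)"
  proof (rule vertical_bound[OF G, where u'="%t. C / t^2"])
   show "((%t. - C / t) has_real_derivative C / r^2) (at r)" if "s <= r" "r <= t" for r
    using that st by (auto intro!: derivative_eq_intros simp: power2_eq_square)
   show "norm (\<phi> (Cx x r)) <= C / r^2" if "s < r" "r < t" for r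
    using b[of "Cx x r"] that st by simp
  qed (use st in auto)
  thus ?thesis by simp
 qed
 have hz: "norm (G (Cx x y) - G (Cx x' y)) <= C / y^2 * abs (x - x')" if y: "y >= 1/2" for x x' y
 proof -
  have "norm (G (Cx x y) - G (Cx x' y)) <= C / y^2 * norm (Cx x y - Cx x' y)"
  proof (rule field_differentiable_bound[of "{z. Im z = y}" _ \<phi>])
   show "convex {z. Im z = y}" by (rule convex_Im_eq)
   show "(G has_field_derivative \<phi> z) (at z within {z. Im z = y})" if "z : {z. Im z = y}" for z
   proof (rule has_field_derivative_at_within, rule G)
    show "z : UHP" using that y by (auto simp: UHP_def)
   qed
   show "norm (\<phi> z) <= C / y^2" if "z : {z. Im z = y}" for z using b[of z] that y by simp
  qed auto
  moreover have "Cx x y - Cx x' y = cor (x - x')" by (simp add: complex_eq_iff)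
  ultimately show ?thesis by (simp only: norm_of_real)
 qed
 have "Cauchy (%n. G (Cx 0 (real n + 1)))"
 proof (rule metric_CauchyI)
  fix e :: real assume e: "e > 0"
  obtain N :: nat where N: "C / e < real N" using reals_Archimedean2 by blast
  have key: "dist (G (Cx 0 (real n + 1))) (G (Cx 0 (real m + 1))) < e" if "N <= m" "m <= n" for m n
  proof -
   have "dist (G (Cx 0 (real n + 1))) (G (Cx 0 (real m + 1))) <= C / (real m + 1) - C / (real n + 1)"
    unfolding dist_norm using v[of "real m + 1" "real n + 1" 0] that by simp
   also have "... <= C / (real m + 1)" using C by simp
   also have "... < e"
   proof -
    have "C / e < real m + 1" using N that by linarith
    thus ?thesis using e by (simp add: field_simps)
   qed
   finally show ?thesis .
  qed
  show "EX M. ALL m>=M. ALL n>=M. dist (G (Cx 0 (real m + 1))) (G (Cx 0 (real n + 1))) < e"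
   using key by (intro exI[of _ N]) (metis dist_commute nle_le)
 qed
 then obtain L where L: "(%n. G (Cx 0 (real n + 1))) \<longlonglongrightarrow> L" using Cauchy_convergent convergent_def by blast
 show ?thesis
 proof (intro exI[of _ L] allI impI)
  fix z assume z: "Im z >= 1/2"
  define x y where "x = Re z" and "y = Im z"
  have zz: "z = Cx x y" by (simp add: x_def y_def)
  have y: "y >= 1/2" using z by (simp add: y_def)
  have bd: "norm (G z - G (Cx 0 (real n + 1))) <= C / y + C * abs x / (real n + 1)^2" if n: "y <= real n + 1" for n
  proof -
   have "norm (G z - G (Cx 0 (real n + 1))) <= norm (G (Cx x (real n + 1)) - G (Cx x y)) + norm (G (Cx x (real n + 1)) - G (Cx 0 (real n + 1)))"
    unfolding zz using norm_triangle_ineq4[of "G (Cx x (real n + 1)) - G (Cx 0 (real n + 1))" "G (Cx x (real n + 1)) - G (Cx x y)"]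
    by (simp add: add.commute)
   also have "... <= (C / y - C / (real n + 1)) + C / (real n + 1)^2 * abs (x - 0)"
    by (intro add_mono v hz) (use y n in auto)
   also have "... <= C / y + C * abs x / (real n + 1)^2" using C by simp
   finally show ?thesis .
  qed
  have l1: "(%n. norm (G z - G (Cx 0 (real n + 1)))) \<longlonglongrightarrow> norm (G z - L)"
   by (intro tendsto_intros L)
  have "(%n. 1 / (real n + 1)^2) \<longlonglongrightarrow> 0" by real_asymp
  from tendsto_add[OF tendsto_const[of "C / y"] tendsto_mult_right_zero[OF this, of "C * abs x"]]
  have l2: "(%n. C / y + C * abs x / (real n + 1)^2) \<longlonglongrightarrow> C / y" by simp
  have ev: "eventually (%n. norm (G z - G (Cx 0 (real n + 1))) <= C / y + C * abs x / (real n + 1)^2) sequentially"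
  proof -
   obtain N :: nat where "y <= real N" using real_arch_simple by blast
   thus ?thesis using bd by (intro eventually_sequentiallyI[of N]) auto
  qed
  have "norm (G z - L) <= C / y" by (rule tendsto_le[OF sequentially_bot l2 l1 ev])
  thus "norm (G z - L) <= C / Im z" by (simp add: y_def)
 qed
qed

text \<open>The purely imaginary symbol divided by i.\<close>

definition Fr :: "(complex => complex) => real => real" where
 "Fr f r = 2 * pi * (LINT t:{0<..}|lb. Im (f (cor r + \<i> * cor t)))"

lemma normalized_symbol_Fr: "normalized_symbol K f r c = Fr f r / sqrt (abs K * ln (roi c))"
proof -
 have e: "modsym f r = \<i> * cor (Fr f r)" by (simp add: modsym_def Fr_def)
 have "modsym f r / (\<i> * cor (sqrt (abs K * ln (roi c))))
   = cor (Fr f r) / cor (sqrt (abs K * ln (roi c)))"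
  unfolding e by (rule mult_divide_mult_cancel_left) simp
 also have "... = cor (Fr f r / sqrt (abs K * ln (roi c)))" by simp
 finally show ?thesis by (simp add: normalized_symbol_def)
qed

context cusp
begin

lemma compose_deriv:
 assumes G: "!!z. z : UHP ==> (G has_field_derivative f z) (at z)" and s: "s : SL2Z" and z: "z : UHP"
 shows "((%z. G (moeb s z)) has_field_derivative fs f s z) (at z)"
proof -
 have "((%z. G (moeb s z)) has_field_derivative f (moeb s z) * (1 / (jfac s z)^2)) (at z)"
  by (rule DERIV_chain2[of G, OF G[OF moeb_UHP[OF s z]] moeb_deriv[OF s z]])
 thus ?thesis by (simp add: fs_def)
qed

text \<open>Collects the facts that the locale \<open>cdata\<close> fixes below, with
  \<open>G\<close> normalised to vanish at infinity. The bound on \<open>Im z * |f|\<close> holds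
  because this quantity equals its slashed counterpart at a reduced point, where it is at most
  \<open>C / Im w <= 2 C\<close>.\<close>

lemma cusp_data:
 "EX G B C. C >= 0 & B >= 0 & (ALL z:UHP. (G has_field_derivative f z) (at z)) & (ALL z:UHP. Im z * norm (f z) <= B) &
  (ALL s:SL2Z. EX L. ALL z. Im z >= 1/2 --> norm (G (moeb s z) - L) <= C / Im z) &
  (ALL z. Im z >= 1/2 --> norm (G z) <= C / Im z) &
  (ALL s:SL2Z. ALL z. Im z >= 1/2 --> norm (fs f s z) <= C / (Im z)^2)"
proof -
 obtain C where C: "C >= 0" and Cb: "!!s z. s : SL2Z ==> Im z >= 1/2 ==> norm (fs f s z) <= C / (Im z)^2"
  using fs_uniform by blast
 obtain G1 where G1: "ALL z:UHP. (G1 has_field_derivative f z) (at z)" using UHP_primitive[OF f_hol] by blast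
 hence G1': "(G1 has_field_derivative f z) (at z)" if "z : UHP" for z using that by blast
 have one: "(1,0,0,1) : SL2Z" by (simp add: SL2Z_def)
 have f1: "fs f (1,0,0,1) z = f z" for z by (simp add: fs_def jfac_def)
 have "EX L. ALL z. Im z >= 1/2 --> norm (G1 z - L) <= C / Im z"
  by (rule prim_limit[OF G1' C]) (use Cb[OF one] f1 in auto)
 then obtain L0 where L0: "!!z. Im z >= 1/2 ==> norm (G1 z - L0) <= C / Im z" by blast
 define G where "G = (%z. G1 z - L0)"
 have G: "(G has_field_derivative f z) (at z)" if "z : UHP" for z
  using DERIV_diff[OF G1'[OF that] DERIV_const[of L0]] by (simp add: G_def)
 have B: "Im z * norm (f z) <= 2 * C" if z: "z : UHP" for z
 proof -
  obtain s where s: "s : SL2Z" "Im (moeb s z) >= 1/2" using reduction[OF z] by blast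
  define w where "w = moeb s z"
  define t where "t = minv s"
  have t: "t : SL2Z" using s SL2Z_minv by (simp add: t_def)
  have w: "w : UHP" "Im w >= 1/2" using s z moeb_UHP by (auto simp: w_def)
  have zt: "z = moeb t w" using s z by (simp add: t_def w_def)
  have nz: "jfac t w ~= 0" by (rule jfac_nz[OF t w(1)])
  have "Im z * norm (f z) = Im w * norm (fs f t w)"
   using nz by (simp add: zt Im_moeb[OF t w(1)] fs_def norm_divide norm_power)
  also have "... <= Im w * (C / (Im w)^2)" using Cb[OF t w(2)] w(2) by (intro mult_left_mono) auto
  also have "... = C / Im w" using w(2) by (simp add: power2_eq_square)
  also have "... <= C / (1/2)" using C w(2) by (intro divide_left_mono) auto
  finally show ?thesis by simp
 qed
 have L: "EX L. ALL z. Im z >= 1/2 --> norm (G (moeb s z) - L) <= C / Im z" if s: "s : SL2Z" for s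
  by (rule prim_limit[where \<phi>="fs f s" and G="%z. G (moeb s z)", OF compose_deriv[OF G s] C Cb[OF s]])
 show ?thesis
  by (rule exI[of _ G], rule exI[of _ "2 * C"], rule exI[of _ C])
   (use C G B L Cb L0 in \<open>auto simp: G_def\<close>)
qed

end

text \<open>Assumption \<open>bloch\<close> is the Bloch condition, by which \<open>G\<close> is
  Lipschitz for the hyperbolic metric. Assumption \<open>cuspL\<close> gives its value at every
  cusp, with the same \<open>C\<close> throughout.\<close>

locale cdata = fdom q D + cusp q f for q D f +
 fixes G :: "complex => complex" and B C :: real
 assumes C0: "C >= 0" and B0: "B >= 0"
  and G_der: "!!z. z : UHP ==> (G has_field_derivative f z) (at z)"
  and bloch: "!!z. z : UHP ==> Im z * norm (f z) <= B"
  and cuspL: "!!s. s : SL2Z ==> EX L. ALL z. Im z >= 1/2 --> norm (G (moeb s z) - L) <= C / Im z"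
  and Ginf: "!!z. Im z >= 1/2 ==> norm (G z) <= C / Im z"
  and fsC: "!!s z. s : SL2Z ==> Im z >= 1/2 ==> norm (fs f s z) <= C / (Im z)^2"
begin

definition F :: "complex => real" where "F z = 2 * pi * Re (G z)"

lemma f_cont: "continuous_on UHP f"
 using f_hol by (rule holomorphic_on_imp_continuous_on)

lemma fs_bloch:
 assumes s: "s : SL2Z" and z: "z : UHP"
 shows "Im z * norm (fs f s z) <= B"
proof -
 have "Im (moeb s z) * norm (f (moeb s z)) = Im z * norm (fs f s z)"
  using jfac_nz[OF s z] by (simp add: Im_moeb[OF s z] fs_def norm_divide norm_power)
 thus ?thesis using bloch[OF moeb_UHP[OF s z]] by simp
qed

lemma G_vertical:
 assumes s: "s : SL2Z" and ab: "0 < a" "a <= b"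
 shows "norm (G (moeb s (Cx x b)) - G (moeb s (Cx x a))) <= B * ln b - B * ln a"
proof (rule vertical_bound[where G="%z. G (moeb s z)", OF compose_deriv[OF G_der s]])
 fix t
 show "((%t. B * ln t) has_real_derivative B / t) (at t)" if "a <= t" "t <= b"
  using that ab by (auto intro!: derivative_eq_intros)
 show "norm (fs f s (Cx x t)) <= B / t" if "a < t" "t < b"
  using fs_bloch[OF s, of "Cx x t"] that ab by (simp add: UHP_def field_simps)
qed (use ab in auto)

text \<open>Both points lie in the half plane of heights at least
  \<open>Im z / (2 + \<rho>)\<close>, which is convex and on which the Bloch condition bounds
  \<open>|f|\<close> by a multiple of \<open>1 / Im z\<close>; their distance is a multiple of
  \<open>Im z\<close>.\<close>

lemma F_hnear:
 assumes z: "z : UHP" and w: "w : UHP" and \<rho>: "\<rho> > 0" and n: "hnear \<rho> z w"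
 shows "abs (F z - F w) <= 2 * pi * B * (2 + \<rho>)^2"
proof -
 note hb = hnear_bounds[OF n z w \<rho>]
 have yz: "Im z > 0" using z by (simp add: UHP_def)
 define m where "m = Im z / (2 + \<rho>)"
 have m: "m > 0" using yz \<rho> by (simp add: m_def)
 let ?S = "{u. Im u >= m}"
 have "norm (G z - G w) <= B / m * norm (z - w)"
 proof (rule field_differentiable_bound[where S="?S" and f=G and f'=f])
  show "convex ?S" by (rule convex_halfspace_Im_ge)
  show "(G has_field_derivative f u) (at u within ?S)" if "u : ?S" for u
  proof (rule has_field_derivative_at_within, rule G_der)
   show "u : UHP" using that m by (simp add: UHP_def)
  qed
  show "norm (f u) <= B / m" if "u : ?S" for u
  proof -
   have u: "Im u >= m" "u : UHP" using that m by (auto simp: UHP_def)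
   have "m * norm (f u) <= Im u * norm (f u)" using u by (intro mult_right_mono) auto
   also have "... <= B" by (rule bloch[OF u(2)])
   finally show ?thesis using m by (simp add: field_simps)
  qed
  have "Im z * 1 <= Im z * (2 + \<rho>)" using yz \<rho> by (intro mult_left_mono) auto
  thus "z : ?S" using \<rho> by (simp add: m_def field_simps)
  show "w : ?S" using hb(2) \<rho> by (simp add: m_def field_simps)
 qed
 also have "... <= B / m * ((2 + \<rho>) * Im z)" using hb(4) B0 m by (intro mult_left_mono) auto
 also have "... = B * (2 + \<rho>)^2" using yz \<rho> by (simp add: m_def power2_eq_square field_simps)
 finally have "norm (G z - G w) <= B * (2 + \<rho>)^2" .
 hence "abs (Re (G z - G w)) <= B * (2 + \<rho>)^2" using abs_Re_le_cmod order_trans by blast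
 hence "2 * pi * abs (Re (G z - G w)) <= 2 * pi * (B * (2 + \<rho>)^2)" by (intro mult_left_mono) auto
 moreover have "F z - F w = 2 * pi * Re (G z - G w)" by (simp add: F_def algebra_simps)
 ultimately show ?thesis by (simp add: abs_mult mult.assoc)
qed

text \<open>From height 1/2 upwards the cusp estimate applies; descending further to height
  \<open>\<eta>\<close> costs only the hyperbolic length, a logarithm.\<close>

lemma G_near_cusp:
 assumes s: "s : SL2Z" and L: "!!z. Im z >= 1/2 ==> norm (G (moeb s z) - L) <= C / Im z"
  and \<eta>: "0 < \<eta>" "\<eta> <= 1/2" and z: "Im z >= \<eta>"
 shows "norm (G (moeb s z) - L) <= 2 * C + B * ln (1 / \<eta>)"
proof (cases "Im z >= 1/2")
 case True
 have "norm (G (moeb s z) - L) <= C / Im z" by (rule L[OF True])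
 also have "... <= C / (1/2)" using C0 True by (intro divide_left_mono) auto
 finally have "norm (G (moeb s z) - L) <= 2 * C" by simp
 moreover have "B * ln (1 / \<eta>) >= 0" using B0 \<eta> by simp
 ultimately show ?thesis by linarith
next
 case False
 define x where "x = Re z"
 define y where "y = Im z"
 have zz: "z = Cx x y" by (simp add: x_def y_def)
 have y: "\<eta> <= y" "y < 1/2" using z False by (auto simp: y_def)
 have "norm (G (moeb s (Cx x (1/2))) - G (moeb s z)) <= B * ln (1/2) - B * ln y"
  unfolding zz by (rule G_vertical[OF s]) (use y \<eta> in auto)
 also have "... <= B * ln (1 / \<eta>)"
 proof -
  have "ln \<eta> <= ln y" "ln (1/2::real) <= 0" "ln (1/\<eta>) = - ln \<eta>" using y \<eta> by (simp_all add: ln_div)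
  hence "ln (1/2) - ln y <= ln (1/\<eta>)" by linarith
  thus ?thesis using mult_left_mono[OF _ B0, of "ln (1/2) - ln y" "ln (1/\<eta>)"] by (simp add: algebra_simps)
 qed
 finally have 1: "norm (G (moeb s (Cx x (1/2))) - G (moeb s z)) <= B * ln (1 / \<eta>)" .
 have 2: "norm (G (moeb s (Cx x (1/2))) - L) <= 2 * C" using L[of "Cx x (1/2)"] by simp
 have "G (moeb s z) - L = (G (moeb s (Cx x (1/2))) - L) - (G (moeb s (Cx x (1/2))) - G (moeb s z))" by simp
 hence "norm (G (moeb s z) - L) <= norm (G (moeb s (Cx x (1/2))) - L) + norm (G (moeb s (Cx x (1/2))) - G (moeb s z))"
  by (metis norm_triangle_ineq4)
 thus ?thesis using 1 2 by linarith
qed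

lemma F_bound:
 assumes "0 < Im z" "Im z <= 1"
 shows "abs (F z) <= 2 * pi * (2 * C + B * (ln (1 / Im z) + 1))"
proof -
 have one: "(1,0,0,1) : SL2Z" by (simp add: SL2Z_def)
 \<comment> \<open>Half the height is used because the cusp estimate asks for a level at most 1/2,
   while \<open>Im z\<close> may reach 1.\<close>
 have "norm (G (moeb (1,0,0,1) z) - 0) <= 2 * C + B * ln (1 / (Im z / 2))"
  by (rule G_near_cusp[OF one]) (use Ginf assms in auto)
 also have "ln (1 / (Im z / 2)) <= ln (1 / Im z) + 1"
 proof -
  have "ln (2::real) <= 1" using ln_le_minus_one[of 2] by simp
  thus ?thesis using assms by (simp add: ln_div)
 qed
 finally have "norm (G z) <= 2 * C + B * (ln (1 / Im z) + 1)" using B0 by (simp add: mult_left_mono)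
 hence "abs (Re (G z)) <= 2 * C + B * (ln (1 / Im z) + 1)" using abs_Re_le_cmod order_trans by blast
 thus ?thesis by (simp add: F_def abs_mult mult_left_mono)
qed

lemma jfac_vertical:
 assumes c: "c > 0" and t: "t > 0"
 shows "jfac (a,b,c,d) (Cx (- roi d / roi c) (1 / ((roi c)^2 * t))) = \<i> / (of_int c * cor t)"
proof -
 have "of_int c * Cx (- roi d / roi c) (1 / ((roi c)^2 * t)) + of_int d = Cx 0 (1 / (roi c * t))"
  using c t by (simp add: complex_eq_iff power2_eq_square)
 also have "... = \<i> * cor (1 / (roi c * t))" by (simp add: complex_eq_iff)
 also have "... = \<i> / (of_int c * cor t)" by simp
 finally show ?thesis by (simp add: jfac_def)
qed

text \<open>The vertical geodesic to \<open>a/c\<close> is the image of the one over \<open>-d/c\<close>, with \<open>t\<close> and \<open>1/(c\<^sup>2t)\<close> exchanged.\<close>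
lemma moeb_vertical:
 assumes s: "(a,b,c,d) : SL2Z" and c: "c > 0" and t: "t > 0"
 shows "cor (roi a / roi c) + \<i> * cor t
  = moeb (a,b,c,d) (Cx (- roi d / roi c) (1 / ((roi c)^2 * t)))"
proof -
 let ?w = "Cx (- roi d / roi c) (1 / ((roi c)^2 * t))"
 have c0: "(of_int c :: complex) ~= 0" using c by simp
 have "a * d - b * c = 1" using s by (simp add: SL2Z_def)
 hence dd: "of_int a * of_int d - of_int b * of_int c = (1::complex)"
  by (metis of_int_1 of_int_diff of_int_mult)
 have j: "of_int c * ?w + of_int d = \<i> / (of_int c * cor t)"
  using jfac_vertical[OF c t, of a b d] by (simp add: jfac_def)
 have n: "of_int a * ?w + of_int b = (of_int a * \<i> / (of_int c * cor t) - 1) / of_int c"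
 proof -
  have "of_int c * (of_int a * ?w + of_int b) = of_int a * (of_int c * ?w + of_int d) - (of_int a * of_int d - of_int b * of_int c)"
   by (simp add: algebra_simps)
  also have "... = of_int a * \<i> / (of_int c * cor t) - 1" unfolding j dd by simp
  finally have e: "of_int c * (of_int a * ?w + of_int b) = of_int a * \<i> / (of_int c * cor t) - 1" .
  have "of_int a * ?w + of_int b = of_int c * (of_int a * ?w + of_int b) / of_int c" using c0 by simp
  thus ?thesis unfolding e .
 qed
 have t0: "cor t ~= 0" using t by simp
 have A: "\<i> * cor t * (\<i> / (of_int c * cor t)) = - 1 / of_int c" using t0 by simp
 have "of_int a * ?w + of_int b = of_int a / of_int c * (\<i> / (of_int c * cor t)) + - 1 / of_int c"
  unfolding n by (simp add: diff_divide_distrib)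
 also have "... = (of_int a / of_int c + \<i> * cor t) * (\<i> / (of_int c * cor t))"
  unfolding distrib_right A by simp
 finally have N: "of_int a * ?w + of_int b = (of_int a / of_int c + \<i> * cor t) * (\<i> / (of_int c * cor t))" .
 have "moeb (a,b,c,d) ?w = (of_int a / of_int c + \<i> * cor t) * (\<i> / (of_int c * cor t)) / (\<i> / (of_int c * cor t))"
  by (simp only: moeb_def case_prod_conv N j)
 also have "... = of_int a / of_int c + \<i> * cor t"
  using c0 t0 by (intro nonzero_mult_div_cancel_right) simp
 finally show ?thesis by simp
qed

text \<open>The integrand on the vertical line is the derivative of \<open>- Re (G (p t))\<close>,
  which tends to 0 at infinity and to \<open>- Re L\<close> at the cusp. Absolute integrability down
  to \<open>t = 0\<close> comes from the decay of the slashed form.\<close>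

lemma Fr_cusp:
 assumes s: "(a,b,c,d) : SL2Z" and c: "c > 0"
  and L: "!!z. Im z >= 1/2 ==> norm (G (moeb (a,b,c,d) z) - L) <= C / Im z"
 shows "Fr f (roi a / roi c) = 2 * pi * Re L"
proof -
 define r where "r = roi a / roi c"
 define p where "p = (%t::real. cor r + \<i> * cor t)"
 have pU: "p t : UHP" if "t > 0" for t using that by (simp add: p_def UHP_def)
 have Imp: "Im (p t) = t" for t by (simp add: p_def)
 define w where "w = (%t::real. Cx (- roi d / roi c) (1 / ((roi c)^2 * t)))"
 have pw: "p t = moeb (a,b,c,d) (w t)" if "t > 0" for t
  unfolding p_def w_def r_def by (rule moeb_vertical[OF s c that])
 have cr: "roi c >= 1" using c by simp
 \<comment> \<open>One constant for two ranges: \<open>C c\<^sup>2\<close> serves for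
   \<open>t <= 2 / c\<^sup>2\<close>, where the transported point has height at least 1/2, and
   beyond that the Bloch bound \<open>B / t\<close> is at most \<open>B c\<^sup>2\<close>.\<close>
 define K where "K = (C + B) * (roi c)^2"
 have fb: "norm (f (p t)) <= K" if t: "0 < t" "t < 1/2" for t
 proof (cases "t <= 2 / (roi c)^2")
  case True
  have Iw: "Im (w t) >= 1/2"
  proof -
   have "(roi c)^2 * t <= 2" using True cr by (simp add: field_simps)
   thus ?thesis using t cr by (simp add: w_def field_simps)
  qed
  hence wU: "w t : UHP" by (simp add: UHP_def)
  have j: "jfac (a,b,c,d) (w t) = \<i> / (of_int c * cor t)"
   unfolding w_def by (rule jfac_vertical[OF c t(1)])
  have "norm (f (p t)) = norm (fs f (a,b,c,d) (w t)) * (norm (jfac (a,b,c,d) (w t)))^2"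
   using jfac_nz[OF s wU] by (simp add: pw[OF t(1)] fs_def norm_divide norm_power)
  also have "... <= C / (Im (w t))^2 * (norm (jfac (a,b,c,d) (w t)))^2"
   using fsC[OF s Iw] by (intro mult_right_mono) auto
  \<comment> \<open>The quadratic decay exactly cancels the squared automorphy factor, so
    \<open>f\<close> stays bounded along the line.\<close>
  also have "... = C * (roi c)^2"     proof -
   have "norm (jfac (a,b,c,d) (w t)) = 1 / (roi c * t)" using c t by (simp add: j norm_divide norm_mult)
   moreover have "Im (w t) = 1 / ((roi c)^2 * t)" by (simp add: w_def)
   ultimately show ?thesis using c t by (simp add: power2_eq_square)
  qed
  also have "... <= K" using B0 by (simp add: K_def algebra_simps)
  finally show ?thesis .
 next
  case False
  hence t2: "2 / (roi c)^2 < t" by simp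
  have "norm (f (p t)) <= B / t" using bloch[OF pU[OF t(1)]] t by (simp add: Imp field_simps)
  also have "... <= B / (2 / (roi c)^2)" using t2 B0 cr t by (intro divide_left_mono) auto
  also have "... <= B * (roi c)^2" using B0 by simp
  also have "... <= K" using C0 by (simp add: K_def algebra_simps)
  finally show ?thesis .
 qed
 have one: "(1,0,0,1) : SL2Z" by (simp add: SL2Z_def)
 have fb2: "norm (f (p t)) <= C / t^2" if "t >= 1/2" for t
  using fsC[OF one, of "p t"] that by (simp add: Imp fs_def jfac_def)
 have K0: "K >= 0" using C0 B0 by (simp add: K_def)
 have pc: "continuous_on {0<..} (%t. f (p t))"
 proof (rule continuous_on_compose2[OF f_cont])
  show "continuous_on {0<..} p" unfolding p_def by (intro continuous_intros)
  show "p ` {0<..} <= UHP" using pU by auto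
 qed
 have m: "(%t. ind {0<..} t *\<^sub>R Im (f (p t))) : BM"
  by (intro borel_measurable_continuous_on_indicator continuous_intros pc) auto
 have int: "set_integrable lb {0<..} (%t. Im (f (p t)))"
  unfolding set_integrable_def
 proof (rule Bochner_Integration.integrable_bound)
  show "integrable lb (%t::real. K * ind {0..1/2} t + C * (ind {1/2..} t * (1 / t^2)))"
  proof (intro Bochner_Integration.integrable_add integrable_mult_right)
   show "integrable lb (indicat_real {0..1/2::real})" by (rule integrable_real_indicator) (use emeasure_compact_finite[of "{0..1/2::real}"] in \<open>simp_all only: compact_Icc sets_lborel borel_closed closed_atLeastAtMost\<close>)
   have "(NL t. en (1 / t^2) * ind {1/2..} t) = en (0 - (- 1 / (1/2)))"
   proof (rule nn_integral_FTC_atLeast)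
    show "((%y. - 1 / y) has_real_derivative 1 / y^2) (at y)" if "1/2 <= y" for y :: real
     using that by (auto intro!: derivative_eq_intros simp: power2_eq_square)
    show "((%y::real. - 1 / y) \<longlongrightarrow> 0) at_top"
     by (rule tendsto_divide_0[OF tendsto_const filterlim_at_top_imp_at_infinity[OF filterlim_ident]])
   qed auto
   also have "(NL t. en (1 / t^2) * ind {1/2..} t) = (NL t. en (ind {1/2..} t * (1 / t^2)))"
    by (intro nn_integral_cong) (auto simp: indicator_def)
   finally have "(NL t. en (ind {1/2..} t * (1 / t^2))) < \<infinity>" by simp
   thus "integrable lb (%t::real. ind {1/2..} t * (1 / t^2))"
    by (intro integrableI_nonneg) auto
  qed
  show "(%t. ind {0<..} t *\<^sub>R Im (f (p t))) : borel_measurable lb" using m by simp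
  have "norm (ind {0<..} t *\<^sub>R Im (f (p t))) <= norm (K * ind {0..1/2} t + C * (ind {1/2..} t * (1 / t^2)))" for t
  proof -
   have nn: "K * ind {0..1/2} t + C * (ind {1/2..} t * (1 / t^2)) >= 0" using K0 C0 by (simp add: indicator_def)
   consider "t <= 0" | "0 < t" "t < 1/2" | "t >= 1/2" by linarith
   hence "abs (ind {0<..} t * Im (f (p t))) <= K * ind {0..1/2} t + C * (ind {1/2..} t * (1 / t^2))"
   proof cases
    case 1 thus ?thesis using nn by simp
   next
    case 2
    have "abs (Im (f (p t))) <= K" using fb[OF 2] abs_Im_le_cmod[of "f (p t)"] by linarith
    thus ?thesis using 2 by simp
   next
    case 3
    have "abs (Im (f (p t))) <= C / t^2" using fb2[OF 3] abs_Im_le_cmod[of "f (p t)"] by linarith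
    moreover have "K * ind {0..1/2} t >= 0" using K0 by simp
    ultimately show ?thesis using 3 by simp
   qed
   thus ?thesis using nn by simp
  qed
  thus "AE t in lb. norm (ind {0<..} t *\<^sub>R Im (f (p t))) <= norm (K * ind {0..1/2} t + C * (ind {1/2..} t * (1 / t^2)))"
   by simp
 qed
 have "(LBINT t=0..\<infinity>. Im (f (p t))) = 0 - (- Re L)"
 proof (rule interval_integral_FTC_integrable[where F="%t. - Re (G (p t))"])
  show "((%t. - Re (G (p t))) has_vector_derivative Im (f (p t))) (at t)" if "0 < ereal t" "ereal t < \<infinity>" for t
  proof -
   have t: "t > 0" using that by simp
   have "(p has_vector_derivative \<i>) (at t)" unfolding p_def by (auto intro!: derivative_eq_intros)
   from field_vector_diff_chain_at[OF this G_der[OF pU[OF t]]]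
   have "((%t. G (p t)) has_vector_derivative \<i> * f (p t)) (at t)" by (simp add: o_def)
   from bounded_linear.has_vector_derivative[OF bounded_linear_Re this]
   have "((%t. Re (G (p t))) has_vector_derivative - Im (f (p t))) (at t)" by simp
   from has_vector_derivative_minus[OF this] show ?thesis by simp
  qed
  show "isCont (%t. Im (f (p t))) t" if "0 < ereal t" "ereal t < \<infinity>" for t
  proof -
   have t: "t : {0<..}" using that by simp
   have "isCont (%t. f (p t)) t" using pc t by (simp add: continuous_on_eq_continuous_at)
   thus ?thesis by (rule isCont_Im)
  qed
  show "set_integrable lb (einterval 0 \<infinity>) (%t. Im (f (p t)))"
   using int by (simp add: zero_ereal_def)
  have "((%t. - Re (G (p t))) \<longlongrightarrow> - Re L) (at_right 0)"
  proof (intro tendsto_minus tendsto_Re)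
   have "((%t. G (p t) - L) \<longlongrightarrow> 0) (at_right 0)"
   proof (rule Lim_null_comparison)
    show "((%t. C * (roi c)^2 * t) \<longlongrightarrow> 0) (at_right 0)"
     by (auto intro!: tendsto_eq_intros)
    have "eventually (%t. t : {0<..<2 / (roi c)^2}) (at_right 0)"
     using cr by (intro eventually_at_right_real) auto
    thus "eventually (%t. norm (G (p t) - L) <= C * (roi c)^2 * t) (at_right 0)"
    proof (rule eventually_mono)
     fix t assume t: "t : {0<..<2 / (roi c)^2}"
     hence "(roi c)^2 * t <= 2" using cr by (simp add: field_simps)
     hence "Im (w t) >= 1/2" using t cr by (simp add: w_def field_simps)
     from L[OF this] show "norm (G (p t) - L) <= C * (roi c)^2 * t"
      using t by (simp add: pw w_def mult.assoc)
    qed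
   qed
   thus "((%t. G (p t)) \<longlongrightarrow> L) (at_right 0)" by (rule Lim_null[THEN iffD2])
  qed
  thus "(((%t. - Re (G (p t))) \<circ> real_of_ereal) \<longlongrightarrow> - Re L) (at_right 0)"
   unfolding zero_ereal_def by (simp only: ereal_tendsto_simps1)
  have "((%t. - Re (G (p t))) \<longlongrightarrow> - Re 0) at_top"
  proof (intro tendsto_minus tendsto_Re, rule Lim_null_comparison)
   show "((%t. C / t) \<longlongrightarrow> 0) at_top"
    by (rule tendsto_divide_0[OF tendsto_const filterlim_at_top_imp_at_infinity[OF filterlim_ident]])
   show "eventually (%t. norm (G (p t)) <= C / t) at_top"
    
   proof (rule eventually_mono[OF eventually_ge_at_top[of "1/2"]])
    fix t :: real assume "1/2 <= t"
    thus "norm (G (p t)) <= C / t" using Ginf[of "p t"] by (simp add: Imp)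
   qed
  qed
  hence "((%t. - Re (G (p t))) \<longlongrightarrow> 0) at_top" by simp
  thus "(((%t. - Re (G (p t))) \<circ> real_of_ereal) \<longlongrightarrow> 0) (at_left \<infinity>)"
   by (simp only: ereal_tendsto_simps1)
 qed simp
 moreover have "(LBINT t=0..\<infinity>. Im (f (p t))) = (LINT t:{0<..}|lb. Im (f (p t)))"
  unfolding zero_ereal_def by (rule interval_integral_to_infinity_eq)
 ultimately show ?thesis by (simp add: Fr_def p_def r_def)
qed

text \<open>A matrix \<open>s\<close> sending infinity to \<open>a/c\<close> carries heights at
  least \<open>\<eta>\<close> to a horoball at \<open>a/c\<close>; the hypothesis
  \<open>near\<close> is the equation of that horoball, and the boundary value is the limit of
  \<open>G\<close> inside it.\<close>

lemma F_near_rational: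
 assumes "coprime a c" "c > 0" and \<eta>: "0 < \<eta>" "\<eta> <= 1/2" and z: "z : UHP"
  and near: "\<eta> * ((roi c)^2 * (norm (z - cor (roi a / roi c)))^2) <= Im z"
 shows "abs (F z - Fr f (roi a / roi c)) <= 2 * pi * (2 * C + B * ln (1 / \<eta>))"
proof -
 obtain u v where uv: "u * a + v * c = 1" using bezout_int[of a c] assms(1) by (metis coprime_iff_gcd_eq_1)
 define s where "s = (a, -v, c, u)"
 have s: "s : SL2Z" using uv by (simp add: s_def SL2Z_def algebra_simps)
 obtain L where L: "!!z. Im z >= 1/2 ==> norm (G (moeb s z) - L) <= C / Im z" using cuspL[OF s] by blast
 have Fr: "Fr f (roi a / roi c) = 2 * pi * Re L"
  by (rule Fr_cusp[of a "-v" c u]) (use s L assms(2) in \<open>auto simp: s_def\<close>)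
 define w where "w = moeb (minv s) z"
 have zw: "z = moeb s w" using s z by (simp add: w_def)
 have nz: "jfac (minv s) z ~= 0" by (rule jfac_nz[OF SL2Z_minv[OF s] z])
 have "jfac (minv s) z = - of_int c * (z - cor (roi a / roi c))"
  using assms(2) by (simp add: s_def jfac_def field_simps)
 hence j: "(norm (jfac (minv s) z))^2 = (roi c)^2 * (norm (z - cor (roi a / roi c)))^2"
  by (simp add: norm_mult power_mult_distrib)
 have "Im w = Im z / (norm (jfac (minv s) z))^2" unfolding w_def by (rule Im_moeb[OF SL2Z_minv[OF s] z])
 moreover have "\<eta> * (norm (jfac (minv s) z))^2 <= Im z" using near by (simp only: j)
 ultimately have "Im w >= \<eta>" using nz by (simp add: pos_le_divide_eq)
 from G_near_cusp[OF s L \<eta> this] have "norm (G z - L) <= 2 * C + B * ln (1 / \<eta>)" by (simp add: zw)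
 hence "abs (Re (G z - L)) <= 2 * C + B * ln (1 / \<eta>)" using abs_Re_le_cmod order_trans by blast
 hence "2 * pi * abs (Re (G z - L)) <= 2 * pi * (2 * C + B * ln (1 / \<eta>))" by (intro mult_left_mono) auto
 moreover have "F z - Fr f (roi a / roi c) = 2 * pi * Re (G z - L)" by (simp add: F_def Fr algebra_simps)
 ultimately show ?thesis by (simp add: abs_mult)
qed

definition gm :: "complex => real" where
 "gm z = ind UHP z * ((Im z)^2 * (norm (f z))^2)"

lemma gm_measurable [measurable]: "gm : BM"
proof -
 have "continuous_on UHP (%z. (Im z)^2 * (norm (f z))^2)" by (intro continuous_intros f_cont)
 hence "(%z. ind UHP z *\<^sub>R ((Im z)^2 * (norm (f z))^2)) : BM"
  by (intro borel_measurable_continuous_on_indicator) auto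
 thus ?thesis by (simp add: gm_def[abs_def])
qed

lemma gm_bounds: "0 <= gm z" "gm z <= B^2"
proof -
 show "0 <= gm z" by (simp add: gm_def)
 show "gm z <= B^2"
 proof (cases "z : UHP")
  case True
  have "(Im z * norm (f z))^2 <= B^2" using bloch[OF True] True by (intro power_mono) (auto simp: UHP_def)
  thus ?thesis using True by (simp add: gm_def power_mult_distrib)
 qed (simp add: gm_def)
qed

lemma gm_inv: "Ginv q gm"
 unfolding Ginv_def
proof (intro ballI)
 fix g z assume g: "g : Gamma0 q" and z: "z : UHP"
 note s = SL2Z_of_Gamma0[OF g]
 show "gm (moeb g z) = gm z"
  using z moeb_UHP[OF s z] jfac_nz[OF s z]
  by (simp add: gm_def Im_moeb[OF s z] f_aut[OF g z] norm_mult norm_power power_mult_distrib power_divide power2_eq_square)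
qed

lemma hyp_LINT: 
 assumes [measurable]: "k : BM"
 shows "(LINT z|hyp. k z) = (LINT z|lb. ind UHP z / (Im z)^2 * k z)"
proof -
 have "hyp = density lb (%z. en (ind UHP z / (Im z)^2))"
  unfolding hyp_def by (intro density_cong) (auto simp: indicator_def)
 note h = this
 have "(LINT z|hyp. k z) = (LINT z|lb. (ind UHP z / (Im z)^2) *\<^sub>R k z)"
  unfolding h by (rule integral_density) auto
 thus ?thesis by simp
qed

lemma petersson_gm: "petersson_sq D f = (LINT z|hyp. ind D z * gm z)"
 and hyp_vol_measure: "hyp_vol D = (LINT z|hyp. ind D z)"
proof -
 have "(LINT z|hyp. ind D z * gm z) = (LINT z|lb. ind UHP z / (Im z)^2 * (ind D z * gm z))"
  by (rule hyp_LINT) measurable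
 also have "... = petersson_sq D f" unfolding petersson_sq_def set_lebesgue_integral_def
  using D_UHP by (intro Bochner_Integration.integral_cong) (auto simp: gm_def indicator_def UHP_def)
 finally show "petersson_sq D f = (LINT z|hyp. ind D z * gm z)" ..
 have "(LINT z|hyp. ind D z) = (LINT z|lb. ind UHP z / (Im z)^2 * indicat_real D z)"
  by (rule hyp_LINT) measurable
 also have "... = hyp_vol D" unfolding hyp_vol_def set_lebesgue_integral_def
  using D_UHP by (intro Bochner_Integration.integral_cong) (auto simp: indicator_def)
 finally show "hyp_vol D = (LINT z|hyp. ind D z)" ..
qed

lemma gm_nonneg_D: "petersson_sq D f >= 0"
 unfolding petersson_gm by (rule Bochner_Integration.integral_nonneg) (simp add: gm_bounds)

text \<open>If the norm vanished, unfolding would make \<open>gm\<close> vanish almost everywhere on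
  the half plane, whereas the set where \<open>f\<close> is nonzero is open and nonempty. Positive
  area follows, as a null \<open>D\<close> would make the norm vanish.\<close>

lemma petersson_pos:
 assumes "EX z:UHP. f z ~= 0"
 shows "petersson_sq D f > 0" "hyp_vol D > 0"
proof -
 have i: "integrable hyp (%z. ind D z * gm z)"
  by (rule integrable_D[of _ "B^2"]) (use gm_bounds in auto)
 show pos: "petersson_sq D f > 0"
 proof (rule ccontr)
  assume "~ ?thesis"
  hence "(LINT z|hyp. ind D z * gm z) = 0" using gm_nonneg_D by (simp add: petersson_gm)
  hence "AE z in hyp. ind D z * gm z = 0"
   using integral_nonneg_eq_0_iff_AE[OF i] gm_bounds by simp
  hence z0: "AE z in hyp. ind D z * en (gm z) = 0"
   by (rule eventually_mono) (auto simp: indicator_def)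
  obtain z0 where z0': "z0 : UHP" "f z0 ~= 0" using assms by blast
  \<comment> \<open>Unfolding is applied to the constant 1, whose periodization is infinite; the
    product with a vanishing factor is still 0 in \<open>ennreal\<close>.\<close>
  have "(NN z. 1 * en (gm z)) * 2 = (NN z. ind D z * (Gsum q (%_. 1) z * en (gm z)))"
   using unfolding_nn_inv[of "%_. 1" "%z. en (gm z)"] gm_inv by (simp add: Ginv_def mult.commute)
  also have "... = 0" by (rule nn_integral_0_iff_AE[THEN iffD2, rotated], rule eventually_mono[OF z0]) auto
  finally have "(NN z. en (gm z)) = 0" by simp
  hence "AE z in hyp. en (gm z) = 0" by (subst (asm) nn_integral_0_iff_AE) auto
  hence ae: "AE z in lb. 0 < ind UHP z * en (1 / (Im z)^2) --> en (gm z) = 0"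
   unfolding hyp_def by (subst (asm) AE_density) auto
  have "z \<notin> {z\<in>UHP. f z ~= 0}" if z: "0 < ind UHP z * en (1 / (Im z)^2) --> en (gm z) = 0" for z
  proof
   assume a: "z : {z\<in>UHP. f z ~= 0}"
   hence zU: "z : UHP" and "Im z > 0" and "f z ~= 0" by (auto simp: UHP_def)
   hence "gm z > 0" "0 < ind UHP z * en (1 / (Im z)^2)" by (simp_all add: gm_def)
   thus False using z by simp
  qed
  with ae have ae2: "AE z in lb. z \<notin> {z\<in>UHP. f z ~= 0}" by (auto elim: eventually_mono)
  have eq: "{z\<in>UHP. f z ~= 0} = UHP \<inter> f -` (- {0})" by auto
  have op: "open {z\<in>UHP. f z ~= 0}"
   unfolding eq by (rule continuous_open_preimage[OF f_cont open_UHP]) auto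
  have "{z\<in>UHP. f z ~= 0} : null_sets lb"
   by (rule AE_iff_null_sets[THEN iffD2, OF _ ae2]) (use op in simp)
  hence "negligible {z\<in>UHP. f z ~= 0}" unfolding negligible_iff_null_sets by (rule null_sets_completionI)
  hence "{z\<in>UHP. f z ~= 0} = {}" using open_not_negligible op by blast
  thus False using z0' by blast
 qed
 show "hyp_vol D > 0"
 proof (rule ccontr)
  assume "~ ?thesis"
  moreover have "hyp_vol D = measure hyp D" by (simp add: hyp_vol_measure)
  ultimately have "measure hyp D = 0" using measure_nonneg[of hyp D] by linarith
  hence "emeasure hyp D = 0" using D_finite by (auto simp: measure_def enn2real_eq_0_iff)
  hence "AE z in hyp. z \<notin> D" by (intro AE_not_in) (auto simp: null_sets_def)
  hence "(LINT z|hyp. ind D z * gm z) = (LINT z|hyp. 0)"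
   by (intro integral_cong_AE) (auto elim: eventually_mono)
  thus False using pos by (simp add: petersson_gm)
 qed
qed

end

section \<open>The equation for horocycle averages\<close>

text \<open>Two derivatives are recorded because the horizontal part of the Laplacian is moved onto
  the weight by two integrations by parts.\<close>

locale bump =
 fixes \<psi> \<psi>1 \<psi>2 :: "real => real" and X0 X1 Lp Mp :: real
 assumes X01: "X0 <= X1"
  and psi1: "!!x. (\<psi> has_real_derivative \<psi>1 x) (at x)"
  and psi2: "!!x. (\<psi>1 has_real_derivative \<psi>2 x) (at x)"
  and psi2c: "continuous_on UNIV \<psi>2"
  and supp: "!!x. x \<notin> {X0..X1} ==> \<psi> x = 0" "!!x. x \<notin> {X0..X1} ==> \<psi>1 x = 0"
  and psi01: "!!x. 0 <= \<psi> x" "!!x. \<psi> x <= 1"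
  and psi1b: "!!x. abs (\<psi>1 x) <= Lp" and psi2b: "!!x. abs (\<psi>2 x) <= Mp"
begin

lemma Lp0: "Lp >= 0" and Mp0: "Mp >= 0"
 using psi1b[of 0] psi2b[of 0] by auto

lemma psi_c: "continuous_on S \<psi>" and psi1_c: "continuous_on S \<psi>1" and psi2_c: "continuous_on S \<psi>2"
proof -
 show "continuous_on S \<psi>" by (meson DERIV_isCont continuous_at_imp_continuous_on psi1)
 show "continuous_on S \<psi>1" by (meson DERIV_isCont continuous_at_imp_continuous_on psi2)
 show "continuous_on S \<psi>2" by (rule continuous_on_subset[OF psi2c]) simp
qed

lemma psi_lip: "abs (\<psi> x - \<psi> y) <= Lp * abs (x - y)"
 using field_differentiable_bound[where S=UNIV and f=\<psi> and f'=\<psi>1 and B=Lp and x=x and y=y] psi1 psi1b by simp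

end

lemma cis_deriv:
 assumes "(g has_real_derivative d) (at y)"
 shows "((%y. cis (\<xi> * g y)) has_vector_derivative (\<i> * cor (\<xi> * d)) * cis (\<xi> * g y)) (at y)"
 unfolding has_vector_derivative_complex_iff
 using assms by (auto intro!: derivative_eq_intros)

lemma Complex_vertical_deriv: "((%t. Cx x t) has_vector_derivative \<i>) (at t)"
 and Complex_horizontal_deriv: "((%s. Cx s y) has_vector_derivative 1) (at s)"
 unfolding has_vector_derivative_complex_iff by (auto intro!: derivative_eq_intros)

lemma continuous_on_Complex_swap:
 assumes "continuous_on UHP k"
 shows "continuous_on ({0<..} \<times> S) (%p. k (Cx (snd p) (fst p)))"
proof (rule continuous_on_compose2[OF assms])
 show "continuous_on ({0<..} \<times> S) (%p. Cx (snd p) (fst p))"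
  unfolding Complex_eq by (intro continuous_intros)
qed (auto simp: UHP_def)

lemma norm_cis_minus_1: "norm (cis x - 1) <= abs x"
proof -
 have "norm (cis x - cis 0) <= 1 * norm (x - 0)"
 proof (rule differentiable_bound[where S=UNIV and f'="%t h. h *\<^sub>R (\<i> * cis t)"])
  fix t :: real
  have "((%y. cis (1 * y)) has_vector_derivative (\<i> * cor (1 * 1)) * cis (1 * t)) (at t)"
   by (rule cis_deriv) (auto intro!: derivative_eq_intros)
  thus "(cis has_derivative (%h. h *\<^sub>R (\<i> * cis t))) (at t within UNIV)"
   by (simp add: has_vector_derivative_def)
  show "onorm (%h. h *\<^sub>R (\<i> * cis t)) <= 1"
   by (rule onorm_le) (simp add: norm_mult)
 qed auto
 thus ?thesis by simp
qed

locale cbump = cdata q D f G B C + bump \<psi> \<psi>1 \<psi>2 X0 X1 Lp Mp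
 for q D f G B C \<psi> \<psi>1 \<psi>2 X0 X1 Lp Mp
begin

text \<open>The margin 1 puts the end points strictly outside the support, where
  \<open>\<psi>\<close> and \<open>\<psi>1\<close> vanish by \<open>supp\<close>. It also leaves
  room for intervals of radius \<open>y <= 1\<close> about fractions in the support.\<close>

abbreviation "a \<equiv> X0 - 1"
abbreviation "b \<equiv> X1 + 1"

definition u :: "real => complex => complex" where "u \<xi> z = cis (\<xi> * F z)"

definition Fy where "Fy z = - 2 * pi * Im (f z)"
definition Fx where "Fx z = 2 * pi * Re (f z)"

lemma G_cont: "continuous_on UHP G"
 by (meson DERIV_isCont G_der continuous_at_imp_continuous_on)

lemma F_cont: "continuous_on UHP F"
 unfolding F_def[abs_def] by (intro continuous_intros G_cont)

lemma u_cont: "continuous_on UHP (u \<xi>)"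
 unfolding u_def[abs_def] cis_conv_exp by (intro continuous_intros F_cont)

lemma f'_cont: "continuous_on UHP (deriv f)"
 by (intro holomorphic_on_imp_continuous_on holomorphic_deriv f_hol open_UHP)

lemma Fx_cont: "continuous_on UHP Fx" and Fy_cont: "continuous_on UHP Fy"
 unfolding Fx_def[abs_def] Fy_def[abs_def] by (intro continuous_intros f_cont)+

lemma norm_u [simp]: "norm (u \<xi> z) = 1" by (simp add: u_def)

lemma F_dy: "y > 0 ==> ((%y. F (Cx x y)) has_real_derivative Fy (Cx x y)) (at y)"
proof -
 assume "y > 0"
 hence U: "Cx x y : UHP" by (simp add: UHP_def)
 from field_vector_diff_chain_at[OF Complex_vertical_deriv G_der[OF U]]
 have "((%y. G (Cx x y)) has_vector_derivative \<i> * f (Cx x y)) (at y)" by (simp add: o_def)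
 hence "((%y. Re (G (Cx x y))) has_real_derivative - Im (f (Cx x y))) (at y)"
  unfolding has_vector_derivative_complex_iff by simp
 from DERIV_cmult[OF this, of "2 * pi"] show ?thesis by (simp add: F_def Fy_def)
qed

lemma F_dx: "y > 0 ==> ((%x. F (Cx x y)) has_real_derivative Fx (Cx x y)) (at x)"
proof -
 assume "y > 0"
 hence U: "Cx x y : UHP" by (simp add: UHP_def)
 from field_vector_diff_chain_at[OF Complex_horizontal_deriv G_der[OF U]]
 have "((%x. G (Cx x y)) has_vector_derivative f (Cx x y)) (at x)" by (simp add: o_def)
 hence "((%x. Re (G (Cx x y))) has_real_derivative Re (f (Cx x y))) (at x)"
  unfolding has_vector_derivative_complex_iff by simp
 from DERIV_cmult[OF this, of "2 * pi"] show ?thesis by (simp add: F_def Fx_def)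
qed

lemma f_der: "z : UHP ==> (f has_field_derivative deriv f z) (at z)"
 using holomorphic_derivI[OF f_hol open_UHP] by blast

lemma Fy_dy: "y > 0 ==> ((%y. Fy (Cx x y)) has_real_derivative - 2 * pi * Re (deriv f (Cx x y))) (at y)"
proof -
 assume "y > 0"
 hence U: "Cx x y : UHP" by (simp add: UHP_def)
 from field_vector_diff_chain_at[OF Complex_vertical_deriv f_der[OF U]]
 have "((%y. f (Cx x y)) has_vector_derivative \<i> * deriv f (Cx x y)) (at y)" by (simp add: o_def)
 hence "((%y. Im (f (Cx x y))) has_real_derivative Re (deriv f (Cx x y))) (at y)"
  unfolding has_vector_derivative_complex_iff by simp
 from DERIV_cmult[OF this, of "- 2 * pi"] show ?thesis by (simp add: Fy_def)
qed

lemma Fx_dx: "y > 0 ==> ((%x. Fx (Cx x y)) has_real_derivative 2 * pi * Re (deriv f (Cx x y))) (at x)"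
proof -
 assume "y > 0"
 hence U: "Cx x y : UHP" by (simp add: UHP_def)
 from field_vector_diff_chain_at[OF Complex_horizontal_deriv f_der[OF U]]
 have "((%x. f (Cx x y)) has_vector_derivative deriv f (Cx x y)) (at x)" by (simp add: o_def)
 hence "((%x. Re (f (Cx x y))) has_real_derivative Re (deriv f (Cx x y))) (at x)"
  unfolding has_vector_derivative_complex_iff by simp
 from DERIV_cmult[OF this, of "2 * pi"] show ?thesis by (simp add: Fx_def)
qed

definition uy where "uy \<xi> z = (\<i> * cor (\<xi> * Fy z)) * u \<xi> z"
definition ux where "ux \<xi> z = (\<i> * cor (\<xi> * Fx z)) * u \<xi> z"
definition uyy where "uyy \<xi> z = (\<i> * cor (\<xi> * Fy z)) * uy \<xi> z + (\<i> * cor (\<xi> * (- 2 * pi * Re (deriv f z)))) * u \<xi> z"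
definition uxx where "uxx \<xi> z = (\<i> * cor (\<xi> * Fx z)) * ux \<xi> z + (\<i> * cor (\<xi> * (2 * pi * Re (deriv f z)))) * u \<xi> z"

lemma u_dy: "y > 0 ==> ((%y. u \<xi> (Cx x y)) has_vector_derivative uy \<xi> (Cx x y)) (at y)"
 unfolding u_def uy_def by (rule cis_deriv[OF F_dy])

lemma u_dx: "y > 0 ==> ((%x. u \<xi> (Cx x y)) has_vector_derivative ux \<xi> (Cx x y)) (at x)"
 unfolding u_def ux_def by (rule cis_deriv[OF F_dx])

lemma icoef_deriv:
 assumes "(g has_real_derivative d) (at y)"
 shows "((%y. \<i> * cor (\<xi> * g y)) has_vector_derivative \<i> * cor (\<xi> * d)) (at y)"
 unfolding has_vector_derivative_complex_iff using assms by (auto intro!: derivative_eq_intros)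

lemma uy_dy:
 assumes y: "y > 0"
 shows "((%y. uy \<xi> (Cx x y)) has_vector_derivative uyy \<xi> (Cx x y)) (at y)"
proof -
 from has_vector_derivative_mult[OF icoef_deriv[OF Fy_dy[OF y]] u_dy[OF y]]
 show ?thesis unfolding uyy_def by (simp only: uy_def)
qed

lemma ux_dx:
 assumes y: "y > 0"
 shows "((%x. ux \<xi> (Cx x y)) has_vector_derivative uxx \<xi> (Cx x y)) (at x)"
proof -
 from has_vector_derivative_mult[OF icoef_deriv[OF Fx_dx[OF y]] u_dx[OF y]]
 show ?thesis unfolding uxx_def by (simp only: ux_def)
qed

text \<open>\<open>F\<close> is harmonic, so the Laplacian of \<open>u = e\<^sup>i\<^sup>\<xi>\<^sup>F\<close> only sees the gradient of \<open>F\<close>.\<close>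
lemma u_laplace: "uyy \<xi> z = - uxx \<xi> z - cor (4 * pi^2 * \<xi>^2 * (norm (f z))^2) * u \<xi> z"
proof -
 have n: "(norm (f z))^2 = (Re (f z))^2 + (Im (f z))^2" by (rule cmod_power2)
 have i: "\<i> * (\<i> * w) = - w" for w :: complex by (simp add: mult.assoc[symmetric])
 show ?thesis
  unfolding uyy_def uxx_def uy_def ux_def Fx_def Fy_def n
  by (simp add: algebra_simps power2_eq_square i)
qed

lemma uy_cont: "continuous_on UHP (uy \<xi>)" and ux_cont: "continuous_on UHP (ux \<xi>)"
 unfolding uy_def[abs_def] ux_def[abs_def] by (intro continuous_intros Fx_cont Fy_cont u_cont)+

lemma uyy_cont: "continuous_on UHP (uyy \<xi>)" and uxx_cont: "continuous_on UHP (uxx \<xi>)"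
 unfolding uyy_def[abs_def] uxx_def[abs_def]
 by (intro continuous_intros Fx_cont Fy_cont u_cont uy_cont ux_cont f'_cont)+

definition hint :: "(real => real) => (complex => complex) => real => complex" where
 "hint p k y = integral {a..b} (%x. cor (p x) * k (Cx x y))"

lemma hint_integrand_cont:
 assumes "continuous_on {a..b} p" "continuous_on UHP k" "y > 0"
 shows "continuous_on {a..b} (%x. cor (p x) * k (Cx x y))"
proof -
 have "continuous_on {a..b} (%x. k (Cx x y))"
 proof (rule continuous_on_compose2[OF assms(2)])
  show "continuous_on {a..b} (%x. Cx x y)" unfolding Complex_eq by (intro continuous_intros)
 qed (use assms in \<open>auto simp: UHP_def\<close>)
 thus ?thesis by (intro continuous_intros assms)
qed

lemma hint_deriv:
 assumes p: "continuous_on {a..b} p" and k: "continuous_on UHP k" and k': "continuous_on UHP k'"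
  and d: "!!x y. y > 0 ==> ((%y. k (Cx x y)) has_vector_derivative k' (Cx x y)) (at y)" and y: "y > 0"
 shows "((%y. hint p k y) has_vector_derivative hint p k' y) (at y)"
proof -
 have "((%y. integral (cbox a b) (%x. cor (p x) * k (Cx x y))) has_vector_derivative
   integral (cbox a b) (%x. cor (p x) * k' (Cx x y))) (at y within {0<..})"
 proof (rule leibniz_rule_vector_derivative)
  fix y x :: real assume yx: "y : {0<..}" "x : cbox a b"
  have "((%y. k (Cx x y)) has_vector_derivative k' (Cx x y)) (at y within {0<..})"
   using d[of y x] yx has_vector_derivative_at_within by auto
  from has_vector_derivative_mult_right[OF this]
  show "((%y. cor (p x) * k (Cx x y)) has_vector_derivative cor (p x) * k' (Cx x y)) (at y within {0<..})" .
 next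
  fix y :: real assume "y : {0<..}"
  thus "(%x. cor (p x) * k (Cx x y)) integrable_on cbox a b"
   using hint_integrand_cont[OF p k, of y] by (intro integrable_continuous) auto
 next
  have "continuous_on ({0<..} \<times> {a..b}) (%q. cor (p (snd q)) * k' (Cx (snd q) (fst q)))"
  proof (intro continuous_intros continuous_on_Complex_swap k')
   show "continuous_on ({0<..} \<times> {a..b}) (%q. p (snd q))"
    by (rule continuous_on_compose2[OF p]) (auto intro!: continuous_intros)
  qed
  thus "continuous_on ({0<..} \<times> cbox a b) (%(y, x). cor (p x) * k' (Cx x y))"
   by (simp add: case_prod_unfold)
 qed (use y in auto)
 thus ?thesis using y by (simp add: hint_def at_within_open[of y "{0<..}"])
qed

lemma hint_cont:
 assumes p: "continuous_on {a..b} p" and k: "continuous_on UHP k" and S: "S <= {0<..}"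
 shows "continuous_on S (hint p k)"
proof -
 have "continuous_on ({0<..} \<times> {a..b}) (%q. cor (p (snd q)) * k (Cx (snd q) (fst q)))"
 proof (intro continuous_intros continuous_on_Complex_swap k)
  show "continuous_on ({0<..} \<times> {a..b}) (%q. p (snd q))"
   by (rule continuous_on_compose2[OF p]) (auto intro!: continuous_intros)
 qed
 hence "continuous_on ({0<..} \<times> cbox a b) (%(y, x). cor (p x) * k (Cx x y))"
  by (simp add: case_prod_unfold)
 from integral_continuous_on_param[OF this] have "continuous_on {0<..} (hint p k)" by (simp add: hint_def[abs_def])
 thus ?thesis using S continuous_on_subset by blast
qed

lemma hint_bound:
 assumes "continuous_on {a..b} p" "continuous_on UHP k" "y > 0"
  and "!!x. norm (cor (p x) * k (Cx x y)) <= M"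
 shows "norm (hint p k y) <= M * (b - a)"
 unfolding hint_def
 by (rule integral_bound) (use assms hint_integrand_cont[OF assms(1-3)] X01 in auto)

text \<open>\<open>Gam\<close> is the average with the invariant density inserted, the driving term
  of the equation; \<open>Xi\<close> is the error caused by the curvature of the weight.\<close>

definition Phi where "Phi \<xi> y = hint \<psi> (u \<xi>) y"
definition Gam where "Gam \<xi> y = hint \<psi> (%z. cor (gm z) * u \<xi> z) y"
definition Xi where "Xi \<xi> y = hint \<psi>2 (u \<xi>) y"

lemma gm_cont: "continuous_on UHP gm"
proof -
 have "continuous_on UHP (%z. (Im z)^2 * (norm (f z))^2)" by (intro continuous_intros f_cont)
 thus ?thesis by (rule continuous_on_eq) (simp add: gm_def)
qed

lemma gmu_cont: "continuous_on UHP (%z. cor (gm z) * u \<xi> z)"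
 by (intro continuous_intros gm_cont u_cont)

text \<open>The vertical second derivative is replaced through \<open>u_laplace\<close>, and two
  integrations by parts move the horizontal one onto \<open>\<psi>\<close>. The boundary terms
  vanish at \<open>a\<close> and \<open>b\<close>.\<close>

lemma Phi_dd: 
 assumes y: "y > 0"
 shows "hint \<psi> (uyy \<xi>) y = - Xi \<xi> y - cor (4 * pi^2 * \<xi>^2 / y^2) * Gam \<xi> y"
proof -
 have ab: "a <= b" using X01 by simp
 let ?z = "%x. Cx x y"
 have "((%x. cor (\<psi> x) * uxx \<xi> (?z x) - cor (\<psi>2 x) * u \<xi> (?z x)) has_integral
   (cor (\<psi> b) * ux \<xi> (?z b) - cor (\<psi>1 b) * u \<xi> (?z b))
   - (cor (\<psi> a) * ux \<xi> (?z a) - cor (\<psi>1 a) * u \<xi> (?z a))) {a..b}"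
 proof (rule fundamental_theorem_of_calculus[OF ab])
  fix x assume "x : {a..b}"
  have d1: "((%x. cor (\<psi> x)) has_vector_derivative cor (\<psi>1 x)) (at x)"
   and d2: "((%x. cor (\<psi>1 x)) has_vector_derivative cor (\<psi>2 x)) (at x)"
   unfolding has_vector_derivative_complex_iff using psi1[of x] psi2[of x] by auto
  have "((%x. cor (\<psi> x) * ux \<xi> (?z x) - cor (\<psi>1 x) * u \<xi> (?z x)) has_vector_derivative
   (cor (\<psi> x) * uxx \<xi> (?z x) + cor (\<psi>1 x) * ux \<xi> (?z x))
   - (cor (\<psi>1 x) * ux \<xi> (?z x) + cor (\<psi>2 x) * u \<xi> (?z x))) (at x)"
   by (rule has_vector_derivative_diff[OF has_vector_derivative_mult[OF d1 ux_dx[OF y]] has_vector_derivative_mult[OF d2 u_dx[OF y]]])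
  hence "((%x. cor (\<psi> x) * ux \<xi> (?z x) - cor (\<psi>1 x) * u \<xi> (?z x)) has_vector_derivative
   (cor (\<psi> x) * uxx \<xi> (?z x) - cor (\<psi>2 x) * u \<xi> (?z x))) (at x)" by (simp add: algebra_simps)
  thus "((%x. cor (\<psi> x) * ux \<xi> (?z x) - cor (\<psi>1 x) * u \<xi> (?z x)) has_vector_derivative
   (cor (\<psi> x) * uxx \<xi> (?z x) - cor (\<psi>2 x) * u \<xi> (?z x))) (at x within {a..b})"
   by (rule has_vector_derivative_at_within)
 qed
 moreover have "\<psi> b = 0" "\<psi>1 b = 0" "\<psi> a = 0" "\<psi>1 a = 0" using supp[of a] supp[of b] X01 by auto
 ultimately have ibp: "((%x. cor (\<psi> x) * uxx \<xi> (?z x) - cor (\<psi>2 x) * u \<xi> (?z x)) has_integral 0) {a..b}" by simp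
 have i2: "(%x. cor (\<psi>2 x) * u \<xi> (?z x)) integrable_on {a..b}"
  by (rule integrable_continuous_interval[OF hint_integrand_cont[OF psi2_c u_cont y]])
 have ig: "(%x. cor (\<psi> x) * (cor (gm (?z x)) * u \<xi> (?z x))) integrable_on {a..b}"
  by (rule integrable_continuous_interval[OF hint_integrand_cont[OF psi_c gmu_cont y]])
 have "hint \<psi> (uyy \<xi>) y = integral {a..b} (%x. - (cor (\<psi> x) * uxx \<xi> (?z x) - cor (\<psi>2 x) * u \<xi> (?z x))
   - cor (\<psi>2 x) * u \<xi> (?z x)
   - cor (4 * pi^2 * \<xi>^2 / y^2) * (cor (\<psi> x) * (cor (gm (?z x)) * u \<xi> (?z x))))"
  unfolding hint_def
 proof (rule integral_cong)
  fix x
  have g: "gm (?z x) = y^2 * (norm (f (?z x)))^2" using y by (simp add: gm_def UHP_def)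
  have "cor (4 * pi^2 * \<xi>^2 / y^2) * (cor (\<psi> x) * (cor (gm (?z x)) * u \<xi> (?z x)))
    = cor (\<psi> x) * (cor (4 * pi^2 * \<xi>^2 / y^2 * gm (?z x)) * u \<xi> (?z x))" by (simp add: mult_ac)
  also have "4 * pi^2 * \<xi>^2 / y^2 * gm (?z x) = 4 * pi^2 * \<xi>^2 * (norm (f (?z x)))^2" using y by (simp add: g)
  finally show "cor (\<psi> x) * uyy \<xi> (?z x) = - (cor (\<psi> x) * uxx \<xi> (?z x) - cor (\<psi>2 x) * u \<xi> (?z x))
   - cor (\<psi>2 x) * u \<xi> (?z x)
   - cor (4 * pi^2 * \<xi>^2 / y^2) * (cor (\<psi> x) * (cor (gm (?z x)) * u \<xi> (?z x)))"
   by (simp only: u_laplace[of \<xi> "?z x"]) (simp add: right_diff_distrib)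
 qed
 also have "... = - 0 - integral {a..b} (%x. cor (\<psi>2 x) * u \<xi> (?z x))
   - cor (4 * pi^2 * \<xi>^2 / y^2) * integral {a..b} (%x. cor (\<psi> x) * (cor (gm (?z x)) * u \<xi> (?z x)))"
  by (intro integral_unique has_integral_diff has_integral_neg has_integral_mult_right ibp integrable_integral i2 ig)
 finally show ?thesis by (simp add: Xi_def Gam_def hint_def)
qed

lemma Phi_cont: "S <= {0<..} ==> continuous_on S (Phi \<xi>)" and Gam_cont: "S <= {0<..} ==> continuous_on S (Gam \<xi>)"
 and Xi_cont: "S <= {0<..} ==> continuous_on S (Xi \<xi>)"
 unfolding Phi_def[abs_def] Gam_def[abs_def] Xi_def[abs_def]
 using hint_cont[OF psi_c u_cont] hint_cont[OF psi_c gmu_cont] hint_cont[OF psi2_c u_cont] by blast+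

text \<open>Taylor's formula about height 1 with integral remainder, into which the equation for the
  second derivative is inserted.\<close>

lemma Phi_taylor:
 assumes y: "0 < y" "y <= 1"
 shows "Phi \<xi> y = Phi \<xi> 1 - cor (1 - y) * hint \<psi> (uy \<xi>) 1
  - integral {y..1} (%w. cor (w - y) * Xi \<xi> w)
  - cor (4 * pi^2 * \<xi>^2) * integral {y..1} (%w. cor ((w - y) / w^2) * Gam \<xi> w)"
proof -
 have d1: "((%w. Phi \<xi> w) has_vector_derivative hint \<psi> (uy \<xi>) w) (at w)" if "w > 0" for w
  unfolding Phi_def by (rule hint_deriv[OF psi_c u_cont uy_cont u_dy that])
 have d2: "((%w. hint \<psi> (uy \<xi>) w) has_vector_derivative hint \<psi> (uyy \<xi>) w) (at w)" if "w > 0" for w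
  by (rule hint_deriv[OF psi_c uy_cont uyy_cont uy_dy that])
 have "((%w. cor (y - w) * hint \<psi> (uyy \<xi>) w) has_integral
  (Phi \<xi> 1 + cor (y - 1) * hint \<psi> (uy \<xi>) 1) - (Phi \<xi> y + cor (y - y) * hint \<psi> (uy \<xi>) y)) {y..1}"
 proof (rule fundamental_theorem_of_calculus[OF y(2)])
  fix w assume "w : {y..1}"
  hence w: "w > 0" using y by simp
  have l: "((%w. cor (y - w)) has_vector_derivative cor (-1)) (at w)"
   unfolding has_vector_derivative_complex_iff by (auto intro!: derivative_eq_intros)
  have "((%w. Phi \<xi> w + cor (y - w) * hint \<psi> (uy \<xi>) w) has_vector_derivative
   hint \<psi> (uy \<xi>) w + (cor (y - w) * hint \<psi> (uyy \<xi>) w + cor (-1) * hint \<psi> (uy \<xi>) w)) (at w)"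
   by (rule has_vector_derivative_add[OF d1[OF w] has_vector_derivative_mult[OF l d2[OF w]]])
  hence "((%w. Phi \<xi> w + cor (y - w) * hint \<psi> (uy \<xi>) w) has_vector_derivative
   cor (y - w) * hint \<psi> (uyy \<xi>) w) (at w)" by simp
  thus "((%w. Phi \<xi> w + cor (y - w) * hint \<psi> (uy \<xi>) w) has_vector_derivative
   cor (y - w) * hint \<psi> (uyy \<xi>) w) (at w within {y..1})" by (rule has_vector_derivative_at_within)
 qed
 hence I: "integral {y..1} (%w. cor (y - w) * hint \<psi> (uyy \<xi>) w)
  = Phi \<xi> 1 + cor (y - 1) * hint \<psi> (uy \<xi>) 1 - Phi \<xi> y" by (simp add: integral_unique)
 have S: "{y..1} <= {0<..}" using y by auto
 have iX: "(%w. cor (w - y) * Xi \<xi> w) integrable_on {y..1}"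
  by (intro integrable_continuous_interval continuous_intros Xi_cont S)
 have iG: "(%w. cor ((w - y) / w^2) * Gam \<xi> w) integrable_on {y..1}"
  using y by (intro integrable_continuous_interval continuous_intros Gam_cont S) auto
 have "integral {y..1} (%w. cor (y - w) * hint \<psi> (uyy \<xi>) w)
   = integral {y..1} (%w. cor (w - y) * Xi \<xi> w + cor (4 * pi^2 * \<xi>^2) * (cor ((w - y) / w^2) * Gam \<xi> w))"
 proof (rule integral_cong)
  fix w assume "w : {y..1}"
  hence w: "w > 0" using y by simp
  have e: "cor (4 * pi^2 * \<xi>^2 / w^2) * cor (y - w) = - (cor (4 * pi^2 * \<xi>^2) * cor ((w - y) / w^2))"
  proof -
   have "4 * pi^2 * \<xi>^2 / w^2 * (y - w) = - (4 * pi^2 * \<xi>^2 * ((w - y) / w^2))" using w by (simp add: field_simps)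
   thus ?thesis by (simp only: of_real_mult[symmetric] of_real_minus[symmetric])
  qed
  have "cor (y - w) * hint \<psi> (uyy \<xi>) w = cor (w - y) * Xi \<xi> w - cor (4 * pi^2 * \<xi>^2 / w^2) * cor (y - w) * Gam \<xi> w"
   unfolding Phi_dd[OF w] by (simp add: algebra_simps)
  thus "cor (y - w) * hint \<psi> (uyy \<xi>) w = cor (w - y) * Xi \<xi> w + cor (4 * pi^2 * \<xi>^2) * (cor ((w - y) / w^2) * Gam \<xi> w)"
   unfolding e by (simp add: mult.assoc)
 qed
 also have "... = integral {y..1} (%w. cor (w - y) * Xi \<xi> w) + cor (4 * pi^2 * \<xi>^2) * integral {y..1} (%w. cor ((w - y) / w^2) * Gam \<xi> w)"
  by (intro integral_unique has_integral_add has_integral_mult_right integrable_integral iX iG)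
 finally show ?thesis using I by (simp add: algebra_simps)
qed

definition c0 where "c0 = integral {a..b} \<psi>"

text \<open>The summands bound, in this order, the value at height 1, the first derivative there,
  the weight term \<open>Xi\<close>, and the part \<open>y / w\<^sup>2\<close> of the Taylor
  kernel.\<close>

definition K2 where "K2 = (b - a) * (2 * pi * (2 * C + B) + 2 * pi * B + Mp * (2 * pi * (2 * C + B)) + 4 * pi^2 * B^2)"

lemma K2_nonneg: "K2 >= 0"
 unfolding K2_def using X01 C0 B0 Mp0 by (intro mult_nonneg_nonneg add_nonneg_nonneg) auto

lemma hint_1: "hint p (%_. 1) y = cor (integral {a..b} p)" if "continuous_on {a..b} p"
proof -
 have "(p has_integral integral {a..b} p) {a..b}" using that by (intro integrable_integral integrable_continuous_interval)
 from has_integral_linear[OF this bounded_linear_of_real[where 'a=complex]]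
 show ?thesis by (simp add: o_def hint_def integral_unique)
qed

lemma hint_minus_1:
 assumes p: "continuous_on {a..b} p" and y: "y > 0"
 shows "hint p (u \<xi>) y - cor (integral {a..b} p) = hint p (%z. u \<xi> z - 1) y"
proof -
 have i1: "(%x. cor (p x) * u \<xi> (Cx x y)) integrable_on {a..b}"
  by (rule integrable_continuous_interval[OF hint_integrand_cont[OF p u_cont y]])
 have i2: "(%x. cor (p x) * 1) integrable_on {a..b}"
  by (rule integrable_continuous_interval[OF hint_integrand_cont[OF p _ y]]) (rule continuous_on_const)
 have "hint p (u \<xi>) y - hint p (%_. 1) y = hint p (%z. u \<xi> z - 1) y"
  unfolding hint_def integral_diff[OF i1 i2, symmetric] by (simp only: right_diff_distrib)
 thus ?thesis by (simp add: hint_1[OF p])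
qed

text \<open>\<open>u\<close> differs from 1 by at most \<open>\<xi> |F|\<close>, and
  \<open>F\<close> grows only logarithmically towards the real line.\<close>

lemma hint_u_near:
 assumes p: "continuous_on {a..b} p" and y: "0 < y" "y <= 1" and M: "!!x. abs (p x) <= M" and \<xi>: "\<xi> >= 0"
 shows "norm (hint p (u \<xi>) y - cor (integral {a..b} p)) <= M * (\<xi> * (2 * pi * (2 * C + B * (ln (1 / y) + 1)))) * (b - a)"
 unfolding hint_minus_1[OF p y(1)]
proof (rule hint_bound[OF p _ y(1)])
 show "continuous_on UHP (%z. u \<xi> z - 1)" by (intro continuous_intros u_cont)
 fix x
 have "norm (u \<xi> (Cx x y) - 1) <= abs (\<xi> * F (Cx x y))" unfolding u_def by (rule norm_cis_minus_1)
 also have "... <= \<xi> * (2 * pi * (2 * C + B * (ln (1 / y) + 1)))"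
  using F_bound[of "Cx x y"] y \<xi> by (simp add: abs_mult mult_left_mono)
 finally have n: "norm (u \<xi> (Cx x y) - 1) <= \<xi> * (2 * pi * (2 * C + B * (ln (1 / y) + 1)))" .
 have "M >= 0" using M[of 0] by linarith
 thus "norm (cor (p x) * (u \<xi> (Cx x y) - 1)) <= M * (\<xi> * (2 * pi * (2 * C + B * (ln (1 / y) + 1))))"
  unfolding norm_mult norm_of_real by (intro mult_mono M n) auto
qed

lemma Gam_bound: "y > 0 ==> norm (Gam \<xi> y) <= B^2 * (b - a)"
 unfolding Gam_def
proof (rule hint_bound[OF psi_c gmu_cont])
 fix x
 show "norm (cor (\<psi> x) * (cor (gm (Cx x y)) * u \<xi> (Cx x y))) <= B^2"
  using mult_mono[of "\<psi> x" 1 "gm (Cx x y)" "B^2"] psi01[of x] gm_bounds[of "Cx x y"]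
  by (simp add: norm_mult)
qed auto

text \<open>Every term of the Taylor formula except the integral with kernel \<open>1 / w\<close> is
  O(\<xi>), uniformly down to \<open>y = 0\<close>. What remains is a first-order equation in the
  variable \<open>ln y\<close>.\<close>

lemma Phi_approx:
 assumes y: "0 < y" "y <= 1" and \<xi>: "0 <= \<xi>" "\<xi> <= 1"
 shows "norm (Phi \<xi> y - (cor c0 - cor (4 * pi^2 * \<xi>^2) * integral {y..1} (%w. cor (1 / w) * Gam \<xi> w))) <= \<xi> * K2"
proof -
 have ab: "b - a >= 0" using X01 by simp
 have 1: "norm (Phi \<xi> 1 - cor c0) <= \<xi> * ((b - a) * (2 * pi * (2 * C + B)))"
  unfolding Phi_def c0_def using hint_u_near[OF psi_c, of 1 1 \<xi>] psi01 \<xi> by (simp add: abs_of_nonneg mult_ac)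
 have 2: "norm (hint \<psi> (uy \<xi>) 1) <= (\<xi> * (2 * pi * B)) * (b - a)"
 proof (rule hint_bound[OF psi_c uy_cont])
  fix x
  have "norm (f (Cx x 1)) <= B" using bloch[of "Cx x 1"] by (simp add: UHP_def)
  hence "abs (Im (f (Cx x 1))) <= B" using abs_Im_le_cmod order_trans by blast
  hence "abs (Fy (Cx x 1)) <= 2 * pi * B" by (simp add: Fy_def abs_mult)
  hence "norm (uy \<xi> (Cx x 1)) <= \<xi> * (2 * pi * B)" using \<xi> by (simp add: uy_def norm_mult abs_mult mult_left_mono)
  thus "norm (cor (\<psi> x) * uy \<xi> (Cx x 1)) <= \<xi> * (2 * pi * B)"
   unfolding norm_mult norm_of_real using psi01[of x] mult_mono[of "abs (\<psi> x)" 1 "norm (uy \<xi> (Cx x 1))" "\<xi> * (2 * pi * B)"] by simp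
 qed auto
 have S: "{y..1} <= {0<..}" using y by auto
 \<comment> \<open>A second derivative of a compactly supported weight has integral 0, so
   \<open>Xi\<close> is compared with 0 and inherits the factor \<open>\<xi>\<close>.\<close>
 have psi2_int: "integral {a..b} \<psi>2 = 0"
 proof -
  have "(\<psi>2 has_integral \<psi>1 b - \<psi>1 a) {a..b}"
   using X01 psi2 by (intro fundamental_theorem_of_calculus)
    (auto simp flip: has_real_derivative_iff_has_vector_derivative intro: has_field_derivative_at_within)
  moreover have "\<psi>1 b = 0" "\<psi>1 a = 0" using supp(2)[of a] supp(2)[of b] by auto
  ultimately show ?thesis by (simp add: integral_unique)
 qed
 have 3: "norm (integral {y..1} (%w. cor (w - y) * Xi \<xi> w)) <= (\<xi> * ((b - a) * (Mp * (2 * pi * (2 * C + B))))) * (1 - y)"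
 proof (rule integral_bound[OF y(2)])
  show "continuous_on {y..1} (%w. cor (w - y) * Xi \<xi> w)" by (intro continuous_intros Xi_cont S)
  show "norm (cor (w - y) * Xi \<xi> w) <= \<xi> * ((b - a) * (Mp * (2 * pi * (2 * C + B))))" if "w : {y..1}" for w
  proof -
   have w: "0 < w" "w <= 1" "y <= w" using that y by auto
   have X: "norm (Xi \<xi> w) <= Mp * (\<xi> * (2 * pi * (2 * C + B * (ln (1 / w) + 1)))) * (b - a)"
    using hint_u_near[OF psi2_c w(1,2) psi2b \<xi>(1)] by (simp add: Xi_def psi2_int)
   \<comment> \<open>The Taylor factor \<open>w - y <= w\<close> tames the logarithm of
     \<open>hint_u_near\<close>, since \<open>w (ln (1/w) + 1) <= 1\<close>.\<close>
   have "ln (1 / w) <= 1 / w - 1" using ln_le_minus_one[of "1/w"] w by simp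
   hence "w * (ln (1 / w) + 1) <= w * (1 / w)" using w by (intro mult_left_mono) auto
   hence l: "w * (ln (1 / w) + 1) <= 1" using w by simp
   have "norm (cor (w - y) * Xi \<xi> w) <= w * (Mp * (\<xi> * (2 * pi * (2 * C + B * (ln (1 / w) + 1)))) * (b - a))"
    unfolding norm_mult norm_of_real using w y X by (intro mult_mono) auto
   also have "... = \<xi> * ((b - a) * (Mp * (2 * pi * (2 * C * w + B * (w * (ln (1 / w) + 1))))))" by (simp add: algebra_simps)
   also have "... <= \<xi> * ((b - a) * (Mp * (2 * pi * (2 * C * 1 + B * 1))))"
    using l w C0 B0 Mp0 \<xi> ab by (intro mult_left_mono add_mono) auto
   finally show ?thesis by simp
  qed
 qed
 have "(\<xi> * ((b - a) * (Mp * (2 * pi * (2 * C + B))))) * (1 - y) <= (\<xi> * ((b - a) * (Mp * (2 * pi * (2 * C + B))))) * 1"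
  using y \<xi> ab Mp0 C0 B0 by (intro mult_left_mono) auto
 hence 3: "norm (integral {y..1} (%w. cor (w - y) * Xi \<xi> w)) <= \<xi> * ((b - a) * (Mp * (2 * pi * (2 * C + B))))" using 3 by linarith
 let ?I1 = "integral {y..1} (%w. cor (1 / w) * Gam \<xi> w)"
 let ?I2 = "integral {y..1} (%w. cor (y / w^2) * Gam \<xi> w)"
 have i1: "(%w. cor (1 / w) * Gam \<xi> w) integrable_on {y..1}" "(%w. cor (y / w^2) * Gam \<xi> w) integrable_on {y..1}"
  using y by (intro integrable_continuous_interval continuous_intros Gam_cont S; force)+
 \<comment> \<open>The kernel is \<open>1/w - y/w\<^sup>2\<close>; the second part has total mass at
   most 1 on \<open>[y, 1]\<close> and is therefore an error term of size \<xi>^2.\<close>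
 have split: "integral {y..1} (%w. cor ((w - y) / w^2) * Gam \<xi> w) = ?I1 - ?I2"
 proof -
  have "integral {y..1} (%w. cor ((w - y) / w^2) * Gam \<xi> w) = integral {y..1} (%w. cor (1 / w) * Gam \<xi> w - cor (y / w^2) * Gam \<xi> w)"
  proof (rule integral_cong)
   fix w assume "w : {y..1}"
   hence "w > 0" using y by simp
   hence "(w - y) / w^2 = 1 / w - y / w^2" by (simp add: diff_divide_distrib power2_eq_square)
   thus "cor ((w - y) / w^2) * Gam \<xi> w = cor (1 / w) * Gam \<xi> w - cor (y / w^2) * Gam \<xi> w"
    by (simp only: of_real_diff left_diff_distrib)
  qed
  also have "... = ?I1 - ?I2" by (rule integral_diff[OF i1])
  finally show ?thesis .
 qed
 have 4: "norm ?I2 <= B^2 * (b - a)"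
 proof -
  have hi: "((%w. (B^2 * (b - a)) * (y / w^2)) has_integral (B^2 * (b - a)) * ((- y / 1) - (- y / y))) {y..1}"
  proof (intro has_integral_mult_right fundamental_theorem_of_calculus[OF y(2)])
   fix w assume "w : {y..1}"
   hence "w > 0" using y by simp
   hence "((%w. - y / w) has_real_derivative y / w^2) (at w)"
    by (auto intro!: derivative_eq_intros simp: power2_eq_square)
   thus "((%w. - y / w) has_vector_derivative y / w^2) (at w within {y..1})"
    by (simp add: has_real_derivative_iff_has_vector_derivative has_vector_derivative_at_within)
  qed
  have "norm ?I2 <= integral {y..1} (%w. (B^2 * (b - a)) * (y / w^2))"
  proof (rule integral_norm_bound_integral[OF i1(2)])
   show "(%w. (B^2 * (b - a)) * (y / w^2)) integrable_on {y..1}" using hi by blast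
   fix w assume "w : {y..1}"
   hence w: "w > 0" using y by simp
   have "(y / w^2) * norm (Gam \<xi> w) <= (y / w^2) * (B^2 * (b - a))" using Gam_bound[OF w] y by (intro mult_left_mono) auto
   thus "norm (cor (y / w^2) * Gam \<xi> w) <= (B^2 * (b - a)) * (y / w^2)"
    using y by (simp add: norm_mult norm_divide norm_power mult.commute)
  qed
  also have "... = (B^2 * (b - a)) * ((- y / 1) - (- y / y))" using hi by (rule integral_unique)
  also have "... <= (B^2 * (b - a)) * 1" using y ab by (intro mult_left_mono) auto
  finally show ?thesis by simp
 qed
 have t2: "\<xi>^2 <= \<xi>" using \<xi> by (simp add: power2_eq_square mult_left_le)
 have tri: "norm (w1 - w2 - w3 + w4) <= norm w1 + norm w2 + norm w3 + norm w4" for w1 w2 w3 w4 :: complex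
  using norm_triangle_ineq[of "w1 - w2 - w3" w4] norm_triangle_ineq4[of "w1 - w2" w3] norm_triangle_ineq4[of w1 w2] by linarith
 have e: "Phi \<xi> y - (cor c0 - cor (4 * pi^2 * \<xi>^2) * ?I1)
  = (Phi \<xi> 1 - cor c0) - cor (1 - y) * hint \<psi> (uy \<xi>) 1
   - integral {y..1} (%w. cor (w - y) * Xi \<xi> w) + cor (4 * pi^2 * \<xi>^2) * ?I2"
  unfolding Phi_taylor[OF y, of \<xi>] split by (simp add: algebra_simps)
 have n2: "norm (cor (1 - y) * hint \<psi> (uy \<xi>) 1) <= 1 * ((\<xi> * (2 * pi * B)) * (b - a))"
  unfolding norm_mult norm_of_real using y 2 by (intro mult_mono) auto
 have n4: "norm (cor (4 * pi^2 * \<xi>^2) * ?I2) <= (4 * pi^2 * \<xi>) * (B^2 * (b - a))"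
  unfolding norm_mult norm_of_real using 4 t2 \<xi> by (intro mult_mono) auto
 have "norm (Phi \<xi> y - (cor c0 - cor (4 * pi^2 * \<xi>^2) * ?I1))
  <= \<xi> * ((b - a) * (2 * pi * (2 * C + B))) + 1 * ((\<xi> * (2 * pi * B)) * (b - a)) + \<xi> * ((b - a) * (Mp * (2 * pi * (2 * C + B)))) + (4 * pi^2 * \<xi>) * (B^2 * (b - a))"
  unfolding e by (rule order_trans[OF tri]) (intro add_mono 1 n2 3 n4)
 also have "... = \<xi> * K2" by (simp add: K2_def algebra_simps)
 finally show ?thesis .
qed

end

section \<open>From integrals over the half plane to horocycle averages\<close>

lemma LINT_complex:
 fixes k :: "complex => real"
 assumes int: "integrable lb k"
 shows "(LINT z|lb. k z) = (LBINT y. LBINT x. k (Cx x y))"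
proof -
 have [measurable]: "k : BM" using borel_measurable_integrable[OF int] by simp
 have meas [measurable]: "(%(x,y). Cx x y) : measurable (lb \<Otimes>\<^sub>M lb) borel"
  unfolding Complex_eq by measurable
 have d: "integrable (distr (lb \<Otimes>\<^sub>M lb) borel (%(x,y). Cx x y)) k" using int by (simp add: lborel_complex)
 have "(LINT z|lb. k z) = integral\<^sup>L (distr (lb \<Otimes>\<^sub>M lb) borel (%(x,y). Cx x y)) k"
  by (simp add: lborel_complex)
 also have "... = (LINT p|(lb \<Otimes>\<^sub>M lb). k (case p of (x,y) => Cx x y))"
  by (rule integral_distr[OF meas]) measurable
 also have "... = (LINT p|(lb \<Otimes>\<^sub>M lb). (case p of (x,y) => k (Cx x y)))"
  by (intro Bochner_Integration.integral_cong) auto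
 also have "... = (LBINT y. LBINT x. k (Cx x y))"
 proof (rule lborel_pair.integral_snd[symmetric])
  have "integrable (lb \<Otimes>\<^sub>M lb) (%p. k (case p of (x,y) => Cx x y))"
   using d by (subst (asm) integrable_distr_eq) auto
  thus "integrable (lb \<Otimes>\<^sub>M lb) (%(x,y). k (Cx x y))" by (simp add: case_prod_unfold)
 qed
 finally show ?thesis .
qed

lemma LBINT_Icc:
 fixes k :: "real => real"
 assumes "continuous_on {s..t} k"
 shows "(LBINT x. ind {s..t} x * k x) = integral {s..t} k"
proof -
 have "set_integrable lb {s..t} k" by (rule borel_integrable_atLeastAtMost'[OF assms])
 from set_borel_integral_eq_integral(2)[OF this] show ?thesis by (simp add: set_lebesgue_integral_def)
qed

context cbump
begin

text \<open>Translates the conclusion of \<open>decorrelation\<close> into the form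
  \<open>dw / w\<close> in which horocycle averages enter the equation; one factor
  \<open>Im z\<close> cancels against the hyperbolic density.\<close>

lemma strip_integral_eq:
 fixes k :: "complex => real"
 assumes km [measurable]: "k : BM" and kc: "continuous_on UHP k"
  and ks: "!!z. Re z \<notin> {X0..X1} ==> k z = 0" and kb: "!!z. abs (k z) <= M" and y: "0 < y1" "y1 <= 1"
 shows "(LINT z|hyp. ind {y1..1} (Im z) * Im z * k z) = integral {y1..1} (%w. 1 / w * integral {a..b} (%x. k (Cx x w)))"
proof -
 define K where "K = (%z. ind {y1..1} (Im z) * (k z / Im z))"
 have [measurable]: "K : BM" unfolding K_def by measurable
 have M: "M >= 0" using kb[of 0] by linarith
 have "(LINT z|hyp. ind {y1..1} (Im z) * Im z * k z) = (LINT z|lb. ind UHP z / (Im z)^2 * (ind {y1..1} (Im z) * Im z * k z))"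
  by (rule hyp_LINT) measurable
 also have "... = (LINT z|lb. K z)"
  using y by (intro Bochner_Integration.integral_cong) (auto simp: K_def indicator_def UHP_def power2_eq_square)
 also have "... = (LBINT y. LBINT x. K (Cx x y))"
 proof (rule LINT_complex, rule integrableI_bounded_set[where A="cbox (Cx X0 y1) (Cx X1 1)" and B="M / y1"])
  show "emeasure lb (cbox (Cx X0 y1) (Cx X1 1)) < \<infinity>" by (rule emeasure_compact_finite) simp
  have "norm (K z) <= M / y1" for z
  proof (cases "Im z : {y1..1}")
   case True
   hence "abs (k z) / Im z <= M / y1" using kb[of z] y M by (intro frac_le) auto
   thus ?thesis using True y by (simp add: K_def)
  qed (use M y in \<open>simp add: K_def\<close>)
  thus "AE z in lb. z : cbox (Cx X0 y1) (Cx X1 1) --> norm (K z) <= M / y1" by simp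
  have "K z = 0" if "z \<notin> cbox (Cx X0 y1) (Cx X1 1)" for z
   using that ks[of z] by (auto simp: K_def in_cbox_complex_iff indicator_def)
  thus "AE z in lb. z \<notin> cbox (Cx X0 y1) (Cx X1 1) --> K z = 0" by simp
 qed auto
 also have "... = (LBINT w. ind {y1..1} w * (1 / w * integral {a..b} (%x. k (Cx x w))))"
 proof (rule Bochner_Integration.integral_cong[OF refl])
  fix w
  show "(LBINT x. K (Cx x w)) = ind {y1..1} w * (1 / w * integral {a..b} (%x. k (Cx x w)))"
  proof (cases "w : {y1..1}")
   case True
   hence w: "w > 0" using y by simp
   have "(LBINT x. K (Cx x w)) = (LBINT x. 1 / w * (ind {a..b} x * k (Cx x w)))"
   proof (rule Bochner_Integration.integral_cong[OF refl])
    fix x show "K (Cx x w) = 1 / w * (ind {a..b} x * k (Cx x w))"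
     using True ks[of "Cx x w"] by (cases "x : {X0..X1}") (auto simp: K_def)
   qed
   also have "... = 1 / w * (LBINT x. ind {a..b} x * k (Cx x w))" by simp
   also have "(LBINT x. ind {a..b} x * k (Cx x w)) = integral {a..b} (%x. k (Cx x w))"
   proof (rule LBINT_Icc, rule continuous_on_compose2[OF kc])
    show "continuous_on {a..b} (%x. Cx x w)" unfolding Complex_eq by (intro continuous_intros)
   qed (use w in \<open>auto simp: UHP_def\<close>)
   finally show ?thesis using True by simp
  qed (simp add: K_def)
 qed
 also have "... = integral {y1..1} (%w. 1 / w * integral {a..b} (%x. k (Cx x w)))"
 proof (rule LBINT_Icc)
  have "continuous_on ({0<..} \<times> cbox a b) (%(w, x). k (Cx x w))"
   using continuous_on_Complex_swap[OF kc, of "cbox a b"] by (simp add: case_prod_unfold)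
  from integral_continuous_on_param[OF this]
  have "continuous_on {0<..} (%w. integral {a..b} (%x. k (Cx x w)))" by simp
  hence "continuous_on {y1..1} (%w. integral {a..b} (%x. k (Cx x w)))"
   by (rule continuous_on_subset) (use y in auto)
  thus "continuous_on {y1..1} (%w. 1 / w * integral {a..b} (%x. k (Cx x w)))"
   using y by (intro continuous_intros) auto
 qed
 finally show ?thesis .
qed

definition V where "V = petersson_sq D f / hyp_vol D"
definition hh where "hh z = gm z - V"

lemma V_nonneg: "V >= 0"
proof -
 have "hyp_vol D >= 0" by (simp add: hyp_vol_measure)
 thus ?thesis using gm_nonneg_D by (simp add: V_def)
qed

lemma hh_measurable [measurable]: "hh : BM"
 unfolding hh_def[abs_def] by measurable

lemma hh_bound: "abs (hh z) <= B^2 + V"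
 using gm_bounds[of z] V_nonneg by (simp add: hh_def abs_le_iff)

lemma hh_inv: "Ginv q hh"
 using gm_inv by (simp add: Ginv_def hh_def)

lemma hh_mean:
 assumes "hyp_vol D > 0"
 shows "(LINT z|hyp. ind D z * hh z) = 0"
proof -
 have i1: "integrable hyp (%z. ind D z * gm z)" by (rule integrable_D[of _ "B^2"]) (use gm_bounds in auto)
 have i2: "integrable hyp (%z. ind D z * V)" by (rule integrable_D[of _ "abs V"]) auto
 have "(LINT z|hyp. ind D z * hh z) = (LINT z|hyp. ind D z * gm z - ind D z * V)"
  by (intro Bochner_Integration.integral_cong) (auto simp: hh_def algebra_simps)
 also have "... = petersson_sq D f - V * hyp_vol D"
  using i1 i2 by (simp add: petersson_gm hyp_vol_measure)
 also have "... = 0" using assms by (simp add: V_def)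
 finally show ?thesis .
qed

text \<open>Decorrelation wants weights in \<open>[0,1]\<close>, hence the affine change of
  \<open>t\<close>, which will be \<open>cos\<close> or \<open>sin\<close>, to
  \<open>(1 + t) / 2\<close>. The constant function 1 in place of \<open>t\<close> gives the bare
  weight \<open>\<psi>\<close>.\<close>

definition vv :: "(real => real) => real => complex => real" where
 "vv t \<xi> z = ind UHP z * (\<psi> (Re z) * ((1 + t (\<xi> * F z)) / 2))"

definition Kslow where "Kslow \<rho> = Lp * (2 + abs \<rho>) + 2 * pi * B * (2 + abs \<rho>)^2"

lemma Kslow_nonneg: "Kslow \<rho> >= 0"
 unfolding Kslow_def using Lp0 B0 by (intro add_nonneg_nonneg mult_nonneg_nonneg) auto

text \<open>The product rule for differences: the cut-off contributes O(\<open>Im z\<close>) by its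
  Lipschitz constant, the phase O(\<open>\<xi>\<close>) because \<open>F\<close> varies boundedly on
  hyperbolic balls.\<close>

lemma vv_props:
 assumes t: "!!x. abs (t x) <= 1" "!!x y. abs (t x - t y) <= abs (x - y)" "continuous_on UNIV t" and \<xi>: "\<xi> >= 0"
 shows "vv t \<xi> : BM" "ALL z. 0 <= vv t \<xi> z & vv t \<xi> z <= 1"
  "ALL z. Re z \<notin> {X0..X1} --> vv t \<xi> z = 0" "slow Kslow \<xi> (vv t \<xi>)" "continuous_on UHP (vv t \<xi>)"
proof -
 have c: "continuous_on UHP (%z. \<psi> (Re z) * ((1 + t (\<xi> * F z)) / 2))"
 proof (intro continuous_intros)
  show "continuous_on UHP (%z. \<psi> (Re z))" by (rule continuous_on_compose2[OF psi_c[of UNIV]]) (auto intro!: continuous_intros)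
  show "continuous_on UHP (%z. t (\<xi> * F z))" by (rule continuous_on_compose2[OF t(3)]) (auto intro!: continuous_intros F_cont)
 qed auto
 have "(%z. ind UHP z *\<^sub>R (\<psi> (Re z) * ((1 + t (\<xi> * F z)) / 2))) : BM"
  by (intro borel_measurable_continuous_on_indicator c) auto
 thus "vv t \<xi> : BM" by (simp add: vv_def[abs_def])
 show "continuous_on UHP (vv t \<xi>)" by (rule continuous_on_eq[OF c]) (simp add: vv_def)
 have t01: "0 <= (1 + t x) / 2 & (1 + t x) / 2 <= 1" for x using t(1)[of x] by (auto simp: abs_le_iff)
 show "ALL z. 0 <= vv t \<xi> z & vv t \<xi> z <= 1"
 proof
  fix z
  have "\<psi> (Re z) * ((1 + t (\<xi> * F z)) / 2) <= 1 * 1" using psi01[of "Re z"] t01[of "\<xi> * F z"] by (intro mult_mono) auto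
  moreover have "0 <= \<psi> (Re z) * ((1 + t (\<xi> * F z)) / 2)" using psi01[of "Re z"] t01[of "\<xi> * F z"] by (intro mult_nonneg_nonneg) auto
  ultimately show "0 <= vv t \<xi> z & vv t \<xi> z <= 1" by (auto simp: vv_def indicator_def)
 qed
 show "ALL z. Re z \<notin> {X0..X1} --> vv t \<xi> z = 0" using supp(1) by (simp add: vv_def)
 show "slow Kslow \<xi> (vv t \<xi>)" unfolding slow_def
 proof (intro allI impI ballI)
  fix \<rho> :: real and z w assume \<rho>: "\<rho> > 0" and z: "z : UHP" and w: "w : UHP" and n: "hnear \<rho> z w"
  have yz: "Im z > 0" using z by (simp add: UHP_def)
  let ?T = "%z. (1 + t (\<xi> * F z)) / 2"
  have half: "A1 <= R1 ==> D1 = A1 / 2 ==> 0 <= A1 ==> D1 <= R1" for A1 D1 R1 :: real by simp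
  have "abs (t (\<xi> * F z) - t (\<xi> * F w)) <= abs (\<xi> * F z - \<xi> * F w)" by (rule t(2))
  also have "... = \<xi> * abs (F z - F w)" using \<xi> by (simp add: abs_mult flip: right_diff_distrib)
  also have "... <= \<xi> * (2 * pi * B * (2 + \<rho>)^2)" using F_hnear[OF z w \<rho> n] \<xi> by (rule mult_left_mono)
  finally have "abs (t (\<xi> * F z) - t (\<xi> * F w)) <= \<xi> * (2 * pi * B * (2 + \<rho>)^2)" .
  moreover have "abs (?T z - ?T w) = abs (t (\<xi> * F z) - t (\<xi> * F w)) / 2" by (simp add: field_simps flip: diff_divide_distrib)
  moreover have "0 <= abs (t (\<xi> * F z) - t (\<xi> * F w))" by simp
  ultimately have d2: "abs (?T z - ?T w) <= \<xi> * (2 * pi * B * (2 + \<rho>)^2)" by (rule half)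
  have "abs (\<psi> (Re z) - \<psi> (Re w)) <= Lp * abs (Re z - Re w)" by (rule psi_lip)
  also have "... <= Lp * ((2 + \<rho>) * Im z)" using hnear_bounds(3)[OF n z w \<rho>] Lp0 by (rule mult_left_mono)
  finally have d1: "abs (\<psi> (Re z) - \<psi> (Re w)) <= Lp * ((2 + \<rho>) * Im z)" .
  have "vv t \<xi> z - vv t \<xi> w = (\<psi> (Re z) - \<psi> (Re w)) * ?T z + \<psi> (Re w) * (?T z - ?T w)"
  proof -
   have gen: "x * s - x' * s' = (x - x') * s + x' * (s - s')" for x s x' s' :: real by (simp add: algebra_simps)
   have "vv t \<xi> z = \<psi> (Re z) * ?T z" "vv t \<xi> w = \<psi> (Re w) * ?T w" using z w by (simp_all add: vv_def)
   thus ?thesis by (simp only: gen)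
  qed
  hence "abs (vv t \<xi> z - vv t \<xi> w) <= abs (\<psi> (Re z) - \<psi> (Re w)) * abs (?T z) + abs (\<psi> (Re w)) * abs (?T z - ?T w)"
   by (simp only: abs_mult[symmetric] abs_triangle_ineq)
  also have "... <= (Lp * ((2 + \<rho>) * Im z)) * 1 + 1 * (\<xi> * (2 * pi * B * (2 + \<rho>)^2))"
   using t01[of "\<xi> * F z"] psi01[of "Re w"] d1 d2 Lp0 \<rho> yz by (intro add_mono mult_mono) auto
  also have "... <= Kslow \<rho> * (Im z + \<xi>)"
  proof -
   have "Lp * (2 + \<rho>) * \<xi> >= 0" "2 * pi * B * (2 + \<rho>)^2 * Im z >= 0" using Lp0 \<rho> \<xi> B0 yz by auto
   thus ?thesis using \<rho> by (simp add: Kslow_def algebra_simps)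
  qed
  finally show "abs (vv t \<xi> z - vv t \<xi> w) <= Kslow \<rho> * (Im z + \<xi>)" .
 qed
qed

lemma trig_lip: "abs (cos x - cos y) <= abs (x - y)" "abs (sin x - sin y) <= abs (x - (y::real))"
proof -
 have "abs (cos x - cos y) <= 1 * norm (x - y)"
  using field_differentiable_bound[where S=UNIV and f=cos and f'="%x::real. - sin x" and B=1 and x=x and y=y] by (auto intro: DERIV_cos)
 thus "abs (cos x - cos y) <= abs (x - y)" by simp
 have "abs (sin x - sin y) <= 1 * norm (x - y)"
  using field_differentiable_bound[where S=UNIV and f=sin and f'="%x::real. cos x" and B=1 and x=x and y=y] by (auto intro: DERIV_sin)
 thus "abs (sin x - sin y) <= abs (x - y)" by simp
qed

definition Ebound where
 "Ebound \<epsilon> K \<xi> y = \<epsilon> * (1 + ln (1 / y)) + K * sqrt ((1 + ln (1 / y)) * (1 + \<xi> * ln (1 / y)))"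

text \<open>Real and imaginary part are treated separately. Each is twice one admissible weight
  minus another, which costs 3 error bounds, hence 6 in all.\<close>

lemma slow_decorrelation:
 assumes vol: "hyp_vol D > 0" and \<epsilon>: "\<epsilon> > 0"
 shows "EX K>=0. ALL \<xi> y. 0 <= \<xi> --> \<xi> <= 1 --> 0 < y --> y <= 1 -->
  norm (integral {y..1} (%w. cor (1 / w) * (Gam \<xi> w - cor V * Phi \<xi> w))) <= 6 * Ebound \<epsilon> K \<xi> y"
proof -
 let ?g = "%\<xi> w. (Gam \<xi> w - cor V * Phi \<xi> w)"
 note dec = decorrelation[where K=Kslow, OF hh_measurable hh_bound hh_inv hh_mean[OF vol] X01 Kslow_nonneg \<epsilon>]
 from dec obtain K where K0: "K >= 0" and K': "ALL \<xi> y1 v. 0 <= \<xi> --> \<xi> <= 1 --> 0 < y1 --> y1 <= 1 --> v : BM -->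
  (ALL z. 0 <= v z & v z <= 1) --> (ALL z. Re z \<notin> {X0..X1} --> v z = 0) --> slow Kslow \<xi> v -->
  abs (LINT z|hyp. cutp y1 v z * hh z) <= \<epsilon> * (1 + ln (1 / y1)) + K * sqrt ((1 + ln (1 / y1)) * (1 + \<xi> * ln (1 / y1)))" by (elim exE conjE)
 have K: "abs (LINT z|hyp. cutp y1 v z * hh z) <= Ebound \<epsilon> K \<xi> y1"
  if "0 <= \<xi>" "\<xi> <= 1" "0 < y1" "y1 <= 1" "v : BM"
  "ALL z. 0 <= v z & v z <= 1" "ALL z. Re z \<notin> {X0..X1} --> v z = 0" "slow Kslow \<xi> v" for \<xi> y1 v
  unfolding Ebound_def using K' that by blast
 show ?thesis
 proof (intro exI[of _ K] conjI K0 allI impI)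
  fix \<xi> y :: real assume \<xi>: "0 <= \<xi>" "\<xi> <= 1" and y: "0 < y" "y <= 1"
  have part: "abs (integral {y..1} (%w. 1 / w * integral {a..b} (%x. \<psi> x * (t (\<xi> * F (Cx x w)) * hh (Cx x w))))) <= 3 * Ebound \<epsilon> K \<xi> y"
   if t: "!!x. abs (t x) <= 1" "!!x y. abs (t x - t y) <= abs (x - y)" "continuous_on UNIV t" for t
  proof -
   note p1 = vv_props[of t \<xi>, OF t \<xi>(1)]
   have one: "abs ((%_. 1::real) x) <= 1" "abs ((%_. 1::real) x - (%_. 1::real) y) <= abs (x - y)" "continuous_on UNIV (%_. 1::real)" for x y :: real by auto
   note p0 = vv_props[of "%_. 1" \<xi>, OF one \<xi>(1)]
   define k where "k = (%z. ind UHP z * (\<psi> (Re z) * (t (\<xi> * F z) * hh z)))"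
   \<comment> \<open>Undoes the affine normalisation: \<open>t\<close> equals
     \<open>2 * ((1 + t) / 2) - 1\<close>.\<close>
   have kv: "k z = 2 * (vv t \<xi> z * hh z) - vv (%_. 1) \<xi> z * hh z" for z
    by (simp add: k_def vv_def algebra_simps)
   note [measurable] = p1(1) p0(1)
   have km: "k : BM" unfolding kv[abs_def] by measurable
   have hc: "continuous_on UHP hh" unfolding hh_def[abs_def] by (intro continuous_intros gm_cont)
   have kc: "continuous_on UHP k" unfolding kv[abs_def] by (intro continuous_intros p1(5) p0(5) hc)
   have ks: "k z = 0" if "Re z \<notin> {X0..X1}" for z using supp(1)[OF that] by (simp add: k_def)
   have kb: "abs (k z) <= B^2 + V" for z
   proof (cases "z : UHP")
    case True
    have "abs (\<psi> (Re z)) * (abs (t (\<xi> * F z)) * abs (hh z)) <= 1 * (1 * (B^2 + V))"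
     using psi01[of "Re z"] t(1)[of "\<xi> * F z"] hh_bound[of z] V_nonneg by (intro mult_mono) auto
    thus ?thesis using True by (simp add: k_def abs_mult)
   qed (use V_nonneg in \<open>simp add: k_def\<close>)
   have int: "integrable hyp (%z. cutp y v z * hh z)" if "v : BM" "ALL z. 0 <= v z & v z <= 1" "ALL z. Re z \<notin> {X0..X1} --> v z = 0" for v
   proof (rule unfolding_real(2)[OF _ _ hh_measurable hh_bound hh_inv])
    show "cutp y v : BM" using that(1) by measurable
    show "cutp y v z >= 0" for z using that(2) y by (auto simp: cutp_def indicator_def)
    show "Gsum q (%z. en (cutp y v z)) z <= en (30 * (X1 - X0 + 1) * (1 + ln (1 / y)))" if "z : UHP" for z
     by (rule Gsum_cutp_bound[OF _ _ _ y X01 that]) (use \<open>ALL z. 0 <= v z & v z <= 1\<close> \<open>ALL z. Re z \<notin> {X0..X1} --> v z = 0\<close> in auto)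
   qed
   note i1 = int[OF p1(1-3)] and i0 = int[OF p0(1-3)]
   have "integral {y..1} (%w. 1 / w * integral {a..b} (%x. k (Cx x w))) = (LINT z|hyp. ind {y..1} (Im z) * Im z * k z)"
    by (rule strip_integral_eq[OF km kc ks kb y, symmetric])
   also have "... = (LINT z|hyp. 2 * (cutp y (vv t \<xi>) z * hh z) - cutp y (vv (%_. 1) \<xi>) z * hh z)"
    by (intro Bochner_Integration.integral_cong) (auto simp: kv cutp_def algebra_simps)
   also have "... = 2 * (LINT z|hyp. cutp y (vv t \<xi>) z * hh z) - (LINT z|hyp. cutp y (vv (%_. 1) \<xi>) z * hh z)"
    using i1 i0 by simp
   finally have "abs (integral {y..1} (%w. 1 / w * integral {a..b} (%x. k (Cx x w)))) <= 3 * Ebound \<epsilon> K \<xi> y"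
    using K[OF \<xi> y p1(1-4)] K[OF \<xi> y p0(1-4)] by linarith
   moreover have "integral {y..1} (%w. 1 / w * integral {a..b} (%x. k (Cx x w)))
    = integral {y..1} (%w. 1 / w * integral {a..b} (%x. \<psi> x * (t (\<xi> * F (Cx x w)) * hh (Cx x w))))"
    using y by (intro integral_cong arg_cong2[where f="(*)"] refl) (auto simp: k_def UHP_def)
   ultimately show ?thesis by simp
  qed
  let ?c = "%w. integral {a..b} (%x. \<psi> x * (cos (\<xi> * F (Cx x w)) * hh (Cx x w)))"
  let ?s = "%w. integral {a..b} (%x. \<psi> x * (sin (\<xi> * F (Cx x w)) * hh (Cx x w)))"
  have S: "{y..1} <= {0<..}" using y by auto
  have e: "Gam \<xi> w - cor V * Phi \<xi> w = Cx (?c w) (?s w)" if w: "w > 0" for w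
  proof -
   have i1: "(%x. cor (\<psi> x) * (cor (gm (Cx x w)) * u \<xi> (Cx x w))) integrable_on {a..b}"
    by (rule integrable_continuous_interval[OF hint_integrand_cont[OF psi_c gmu_cont w]])
   have i2: "(%x. cor (\<psi> x) * u \<xi> (Cx x w)) integrable_on {a..b}"
    by (rule integrable_continuous_interval[OF hint_integrand_cont[OF psi_c u_cont w]])
   let ?k = "%x. cor (\<psi> x) * (cor (gm (Cx x w)) * u \<xi> (Cx x w)) - cor V * (cor (\<psi> x) * u \<xi> (Cx x w))"
   have hi: "(?k has_integral (?g \<xi> w)) {a..b}"
    unfolding Gam_def Phi_def hint_def by (intro has_integral_diff has_integral_mult_right integrable_integral i1 i2)
   have "Re (?k x) = \<psi> x * (cos (\<xi> * F (Cx x w)) * hh (Cx x w))" "Im (?k x) = \<psi> x * (sin (\<xi> * F (Cx x w)) * hh (Cx x w))" for x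
    by (simp_all add: u_def hh_def algebra_simps)
   hence "((%x. \<psi> x * (cos (\<xi> * F (Cx x w)) * hh (Cx x w))) has_integral Re (?g \<xi> w)) {a..b}"
    "((%x. \<psi> x * (sin (\<xi> * F (Cx x w)) * hh (Cx x w))) has_integral Im (?g \<xi> w)) {a..b}"
    using has_integral_linear[OF hi bounded_linear_Re] has_integral_linear[OF hi bounded_linear_Im] by (simp_all only: o_def)
   thus ?thesis by (simp add: complex_eq_iff integral_unique)
  qed
  have iI: "(%w. cor (1 / w) * (?g \<xi> w)) integrable_on {y..1}"
   using y by (intro integrable_continuous_interval continuous_intros Gam_cont Phi_cont S) auto
  let ?I = "integral {y..1} (%w. cor (1 / w) * (?g \<xi> w))"
  have "Re ?I = integral {y..1} (%w. 1 / w * ?c w)"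
  proof -
   have "((%w. Re (cor (1 / w) * (?g \<xi> w))) has_integral Re ?I) {y..1}"
    using has_integral_linear[OF integrable_integral[OF iI] bounded_linear_Re] by (simp only: o_def)
   hence "((%w. 1 / w * ?c w) has_integral Re ?I) {y..1}"
    by (rule has_integral_eq[rotated]) (use y e in auto)
   thus ?thesis by (rule integral_unique[symmetric])
  qed
  moreover have "Im ?I = integral {y..1} (%w. 1 / w * ?s w)"
  proof -
   have "((%w. Im (cor (1 / w) * (?g \<xi> w))) has_integral Im ?I) {y..1}"
    using has_integral_linear[OF integrable_integral[OF iI] bounded_linear_Im] by (simp only: o_def)
   hence "((%w. 1 / w * ?s w) has_integral Im ?I) {y..1}"
    by (rule has_integral_eq[rotated]) (use y e in auto)
   thus ?thesis by (rule integral_unique[symmetric])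
  qed
  moreover have "norm ?I <= abs (Re ?I) + abs (Im ?I)" by (rule cmod_le)
  moreover have "abs (integral {y..1} (%w. 1 / w * ?c w)) <= 3 * Ebound \<epsilon> K \<xi> y"
   by (rule part[of cos]) (auto intro: trig_lip continuous_intros)
  moreover have "abs (integral {y..1} (%w. 1 / w * ?s w)) <= 3 * Ebound \<epsilon> K \<xi> y"
   by (rule part[of sin]) (auto intro: trig_lip continuous_intros)
  ultimately show "norm ?I <= 6 * Ebound \<epsilon> K \<xi> y" by linarith
 qed
qed

text \<open>The function \<open>E = c - k J\<close> satisfies \<open>E' = (k / y) P\<close>, so the
  derivative of \<open>y\<^sup>-\<^sup>k E\<close> is
  \<open>k y\<^sup>-\<^sup>k\<^sup>-\<^sup>1 (P - E)\<close>. Integrating and multiplying back by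
  \<open>y1\<^sup>k\<close> leaves an error at most \<open>e\<close>, uniformly in \<open>k\<close>;
  passing from \<open>E\<close> to \<open>P\<close> adds another \<open>e\<close>.\<close>

lemma gronwall:
 fixes P :: "real => complex"
 assumes y: "0 < y1" "y1 <= 1" and k: "k >= 0" and e: "e >= 0" and Pc: "continuous_on {y1..1} P"
  and P: "!!y. y1 <= y ==> y <= 1 ==> norm (P y - (c - cor k * integral {y..1} (%w. cor (1 / w) * P w))) <= e"
 shows "norm (P y1 - cor (y1 powr k) * c) <= 2 * e"
proof (cases "y1 = 1")
 case True
 thus ?thesis using P[of 1] e by simp
next
 case False
 hence lt: "y1 < 1" using y by simp
 define J where "J = (%y. integral {y..1} (%w. cor (1 / w) * P w))"
 define E where "E = (%y. c - cor k * J y)"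
 have ic: "continuous_on {y1..1} (%w. cor (1 / w) * P w)"
  using y by (intro continuous_intros Pc) auto
 have J1: "J y = integral {y1..1} (%w. cor (1 / w) * P w) - integral {y1..y} (%w. cor (1 / w) * P w)" if "y : {y1..1}" for y
  using Henstock_Kurzweil_Integration.integral_combine[of y1 y 1 "%w. cor (1 / w) * P w"] integrable_continuous_interval[OF ic] that
  by (simp add: J_def algebra_simps)
 have dJ: "(J has_vector_derivative - (cor (1 / y) * P y)) (at y within {y1..1})" if "y : {y1..1}" for y
 proof -
  have "((%y. integral {y1..1} (%w. cor (1 / w) * P w) - integral {y1..y} (%w. cor (1 / w) * P w)) has_vector_derivative 0 - cor (1 / y) * P y) (at y within {y1..1})"
   by (rule has_vector_derivative_diff[OF has_vector_derivative_const integral_has_vector_derivative[OF ic that]])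
  from has_vector_derivative_transform[where g=J, OF that J1 this] show ?thesis by simp
 qed
 have dE: "(E has_vector_derivative cor (k / y) * P y) (at y within {y1..1})" if "y : {y1..1}" for y
 proof -
  have "(E has_vector_derivative 0 - cor k * (- (cor (1 / y) * P y))) (at y within {y1..1})"
   unfolding E_def by (rule has_vector_derivative_diff[OF has_vector_derivative_const has_vector_derivative_mult_right[OF dJ[OF that]]])
  thus ?thesis by simp
 qed
 have w: "at y within {y1..1} = at y" if "y1 < y" "y < 1" for y
  using that by (intro at_within_interior) auto
 let ?H = "%y. cor (y powr (-k)) * E y"
 have pw: "((%y. cor (y powr (-k))) has_vector_derivative cor (- k * y powr (-k - 1))) (at y)" if "y > 0" for y
  unfolding has_vector_derivative_complex_iff using that by (auto intro!: derivative_eq_intros)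
 have "norm (?H 1 - ?H y1) <= (- e * 1 powr (-k)) - (- e * y1 powr (-k))"
 proof (rule differentiable_bound_general[OF lt, where \<phi>="%y. - e * y powr (-k)" and \<phi>'="%y. e * k * y powr (-k - 1)"])
  have "continuous_on {y1..1} E"
   using dE has_vector_derivative_continuous continuous_on_eq_continuous_within by blast
  thus "continuous_on {y1..1} ?H" using y by (intro continuous_intros) auto
  show "continuous_on {y1..1} (%y. - e * y powr (-k))" using y by (intro continuous_intros) auto
  fix y assume yy: "y1 < y" "y < 1"
  have y0: "y > 0" using yy y by simp
  have "(E has_vector_derivative cor (k / y) * P y) (at y)" using dE[of y] yy w[OF yy] by simp
  from has_vector_derivative_mult[OF pw[OF y0] this]
  show "(?H has_vector_derivative cor (y powr (-k)) * (cor (k / y) * P y) + cor (- k * y powr (-k - 1)) * E y) (at y)" .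
  show "((%y. - e * y powr (-k)) has_vector_derivative e * k * y powr (-k - 1)) (at y)"
   unfolding has_real_derivative_iff_has_vector_derivative[symmetric] using y0 by (auto intro!: derivative_eq_intros)
  have pe: "y powr (-k - 1) = y powr (-k) / y" using y0 by (simp add: powr_diff)
  have "cor (y powr (-k)) * (cor (k / y) * P y) + cor (- k * y powr (-k - 1)) * E y
   = cor (k * y powr (-k - 1)) * (P y - E y)"
   unfolding pe by (simp add: algebra_simps diff_divide_distrib)
  also have "norm ... = k * y powr (-k - 1) * norm (P y - E y)" using k by (simp add: norm_mult)
  also have "... <= k * y powr (-k - 1) * e"
   using P[of y] yy k by (intro mult_left_mono) (auto simp: E_def J_def)
  finally show "norm (cor (y powr (-k)) * (cor (k / y) * P y) + cor (- k * y powr (-k - 1)) * E y) <= e * k * y powr (-k - 1)"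
   by (simp add: mult_ac)
 qed
 moreover have "E 1 = c" by (simp add: E_def J_def)
 ultimately have "norm (c - cor (y1 powr (-k)) * E y1) <= e * (y1 powr (-k) - 1)" by (simp add: algebra_simps)
 hence "y1 powr k * norm (c - cor (y1 powr (-k)) * E y1) <= y1 powr k * (e * (y1 powr (-k) - 1))"
  by (rule mult_left_mono) simp
 also have "... = e * (1 - y1 powr k)"
  using y by (simp add: algebra_simps powr_minus)
 also have "... <= e" using e by (simp add: algebra_simps)
 also have "y1 powr k * norm (c - cor (y1 powr (-k)) * E y1) = norm (cor (y1 powr k) * (c - cor (y1 powr (-k)) * E y1))"
  by (simp add: norm_mult)
 also have "cor (y1 powr k) * (c - cor (y1 powr (-k)) * E y1) = cor (y1 powr k) * c - E y1"
 proof -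
  have "cor (y1 powr k) * cor (y1 powr (-k)) = 1"
   using y by (simp add: powr_minus flip: of_real_mult)
  thus ?thesis by (simp add: algebra_simps)
 qed
 finally have 1: "norm (cor (y1 powr k) * c - E y1) <= e" .
 have 2: "norm (P y1 - E y1) <= e" using P[of y1] y by (simp add: E_def J_def)
 have "P y1 - cor (y1 powr k) * c = (P y1 - E y1) - (cor (y1 powr k) * c - E y1)" by simp
 hence "norm (P y1 - cor (y1 powr k) * c) <= norm (P y1 - E y1) + norm (cor (y1 powr k) * c - E y1)"
  by (simp only: norm_triangle_ineq4)
 thus ?thesis using 1 2 by linarith
qed

text \<open>The condition \<open>\<xi>\<^sup>2 ln (1/y) <= t\<close> is the regime of the limit law.
  In it the decorrelation error, multiplied by \<open>\<xi>\<^sup>2\<close>, becomes small for small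
  \<open>\<xi>\<close>, and \<open>gronwall\<close> solves the resulting equation with exponent
  \<open>k = 4 \<pi>\<^sup>2 \<xi>\<^sup>2 V\<close>.\<close>

lemma Phi_asymp:
 assumes vol: "hyp_vol D > 0" and \<epsilon>: "\<epsilon> > 0" and t: "t >= 0"
 shows "EX \<delta>>0. ALL \<xi> y. 0 <= \<xi> --> \<xi> <= \<delta> --> 0 < y --> y <= 1 --> \<xi>^2 * ln (1 / y) <= t -->
  norm (Phi \<xi> y - cor (c0 * exp (- 4 * pi^2 * V * (\<xi>^2 * ln (1 / y))))) <= \<epsilon>"
proof -
 \<comment> \<open>Chosen so that
   \<open>4 \<pi>\<^sup>2 * 6 * \<epsilon>1 * (1 + t) = \<epsilon> / 4\<close>. The total budget is
   \<open>\<epsilon> / 2\<close>, since \<open>gronwall\<close> doubles the error.\<close>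
 define \<epsilon>1 where "\<epsilon>1 = \<epsilon> / (4 * (4 * pi^2 * 6 * (1 + t)))"
 have e1: "\<epsilon>1 > 0" using \<epsilon> t by (simp add: \<epsilon>1_def)
 obtain K where K0: "K >= 0" and K: "ALL \<xi> y. 0 <= \<xi> --> \<xi> <= 1 --> 0 < y --> y <= 1 -->
  norm (integral {y..1} (%w. cor (1 / w) * (Gam \<xi> w - cor V * Phi \<xi> w))) <= 6 * Ebound \<epsilon>1 K \<xi> y"
  using slow_decorrelation[OF vol e1] by blast
 define M where "M = 4 * pi^2 * 6 * K * (1 + t)"
 have M0: "M >= 0" using K0 t by (simp add: M_def)
 \<comment> \<open>The second bound makes the term \<open>\<xi> K2\<close> at most
   \<open>\<epsilon> / 8\<close>, the third does the same for
   \<open>M * sqrt \<delta>\<close>.\<close>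
 define \<delta> where "\<delta> = min 1 (min (\<epsilon> / (8 * (K2 + 1))) ((\<epsilon> / (8 * (M + 1)))^2))"
 have d: "\<delta> > 0" using \<epsilon> K2_nonneg M0 by (simp add: \<delta>_def)
 show ?thesis
 proof (intro exI[of _ \<delta>] conjI d allI impI)
  fix \<xi> y :: real assume \<xi>: "0 <= \<xi>" "\<xi> <= \<delta>" and y: "0 < y" "y <= 1" and ty: "\<xi>^2 * ln (1 / y) <= t"
  have \<xi>1: "\<xi> <= 1" using \<xi> by (simp add: \<delta>_def)
  define k where "k = 4 * pi^2 * \<xi>^2 * V"
  have k: "k >= 0" using V_nonneg by (simp add: k_def)
  have err: "norm (Phi \<xi> w - (cor c0 - cor k * integral {w..1} (%w. cor (1 / w) * Phi \<xi> w))) <= \<epsilon> / 2"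
   if w: "y <= w" "w <= 1" for w
  proof -
   have w0: "0 < w" using w y by simp
   have S: "{w..1} <= {0<..}" using w0 by auto
   define T where "T = ln (1 / w)"
   have T: "T >= 0" using w w0 by (simp add: T_def)
   have "T <= ln (1 / y)" using w y w0 by (simp add: T_def frac_le)
   hence tT: "\<xi>^2 * T <= t" using ty mult_left_mono[of T "ln (1/y)" "\<xi>^2"] by simp
   let ?A = "integral {w..1} (%w. cor (1 / w) * Gam \<xi> w)"
   let ?Bi = "integral {w..1} (%w. cor (1 / w) * Phi \<xi> w)"
   let ?E = "integral {w..1} (%w. cor (1 / w) * (Gam \<xi> w - cor V * Phi \<xi> w))"
   have i1: "(%w. cor (1 / w) * Gam \<xi> w) integrable_on {w..1}" "(%w. cor (1 / w) * Phi \<xi> w) integrable_on {w..1}"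
    using w0 by (intro integrable_continuous_interval continuous_intros Gam_cont Phi_cont S; force)+
   have hi: "((%w. cor (1 / w) * Gam \<xi> w - cor V * (cor (1 / w) * Phi \<xi> w)) has_integral (?A - cor V * ?Bi)) {w..1}"
    by (intro has_integral_diff has_integral_mult_right integrable_integral i1)
   have "?E = ?A - cor V * ?Bi"
    using integral_unique[OF hi] by (simp add: algebra_simps)
   hence A: "?A = cor V * ?Bi + ?E" by simp
   have En: "norm ?E <= 6 * Ebound \<epsilon>1 K \<xi> w" using K \<xi> \<xi>1 w0 w by blast
   \<comment> \<open>One factor \<open>\<xi>\<^sup>2\<close> is split evenly between the factors
     under the root: \<open>\<xi>\<^sup>2 (1 + T)\<close> stays bounded by \<open>1 + t\<close>,
     while \<open>\<xi>\<^sup>2 (1 + \<xi> T)\<close> retains one factor \<open>\<xi>\<close> and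
     gives \<open>\<delta>\<close>.\<close>
   have sq: "\<xi>^2 * Ebound \<epsilon>1 K \<xi> w <= \<epsilon>1 * (1 + t) + K * ((1 + t) * sqrt \<delta>)"
   proof -
    have t1: "\<xi>^2 * (1 + T) <= 1 + t" using tT \<xi> \<xi>1 by (simp add: algebra_simps) (smt (verit) power_le_one)
    have "\<xi>^2 * (1 + \<xi> * T) = \<xi> * (\<xi> + \<xi>^2 * T)" by (simp add: power2_eq_square algebra_simps)
    also have "... <= \<delta> * (1 + t)" using \<xi> \<xi>1 tT T by (intro mult_mono add_mono) auto
    finally have t2: "\<xi>^2 * (1 + \<xi> * T) <= \<delta> * (1 + t)" .
    have "\<xi>^2 * sqrt ((1 + T) * (1 + \<xi> * T)) = sqrt ((\<xi>^2 * (1 + T)) * (\<xi>^2 * (1 + \<xi> * T)))"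
     using \<xi> by (simp add: real_sqrt_mult power2_eq_square)
    also have "... <= sqrt ((1 + t) * (\<delta> * (1 + t)))"
     by (rule real_sqrt_le_mono, rule mult_mono[OF t1 t2]) (use T \<xi> t in auto)
    also have "... = (1 + t) * sqrt \<delta>" using t by (simp add: real_sqrt_mult)
    finally have r: "\<xi>^2 * sqrt ((1 + T) * (1 + \<xi> * T)) <= (1 + t) * sqrt \<delta>" .
    have "\<xi>^2 * Ebound \<epsilon>1 K \<xi> w = \<epsilon>1 * (\<xi>^2 * (1 + T)) + K * (\<xi>^2 * sqrt ((1 + T) * (1 + \<xi> * T)))"
     by (simp add: Ebound_def T_def algebra_simps)
    also have "... <= \<epsilon>1 * (1 + t) + K * ((1 + t) * sqrt \<delta>)"
     using t1 r e1 K0 by (intro add_mono mult_left_mono) auto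
    finally show ?thesis .
   qed
   have "Phi \<xi> w - (cor c0 - cor k * ?Bi) = (Phi \<xi> w - (cor c0 - cor (4 * pi^2 * \<xi>^2) * ?A)) - cor (4 * pi^2 * \<xi>^2) * ?E"
    unfolding A k_def by (simp add: algebra_simps)
   hence "norm (Phi \<xi> w - (cor c0 - cor k * ?Bi)) <= norm (Phi \<xi> w - (cor c0 - cor (4 * pi^2 * \<xi>^2) * ?A)) + norm (cor (4 * pi^2 * \<xi>^2) * ?E)"
    by (simp only: norm_triangle_ineq4)
   also have "... <= \<xi> * K2 + 4 * pi^2 * \<xi>^2 * (6 * Ebound \<epsilon>1 K \<xi> w)"
   proof (rule add_mono)
    show "norm (Phi \<xi> w - (cor c0 - cor (4 * pi^2 * \<xi>^2) * ?A)) <= \<xi> * K2"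
     by (rule Phi_approx[OF w0 w(2) \<xi>(1) \<xi>1])
    show "norm (cor (4 * pi^2 * \<xi>^2) * ?E) <= 4 * pi^2 * \<xi>^2 * (6 * Ebound \<epsilon>1 K \<xi> w)"
    proof -
     have "abs (4 * pi^2 * \<xi>^2) * norm ?E <= abs (4 * pi^2 * \<xi>^2) * (6 * Ebound \<epsilon>1 K \<xi> w)" by (rule mult_left_mono[OF En]) simp
     thus ?thesis by (simp only: norm_mult norm_of_real) (simp add: abs_mult)
    qed
   qed
   also have "4 * pi^2 * \<xi>^2 * (6 * Ebound \<epsilon>1 K \<xi> w) = 4 * pi^2 * 6 * (\<xi>^2 * Ebound \<epsilon>1 K \<xi> w)" by simp
   also have "\<xi> * K2 + 4 * pi^2 * 6 * (\<xi>^2 * Ebound \<epsilon>1 K \<xi> w) <= \<xi> * K2 + 4 * pi^2 * 6 * (\<epsilon>1 * (1 + t) + K * ((1 + t) * sqrt \<delta>))"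
    using sq by (intro add_left_mono mult_left_mono) auto
   also have "... = \<xi> * K2 + \<epsilon>1 * (4 * pi^2 * 6 * (1 + t)) + M * sqrt \<delta>" by (simp add: M_def algebra_simps)
   also have "... <= \<epsilon> / 8 + \<epsilon> / 4 + \<epsilon> / 8"
   proof (intro add_mono)
    have "\<xi> <= \<epsilon> / (8 * (K2 + 1))" using \<xi> by (simp add: \<delta>_def)
    hence "\<xi> * (K2 + 1) <= \<epsilon> / (8 * (K2 + 1)) * (K2 + 1)" using K2_nonneg by (intro mult_right_mono) auto
    also have "... = \<epsilon> / 8" using K2_nonneg by (simp add: field_simps add_nonneg_eq_0_iff)
    finally show "\<xi> * K2 <= \<epsilon> / 8" using \<xi> by (simp add: algebra_simps)
    have gen: "\<epsilon> / (4 * r) * r = \<epsilon> / 4" if "r > 0" for r :: real using that by simp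
    have "4 * pi^2 * 6 * (1 + t) > 0" using t by simp
    from gen[OF this] show "\<epsilon>1 * (4 * pi^2 * 6 * (1 + t)) <= \<epsilon> / 4" unfolding \<epsilon>1_def by (rule eq_refl)
    have "\<delta> <= (\<epsilon> / (8 * (M + 1)))^2" by (simp add: \<delta>_def)
    hence "sqrt \<delta> <= sqrt ((\<epsilon> / (8 * (M + 1)))^2)" by (rule real_sqrt_le_mono)
    also have "... = \<epsilon> / (8 * (M + 1))" using \<epsilon> M0 by (simp add: real_sqrt_abs)
    finally have "M * sqrt \<delta> <= M * (\<epsilon> / (8 * (M + 1)))" using M0 by (rule mult_left_mono)
    also have "... = \<epsilon> / 8 * (M / (M + 1))" by simp
    also have "... <= \<epsilon> / 8 * 1" using \<epsilon> M0 by (intro mult_left_mono) auto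
    finally show "M * sqrt \<delta> <= \<epsilon> / 8" by simp
   qed
   finally show ?thesis by simp
  qed
  have "norm (Phi \<xi> y - cor (y powr k) * cor c0) <= 2 * (\<epsilon> / 2)"
   by (rule gronwall[OF y k _ _ err]) (use \<epsilon> y in \<open>auto intro!: Phi_cont\<close>)
  moreover have "y powr k = exp (- 4 * pi^2 * V * (\<xi>^2 * ln (1 / y)))"
   using y by (simp add: powr_def k_def ln_div mult_ac)
  ultimately show "norm (Phi \<xi> y - cor (c0 * exp (- 4 * pi^2 * V * (\<xi>^2 * ln (1 / y))))) <= \<epsilon>"
   by (simp add: mult.commute)
 qed
qed

end

section \<open>Fractions in short intervals\<close>

lemma int_interval_card_lower:
 fixes a b :: real
 shows "real (card {n::int. a <= of_int n & of_int n <= b}) >= b - a - 1"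
proof -
 have eq: "{n::int. a <= of_int n & of_int n <= b} = {\<lceil>a\<rceil>..\<lfloor>b\<rfloor>}"
  by (auto simp: ceiling_le_iff le_floor_iff)
 have "real (card {\<lceil>a\<rceil>..\<lfloor>b\<rfloor>}) >= roi (\<lfloor>b\<rfloor> - \<lceil>a\<rceil> + 1)" by simp
 moreover have "b < roi \<lfloor>b\<rfloor> + 1" "roi \<lceil>a\<rceil> < a + 1"
  using floor_correct[of b] ceiling_correct[of a] by linarith+
 ultimately show ?thesis unfolding eq by linarith
qed

text \<open>Counts all numerators, reduced or not, of fractions with denominator \<open>c\<close>
  within \<open>y\<close> of \<open>x\<close>; coprimality is restored later by a sieve.\<close>

definition ecount :: "real => real => nat => nat" where
 "ecount x y c = card {a::int. abs (real c * x - of_int a) <= real c * y}"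

lemma ecount_finite: "finite {a::int. abs (t - of_int a) <= d}" for t d :: real
proof -
 have "{a::int. abs (t - of_int a) <= d} = {a::int. t - d <= of_int a & of_int a <= t + d}"
  by (auto simp: abs_le_iff)
 thus ?thesis using finite_int_interval_card(1) by simp
qed

text \<open>Let c run over Q consecutive members c0 + q j of a progression of step q, and let p/Q be
  close to q x. Then Q (c x - a) is nearly c0 x Q + (j p - a Q). As p is prime to Q, the integer j p
  - a Q takes each value exactly once when j < Q and a is any integer. Counting pairs thus becomes
  counting integers in a single interval.\<close>

lemma block_bounds:
 fixes p :: int and Q q c0 :: nat and x y \<eta> :: real
 assumes Q: "Q >= 1" and cop: "coprime p (int Q)" and \<eta>: "abs (real q * x * real Q - of_int p) <= \<eta>" and y: "y >= 0"
 shows "real (\<Sum>j<Q. ecount x y (c0 + q * j)) <= 2 * real Q * (real c0 + real q * real Q) * y + 2 * real Q * \<eta> + 1"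
  and "real (\<Sum>j<Q. ecount x y (c0 + q * j)) >= 2 * real Q * real c0 * y - 2 * real Q * \<eta> - 1"
proof -
 define A where "A = (SIGMA j:{..<Q}. {a::int. abs (real (c0 + q * j) * x - of_int a) <= real (c0 + q * j) * y})"
 have finA: "finite A" unfolding A_def using ecount_finite by blast
 have cardA: "card A = (\<Sum>j<Q. ecount x y (c0 + q * j))"
  unfolding A_def ecount_def by (rule card_SigmaI) (use ecount_finite in auto)
 have \<eta>0: "\<eta> >= 0" using \<eta> by linarith
 define \<phi> where "\<phi> = (%(j::nat, a::int). int j * p - a * int Q)"
 have key: "abs ((real (c0 + q * j) * x - of_int a) * real Q - (real c0 * x * real Q + of_int (\<phi> (j,a)))) <= \<eta> * real Q" if "j < Q" for j a
 proof -
  have "(real (c0 + q * j) * x - of_int a) * real Q - (real c0 * x * real Q + of_int (\<phi> (j,a))) = real j * (real q * x * real Q - of_int p)"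
   by (simp add: \<phi>_def algebra_simps)
  also have "abs (...) = real j * abs (real q * x * real Q - of_int p)" by (simp add: abs_mult)
  also have "... <= real Q * \<eta>" using that \<eta> by (intro mult_mono) auto
  finally show ?thesis by (simp add: mult.commute)
 qed
 \<comment> \<open>Equal values force \<open>Q\<close> to divide the difference of the indices
   \<open>j\<close>, which is smaller than \<open>Q\<close>.\<close>
 have inj: "inj_on \<phi> A"
 proof (rule inj_onI)
  fix u v assume uv: "u : A" "v : A" "\<phi> u = \<phi> v"
  obtain j a j' a' where e: "u = (j,a)" "v = (j',a')" by (cases u; cases v) auto
  have jj: "j < Q" "j' < Q" using uv e by (auto simp: A_def)
  have eq: "(int j - int j') * p = (a - a') * int Q" using uv(3) by (simp add: \<phi>_def e algebra_simps)
  hence "int Q dvd (int j - int j') * p" by simp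
  hence d: "int Q dvd int j - int j'" using cop by (metis coprime_commute coprime_dvd_mult_left_iff)
  have "j = j'"
  proof (rule ccontr)
   assume "j ~= j'"
   hence "int Q <= abs (int j - int j')" using d dvd_imp_le_int[of "int j - int j'" "int Q"] by simp
   thus False using jj by linarith
  qed
  moreover from this eq Q have "a = a'" by simp
  ultimately show "u = v" by (simp add: e)
 qed
 let ?w = "real c0 * x * real Q"
 show "real (\<Sum>j<Q. ecount x y (c0 + q * j)) <= 2 * real Q * (real c0 + real q * real Q) * y + 2 * real Q * \<eta> + 1"
 proof -
  let ?d = "(real c0 + real q * real Q) * y * real Q + \<eta> * real Q"
  let ?S = "{m::int. - ?w - ?d <= of_int m & of_int m <= - ?w + ?d}"
  have "\<phi> ` A <= ?S"
  proof
   fix m assume "m : \<phi> ` A"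
   then obtain j a where ja: "(j,a) : A" "m = \<phi> (j,a)" by auto
   have j: "j < Q" and le: "abs (real (c0 + q * j) * x - of_int a) <= real (c0 + q * j) * y" using ja by (auto simp: A_def)
   have "abs ((real (c0 + q * j) * x - of_int a) * real Q) <= real (c0 + q * j) * y * real Q"
    using le Q by (simp add: abs_mult mult_right_mono)
   also have "... <= (real c0 + real q * real Q) * y * real Q" using j y by (intro mult_right_mono) (auto simp: mult_left_mono)
   finally have "abs (?w + of_int m) <= ?d" using key[OF j, of a] ja(2) by linarith
   thus "m : ?S" by (auto simp: abs_le_iff)
  qed
  hence "card A <= card ?S" using card_inj_on_le[OF inj _ finite_int_interval_card(1)] by blast
  hence "real (card A) <= real (card ?S)" by simp
  also have "... <= (- ?w + ?d) - (- ?w - ?d) + 1"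
   by (rule finite_int_interval_card(2)) (use y \<eta>0 in auto)
  finally show ?thesis unfolding cardA by (simp add: algebra_simps)
 qed
 show "real (\<Sum>j<Q. ecount x y (c0 + q * j)) >= 2 * real Q * real c0 * y - 2 * real Q * \<eta> - 1"
 proof -
  let ?d = "real c0 * y * real Q - \<eta> * real Q"
  let ?S = "{m::int. - ?w - ?d <= of_int m & of_int m <= - ?w + ?d}"
  have "?S <= \<phi> ` A"
  proof
   \<comment> \<open>The index is recovered from \<open>m\<close> by multiplying with the inverse of
     \<open>p\<close> modulo \<open>Q\<close>.\<close>
   fix m assume m: "m : ?S"
   obtain i where i: "[p * i = 1] (mod int Q)" using cop cong_solve_coprime_int by blast
   define j where "j = nat ((i * m) mod int Q)"
   have jQ: "j < Q" using Q by (simp add: j_def nat_less_iff)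
   have ij: "int j = (i * m) mod int Q" using Q by (simp add: j_def)
   have "[int j * p = (i * m) * p] (mod int Q)" unfolding ij by (simp add: cong_def mod_mult_left_eq)
   also have "(i * m) * p = (p * i) * m" by simp
   also have "[(p * i) * m = 1 * m] (mod int Q)" using i by (rule cong_mult) simp
   finally have "[int j * p = m] (mod int Q)" by simp
   then obtain a where a: "int j * p - m = int Q * a" by (auto simp: cong_iff_dvd_diff dvd_def)
   have ma: "m = \<phi> (j,a)" using a by (simp add: \<phi>_def algebra_simps)
   have "abs (?w + of_int m) <= ?d" using m by (auto simp: abs_le_iff)
   hence "abs ((real (c0 + q * j) * x - of_int a) * real Q) <= real c0 * y * real Q" using key[OF jQ, of a] ma by linarith
   hence "abs (real (c0 + q * j) * x - of_int a) * real Q <= real c0 * y * real Q" by (simp add: abs_mult)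
   hence "abs (real (c0 + q * j) * x - of_int a) <= real c0 * y" using Q by simp
   also have "... <= real (c0 + q * j) * y" using y by (intro mult_right_mono) auto
   finally have "(j,a) : A" using jQ by (simp add: A_def)
   thus "m : \<phi> ` A" using ma by blast
  qed
  hence "card ?S <= card A" using finA by (rule surj_card_le[rotated])
  hence "real (card ?S) <= real (card A)" by simp
  moreover have "(- ?w + ?d) - (- ?w - ?d) - 1 <= real (card ?S)" by (rule int_interval_card_lower)
  ultimately show ?thesis unfolding cardA by (simp add: algebra_simps)
 qed
qed

definition Ac :: "nat => nat => nat => nat set" where
 "Ac q r M = {c. 1 <= c & c <= M & c mod q = r}"

abbreviation Ne :: "nat => nat => nat => real => real => real" where
 "Ne q r M y x == (\<Sum>c\<in>Ac q r M. real (ecount x y c))"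

lemma finite_Ac [simp]: "finite (Ac q r M)"
 by (rule finite_subset[of _ "{..M}"]) (auto simp: Ac_def)

lemma card_Ac: "card (Ac q r M) <= M"
proof -
 have "card (Ac q r M) <= card {1..M}" by (rule card_mono) (auto simp: Ac_def)
 thus ?thesis by simp
qed

text \<open>Times \<open>y\<close> this is the expected number of pairs, since an interval of length
  \<open>2 c y\<close> contains about that many numerators.\<close>

definition EA :: "nat => nat => nat => real" where "EA q r M = (\<Sum>c\<in>Ac q r M. 2 * real c)"

lemma EA_bound: "EA q r M <= 2 * (real M)^2" "EA q r M >= 0"
proof -
 have "EA q r M <= (\<Sum>c\<in>Ac q r M. 2 * real M)" unfolding EA_def by (intro sum_mono) (auto simp: Ac_def)
 also have "... = real (card (Ac q r M)) * (2 * real M)" by simp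
 also have "... <= real M * (2 * real M)" using card_Ac[of q r M] by (intro mult_right_mono) auto
 finally show "EA q r M <= 2 * (real M)^2" by (simp add: power2_eq_square)
 show "EA q r M >= 0" by (simp add: EA_def sum_nonneg)
qed

lemma Ac_enum:
 assumes q: "q >= 1" and r: "r < q"
 obtains r' J where "1 <= r'" "r' <= q" "Ac q r M = (%j. r' + q * j) ` {..<J}" "real q * real J <= real M + real q" "real q * real J >= real M - real q" "J <= M"
proof -
 \<comment> \<open>Denominators start at 1, so the class of 0 has first member
   \<open>q\<close>.\<close>
 define r' where "r' = (if r = 0 then q else r)"
 define J where "J = (if r' <= M then (M - r') div q + 1 else 0)"
 have r': "1 <= r'" "r' <= q" "r' mod q = r" using q r by (auto simp: r'_def)
 have eq: "Ac q r M = (%j. r' + q * j) ` {..<J}"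
 proof (intro equalityI subsetI)
  fix c assume "c : Ac q r M"
  hence c: "1 <= c" "c <= M" "c mod q = r" by (auto simp: Ac_def)
  have rc: "r' <= c"
  proof (cases "r = 0")
   case True
   hence "q dvd c" using c by auto
   thus ?thesis using c True by (simp add: r'_def dvd_imp_le)
  next
   case False thus ?thesis using c mod_less_eq_dividend[of c q] by (simp add: r'_def)
  qed
  have "c mod q = r' mod q" using c r' by simp
  hence "q dvd c - r'" using rc by (metis mod_eq_dvd_iff_nat)
  then obtain j where j: "c - r' = q * j" by (auto simp: dvd_def)
  have "q * j <= M - r'" using j c by linarith
  hence "j <= (M - r') div q" using q by (simp add: less_eq_div_iff_mult_less_eq mult.commute)
  hence "j < J" using rc c by (simp add: J_def)
  moreover have "c = r' + q * j" using j rc by linarith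
  ultimately show "c : (%j. r' + q * j) ` {..<J}" by blast
 next
  fix c assume "c : (%j. r' + q * j) ` {..<J}"
  then obtain j where j: "j < J" "c = r' + q * j" by auto
  have rM: "r' <= M" using j by (auto simp: J_def split: if_splits)
  hence "j <= (M - r') div q" using j by (simp add: J_def)
  hence "q * j <= M - r'" using q by (simp add: less_eq_div_iff_mult_less_eq mult.commute)
  hence "c <= M" using j rM by linarith
  moreover have "c mod q = r" using j r' by simp
  ultimately show "c : Ac q r M" using j r' by (simp add: Ac_def)
 qed
 have b: "real q * real J <= real M + real q & real q * real J >= real M - real q & J <= M"
 proof (cases "r' <= M")
  case True
  have d: "q * ((M - r') div q) <= M - r'" "M - r' < q * ((M - r') div q) + q"
   using q mod_less_divisor[of q "M - r'"] mult_div_mod_eq[of q "M - r'"] by linarith+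
  have qJ: "q * J = q * ((M - r') div q) + q" using True by (simp add: J_def)
  have "q * J <= M + q" "M <= q * J + q" using d qJ True r' by linarith+
  hence "real q * real J <= real M + real q" "real q * real J >= real M - real q"
   by (metis of_nat_add of_nat_le_iff of_nat_mult, metis of_nat_add of_nat_le_iff of_nat_mult diff_le_eq)
  moreover have "(M - r') div q <= M - r'" by simp
  hence "J <= M" using True r'(1) unfolding J_def if_P[OF True] by linarith
  ultimately show ?thesis by blast
 next
  case False
  thus ?thesis using r' by (simp add: J_def)
 qed
 show ?thesis by (rule that[OF r'(1,2) eq]) (use b in auto)
qed

lemma inj_affine: "q >= 1 ==> inj_on (%j::nat. r' + q * j) S"
 by (rule inj_onI) simp

lemma EA_asymp:
 assumes q: "q >= 1" and r: "r < q"
 shows "abs (EA q r M - (real M)^2 / real q) <= 6 * real M + 6 * real q"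
proof -
 obtain r' J where r': "1 <= r'" "r' <= q" and eq: "Ac q r M = (%j. r' + q * j) ` {..<J}"
  and J: "real q * real J <= real M + real q" "real q * real J >= real M - real q" "J <= M"
  using Ac_enum[OF q r] by blast
 have "EA q r M = (\<Sum>j<J. 2 * real (r' + q * j))"
  unfolding EA_def eq using inj_affine[OF q] by (subst sum.reindex) auto
 also have "... = 2 * real r' * real J + real q * (real J * (real J - 1))"
 proof (induction J)
  case (Suc n)
  thus ?case by (simp add: algebra_simps)
 qed simp
 finally have E: "EA q r M = 2 * real r' * real J + real q * (real J * (real J - 1))" .
 define t where "t = real q * real J"
 have q0: "real q >= 1" using q by simp
 have "real q * EA q r M = t^2 + t * (2 * real r' - real q)"
  unfolding E t_def by (simp add: power2_eq_square algebra_simps)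
 hence "real q * EA q r M - (real M)^2 = (t - real M) * (t + real M) + t * (2 * real r' - real q)"
  by (simp add: power2_eq_square algebra_simps)
 also have "abs (...) <= abs (t - real M) * abs (t + real M) + abs t * abs (2 * real r' - real q)"
  by (metis abs_mult abs_triangle_ineq)
 also have "... <= real q * (2 * real M + real q) + (real M + real q) * real q"
 proof (intro add_mono mult_mono)
  show "abs (t - real M) <= real q" using J by (auto simp: t_def abs_le_iff)
  have "t >= 0" by (simp add: t_def)
  thus "abs (t + real M) <= 2 * real M + real q" "abs t <= real M + real q" using J by (auto simp: t_def)
  show "abs (2 * real r' - real q) <= real q" using r' by (auto simp: abs_le_iff)
 qed auto
 also have "... = real q * (3 * real M + 2 * real q)" by (simp add: algebra_simps)
 finally have "abs (real q * EA q r M - (real M)^2) <= real q * (3 * real M + 2 * real q)" .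
 moreover have "EA q r M - (real M)^2 / real q = (real q * EA q r M - (real M)^2) / real q" using q0 by (simp add: field_simps)
 ultimately have "abs (EA q r M - (real M)^2 / real q) <= 3 * real M + 2 * real q"
  using q0 by (simp add: abs_divide pos_divide_le_eq mult.commute)
 thus ?thesis by simp
qed

text \<open>The progression is cut into full blocks of \<open>Q\<close> members and a remainder,
  which is bounded by one more full block. Within a block both the count and its expectation lie in
  the same short range, so the error per block is a fixed quantity, about \<open>M / Q\<close> times
  over.\<close>

lemma good_count:
 fixes p :: int and Q q :: nat and x y \<eta> :: real
 assumes q: "q >= 1" and r: "r < q" and Q: "Q >= 1" and cop: "coprime p (int Q)"
  and \<eta>: "abs (real q * x * real Q - of_int p) <= \<eta>" and y: "y >= 0"
 shows "abs (real (\<Sum>c\<in>Ac q r M. ecount x y c) - y * EA q r M)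
  <= real M / real Q * (2 * real q * (real Q)^2 * y + 2 * real Q * \<eta> + 1)
   + (2 * real Q * (real M + 2 * real q + real q * real Q) * y + 2 * real Q * \<eta> + 1)"
proof -
 obtain r' J where r': "1 <= r'" "r' <= q" and eq: "Ac q r M = (%j. r' + q * j) ` {..<J}"
  and J: "real q * real J <= real M + real q" "real q * real J >= real M - real q" "J <= M"
  using Ac_enum[OF q r] by blast
 have \<eta>0: "\<eta> >= 0" using \<eta> by linarith
 define n where "n = J div Q"
 define m where "m = J mod Q"
 have Jnm: "J = n * Q + m" "m < Q" using Q by (auto simp: n_def m_def)
 define e where "e = (%j. real (ecount x y (r' + q * j)))"
 define g where "g = (%j. 2 * real (r' + q * j) * y)"
 have s1: "real (\<Sum>c\<in>Ac q r M. ecount x y c) = sum e {..<J}"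
  unfolding eq e_def using inj_affine[OF q] by (subst sum.reindex) auto
 have s2: "y * EA q r M = sum g {..<J}"
  unfolding EA_def eq g_def using inj_affine[OF q] by (subst sum.reindex) (auto simp: sum_distrib_left mult_ac)
 have split: "sum h {..<J} = (\<Sum>b<n. \<Sum>j<Q. h (b * Q + j)) + (\<Sum>j<m. h (n * Q + j))" for h :: "nat => real"
 proof -
  have "sum h {..<J} = sum h {..<n * Q} + sum h {n * Q..<n * Q + m}"
   unfolding Jnm(1) by (simp add: sum.atLeastLessThan_concat lessThan_atLeast0)
  also have "sum h {..<n * Q} = (\<Sum>b<n. sum h {b * Q..<b * Q + Q})" by (rule sum.nat_group[symmetric])
  also have "... = (\<Sum>b<n. \<Sum>j<Q. h (b * Q + j))"
  proof (rule sum.cong[OF refl])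
   fix b show "sum h {b * Q..<b * Q + Q} = (\<Sum>j<Q. h (b * Q + j))"
    using sum.shift_bounds_nat_ivl[of h 0 "b * Q" Q] by (simp add: add.commute lessThan_atLeast0)
  qed
  also have "sum h {n * Q..<n * Q + m} = (\<Sum>j<m. h (n * Q + j))"
   using sum.shift_bounds_nat_ivl[of h 0 "n * Q" m] by (simp add: add.commute lessThan_atLeast0)
  finally show ?thesis .
 qed
 have bidx: "r' + q * (b * Q + j) = (r' + q * (b * Q)) + q * j" for b j by (simp add: algebra_simps)
 define U where "U = (%b. real (r' + q * (b * Q)))"
 have eb: "(\<Sum>j<Q. e (b * Q + j)) <= 2 * real Q * (U b + real q * real Q) * y + 2 * real Q * \<eta> + 1"
   "(\<Sum>j<Q. e (b * Q + j)) >= 2 * real Q * U b * y - 2 * real Q * \<eta> - 1" for b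
  using block_bounds[OF Q cop \<eta> y, of "r' + q * (b * Q)"] by (simp_all add: e_def U_def bidx del: of_nat_add of_nat_mult)
 have gb: "2 * real Q * U b * y <= (\<Sum>j<Q. g (b * Q + j))" "(\<Sum>j<Q. g (b * Q + j)) <= 2 * real Q * (U b + real q * real Q) * y" for b
 proof -
  have l: "2 * U b * y <= g (b * Q + j)" for j unfolding g_def U_def using y by (intro mult_right_mono) (auto simp: distrib_left)
  have u: "g (b * Q + j) <= 2 * (U b + real q * real Q) * y" if "j < Q" for j
   unfolding g_def U_def using y that by (intro mult_right_mono) (auto simp: algebra_simps mult_right_mono)
  have "real (card {..<Q}) * (2 * U b * y) <= (\<Sum>j<Q. g (b * Q + j))" by (rule sum_bounded_below) (use l in auto)
  thus "2 * real Q * U b * y <= (\<Sum>j<Q. g (b * Q + j))" by (simp add: mult_ac)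
  have "(\<Sum>j<Q. g (b * Q + j)) <= real (card {..<Q}) * (2 * (U b + real q * real Q) * y)" by (rule sum_bounded_above) (use u in auto)
  thus "(\<Sum>j<Q. g (b * Q + j)) <= 2 * real Q * (U b + real q * real Q) * y" by (simp add: mult_ac)
 qed
 let ?err = "2 * real q * (real Q)^2 * y + 2 * real Q * \<eta> + 1"
 have blk: "abs ((\<Sum>j<Q. e (b * Q + j)) - (\<Sum>j<Q. g (b * Q + j))) <= ?err" for b
 proof -
  have w: "2 * real Q * (U b + real q * real Q) * y - 2 * real Q * U b * y = 2 * real q * (real Q)^2 * y"
   by (simp add: algebra_simps power2_eq_square)
  show ?thesis using eb[of b] gb[of b] w by linarith
 qed
 have nM: "real n <= real M / real Q"
 proof -
  have "n * Q <= M" using Jnm J(3) by linarith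
  hence "real n * real Q <= real M" by (metis of_nat_le_iff of_nat_mult)
  thus ?thesis using Q by (simp add: pos_le_divide_eq)
 qed
 have err0: "?err >= 0" using y \<eta>0 by simp
 have "abs ((\<Sum>b<n. \<Sum>j<Q. e (b * Q + j)) - (\<Sum>b<n. \<Sum>j<Q. g (b * Q + j))) <= (\<Sum>b<n. ?err)"
  unfolding sum_subtractf[symmetric] by (rule order_trans[OF sum_abs sum_mono]) (use blk in \<open>simp add: sum_subtractf\<close>)
 also have "... = real n * ?err" by simp
 also have "... <= real M / real Q * ?err" using nM err0 by (rule mult_right_mono)
 finally have F: "abs ((\<Sum>b<n. \<Sum>j<Q. e (b * Q + j)) - (\<Sum>b<n. \<Sum>j<Q. g (b * Q + j))) <= real M / real Q * ?err" .
 let ?lim = "2 * real Q * (real M + 2 * real q + real q * real Q) * y + 2 * real Q * \<eta> + 1"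
 have Un: "U n <= real M + 2 * real q"
 proof -
  have "real (q * (n * Q)) <= real q * real J" using Jnm(1) by (simp add: mult_left_mono)
  moreover have "real r' <= real q" using r' by simp
  moreover have "U n = real r' + real (q * (n * Q))" unfolding U_def by (rule of_nat_add)
  ultimately show ?thesis using J(1) by linarith
 qed
 have up: "2 * real Q * (U n + real q * real Q) * y <= 2 * real Q * (real M + 2 * real q + real q * real Q) * y"
  using Un y by (intro mult_right_mono mult_left_mono) auto
 have nn: "e j >= 0" "g j >= 0" for j using y by (simp_all add: e_def g_def)
 have "(\<Sum>j<m. e (n * Q + j)) <= (\<Sum>j<Q. e (n * Q + j))" "(\<Sum>j<m. g (n * Q + j)) <= (\<Sum>j<Q. g (n * Q + j))"
  using Jnm(2) nn by (intro sum_mono2; auto)+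
 moreover have "(\<Sum>j<m. e (n * Q + j)) >= 0" "(\<Sum>j<m. g (n * Q + j)) >= 0" using nn by (auto intro: sum_nonneg)
 moreover have "2 * real Q * \<eta> >= 0" using \<eta>0 by simp
 ultimately have L: "abs ((\<Sum>j<m. e (n * Q + j)) - (\<Sum>j<m. g (n * Q + j))) <= ?lim"
  using eb(1)[of n] gb(2)[of n] up by linarith
 show ?thesis unfolding s1 s2 split[of e] split[of g] using F L by linarith
qed

section \<open>Averages of the counts over \<open>x\<close>\<close>

lemma card_eq_sum_indicator:
 fixes s e x y :: real and c :: nat
 assumes c: "c >= 1" and x: "x : {s..e}"
 shows "real (card {a::int. T a & abs (real c * x - of_int a) <= real c * y})
  = (\<Sum>a | T a & real c * (s - y) <= of_int a & of_int a <= real c * (e + y). ind {of_int a / real c - y..of_int a / real c + y} x)"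
proof -
 let ?A = "{a::int. T a & real c * (s - y) <= of_int a & of_int a <= real c * (e + y)}"
 have fin: "finite ?A" by (rule finite_subset[OF _ finite_int_interval_card(1)[of "real c * (s - y)" "real c * (e + y)"]]) auto
 have c0: "real c > 0" using c by simp
 have "{a. T a & abs (real c * x - of_int a) <= real c * y} = {a\<in>?A. x : {of_int a / real c - y..of_int a / real c + y}}" (is "?L = ?R")
 proof (intro equalityI subsetI)
  fix a assume "a : ?L"
  hence a: "T a" "real c * x - of_int a <= real c * y" "of_int a - real c * x <= real c * y" by (auto simp: abs_le_iff)
  have "real c * s <= real c * x" "real c * x <= real c * e" using x by (auto intro: mult_left_mono)
  hence "real c * (s - y) <= of_int a" "of_int a <= real c * (e + y)" using a by (auto simp: algebra_simps)
  moreover have "x : {of_int a / real c - y..of_int a / real c + y}" using a c0 by (auto simp: field_simps)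
  ultimately show "a : ?R" using a by simp
 next
  fix a assume "a : ?R"
  thus "a : ?L" using c0 by (auto simp: field_simps abs_le_iff)
 qed
 thus ?thesis using fin by (simp add: indicator_def sum.If_cases Int_def)
qed

text \<open>As a function of \<open>x\<close> the count is a sum of indicators of intervals of
  length \<open>2 y\<close> about the fractions. The predicate \<open>T\<close> lets one computation
  serve both all numerators and the coprime ones.\<close>

lemma card_set_integral:
 fixes s e y :: real and c :: nat
 assumes c: "c >= 1" and se: "s <= e" and y: "y >= 0"
 shows "set_integrable lb {s..e} (%x. real (card {a::int. T a & abs (real c * x - of_int a) <= real c * y}))" (is ?th1)
  and "(LINT x:{s..e}|lb. real (card {a::int. T a & abs (real c * x - of_int a) <= real c * y})) <= 2 * y * (real c * (e - s + 2 * y) + 1)" (is ?th2)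
proof -
 let ?A = "{a::int. T a & real c * (s - y) <= of_int a & of_int a <= real c * (e + y)}"
 let ?B = "%a::int. {of_int a / real c - y..of_int a / real c + y}"
 let ?g = "%x. \<Sum>a\<in>?A. ind (?B a) x :: real"
 have fin: "finite ?A" by (rule finite_subset[OF _ finite_int_interval_card(1)[of "real c * (s - y)" "real c * (e + y)"]]) auto
 have int: "integrable lb (%x. ind {s..e} x * ind (?B a) x :: real)" for a
 proof -
  have "integrable lb (ind ({s..e} \<inter> ?B a) :: real => real)"
   by (rule integrable_real_indicator) (auto simp: emeasure_lborel_Icc_eq Int_atLeastAtMost)
  thus ?thesis unfolding indicator_inter_arith .
 qed
 have si: "set_integrable lb {s..e} ?g"
  unfolding set_integrable_def by (simp add: sum_distrib_left int)
 have eq: "ind {s..e} x *\<^sub>R real (card {a::int. T a & abs (real c * x - of_int a) <= real c * y}) = ind {s..e} x *\<^sub>R ?g x" for x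
  using card_eq_sum_indicator[OF c, of x s e T y] by (simp add: indicator_def)
 show ?th1 using si unfolding set_integrable_def eq .
 have "(LINT x:{s..e}|lb. real (card {a::int. T a & abs (real c * x - of_int a) <= real c * y})) = (LINT x|lb. (\<Sum>a\<in>?A. ind {s..e} x * ind (?B a) x))"
  unfolding set_lebesgue_integral_def eq by (simp add: sum_distrib_left)
 also have "... = (\<Sum>a\<in>?A. (LINT x|lb. ind {s..e} x * ind (?B a) x))"
  by (rule Bochner_Integration.integral_sum) (rule int)
 also have "... <= (\<Sum>a\<in>?A. 2 * y)"
 proof (rule sum_mono)
  fix a
  have "(LINT x|lb. ind {s..e} x * ind (?B a) x :: real) <= (LINT x|lb. ind (?B a) x)"
   by (rule integral_mono[OF int integrable_real_indicator]) (auto simp: emeasure_lborel_Icc_eq indicator_def)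
  also have "... = 2 * y" using y by simp
  finally show "(LINT x|lb. ind {s..e} x * ind (?B a) x :: real) <= 2 * y" .
 qed
 also have "... = real (card ?A) * (2 * y)" by simp
 also have "... <= (real c * (e - s + 2 * y) + 1) * (2 * y)"
 proof (rule mult_right_mono)
  have "real (card ?A) <= real (card {a::int. real c * (s - y) <= of_int a & of_int a <= real c * (e + y)})"
   by (intro of_nat_mono card_mono finite_int_interval_card(1)) auto
  also have "... <= real c * (e + y) - real c * (s - y) + 1"
  proof (rule finite_int_interval_card(2))
   have "real c * (s - y) <= real c * (e + y)" using se y by (intro mult_left_mono) auto
   thus "real c * (s - y) <= real c * (e + y) + 1" by simp
  qed
  finally show "real (card ?A) <= real c * (e - s + 2 * y) + 1" by (simp add: algebra_simps)
 qed (use y in simp)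
 finally show ?th2 by (simp add: mult_ac)
qed

lemma ecount_set_integral:
 fixes s e y :: real and c :: nat
 assumes "c >= 1" and "s <= e" and "y >= 0"
 shows "set_integrable lb {s..e} (%x. real (ecount x y c))"
  and "(LINT x:{s..e}|lb. real (ecount x y c)) <= 2 * y * (real c * (e - s + 2 * y) + 1)"
 using card_set_integral[OF assms, of "%_. True"] by (simp_all add: ecount_def)

lemma set_integrable_sum':
 fixes g :: "'b => real => real"
 assumes "!!i. i : A ==> set_integrable lb S (g i)"
 shows "set_integrable lb S (%x. \<Sum>i\<in>A. g i x)" "(LINT x:S|lb. \<Sum>i\<in>A. g i x) = (\<Sum>i\<in>A. LINT x:S|lb. g i x)"
 using assms unfolding set_integrable_def set_lebesgue_integral_def by (simp_all add: sum_distrib_left)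

text \<open>The points for which \<open>q x\<close> is within \<open>1 / (Q N)\<close> of a fraction
  with small denominator \<open>Q < b\<close>. There the blocks are short and the error of
  \<open>good_count\<close> is too large.\<close>

definition badset :: "nat => real => real => nat => real => real set" where
 "badset q s e N b = (\<Union>Q\<in>{Q. 1 <= Q & real Q < b}. \<Union>p\<in>{p::int. real q * real Q * s - 1 <= of_int p & of_int p <= real q * real Q * e + 1}.
  {of_int p / (real q * real Q) - 1 / (real q * real Q * real N)..of_int p / (real q * real Q) + 1 / (real q * real Q * real N)})"

lemma finite_Q: "finite {Q::nat. 1 <= Q & real Q < b}"
 by (rule finite_subset[of _ "{..nat \<lceil>b\<rceil>}"]) (auto simp: le_nat_iff, linarith)

text \<open>For each \<open>Q\<close> there are about \<open>q Q (e - s)\<close> intervals of length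
  \<open>2 / (q Q N)\<close>, so \<open>Q\<close> cancels and every denominator contributes
  O(1/N).\<close>

lemma badset_measure:
 assumes q: "q >= 1" and N: "N >= 1" and b: "b >= 0" and se: "s <= e"
 shows "badset q s e N b : sets lb" "measure lb (badset q s e N b) <= b * (2 * (e - s) + 6) / real N"
proof -
 let ?P = "%Q::nat. {p::int. real q * real Q * s - 1 <= of_int p & of_int p <= real q * real Q * e + 1}"
 let ?K = "%Q (p::int). {of_int p / (real q * real Q) - 1 / (real q * real Q * real N)..of_int p / (real q * real Q) + 1 / (real q * real Q * real N)}"
 have fP: "finite (?P Q)" for Q by (rule finite_int_interval_card(1))
 have s1: "(\<Union>p\<in>?P Q. ?K Q p) : sets lb" for Q using fP by (intro sets.finite_UN) auto
 show "badset q s e N b : sets lb" unfolding badset_def by (intro sets.finite_UN finite_Q fP) auto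
 have m1: "measure lb (\<Union>p\<in>?P Q. ?K Q p) <= (2 * (e - s) + 6) / real N" if Q: "Q >= 1" for Q
 proof -
  have qQ: "real q * real Q >= 1" using q Q by (metis of_nat_mono of_nat_1 of_nat_mult mult_le_mono mult_1)
  have "measure lb (\<Union>p\<in>?P Q. ?K Q p) <= (\<Sum>p\<in>?P Q. measure lb (?K Q p))"
   by (rule measure_UNION_le) (use fP in auto)
  also have "... = real (card (?P Q)) * (2 / (real q * real Q * real N))" by simp
  also have "... <= (real q * real Q * (e - s) + 3) * (2 / (real q * real Q * real N))"
  proof (rule mult_right_mono)
   have "real q * real Q * s <= real q * real Q * e" using se by (intro mult_left_mono) auto
   hence "real (card (?P Q)) <= (real q * real Q * e + 1) - (real q * real Q * s - 1) + 1"
    by (intro finite_int_interval_card(2)) simp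
   thus "real (card (?P Q)) <= real q * real Q * (e - s) + 3" by (simp add: algebra_simps)
  qed simp
  also have "... <= (real q * real Q * (e - s + 3)) * (2 / (real q * real Q * real N))"
   using qQ by (intro mult_right_mono) (auto simp: algebra_simps)
  also have "... = (2 * (e - s) + 6) / real N" using qQ N q Q by (simp add: field_simps)
  finally show ?thesis .
 qed
 have "measure lb (badset q s e N b) <= (\<Sum>Q\<in>{Q. 1 <= Q & real Q < b}. measure lb (\<Union>p\<in>?P Q. ?K Q p))"
  unfolding badset_def by (rule measure_UNION_le[OF finite_Q s1])
 also have "... <= real (card {Q::nat. 1 <= Q & real Q < b}) * ((2 * (e - s) + 6) / real N)"
  by (rule sum_bounded_above) (use m1 in auto)
 also have "... <= b * ((2 * (e - s) + 6) / real N)"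
 proof (rule mult_right_mono)
  have "card {Q::nat. 1 <= Q & real Q < b} <= card {1..nat \<lfloor>b\<rfloor>}"
   by (rule card_mono) (auto simp: le_nat_floor)
  thus "real (card {Q::nat. 1 <= Q & real Q < b}) <= b" using b by simp linarith
 qed (use se in simp)
 finally show "measure lb (badset q s e N b) <= b * (2 * (e - s) + 6) / real N" by simp
qed

text \<open>Off the bad set the pointwise estimate applies; on the bad set a lower bound is trivial and the
  total mass is known, so the upper bound on the bad set comes for free.\<close>
lemma farey_L1_explicit:
 fixes s e y b :: real
 assumes q: "q >= 1" and r: "r < q" and se: "s <= e" and y: "y >= 0" and N: "N >= 1" and b: "b > 0"
 shows "set_integrable lb {s..e} (%x. \<Sum>c\<in>Ac q r M. real (ecount x y c))"
  and "(LINT x:{s..e}|lb. abs ((Ne q r M y x) - y * EA q r M))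
  <= 2 * y * (y * EA q r M) + 2 * y * real M + 2 * (y * EA q r M) * (b * (2 * (e - s) + 6) / real N)
   + 2 * (e - s) * (2 * real q * real M * real N * y + 2 * real M / real N + real M / b
     + 2 * real N * (real M + 2 * real q + real q * real N) * y + 3)" (is ?E)
proof -
 define A where "A = y * EA q r M"
 define E where "E = 2 * real q * real M * real N * y + 2 * real M / real N + real M / b
     + 2 * real N * (real M + 2 * real q + real q * real N) * y + 3"
 define \<nu> where "\<nu> = (%x. \<Sum>c\<in>Ac q r M. real (ecount x y c))"
 let ?bad = "badset q s e N b"
 have A0: "A >= 0" using EA_bound y by (simp add: A_def)
 have E0: "E >= 0" using y b by (simp add: E_def)
 have c1: "c : Ac q r M ==> c >= 1" for c by (simp add: Ac_def)
 have int: "set_integrable lb {s..e} \<nu>" unfolding \<nu>_def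
  by (rule set_integrable_sum'(1)) (rule ecount_set_integral(1)[OF c1 se y])
 show "set_integrable lb {s..e} (%x. \<Sum>c\<in>Ac q r M. real (ecount x y c))" using int by (simp add: \<nu>_def)
 have tot: "(LINT x:{s..e}|lb. \<nu> x) <= A * (e - s) + 2 * y * A + 2 * y * real M"
 proof -
  have "(LINT x:{s..e}|lb. \<nu> x) = (\<Sum>c\<in>Ac q r M. LINT x:{s..e}|lb. real (ecount x y c))"
   unfolding \<nu>_def by (rule set_integrable_sum'(2)) (rule ecount_set_integral(1)[OF c1 se y])
  also have "... <= (\<Sum>c\<in>Ac q r M. 2 * y * (real c * (e - s + 2 * y) + 1))"
   by (rule sum_mono) (rule ecount_set_integral(2)[OF c1 se y])
  also have "... = (\<Sum>c\<in>Ac q r M. (y * (e - s + 2 * y)) * (2 * real c) + 2 * y)" by (rule sum.cong) (auto simp: algebra_simps)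
  also have "... = A * (e - s + 2 * y) + 2 * y * real (card (Ac q r M))"
   by (simp only: sum.distrib A_def EA_def sum_distrib_left[symmetric]) (simp add: mult_ac)
  also have "... <= A * (e - s + 2 * y) + 2 * y * real M" using y card_Ac[of q r M] by (simp add: mult_left_mono)
  finally show ?thesis by (simp add: algebra_simps)
 qed
 have good: "abs (\<nu> x - A) <= E" if x: "x : {s..e}" and nb: "x \<notin> ?bad" for x
 proof -
  \<comment> \<open>Dirichlet's theorem is applied to \<open>q x\<close>, since \<open>q\<close> is
    the step of the progression. Off the bad set the denominator found is at least
    \<open>b\<close>.\<close>
  obtain h k where hk: "coprime h k" "0 < k" "k <= int N" "abs (of_int k * (real q * x) - of_int h) < 1 / real N"
   using Dirichlet_approx_coprime[of N "real q * x"] N by auto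
  define Q where "Q = nat k"
  have kQ: "k = int Q" and Q1: "Q >= 1" and QN: "Q <= N" using hk by (auto simp: Q_def)
  have app: "abs (real q * x * real Q - of_int h) <= 1 / real N" using hk(4) by (simp add: kQ mult_ac)
  have Qb: "b <= real Q"
  proof (rule ccontr)
   assume "~ b <= real Q"
   have N1: "1 / real N <= 1" using N by simp
   have pos: "real q * real Q > 0" using q Q1 by simp
   have "real q * real Q * s <= real q * real Q * x" "real q * real Q * x <= real q * real Q * e"
    using x pos by (auto intro: mult_left_mono)
   moreover have "abs (real q * real Q * x - of_int h) <= 1 / real N" using app by (simp add: mult_ac)
   ultimately have hr: "real q * real Q * s - 1 <= of_int h" "of_int h <= real q * real Q * e + 1" using N1 by linarith+
   have "abs (x - of_int h / (real q * real Q)) = abs (real q * real Q * x - of_int h) / (real q * real Q)"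
   proof -
    have "x - of_int h / (real q * real Q) = (real q * real Q * x - of_int h) / (real q * real Q)" using q Q1 by (simp add: diff_divide_distrib)
    thus ?thesis using pos by (simp add: abs_divide)
   qed
   also have "... <= (1 / real N) / (real q * real Q)" using app pos by (intro divide_right_mono) (auto simp: mult_ac)
   also have "... = 1 / (real q * real Q * real N)" by (simp add: mult_ac)
   finally have "abs (x - of_int h / (real q * real Q)) <= 1 / (real q * real Q * real N)" .
   hence "x : {of_int h / (real q * real Q) - 1 / (real q * real Q * real N)..of_int h / (real q * real Q) + 1 / (real q * real Q * real N)}"
    by (auto simp: abs_le_iff)
   hence "x : ?bad" unfolding badset_def using hr Q1 \<open>~ b <= real Q\<close> by (auto intro!: bexI[of _ Q] bexI[of _ h])
   thus False using nb by simp
  qed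
  have "abs (real (\<Sum>c\<in>Ac q r M. ecount x y c) - y * EA q r M)
  <= real M / real Q * (2 * real q * (real Q)^2 * y + 2 * real Q * (1 / real N) + 1)
   + (2 * real Q * (real M + 2 * real q + real q * real Q) * y + 2 * real Q * (1 / real N) + 1)"
   using good_count[OF q r Q1 _ app y] hk(1) kQ by simp
  also have "real M / real Q * (2 * real q * (real Q)^2 * y + 2 * real Q * (1 / real N) + 1)
   = 2 * real q * real M * real Q * y + 2 * real M / real N + real M / real Q"
   using Q1 N by (simp add: field_simps power2_eq_square)
  finally have m: "abs (\<nu> x - A) <= 2 * real q * real M * real Q * y + 2 * real M / real N + real M / real Q
   + (2 * real Q * (real M + 2 * real q + real q * real Q) * y + 2 * real Q * (1 / real N) + 1)" by (simp add: \<nu>_def A_def)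
  have e1: "2 * real q * real M * real Q * y <= 2 * real q * real M * real N * y"
   using QN y by (intro mult_right_mono mult_left_mono) auto
  have e2: "real M / real Q <= real M / b" using Qb b by (intro divide_left_mono) auto
  have e3: "2 * real Q * (real M + 2 * real q + real q * real Q) * y <= 2 * real N * (real M + 2 * real q + real q * real N) * y"
   using QN y by (intro mult_right_mono mult_mono add_mono mult_left_mono) auto
  have e4: "2 * real Q * (1 / real N) <= 2" using QN N by (simp add: field_simps)
  show ?thesis unfolding E_def using m e1 e2 e3 e4 by linarith
 qed
 \<comment> \<open>Off the bad set \<open>\<nu> - A >= - E\<close> gives
   \<open>|\<nu> - A| <= \<nu> - A + 2 E\<close>; on it \<open>|\<nu> - A| <= \<nu> + A\<close>. The
   right side is linear in \<open>\<nu>\<close>, so only the total mass of \<open>\<nu>\<close>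
   enters.\<close>
 have pw: "abs (\<nu> x - A) <= \<nu> x + (2 * E - A) + 2 * A * ind ?bad x" if "x : {s..e}" for x
 proof (cases "x : ?bad")
  case True
  have "\<nu> x >= 0" by (simp add: \<nu>_def sum_nonneg)
  thus ?thesis using True A0 E0 by (simp add: abs_le_iff)
 next
  case False
  thus ?thesis using good[OF that False] by (simp add: abs_le_iff)
 qed
 have ib: "set_integrable lb {s..e} (ind ?bad :: real => real)" "(LINT x:{s..e}|lb. ind ?bad x) <= b * (2 * (e - s) + 6) / real N"
 proof -
  have bs: "?bad : sets lb" and bm: "measure lb ?bad <= b * (2 * (e - s) + 6) / real N"
   using badset_measure[OF q N _ se, of b] b by auto
  have fin: "emeasure lb ?bad < \<infinity>"
  proof -
   have "bounded ?bad" unfolding badset_def using finite_Q finite_int_interval_card(1) by (intro bounded_UN ballI bounded_closed_interval) auto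
   thus ?thesis using emeasure_bounded_finite by blast
  qed
  have i: "integrable lb (ind ?bad :: real => real)" using bs fin by (rule integrable_real_indicator)
  have i2: "integrable lb (%x. ind {s..e} x * ind ?bad x :: real)"
   using integrable_real_mult_indicator[OF _ i, of "{s..e}"] by (simp add: mult.commute)
  thus "set_integrable lb {s..e} (ind ?bad :: real => real)" by (simp add: set_integrable_def)
  have "(LINT x:{s..e}|lb. ind ?bad x) <= (LINT x|lb. ind ?bad x :: real)"
   unfolding set_lebesgue_integral_def real_scaleR_def by (rule integral_mono[OF i2 i]) (auto simp: indicator_def)
  also have "... = measure lb ?bad" by simp
  finally show "(LINT x:{s..e}|lb. ind ?bad x) <= b * (2 * (e - s) + 6) / real N" using bm by simp
 qed
 note ci = borel_integrable_atLeastAtMost'[OF continuous_on_const, of s e]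
 have cv: "(LINT x:{s..e}|lb. k) = (e - s) * k" for k :: real
  using se by (simp add: set_lebesgue_integral_def)
 have "(LINT x:{s..e}|lb. abs (\<nu> x - A)) <= (LINT x:{s..e}|lb. \<nu> x + (2 * E - A) + 2 * A * ind ?bad x)"
  by (rule set_integral_mono[OF set_integrable_abs[OF set_integral_diff(1)[OF int ci]] set_integral_add(1)[OF set_integral_add(1)[OF int ci] set_integrable_mult_right[OF ib(1)]]]) (rule pw)
 also have "... = (LINT x:{s..e}|lb. \<nu> x) + (e - s) * (2 * E - A) + 2 * A * (LINT x:{s..e}|lb. ind ?bad x)"
  by (simp only: set_integral_add(2)[OF set_integral_add(1)[OF int ci] set_integrable_mult_right[OF ib(1)]] set_integral_add(2)[OF int ci] cv set_integral_mult_right)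
 also have "... <= (A * (e - s) + 2 * y * A + 2 * y * real M) + (e - s) * (2 * E - A) + 2 * A * (b * (2 * (e - s) + 6) / real N)"
  using tot ib(2) A0 by (intro add_mono mult_left_mono[OF ib(2)]) auto
 also have "... = 2 * y * A + 2 * y * real M + 2 * A * (b * (2 * (e - s) + 6) / real N) + 2 * (e - s) * E" by (simp add: algebra_simps)
 finally show ?E by (simp only: \<nu>_def A_def E_def)
qed

text \<open>The free parameters are taken proportional to \<open>M\<close>: approximation order
  \<open>N\<close> near \<open>k M\<close> and threshold \<open>b = \<delta> M\<close>. Relative to
  T = y M^2 the errors are of order k from the blocks, \<delta>/k from the bad set, and (1/k +
  1/\<delta>)/T from rounding; k, then \<delta>, then the lower bound for T are chosen in this
  order.\<close>

lemma farey_L1: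
 fixes s e \<epsilon> :: real
 assumes q: "q >= 1" and r: "r < q" and se: "s <= e" and \<epsilon>: "\<epsilon> > 0"
 shows "EX R0>0. ALL R1. EX M0. ALL M>=M0. ALL y>=0. R0 <= y * (real M)^2 --> y * (real M)^2 <= R1 -->
  (LINT x:{s..e}|lb. abs ((Ne q r M y x) - y * EA q r M)) <= \<epsilon> * (y * (real M)^2)" (is "EX R0>0. ALL R1. ?P R0 R1")
proof -
 let ?q = "(12 * real q + 12)"
 define L where "L = e - s"
 have L0: "L >= 0" using se by (simp add: L_def)
 define \<epsilon>' where "\<epsilon>' = \<epsilon> / 5"
 have \<epsilon>': "\<epsilon>' > 0" using \<epsilon> by (simp add: \<epsilon>'_def)
 \<comment> \<open>Makes the block error, whose coefficients are collected in \<open>?q\<close>, at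
   most \<open>\<epsilon>' T\<close>.\<close>
 define k where "k = min 1 (\<epsilon>' / (2 * L * ?q + 1))"
 have den: "2 * L * ?q + 1 > 0" using L0 by (simp add: add_nonneg_pos)
 have k0: "0 < k" "k <= 1" using \<epsilon>' den by (auto simp: k_def)
 have k1: "2 * L * k * ?q <= \<epsilon>'"
 proof -
  have "2 * L * k * ?q = k * (2 * L * ?q)" by simp
  also have "... <= k * (2 * L * ?q + 1)" using k0 by (intro mult_left_mono) auto
  also have "... <= (\<epsilon>' / (2 * L * ?q + 1)) * (2 * L * ?q + 1)"
   using den by (intro mult_right_mono) (auto simp: k_def)
  finally show ?thesis using den by simp
 qed
 \<comment> \<open>Makes the bad-set error exactly \<open>\<epsilon>' T\<close>, once
   \<open>y * EA\<close> is bounded by \<open>2 T\<close>.\<close>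
 define \<delta> where "\<delta> = \<epsilon>' * k / (4 * (2 * L + 6))"
 have \<delta>0: "\<delta> > 0" using \<epsilon>' k0 L0 by (simp add: \<delta>_def)
 have \<delta>1: "4 * (\<delta> * (2 * L + 6) / k) = \<epsilon>'"
 proof -
  have "k ~= 0" "2 * L + 6 ~= 0" using k0 L0 by auto
  moreover have "4 * (\<epsilon>' * k / (4 * w) * w / k) = \<epsilon>'" if "k ~= 0" "w ~= 0" for w using that by simp
  ultimately show ?thesis unfolding \<delta>_def by blast
 qed
 \<comment> \<open>A large expected count makes the rounding terms, which do not grow with
   \<open>T\<close>, negligible. This is why the height in use is \<open>R / M\<^sup>2\<close> with
   a large constant \<open>R\<close>.\<close>
 define R0 where "R0 = 2 * L * (2 / k + 1 / \<delta> + 3) / \<epsilon>' + 1"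
 have R00: "R0 > 0" using L0 k0 \<delta>0 \<epsilon>' by (simp add: R0_def add_nonneg_pos)
 have R01: "2 * L * (2 / k + 1 / \<delta> + 3) <= \<epsilon>' * R0" using \<epsilon>' by (simp add: R0_def field_simps)
 show ?thesis
 proof (intro exI[of _ R0] conjI allI R00)
  fix R1 :: real
  define M0 where "M0 = nat \<lceil>max (1 / k) (max (real q) (max (4 * abs R1 / \<epsilon>') (2 / \<epsilon>')))\<rceil> + 1"
  show "?P R0 R1"
  proof (intro exI[of _ M0] allI impI)
   fix M :: nat and y :: real
   assume M: "M >= M0" and y: "0 <= y" and lo: "R0 <= y * (real M)^2" and hi: "y * (real M)^2 <= R1"
   define T where "T = y * (real M)^2"
   have T0: "T >= 0" using y by (simp add: T_def)
   have "real M >= max (1 / k) (max (real q) (max (4 * abs R1 / \<epsilon>') (2 / \<epsilon>')))"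
    using M unfolding M0_def by linarith
   hence Mk: "1 / k <= real M" and Mq: "real q <= real M" and MR: "4 * abs R1 / \<epsilon>' <= real M" and M2: "2 / \<epsilon>' <= real M" by auto
   have M1: "real M >= 1" using Mq q by simp
   define N where "N = nat \<lceil>k * real M\<rceil>"
   let ?N = "(real M + 2 * real q + real q * real N)"
   have kM: "k * real M >= 1" using Mk k0 by (simp add: field_simps)
   have N1: "N >= 1" and Nl: "k * real M <= real N" and Nu: "real N <= 2 * (k * real M)"
    using kM unfolding N_def by linarith+
   have b0: "\<delta> * real M > 0" using \<delta>0 M1 by simp
   note X = farey_L1_explicit(2)[OF q r se y N1 b0, of M]
   have EA2: "y * EA q r M <= 2 * T" "0 <= y * EA q r M" using EA_bound[of q r M] y mult_left_mono[OF EA_bound(1)[of q r M] y] by (auto simp: T_def)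
   have t1: "2 * y * (y * EA q r M) <= \<epsilon>' * T"
   proof -
    have "2 * y * (y * EA q r M) <= 2 * y * (2 * T)" using y EA2 by (intro mult_left_mono) auto
    also have "... = 4 * y * T" by simp
    also have "... <= \<epsilon>' * T"
    proof (rule mult_right_mono[OF _ T0])
     have "y * real M * 1 <= y * real M * real M" using y M1 by (intro mult_left_mono) auto
     hence "y * real M <= R1" using hi by (simp add: power2_eq_square mult_ac)
     hence "4 * y * real M <= 4 * abs R1" by simp
     also have "... <= \<epsilon>' * real M" using MR \<epsilon>' by (simp add: field_simps)
     finally show "4 * y <= \<epsilon>'" using M1 by simp
    qed
    finally show ?thesis .
   qed
   have t2: "2 * y * real M <= \<epsilon>' * T"
   proof -
    have "2 <= \<epsilon>' * real M" using M2 \<epsilon>' by (simp add: field_simps)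
    hence "2 * (y * real M) <= (\<epsilon>' * real M) * (y * real M)" using y by (intro mult_right_mono) auto
    thus ?thesis by (simp add: T_def power2_eq_square mult_ac)
   qed
   have t3: "2 * (y * EA q r M) * (\<delta> * real M * (2 * (e - s) + 6) / real N) <= \<epsilon>' * T"
   proof -
    have "\<delta> * real M * (2 * L + 6) / real N <= \<delta> * real M * (2 * L + 6) / (k * real M)"
     using Nl kM \<delta>0 L0 M1 k0 N1 by (intro divide_left_mono mult_pos_pos) auto
    also have "... = \<delta> * (2 * L + 6) / k" using M1 k0 by (simp add: field_simps)
    finally have z: "\<delta> * real M * (2 * L + 6) / real N <= \<delta> * (2 * L + 6) / k" .
    have "2 * (y * EA q r M) * (\<delta> * real M * (2 * L + 6) / real N) <= 2 * (2 * T) * (\<delta> * (2 * L + 6) / k)"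
     by (rule mult_mono[OF _ z]) (use EA2 T0 \<delta>0 L0 in auto)
    also have "... = (4 * (\<delta> * (2 * L + 6) / k)) * T" by simp
    finally show ?thesis by (simp only: \<delta>1 L_def[symmetric])
   qed
   have yM: "y * real M * real M = T" by (simp add: T_def power2_eq_square)
   have u1: "2 * real q * real M * real N * y <= 4 * real q * k * T"
   proof -
    have "2 * real q * real M * real N * y <= 2 * real q * real M * (2 * (k * real M)) * y"
     using Nu y by (intro mult_right_mono mult_left_mono) auto
    also have "... = 4 * real q * k * (y * real M * real M)" by simp
    finally show ?thesis by (simp only: yM)
   qed
   have u2: "2 * real M / real N <= 2 / k"
   proof -
    have "2 * real M / real N <= 2 * real M / (k * real M)" using Nl kM M1 k0 N1 by (intro divide_left_mono mult_pos_pos) auto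
    thus ?thesis using M1 by simp
   qed
   have u3: "real M / (\<delta> * real M) = 1 / \<delta>" using M1 by simp
   have u4: "2 * real N * ?N * y <= k * (12 + 8 * real q) * T"
   proof -
    have "real q * real N <= real q * (2 * real M)"
    proof (rule mult_left_mono)
     have "k * real M <= 1 * real M" using k0 by (intro mult_right_mono) auto
     thus "real N <= 2 * real M" using Nu by simp
    qed simp
    hence "real M + 2 * real q + real q * real N <= (3 + 2 * real q) * real M" using Mq by (simp add: algebra_simps)
    hence "2 * real N * ?N * y <= 2 * (2 * (k * real M)) * ((3 + 2 * real q) * real M) * y"
     using Nu y k0 by (intro mult_right_mono mult_mono) auto
    also have "... = k * (12 + 8 * real q) * (y * real M * real M)" by (simp add: algebra_simps)
    finally show ?thesis by (simp only: yM)
   qed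
   have "2 * real q * real M * real N * y + 2 * real M / real N + real M / (\<delta> * real M)
     + 2 * real N * ?N * y + 3 <= k * ?q * T + (2 / k + 1 / \<delta> + 3)"
    using u1 u2 u3 u4 by (simp add: algebra_simps)
   hence "2 * (e - s) * (2 * real q * real M * real N * y + 2 * real M / real N + real M / (\<delta> * real M)
     + 2 * real N * ?N * y + 3) <= 2 * L * (k * ?q * T + (2 / k + 1 / \<delta> + 3))"
    unfolding L_def[symmetric] using L0 by (intro mult_left_mono) auto
   also have "... = (2 * L * k * ?q) * T + 2 * L * (2 / k + 1 / \<delta> + 3)" by (simp add: algebra_simps)
   also have "... <= \<epsilon>' * T + \<epsilon>' * T"
   proof (rule add_mono)
    show "2 * L * k * ?q * T <= \<epsilon>' * T" using k1 T0 by (rule mult_right_mono)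
    have "\<epsilon>' * R0 <= \<epsilon>' * T" using lo \<epsilon>' by (simp add: T_def)
    thus "2 * L * (2 / k + 1 / \<delta> + 3) <= \<epsilon>' * T" using R01 by linarith
   qed
   finally have t4: "2 * (e - s) * (2 * real q * real M * real N * y + 2 * real M / real N + real M / (\<delta> * real M)
     + 2 * real N * ?N * y + 3) <= \<epsilon>' * T + \<epsilon>' * T" .
   have "\<epsilon> * T = \<epsilon>' * T + \<epsilon>' * T + \<epsilon>' * T + \<epsilon>' * T + \<epsilon>' * T" by (simp add: \<epsilon>'_def)
   thus "(LINT x:{s..e}|lb. abs ((Ne q r M y x) - y * EA q r M)) <= \<epsilon> * (y * (real M)^2)"
    unfolding T_def[symmetric] using X t1 t2 t3 t4 by linarith
  qed
 qed
qed

section \<open>Reduced fractions\<close>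

lemma prod_primes_dvd_iff:
 fixes g :: nat
 assumes "finite S" "!!p. p : S ==> prime p"
 shows "\<Prod>S dvd g \<longleftrightarrow> (ALL p:S. p dvd g)"
 using assms
proof (induction S rule: finite_induct)
 case (insert p S)
 have "coprime p (\<Prod>S)" using insert by (intro prod_coprime_right) (metis insertCI primes_coprime)
 hence "p * \<Prod>S dvd g \<longleftrightarrow> p dvd g & \<Prod>S dvd g" by (metis divides_mult dvd_mult_left dvd_mult_right)
 thus ?case using insert by simp
qed simp

text \<open>Legendre's formula: expand the product of \<open>1 - [p divides g]\<close> over the
  primes of \<open>Z\<close>.\<close>

lemma sieve_identity:
 fixes g :: nat
 assumes "finite Z" "!!p. p : Z ==> prime p"
 shows "(\<Sum>S\<in>Pow Z. (-1) ^ card S * of_bool (\<Prod>S dvd g)) = (of_bool (ALL p:Z. ~ p dvd g) :: real)"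
proof -
 have "(\<Prod>p\<in>Z. - of_bool (p dvd g) + 1) = (\<Sum>S\<in>Pow Z. (\<Prod>p\<in>S. - of_bool (p dvd g)) * (\<Prod>p\<in>Z - S. 1 :: real))"
  by (rule prod_add[OF assms(1)])
 also have "... = (\<Sum>S\<in>Pow Z. (-1) ^ card S * of_bool (\<Prod>S dvd g))"
 proof (rule sum.cong[OF refl])
  fix S assume "S : Pow Z"
  hence S: "finite S" "!!p. p : S ==> prime p" using assms finite_subset by auto
  have "(\<Prod>p\<in>S. of_bool (p dvd g) :: real) = of_bool (\<Prod>S dvd g)"
   using prod_primes_dvd_iff[OF S, of g] S(1) by (cases "ALL p:S. p dvd g") (auto intro!: prod.neutral)
  thus "(\<Prod>p\<in>S. - of_bool (p dvd g)) * (\<Prod>p\<in>Z - S. 1) = (-1) ^ card S * (of_bool (\<Prod>S dvd g) :: real)"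
   by (simp add: prod_uminus)
 qed
 also have "(\<Prod>p\<in>Z. - of_bool (p dvd g) + 1) = (of_bool (ALL p:Z. ~ p dvd g) :: real)"
  using assms(1) by (auto simp: of_bool_def)
 finally show ?thesis by simp
qed

definition Bc :: "nat => nat => nat => nat set" where
 "Bc q d M = {c. 1 <= c & c <= M & gcd c q = d}"

lemma finite_Bc [simp]: "finite (Bc q d M)"
 by (rule finite_subset[of _ "{..M}"]) (auto simp: Bc_def)

definition ccount :: "real => real => nat => nat" where
 "ccount x y c = card {a::int. coprime a (int c) & abs (real c * x - of_int a) <= real c * y}"

abbreviation Nc :: "nat => nat => nat => real => real => real" where
 "Nc q d M y x == (\<Sum>c\<in>Bc q d M. real (ccount x y c))"

text \<open>Cancelling the common factor \<open>k\<close> leaves the fraction, and hence its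
  distance from \<open>x\<close>, unchanged.\<close>

lemma card_multiples:
 assumes k: "k >= (1::nat)"
 shows "card {a::int. abs (real (k * c) * x - of_int a) <= real (k * c) * y & int k dvd a} = ecount x y c"
proof -
 have k0: "real k > 0" using k by simp
 have eqv: "abs (real (k * c) * x - of_int (int k * a)) <= real (k * c) * y \<longleftrightarrow> abs (real c * x - of_int a) <= real c * y" for a
 proof -
  have "real (k * c) * x - of_int (int k * a) = real k * (real c * x - of_int a)" by (simp add: algebra_simps)
  hence "abs (real (k * c) * x - of_int (int k * a)) = real k * abs (real c * x - of_int a)" using k0 by (simp add: abs_mult)
  thus ?thesis using k0 by (simp add: mult.assoc)
 qed
 have "{a::int. abs (real (k * c) * x - of_int a) <= real (k * c) * y & int k dvd a} = (*) (int k) ` {a::int. abs (real c * x - of_int a) <= real c * y}"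
  unfolding dvd_def using eqv by blast
 moreover have "inj_on ((*) (int k)) A" for A using k by (auto simp: inj_on_def)
 ultimately show ?thesis unfolding ecount_def by (simp add: card_image)
qed

lemma sum_multiples:
 fixes g :: "nat => real"
 assumes k: "k >= 1"
 shows "(\<Sum>c | 1 <= c & c <= M & P c & k dvd c. g c) = (\<Sum>c | 1 <= c & c <= M div k & P (k * c). g (k * c))"
proof -
 have "{c. 1 <= c & c <= M & P c & k dvd c} = (*) k ` {c. 1 <= c & c <= M div k & P (k * c)}" (is "?A = ?B")
 proof (intro equalityI subsetI)
  fix c assume "c : ?A"
  then obtain j where j: "c = k * j" "1 <= c" "c <= M" "P c" by (auto simp: dvd_def)
  thus "c : ?B" using k by (auto simp: less_eq_div_iff_mult_less_eq mult.commute intro!: image_eqI[of _ _ j] Suc_leI)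
 next
  fix c assume "c : ?B"
  then obtain j where "c = k * j" "1 <= j" "j <= M div k" "P (k * j)" by auto
  thus "c : ?A" using k by (auto simp: less_eq_div_iff_mult_less_eq mult.commute)
 qed
 moreover have "inj_on ((*) k) A" for A using k by (auto simp: inj_on_def)
 ultimately show ?thesis by (simp add: sum.reindex)
qed

text \<open>Once \<open>k\<close> has been divided out of the denominator, the condition
  \<open>gcd (k * c) q = d\<close> depends only on \<open>c\<close> modulo \<open>q\<close>; these
  are the admissible residues.\<close>

definition Rk :: "nat => nat => nat => nat set" where "Rk q d k = {r. r < q & gcd (k * r) q = d}"

lemma finite_Rk [simp]: "finite (Rk q d k)" by (rule finite_subset[of _ "{..<q}"]) (auto simp: Rk_def)

text \<open>Sieving by the primes up to \<open>z\<close> is exact except for pairs whose common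
  divisor has only prime factors above \<open>z\<close>. Such a pair is a multiple by some
  \<open>k > z\<close>, so summing over all these \<open>k\<close> majorises the error.\<close>

lemma sieve_pointwise:
 fixes x y :: real
 assumes q: "q >= 1" and Zdef: "Z = {p. prime p & p <= (z::nat)}"
 shows "abs ((Nc q d M y x) - (\<Sum>S\<in>Pow Z. (-1) ^ card S * (\<Sum>r\<in>Rk q d (\<Prod>S). \<Sum>c\<in>Ac q r (M div \<Prod>S). real (ecount x y c))))
  <= (\<Sum>k\<in>{z<..M}. \<Sum>c\<in>{1..M div k}. real (ecount x y c))"
proof -
 define nr where "nr = (%c::nat. {a::int. abs (real c * x - of_int a) <= real c * y})"
 have fn: "finite (nr c)" for c unfolding nr_def by (rule ecount_finite)
 have finZ: "finite Z" unfolding Zdef by (rule finite_subset[of _ "{..z}"]) auto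
 have prZ: "p : Z ==> prime p" for p by (simp add: Zdef)
 have Sfin: "S : Pow Z ==> finite S" for S using finZ finite_subset by auto
 have kS: "\<Prod>S >= 1" if "S : Pow Z" for S
 proof -
  have "\<Prod>S > 0" using that prZ by (intro prod_pos) (auto simp: prime_gt_0_nat)
  thus ?thesis by simp
 qed
 define G where "G = (%c (a::int). nat (gcd a (int c)))"
 have Gd: "k dvd G c a \<longleftrightarrow> k dvd c & int k dvd a" for k c a
  unfolding G_def by (metis gcd_ge_0_int int_dvd_int_iff int_nat_eq gcd_greatest dvd_trans gcd_dvd1 gcd_dvd2)
 have cc: "real (ccount x y c) = (\<Sum>a\<in>nr c. of_bool (coprime a (int c)))" for c
 proof -
  have "{a::int. coprime a (int c) & abs (real c * x - of_int a) <= real c * y} = nr c \<inter> {a. coprime a (int c)}" by (auto simp: nr_def)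
  thus ?thesis unfolding ccount_def using fn[of c] by (simp add: of_bool_def sum.If_cases)
 qed
 \<comment> \<open>Pairs divisible by \<open>k\<close> correspond to arbitrary pairs with
   denominator at most \<open>M div k\<close>, and the gcd condition splits these into progressions
   modulo \<open>q\<close>.\<close>
 have Ek: "(\<Sum>c\<in>Bc q d M. \<Sum>a\<in>nr c. of_bool (k dvd G c a)) = (\<Sum>r\<in>Rk q d k. \<Sum>c\<in>Ac q r (M div k). real (ecount x y c))" if k: "k >= 1" for k
 proof -
  have in1: "(\<Sum>a\<in>nr c. of_bool (k dvd G c a)) = (if k dvd c then real (card {a\<in>nr c. int k dvd a}) else 0)" for c
   using fn[of c] by (simp add: Gd of_bool_def sum.If_cases Int_def)
  have "(\<Sum>c\<in>Bc q d M. \<Sum>a\<in>nr c. of_bool (k dvd G c a)) = (\<Sum>c\<in>{c\<in>Bc q d M. k dvd c}. real (card {a\<in>nr c. int k dvd a}))"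
   unfolding in1 by (simp add: sum.inter_filter)
  also have "{c\<in>Bc q d M. k dvd c} = {c. 1 <= c & c <= M & gcd c q = d & k dvd c}" by (auto simp: Bc_def)
  also have "(\<Sum>c\<in>\<dots>. real (card {a\<in>nr c. int k dvd a})) = (\<Sum>c | 1 <= c & c <= M div k & gcd (k * c) q = d. real (card {a\<in>nr (k * c). int k dvd a}))"
   by (rule sum_multiples[OF k])
  also have "... = (\<Sum>c | 1 <= c & c <= M div k & gcd (k * c) q = d. real (ecount x y c))"
   using card_multiples[OF k, of _ x y] by (simp add: nr_def)
  also have "{c. 1 <= c & c <= M div k & gcd (k * c) q = d} = (\<Union>r\<in>Rk q d k. Ac q r (M div k))"
  proof -
   have "gcd (k * c) q = gcd (k * (c mod q)) q" for c by (metis gcd.commute gcd_red_nat mod_mult_right_eq)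
   thus ?thesis using q by (auto simp: Rk_def Ac_def)
  qed
  also have "(\<Sum>c\<in>\<dots>. real (ecount x y c)) = (\<Sum>r\<in>Rk q d k. \<Sum>c\<in>Ac q r (M div k). real (ecount x y c))"
   by (rule sum.UNION_disjoint) (auto simp: Ac_def)
  finally show ?thesis .
 qed
 have "(\<Sum>S\<in>Pow Z. (-1) ^ card S * (\<Sum>r\<in>Rk q d (\<Prod>S). \<Sum>c\<in>Ac q r (M div \<Prod>S). real (ecount x y c)))
   = (\<Sum>S\<in>Pow Z. (-1) ^ card S * (\<Sum>c\<in>Bc q d M. \<Sum>a\<in>nr c. of_bool (\<Prod>S dvd G c a)))"
  using Ek[OF kS] by (intro sum.cong) auto
 also have "... = (\<Sum>S\<in>Pow Z. \<Sum>c\<in>Bc q d M. \<Sum>a\<in>nr c. (-1) ^ card S * of_bool (\<Prod>S dvd G c a))"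
  by (simp add: sum_distrib_left)
 also have "... = (\<Sum>c\<in>Bc q d M. \<Sum>S\<in>Pow Z. \<Sum>a\<in>nr c. (-1) ^ card S * of_bool (\<Prod>S dvd G c a))"
  by (rule sum.swap)
 also have "... = (\<Sum>c\<in>Bc q d M. \<Sum>a\<in>nr c. \<Sum>S\<in>Pow Z. (-1) ^ card S * of_bool (\<Prod>S dvd G c a))"
  by (intro sum.cong refl) (rule sum.swap)
 also have "... = (\<Sum>c\<in>Bc q d M. \<Sum>a\<in>nr c. of_bool (ALL p:Z. ~ p dvd G c a))"
  by (simp only: sieve_identity[OF finZ prZ])
 finally have sv: "(\<Sum>S\<in>Pow Z. (-1) ^ card S * (\<Sum>r\<in>Rk q d (\<Prod>S). \<Sum>c\<in>Ac q r (M div \<Prod>S). real (ecount x y c)))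
  = (\<Sum>c\<in>Bc q d M. \<Sum>a\<in>nr c. of_bool (ALL p:Z. ~ p dvd G c a))" .
 have pt: "abs (of_bool (coprime a (int c)) - of_bool (ALL p:Z. ~ p dvd G c a)) <= (\<Sum>k\<in>{z<..M}. of_bool (k dvd G c a) :: real)"
  if c: "c : Bc q d M" for c and a :: int
 proof (cases "coprime a (int c)")
  case True
  have "~ p dvd G c a" if "p : Z" for p
   using True prZ[OF that] unfolding Gd by (metis coprime_common_divisor nat_dvd_1_iff_1 of_nat_1 int_dvd_int_iff not_prime_1 zdvd1_eq nat_int abs_of_nat of_nat_eq_1_iff)
  thus ?thesis using True by (simp add: sum_nonneg)
 next
  case False
  have G1: "G c a ~= 1" using False unfolding G_def coprime_iff_gcd_eq_1 by (metis gcd_ge_0_int int_nat_eq of_nat_1)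
  then obtain p where p: "prime p" "p dvd G c a" using prime_factor_nat by blast
  have pc: "p <= M" using p c unfolding Gd Bc_def by (auto dest: dvd_imp_le)
  show ?thesis
  proof (cases "p <= z")
   case True
   hence "~ (ALL p:Z. ~ p dvd G c a)" using p by (auto simp: Zdef)
   hence "of_bool (ALL p:Z. ~ p dvd G c a) = (0::real)" by (simp only: of_bool_eq)
   moreover have "(\<Sum>k\<in>{z<..M}. of_bool (k dvd G c a) :: real) >= 0" by (intro sum_nonneg) auto
   moreover have "of_bool (coprime a (int c)) = (0::real)" using False by simp
   ultimately show ?thesis by linarith
  next
   case F2: False
   have "(1::real) = of_bool (p dvd G c a)" using p by simp
   also have "... <= (\<Sum>k\<in>{z<..M}. of_bool (k dvd G c a))" using F2 pc by (intro member_le_sum) auto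
   finally show ?thesis by (auto simp: of_bool_def)
  qed
 qed
 have "abs ((Nc q d M y x) - (\<Sum>c\<in>Bc q d M. \<Sum>a\<in>nr c. of_bool (ALL p:Z. ~ p dvd G c a)))
  = abs (\<Sum>c\<in>Bc q d M. \<Sum>a\<in>nr c. of_bool (coprime a (int c)) - of_bool (ALL p:Z. ~ p dvd G c a))"
  by (simp only: cc sum_subtractf)
 also have "... <= (\<Sum>c\<in>Bc q d M. \<Sum>a\<in>nr c. \<Sum>k\<in>{z<..M}. of_bool (k dvd G c a))"
  using pt by (intro order_trans[OF sum_abs] sum_mono) (auto intro!: order_trans[OF sum_abs] sum_mono)
 also have "... = (\<Sum>c\<in>Bc q d M. \<Sum>k\<in>{z<..M}. \<Sum>a\<in>nr c. of_bool (k dvd G c a))" by (intro sum.cong refl) (rule sum.swap)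
 also have "... = (\<Sum>k\<in>{z<..M}. \<Sum>c\<in>Bc q d M. \<Sum>a\<in>nr c. of_bool (k dvd G c a))" by (rule sum.swap)
 also have "... <= (\<Sum>k\<in>{z<..M}. \<Sum>c\<in>{1..M div k}. real (ecount x y c))"
 proof (rule sum_mono)
  fix k assume "k : {z<..M}"
  hence k: "k >= 1" by auto
  have "(\<Sum>c\<in>Bc q d M. \<Sum>a\<in>nr c. of_bool (k dvd G c a) :: real) = (\<Sum>r\<in>Rk q d k. \<Sum>c\<in>Ac q r (M div k). real (ecount x y c))" by (rule Ek[OF k])
  also have "... = (\<Sum>c\<in>(\<Union>r\<in>Rk q d k. Ac q r (M div k)). real (ecount x y c))"
   by (rule sum.UNION_disjoint[symmetric]) (auto simp: Ac_def)
  also have "... <= (\<Sum>c\<in>{1..M div k}. real (ecount x y c))" by (rule sum_mono2) (auto simp: Ac_def)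
  finally show "(\<Sum>c\<in>Bc q d M. \<Sum>a\<in>nr c. of_bool (k dvd G c a) :: real) <= (\<Sum>c\<in>{1..M div k}. real (ecount x y c))" .
 qed
 finally show ?thesis unfolding sv .
qed

lemma sum_inverse_squares_tail:
 assumes "z >= 1"
 shows "(\<Sum>k\<in>{z<..M}. 1 / (real k)^2) <= 1 / real z"
proof (cases "z <= M")
 case True
 have "(\<Sum>k\<in>{z<..M}. 1 / (real k)^2) <= 1 / real z - 1 / real M"
  using True
 proof (induction M rule: dec_induct)
  case (step n)
  have n: "n >= 1" using step assms by simp
  have "{z<..Suc n} = insert (Suc n) {z<..n}" using step by auto
  hence "(\<Sum>k\<in>{z<..Suc n}. 1 / (real k)^2) = (\<Sum>k\<in>{z<..n}. 1 / (real k)^2) + 1 / (real (Suc n))^2" by simp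
  also have "1 / (real (Suc n))^2 <= 1 / real n - 1 / real (Suc n)"
  proof -
   have "1 / real n - 1 / real (Suc n) = 1 / (real n * real (Suc n))" using n by (simp add: field_simps)
   moreover have "1 / (real (Suc n))^2 <= 1 / (real n * real (Suc n))"
    unfolding power2_eq_square using n by (intro divide_left_mono mult_right_mono) auto
   ultimately show ?thesis by linarith
  qed
  finally show ?case using step by linarith
 qed (simp add: sum_nonneg)
 thus ?thesis by (smt (verit) divide_nonneg_nonneg of_nat_0_le_iff)
qed simp

lemma real_div_bounds: "real (M div k) <= real M / real k" "real M / real k - 1 <= real (M div k)"
 using floor_correct[of "real M / real k"] unfolding floor_divide_of_nat_eq by simp_all

text \<open>A truncated sieve with fixed \<open>z\<close> leaves finitely many progressions, to each
  of which \<open>farey_L1\<close> applies with \<open>M\<close> divided by a squarefree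
  \<open>k\<close>; the tail converges like the sum of \<open>1 / k\<^sup>2\<close>. Both
  \<open>\<kappa>\<close> and \<open>R\<close> may depend on the tolerance.\<close>

lemma coprime_L1:
 fixes s e \<epsilon> :: real
 assumes q: "q >= 1" and se: "s <= e" and \<epsilon>: "\<epsilon> > 0"
 shows "EX \<kappa> R. R >= 1 & (EX M0. ALL M>=M0.
  (LINT x:{s..e}|lb. abs ((\<Sum>c\<in>Bc q d M. real (ccount x (R / (real M)^2) c)) - \<kappa> * R)) <= \<epsilon> * R)"
proof -
 define L where "L = e - s"
 have L0: "L >= 0" using se by (simp add: L_def)
 \<comment> \<open>The tail beyond \<open>z\<close> costs at most \<open>2 (L + 3) R / z\<close>;
   this choice makes it \<open>\<epsilon> / 4\<close> times \<open>R\<close>.\<close>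
 define z where "z = nat \<lceil>8 * (L + 3) / \<epsilon>\<rceil> + 1"
 have z1: "z >= 1" by (simp add: z_def)
 have z2: "2 * (L + 3) / real z <= \<epsilon> / 4"
 proof -
  have "8 * (L + 3) / \<epsilon> <= real z" unfolding z_def by linarith
  thus ?thesis using \<epsilon> z1 by (simp add: field_simps)
 qed
 define Z where "Z = {p. prime p & p <= z}"
 have finZ: "finite Z" unfolding Z_def by (rule finite_subset[of _ "{..z}"]) auto
 define K where "K = \<Prod>Z"
 have K1: "K >= 1" unfolding K_def Z_def by (metis (no_types, lifting) Suc_leI One_nat_def mem_Collect_eq prime_gt_0_nat prod_pos)
 have SK: "1 <= \<Prod>S" "\<Prod>S <= K" if "S : Pow Z" for S
 proof -
  have "\<Prod>S > 0" using that by (intro prod_pos) (auto simp: Z_def prime_gt_0_nat)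
  thus "1 <= \<Prod>S" by simp
  have "\<Prod>S dvd K" unfolding K_def using that finZ by (intro prod_dvd_prod_subset) auto
  thus "\<Prod>S <= K" using K1 by (auto dest: dvd_imp_le)
 qed
 define n where "n = real (card (Pow Z)) * real q"
 have n1: "n >= 1"
 proof -
  have "card (Pow Z) >= 1" using finZ by (simp add: card_Pow)
  hence "card (Pow Z) * q >= 1 * 1" using q by (intro mult_le_mono) auto
  thus ?thesis unfolding n_def by (metis of_nat_1 of_nat_mono of_nat_mult mult_1)
 qed
 define \<epsilon>1 where "\<epsilon>1 = \<epsilon> / (4 * n)"
 have \<epsilon>1: "\<epsilon>1 > 0" using \<epsilon> n1 by (simp add: \<epsilon>1_def)
 have "ALL r:{..<q}. EX R0>0. ALL R1. EX M0. ALL M>=M0. ALL y>=0. R0 <= y * (real M)^2 --> y * (real M)^2 <= R1 -->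
  (LINT x:{s..e}|lb. abs ((Ne q r M y x) - y * EA q r M)) <= \<epsilon>1 * (y * (real M)^2)"
  using farey_L1[OF q _ se \<epsilon>1] by simp
 then obtain R0 where R0: "!!r. r < q ==> R0 r > 0" and R0': "!!r R1. r < q ==> EX M0. ALL M>=M0. ALL y>=0. R0 r <= y * (real M)^2 --> y * (real M)^2 <= R1 -->
  (LINT x:{s..e}|lb. abs ((Ne q r M y x) - y * EA q r M)) <= \<epsilon>1 * (y * (real M)^2)"
  unfolding bchoice_iff by auto
 \<comment> \<open>For every modulus \<open>k <= K\<close> of the sieve, \<open>M div k\<close> is
   at least \<open>M / (2 K)\<close>, so \<open>y (M div k)\<^sup>2 >= R / (4 K\<^sup>2)\<close>.
   The definition keeps this above all the thresholds \<open>R0 r\<close>.\<close>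
 define R where "R = 4 * (real K)^2 * (\<Sum>r<q. R0 r) + 1"
 have sR: "(\<Sum>r<q. R0 r) >= 0" using R0 by (intro sum_nonneg) (auto intro: less_imp_le)
 have R1: "R >= 1" using sR by (simp add: R_def)
 have RR0: "R0 r <= R / (4 * (real K)^2)" if "r < q" for r
 proof -
  have "R0 r <= (\<Sum>r<q. R0 r)" using that R0 by (intro member_le_sum) (auto intro: less_imp_le)
  also have "... = 4 * (real K)^2 * (\<Sum>r<q. R0 r) / (4 * (real K)^2)" using K1 by simp
  also have "... <= R / (4 * (real K)^2)" unfolding R_def by (intro divide_right_mono) auto
  finally show ?thesis .
 qed
 obtain M0 where M0: "!!r M y. r < q ==> M >= M0 r ==> y >= 0 ==> R0 r <= y * (real M)^2 ==> y * (real M)^2 <= R ==>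
  (LINT x:{s..e}|lb. abs ((Ne q r M y x) - y * EA q r M)) <= \<epsilon>1 * (y * (real M)^2)"
 proof -
  have "ALL r. EX M0. r < q --> (ALL M>=M0. ALL y>=0. R0 r <= y * (real M)^2 --> y * (real M)^2 <= R -->
  (LINT x:{s..e}|lb. abs ((Ne q r M y x) - y * EA q r M)) <= \<epsilon>1 * (y * (real M)^2))"
   using R0'[where ?R1.0 = R] by blast
  from choice[OF this] show ?thesis using that by blast
 qed
 \<comment> \<open>The expected count divided by \<open>R\<close>, read off from the truncated
   sieve. It depends on \<open>z\<close> and thus on \<open>\<epsilon>\<close>; it is compared only
   with itself later on.\<close>
 define \<kappa> where "\<kappa> = (\<Sum>S\<in>Pow Z. (-1) ^ card S * (\<Sum>r\<in>Rk q d (\<Prod>S). 1 / (real q * (real (\<Prod>S))^2)))"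
 define M1 where "M1 = K * (1 + (\<Sum>r<q. M0 r)) + nat \<lceil>R\<rceil> + nat \<lceil>4 * n * L * (8 + 6 * real q) / \<epsilon>\<rceil> + 1"
 show ?thesis
 proof (rule exI[of _ \<kappa>], rule exI[of _ R], intro conjI exI[of _ M1] allI impI R1)
  fix M assume M: "M >= M1"
  define y where "y = R / (real M)^2"
  have MM: "real M >= 1" "real M >= R" "real M >= 4 * n * L * (8 + 6 * real q) / \<epsilon>" "M >= K * (1 + (\<Sum>r<q. M0 r))"
  proof -
   have "M >= 1" using M unfolding M1_def by linarith
   thus "real M >= 1" by simp
   have "M >= nat \<lceil>R\<rceil>" "M >= nat \<lceil>4 * n * L * (8 + 6 * real q) / \<epsilon>\<rceil>" using M unfolding M1_def by linarith+
   thus "real M >= R" "real M >= 4 * n * L * (8 + 6 * real q) / \<epsilon>" by linarith+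
   show "M >= K * (1 + (\<Sum>r<q. M0 r))" using M unfolding M1_def by linarith
  qed
  have y0: "y > 0" using MM R1 by (simp add: y_def)
  have yM: "y * (real M)^2 = R" using MM by (simp add: y_def)
  have y1: "y <= 1"
  proof -
   have "R <= real M * 1" using MM by simp
   also have "... <= real M * real M" using MM by (intro mult_left_mono) auto
   finally show ?thesis using MM by (simp add: y_def power2_eq_square divide_le_eq)
  qed
  define \<nu> where "\<nu> = (%S r x. \<Sum>c\<in>Ac q r (M div \<Prod>S). real (ecount x y c))"
  define B where "B = R * (8 + 6 * real q) / real M"
  define tl where "tl = (%x. \<Sum>k\<in>{z<..M}. \<Sum>c\<in>{1..M div k}. real (ecount x y c))"
  let ?v = "%S r x. abs (\<nu> S r x - y * EA q r (M div \<Prod>S)) + B"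
  \<comment> \<open>Rounding in \<open>M div k\<close> and in the length of the progression costs
    O(M) in \<open>EA\<close>, hence O(1/M) after multiplication by
    \<open>y = R / M\<^sup>2\<close>.\<close>
  have EAk: "abs (y * EA q r (M div k) - R / (real q * (real k)^2)) <= B" if r: "r < q" and k: "1 <= k" for r k
  proof -
   let ?m = "real (M div k)"
   have mM: "?m <= real M" by simp
   have mk: "?m <= real M / real k" by (rule real_div_bounds(1))
   have mk2: "real M / real k - 1 <= ?m" using real_div_bounds(2)[of M k] by linarith
   have Mk: "real M / real k <= real M" using k by (simp add: divide_le_eq mult_le_cancel_left1)
   have a: "abs (?m^2 - (real M / real k)^2) <= 2 * real M"
   proof -
    have "?m^2 - (real M / real k)^2 = (?m - real M / real k) * (?m + real M / real k)" by (simp add: power2_eq_square algebra_simps)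
    also have "abs (...) = abs (?m - real M / real k) * abs (?m + real M / real k)" by (rule abs_mult)
    also have "... <= 1 * (2 * real M)" using mM mk mk2 Mk by (intro mult_mono) (auto simp: abs_le_iff)
    finally show ?thesis by simp
   qed
   have "abs (?m^2 / real q - (real M / real k)^2 / real q) <= 2 * real M"
   proof -
    have "abs (?m^2 / real q - (real M / real k)^2 / real q) = abs (?m^2 - (real M / real k)^2) / real q"
     by (simp add: diff_divide_distrib[symmetric] abs_divide)
    also have "... <= abs (?m^2 - (real M / real k)^2)" using q by (simp add: divide_le_eq mult_le_cancel_left1)
    finally show ?thesis using a by linarith
   qed
   hence "abs (EA q r (M div k) - (real M / real k)^2 / real q) <= 8 * real M + 6 * real q"
    using EA_asymp[OF q r, of "M div k"] mM by linarith
   also have "... <= (8 + 6 * real q) * real M" using MM q by (simp add: algebra_simps)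
   finally have "y * abs (EA q r (M div k) - (real M / real k)^2 / real q) <= y * ((8 + 6 * real q) * real M)"
    using y0 by (intro mult_left_mono) auto
   also have "... = B" using MM by (simp add: B_def y_def power2_eq_square field_simps)
   also have "y * abs (EA q r (M div k) - (real M / real k)^2 / real q) = abs (y * EA q r (M div k) - y * ((real M / real k)^2 / real q))"
    using y0 by (simp only: right_diff_distrib[symmetric] abs_mult abs_of_pos)
   also have "y * ((real M / real k)^2 / real q) = R / (real q * (real k)^2)" using yM by (simp add: power_divide field_simps)
   finally show ?thesis .
  qed
  have int\<nu>: "set_integrable lb {s..e} (\<nu> S r)" for S r unfolding \<nu>_def
   by (rule set_integrable_sum'(1)) (rule ecount_set_integral(1)[OF _ se less_imp_le[OF y0]], simp add: Ac_def)
  note ci = borel_integrable_atLeastAtMost'[OF continuous_on_const, of s e]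
  have cv: "(LINT x:{s..e}|lb. k) = L * k" for k :: real
   using se by (simp add: set_lebesgue_integral_def L_def)
  have I1: "set_integrable lb {s..e} (%x. abs (\<nu> S r x - y * EA q r (M div \<Prod>S)))" for S r
   by (rule set_integrable_abs[OF set_integral_diff(1)[OF int\<nu> ci]])
  have I2: "set_integrable lb {s..e} (%x. ?v S r x)" for S r
   by (rule set_integral_add(1)[OF I1 ci])
  have J2: "(LINT x:{s..e}|lb. ?v S r x) <= \<epsilon>1 * R + L * B" if S: "S : Pow Z" and r: "r < q" for S r
  proof -
   have kK: "M div \<Prod>S >= 1 + (\<Sum>r<q. M0 r)"
   proof -
    have "\<Prod>S * (1 + (\<Sum>r<q. M0 r)) <= M" using SK(2)[OF S] MM(4) mult_le_mono1 order_trans by blast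
    thus ?thesis using SK(1)[OF S] by (simp add: less_eq_div_iff_mult_less_eq mult.commute)
   qed
   have "M0 r <= (\<Sum>r<q. M0 r)" using r by (intro member_le_sum) auto
   hence mr: "M div \<Prod>S >= M0 r" using kK by linarith
   have k0: "real (\<Prod>S) >= 1" using SK(1)[OF S] by (simp del: of_nat_prod)
   have up: "y * (real (M div \<Prod>S))^2 <= R" unfolding yM[symmetric] using y0 by (intro mult_left_mono power_mono) auto
   have lo: "R0 r <= y * (real (M div \<Prod>S))^2"
   proof -
    have "real M / real (\<Prod>S) - 1 <= real (M div \<Prod>S)" using real_div_bounds(2)[of M "\<Prod>S"] by linarith
    moreover have "1 <= real (M div \<Prod>S)" using kK by linarith
    ultimately have "real M / (2 * real (\<Prod>S)) <= real (M div \<Prod>S)" by simp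
    moreover have "real M / (2 * real K) <= real M / (2 * real (\<Prod>S))"
    proof (rule divide_left_mono)
     show "2 * real (\<Prod>S) <= 2 * real K" using SK(2)[OF S] of_nat_mono by (metis mult_left_mono zero_le_numeral)
     have "real K >= 1" using K1 by simp
     thus "0 < 2 * real K * (2 * real (\<Prod>S))" using k0 by (intro mult_pos_pos) linarith+
    qed simp
    ultimately have "(real M / (2 * real K))^2 <= (real (M div \<Prod>S))^2" by (intro power_mono) auto
    hence "y * (real M / (2 * real K))^2 <= y * (real (M div \<Prod>S))^2" using y0 by (intro mult_left_mono) auto
    moreover have "y * (real M / (2 * real K))^2 = R / (4 * (real K)^2)" using yM by (simp add: power_divide power_mult_distrib)
    ultimately show ?thesis using RR0[OF r] by linarith
   qed
   have "(LINT x:{s..e}|lb. abs (\<nu> S r x - y * EA q r (M div \<Prod>S))) <= \<epsilon>1 * (y * (real (M div \<Prod>S))^2)"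
    unfolding \<nu>_def by (rule M0[OF r mr less_imp_le[OF y0] lo up])
   also have "... <= \<epsilon>1 * R" using up \<epsilon>1 by simp
   finally show ?thesis by (simp only: set_integral_add(2)[OF I1 ci] cv add_le_cancel_right)
  qed
  have It: "set_integrable lb {s..e} tl" unfolding tl_def
   by (intro set_integrable_sum'(1)) (rule ecount_set_integral(1)[OF _ se less_imp_le[OF y0]], simp)
  have Jt: "(LINT x:{s..e}|lb. tl x) <= \<epsilon> / 4 * R"
  proof -
   have i1: "set_integrable lb {s..e} (%x. real (ecount x y c))" if "c : {1..M div k}" for c k
    using that by (intro ecount_set_integral(1)[OF _ se less_imp_le[OF y0]]) simp
   have "(LINT x:{s..e}|lb. tl x) = (\<Sum>k\<in>{z<..M}. LINT x:{s..e}|lb. (\<Sum>c\<in>{1..M div k}. real (ecount x y c)))"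
    unfolding tl_def by (rule set_integrable_sum'(2)) (rule set_integrable_sum'(1)[OF i1])
   also have "... = (\<Sum>k\<in>{z<..M}. \<Sum>c\<in>{1..M div k}. LINT x:{s..e}|lb. real (ecount x y c))"
    by (intro sum.cong refl set_integrable_sum'(2)) (rule i1)
   also have "... <= (\<Sum>k\<in>{z<..M}. (2 * (L + 3) * R) * (1 / (real k)^2))"
   proof (rule sum_mono)
    fix k assume "k : {z<..M}"
    hence k: "k >= 1" using z1 by auto
    let ?m = "real (M div k)"
    have "(\<Sum>c\<in>{1..M div k}. LINT x:{s..e}|lb. real (ecount x y c)) <= (\<Sum>c\<in>{1..M div k}. 2 * y * (?m * (L + 3)))"
    proof (rule sum_mono)
     fix c assume c: "c : {1..M div k}"
     have "(LINT x:{s..e}|lb. real (ecount x y c)) <= 2 * y * (real c * (e - s + 2 * y) + 1)"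
      using c by (intro ecount_set_integral(2)[OF _ se less_imp_le[OF y0]]) simp
     also have "... <= 2 * y * (?m * (L + 3))"
     proof (rule mult_left_mono)
      have "real c * (e - s + 2 * y) <= ?m * (L + 2)" using c y0 y1 L0 by (intro mult_mono) (auto simp: L_def)
      moreover have "1 <= ?m" using c by (auto simp: Suc_le_eq intro: less_le_trans)
      ultimately show "real c * (e - s + 2 * y) + 1 <= ?m * (L + 3)" by (simp add: algebra_simps)
     qed (use y0 in simp)
     finally show "(LINT x:{s..e}|lb. real (ecount x y c)) <= 2 * y * (?m * (L + 3))" .
    qed
    also have "... = 2 * (L + 3) * y * ?m^2" by (simp add: power2_eq_square)
    also have "... <= 2 * (L + 3) * y * (real M / real k)^2"
     using y0 L0 real_div_bounds(1)[of M k] by (intro mult_left_mono power_mono) auto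
    also have "... = (2 * (L + 3) * R) * (1 / (real k)^2)" unfolding yM[symmetric] by (simp add: power_divide)
    finally show "(\<Sum>c\<in>{1..M div k}. LINT x:{s..e}|lb. real (ecount x y c)) <= (2 * (L + 3) * R) * (1 / (real k)^2)" .
   qed
   also have "... = (2 * (L + 3) * R) * (\<Sum>k\<in>{z<..M}. 1 / (real k)^2)" by (rule sum_distrib_left[symmetric])
   also have "... <= (2 * (L + 3) * R) * (1 / real z)" using L0 R1 by (intro mult_left_mono sum_inverse_squares_tail z1) auto
   also have "... = 2 * (L + 3) / real z * R" by simp
   also have "... <= \<epsilon> / 4 * R" using z2 R1 by (intro mult_right_mono) auto
   finally show ?thesis .
  qed
  define H where "H = (%x. (\<Sum>S\<in>Pow Z. \<Sum>r\<in>Rk q d (\<Prod>S). ?v S r x) + tl x)"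
  have pw: "abs ((Nc q d M y x) - \<kappa> * R) <= H x" for x
  proof -
   have "(\<Sum>S\<in>Pow Z. (-1) ^ card S * (\<Sum>r\<in>Rk q d (\<Prod>S). \<nu> S r x)) - \<kappa> * R
    = (\<Sum>S\<in>Pow Z. (-1) ^ card S * (\<Sum>r\<in>Rk q d (\<Prod>S). \<nu> S r x - R / (real q * (real (\<Prod>S))^2)))"
    unfolding \<kappa>_def sum_distrib_right sum_subtractf[symmetric]
    by (intro sum.cong refl) (simp add: sum_subtractf right_diff_distrib)
   also have "abs (...) <= (\<Sum>S\<in>Pow Z. \<Sum>r\<in>Rk q d (\<Prod>S). ?v S r x)"
   proof (rule order_trans[OF sum_abs sum_mono])
    fix S assume S: "S : Pow Z"
    have "abs ((-1) ^ card S * (\<Sum>r\<in>Rk q d (\<Prod>S). \<nu> S r x - R / (real q * (real (\<Prod>S))^2)))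
     = abs (\<Sum>r\<in>Rk q d (\<Prod>S). \<nu> S r x - R / (real q * (real (\<Prod>S))^2))" by (simp add: abs_mult power_abs)
    also have "... <= (\<Sum>r\<in>Rk q d (\<Prod>S). ?v S r x)"
    proof (rule order_trans[OF sum_abs sum_mono])
     fix r assume "r : Rk q d (\<Prod>S)"
     hence "r < q" by (simp add: Rk_def)
     from EAk[OF this SK(1)[OF S]]
     show "abs (\<nu> S r x - R / (real q * (real (\<Prod>S))^2)) <= ?v S r x" by linarith
    qed
    finally show "abs ((-1) ^ card S * (\<Sum>r\<in>Rk q d (\<Prod>S). \<nu> S r x - R / (real q * (real (\<Prod>S))^2))) <= (\<Sum>r\<in>Rk q d (\<Prod>S). ?v S r x)" .
   qed
   finally show ?thesis using sieve_pointwise[OF q Z_def, where d = d and M = M and x = x and y = y] unfolding H_def tl_def \<nu>_def by linarith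
  qed
  have intc: "set_integrable lb {s..e} (%x. \<Sum>c\<in>Bc q d M. real (ccount x y c))"
   unfolding ccount_def by (rule set_integrable_sum'(1)) (rule card_set_integral(1)[OF _ se less_imp_le[OF y0]], simp add: Bc_def)
  have IH: "set_integrable lb {s..e} H" unfolding H_def
   by (rule set_integral_add(1)[OF set_integrable_sum'(1)[OF set_integrable_sum'(1)[OF I2]] It])
  have "(LINT x:{s..e}|lb. abs ((Nc q d M y x) - \<kappa> * R)) <= (LINT x:{s..e}|lb. H x)"
   by (rule set_integral_mono[OF set_integrable_abs[OF set_integral_diff(1)[OF intc ci]] IH]) (rule pw)
  also have "... = (\<Sum>S\<in>Pow Z. \<Sum>r\<in>Rk q d (\<Prod>S). LINT x:{s..e}|lb. ?v S r x) + (LINT x:{s..e}|lb. tl x)"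
   unfolding H_def by (simp only: set_integral_add(2)[OF set_integrable_sum'(1)[OF set_integrable_sum'(1)[OF I2]] It]
    set_integrable_sum'(2)[OF set_integrable_sum'(1)[OF I2]] set_integrable_sum'(2)[OF I2])
  also have "... <= n * (\<epsilon>1 * R + L * B) + \<epsilon> / 4 * R"
  proof (rule add_mono[OF _ Jt])
   have nn: "\<epsilon>1 * R + L * B >= 0" using \<epsilon>1 R1 L0 by (simp add: B_def)
   have "(\<Sum>S\<in>Pow Z. \<Sum>r\<in>Rk q d (\<Prod>S). LINT x:{s..e}|lb. ?v S r x) <= (\<Sum>S\<in>Pow Z. real q * (\<epsilon>1 * R + L * B))"
   proof (rule sum_mono)
    fix S assume S: "S : Pow Z"
    have "(\<Sum>r\<in>Rk q d (\<Prod>S). LINT x:{s..e}|lb. ?v S r x) <= real (card (Rk q d (\<Prod>S))) * (\<epsilon>1 * R + L * B)"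
     by (rule sum_bounded_above) (rule J2[OF S], simp add: Rk_def)
    also have "... <= real q * (\<epsilon>1 * R + L * B)"
    proof (rule mult_right_mono[OF _ nn])
     have "card (Rk q d (\<Prod>S)) <= card {..<q}" by (rule card_mono) (auto simp: Rk_def)
     thus "real (card (Rk q d (\<Prod>S))) <= real q" by simp
    qed
    finally show "(\<Sum>r\<in>Rk q d (\<Prod>S). LINT x:{s..e}|lb. ?v S r x) <= real q * (\<epsilon>1 * R + L * B)" .
   qed
   also have "... = n * (\<epsilon>1 * R + L * B)" by (simp only: sum_constant n_def mult_ac)
   finally show "(\<Sum>S\<in>Pow Z. \<Sum>r\<in>Rk q d (\<Prod>S). LINT x:{s..e}|lb. ?v S r x) <= n * (\<epsilon>1 * R + L * B)" .
  qed
  also have "... <= \<epsilon> * R"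
  proof -
   have "n * (\<epsilon>1 * R) = \<epsilon> / 4 * R" using n1 by (simp add: \<epsilon>1_def)
   moreover have "n * (L * B) <= \<epsilon> / 4 * R"
   proof -
    have "4 * n * L * (8 + 6 * real q) <= \<epsilon> * real M" using MM(3) \<epsilon> by (simp add: field_simps)
    hence "n * L * (8 + 6 * real q) / real M <= \<epsilon> / 4" using MM(1) by (simp add: field_simps)
    hence "n * L * (8 + 6 * real q) / real M * R <= \<epsilon> / 4 * R" using R1 by (intro mult_right_mono) auto
    thus ?thesis by (simp add: B_def mult_ac)
   qed
   moreover have "\<epsilon> * R >= 0" using \<epsilon> R1 by simp
   ultimately show ?thesis unfolding distrib_left by linarith
  qed
  finally show "(LINT x:{s..e}|lb. abs ((\<Sum>c\<in>Bc q d M. real (ccount x (R / (real M)^2) c)) - \<kappa> * R)) <= \<epsilon> * R" by (simp only: y_def)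
 qed
qed

section \<open>Weighted exponential sums over reduced fractions\<close>

context cbump
begin

definition Wt :: "nat => real => nat => complex" where
 "Wt d \<xi> M = (\<Sum>c\<in>Bc q d M. \<Sum>n | coprime n (int c) & real c * X0 <= of_int n & of_int n <= real c * X1.
  cor (\<psi> (of_int n / real c)) * cis (\<xi> * Fr f (of_int n / real c)))"

lemma psi_u_cont: "y > 0 ==> continuous_on T (%x. cor (\<psi> x) * u \<xi> (Cx x y))"
 by (intro continuous_intros psi_c continuous_on_compose2[OF u_cont]) (auto simp: UHP_def Complex_eq intro!: continuous_intros)

lemma norm_cis_diff: "norm (cis s - cis t) <= abs (s - t)"
proof -
 have "cis s - cis t = cis t * (cis (s - t) - 1)" by (simp add: algebra_simps cis_mult)
 thus ?thesis using norm_cis_minus_1[of "s - t"] by (simp add: norm_mult)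
qed

text \<open>Each fraction is spread over the interval of radius \<open>y\<close> around it, on which
  its term is compared with the integrand at height \<open>y\<close>. The symbol differs from
  \<open>F\<close> there by O(1), hence the phases by O(\<open>\<xi>\<close>), and the number of
  fractions times \<open>2 y\<close> is O(\<open>R\<close>).\<close>

lemma Wt_integral:
 assumes R: "R >= 1" and M: "M >= 1" and ydef: "y = R / (real M)^2" and y1: "y <= 1" and \<xi>: "\<xi> >= 0"
 shows "norm (cor (2 * y) * Wt d \<xi> M - (LINT x:{a..b}|lb. cor (Nc q d M y x) * (cor (\<psi> x) * u \<xi> (Cx x y))))
  <= 2 * R * (b - a + 3) * (Lp * y + \<xi> * (2 * pi * (2 * C + B * ln (2 * R))))"
proof -
 define Ce where "Ce = 2 * pi * (2 * C + B * ln (2 * R))"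
 let ?L = "(Lp * y + \<xi> * Ce)"
 have Ce0: "Ce >= 0" using C0 B0 R by (simp add: Ce_def)
 have y0: "y > 0" using R M by (simp add: ydef)
 define k where "k = (%x. cor (\<psi> x) * u \<xi> (Cx x y))"
 define h where "h = (%r. cor (\<psi> r) * cis (\<xi> * Fr f r))"
 define A where "A = (%c::nat. {n::int. coprime n (int c) & real c * (a - y) <= of_int n & of_int n <= real c * (b + y)})"
 define S where "S = (%c (n::int). {a..b} \<inter> {of_int n / real c - y..of_int n / real c + y})"
 have finA: "finite (A c)" for c unfolding A_def
  by (rule finite_subset[OF _ finite_int_interval_card(1)[of "real c * (a - y)" "real c * (b + y)"]]) auto
 have kc: "continuous_on T k" for T unfolding k_def by (rule psi_u_cont[OF y0])
 have Ssets: "S c n : sets lb" for c n by (simp add: S_def)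
 have ki: "set_integrable lb (S c n) k" for c n
  by (rule set_integrable_subset[OF borel_integrable_atLeastAtMost'[OF kc]]) (auto simp: S_def)
 have Sm: "measure lb (S c n) <= 2 * y" "emeasure lb (S c n) < \<infinity>" for c n
 proof -
  have sub: "S c n <= {of_int n / real c - y..of_int n / real c + y}" by (auto simp: S_def)
  have "measure lb (S c n) <= measure lb {of_int n / real c - y..of_int n / real c + y}"
   by (rule measure_mono_fmeasurable[OF sub Ssets]) (simp add: fmeasurable_def emeasure_lborel_Icc_eq)
  thus "measure lb (S c n) <= 2 * y" using y0 by simp
  show "emeasure lb (S c n) < \<infinity>" by (simp add: S_def Int_atLeastAtMost emeasure_lborel_Icc_eq)
 qed
 have ci: "set_integrable lb (S c n) (%_. w)" for c n and w :: complex
  unfolding set_integrable_def using Sm(2)[of c n] Ssets[of c n] by (intro integrable_scaleR_left integrable_real_indicator) auto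
 have cir: "set_integrable lb (S c n) (%_. w)" for c n and w :: real
  unfolding set_integrable_def using Sm(2)[of c n] Ssets[of c n] by (intro integrable_scaleR_left integrable_real_indicator) auto
 have c1: "c : Bc q d M ==> c >= 1 & c <= M" for c by (simp add: Bc_def)
 have T1: "(LINT x:{a..b}|lb. cor (Nc q d M y x) * k x) = (\<Sum>c\<in>Bc q d M. \<Sum>n\<in>A c. LINT x:S c n|lb. k x)"
 proof -
  have pt: "ind {a..b} x *\<^sub>R (cor (Nc q d M y x) * k x) = (\<Sum>c\<in>Bc q d M. \<Sum>n\<in>A c. ind (S c n) x *\<^sub>R k x)" for x
  proof (cases "x : {a..b}")
   case True
   have "(Nc q d M y x) = (\<Sum>c\<in>Bc q d M. \<Sum>n\<in>A c. ind {of_int n / real c - y..of_int n / real c + y} x)"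
    unfolding ccount_def A_def by (rule sum.cong[OF refl]) (rule card_eq_sum_indicator[OF _ True], use c1 in auto)
   also have "... = (\<Sum>c\<in>Bc q d M. \<Sum>n\<in>A c. ind (S c n) x)"
    using True by (intro sum.cong refl) (auto simp: S_def indicator_def)
   finally have "cor (Nc q d M y x) * k x = (\<Sum>c\<in>Bc q d M. \<Sum>n\<in>A c. cor (ind (S c n) x)) * k x"
    by (simp only: of_real_sum)
   thus ?thesis using True by (simp add: sum_distrib_right scaleR_conv_of_real)
  next
   case False
   hence "ind (S c n) x = (0::real)" for c n by (auto simp: S_def indicator_def)
   thus ?thesis using False by (simp add: indicator_def)
  qed
  show ?thesis unfolding set_lebesgue_integral_def pt using ki unfolding set_integrable_def by simp
 qed
 have T2: "cor (2 * y) * Wt d \<xi> M = (\<Sum>c\<in>Bc q d M. \<Sum>n\<in>A c. LINT x:S c n|lb. h (of_int n / real c))"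
 proof -
  have "cor (2 * y) * Wt d \<xi> M = (\<Sum>c\<in>Bc q d M. \<Sum>n | coprime n (int c) & real c * X0 <= of_int n & of_int n <= real c * X1. cor (2 * y) * h (of_int n / real c))"
   unfolding Wt_def h_def sum_distrib_left ..
  also have "... = (\<Sum>c\<in>Bc q d M. \<Sum>n\<in>A c. LINT x:S c n|lb. h (of_int n / real c))"
  proof (rule sum.cong[OF refl])
   fix c assume c: "c : Bc q d M"
   hence c0: "real c > 0" using c1 by fastforce
   show "(\<Sum>n | coprime n (int c) & real c * X0 <= of_int n & of_int n <= real c * X1. cor (2 * y) * h (of_int n / real c)) = (\<Sum>n\<in>A c. LINT x:S c n|lb. h (of_int n / real c))" (is "sum ?f ?I = sum ?g _")
   proof (rule sum.mono_neutral_cong_left[OF finA])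
    have "real c * (a - y) <= real c * X0" "real c * X1 <= real c * (b + y)" using y0 c0 by (auto intro!: mult_left_mono)
    thus "?I <= A c" by (auto simp: A_def)
    show "ALL n:A c - ?I. ?g n = 0"
    proof
     fix n assume "n : A c - ?I"
     hence "of_int n / real c \<notin> {X0..X1}" using c0 by (auto simp: A_def field_simps)
     hence "h (of_int n / real c) = 0" using supp(1) by (simp add: h_def)
     thus "?g n = 0" by (simp add: set_lebesgue_integral_def)
    qed
    fix n assume "n : ?I"
    hence "of_int n / real c : {X0..X1}" using c0 by (auto simp: field_simps)
    \<comment> \<open>As \<open>y <= 1\<close>, the margin between the support and
      \<open>[a, b]\<close> keeps the interval from being cut off, so its length is exactly
      \<open>2 y\<close>.\<close>
    hence "S c n = {of_int n / real c - y..of_int n / real c + y}" using y1 by (auto simp: S_def)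
    thus "?f n = ?g n" using y0 by (simp add: set_lebesgue_integral_def scaleR_conv_of_real)
   qed
  qed
  finally show ?thesis .
 qed
 have T3: "norm ((LINT x:S c n|lb. h (of_int n / real c)) - (LINT x:S c n|lb. k x)) <= 2 * y * ?L"
  if c: "c : Bc q d M" and n: "n : A c" for c n
 proof -
  let ?r = "roi n / real c"
  have c0: "real c >= 1" "real c <= real M" using c1[OF c] by auto
  have pt: "norm (h ?r - k x) <= Lp * y + \<xi> * Ce" if x: "x : S c n" for x
  proof -
   have xr: "abs (x - ?r) <= y" using x by (auto simp: S_def abs_le_iff)
   \<comment> \<open>The horoball level is \<open>1 / (2 R)\<close>: for \<open>c <= M\<close> and
     \<open>|x - n/c| <= y\<close>, the quantity \<open>c\<^sup>2 |z - n/c|\<^sup>2\<close> is at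
     most \<open>2 M\<^sup>2 y\<^sup>2 = 2 R y\<close>.\<close>
   have "abs (F (Cx x y) - Fr f (roi n / roi (int c))) <= 2 * pi * (2 * C + B * ln (1 / (1 / (2 * R))))"
   proof (rule F_near_rational)
    show "coprime n (int c)" using n by (simp add: A_def)
    show "Cx x y : UHP" using y0 by (simp add: UHP_def)
    have "(norm (Cx x y - cor ?r))^2 = (x - ?r)^2 + y^2" by (simp add: cmod_power2)
    also have "... <= 2 * y^2" using xr power_mono[OF xr, of 2] by simp
    finally have "(real c)^2 * (norm (Cx x y - cor ?r))^2 <= (real M)^2 * (2 * y^2)"
     using c0 by (intro mult_mono power_mono) auto
    also have "... = 2 * R * y" using M by (simp add: ydef power2_eq_square field_simps)
    finally have *: "(real c)^2 * (norm (Cx x y - cor ?r))^2 <= 2 * R * y" .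
    have "1 / (2 * R) * ((real c)^2 * (norm (Cx x y - cor ?r))^2) <= 1 / (2 * R) * (2 * R * y)"
     by (rule mult_left_mono[OF *]) (use R in simp)
    thus "1 / (2 * R) * ((roi (int c))^2 * (norm (Cx x y - cor (roi n / roi (int c))))^2) <= Im (Cx x y)"
     using R by simp
   qed (use R c0 in auto)
   hence FF: "abs (F (Cx x y) - Fr f ?r) <= Ce" by (simp add: Ce_def)
   have "h ?r - k x = cor (\<psi> ?r - \<psi> x) * cis (\<xi> * Fr f ?r) + cor (\<psi> x) * (cis (\<xi> * Fr f ?r) - cis (\<xi> * F (Cx x y)))"
    by (simp add: h_def k_def u_def algebra_simps)
   also have "norm ... <= abs (\<psi> ?r - \<psi> x) * 1 + abs (\<psi> x) * norm (cis (\<xi> * Fr f ?r) - cis (\<xi> * F (Cx x y)))"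
    by (rule order_trans[OF norm_triangle_ineq]) (simp add: norm_mult)
   also have "... <= Lp * y + 1 * (\<xi> * Ce)"
   proof (rule add_mono)
    have "abs (\<psi> ?r - \<psi> x) <= Lp * abs (?r - x)" by (rule psi_lip)
    also have "... <= Lp * y" using xr Lp0 by (intro mult_left_mono) (auto simp: abs_minus_commute)
    finally show "abs (\<psi> ?r - \<psi> x) * 1 <= Lp * y" by simp
    have "norm (cis (\<xi> * Fr f ?r) - cis (\<xi> * F (Cx x y))) <= abs (\<xi> * Fr f ?r - \<xi> * F (Cx x y))" by (rule norm_cis_diff)
    also have "... = \<xi> * abs (F (Cx x y) - Fr f ?r)" using \<xi> by (simp only: right_diff_distrib[symmetric] abs_mult abs_of_nonneg abs_minus_commute)
    also have "... <= \<xi> * Ce" using FF \<xi> by (rule mult_left_mono)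
    finally have "norm (cis (\<xi> * Fr f ?r) - cis (\<xi> * F (Cx x y))) <= \<xi> * Ce" .
    from mult_mono[OF _ this, of "abs (\<psi> x)" 1]
    show "abs (\<psi> x) * norm (cis (\<xi> * Fr f ?r) - cis (\<xi> * F (Cx x y))) <= 1 * (\<xi> * Ce)" using psi01[of x] by simp
   qed
   finally show ?thesis by simp
  qed
  have "(LINT x:S c n|lb. h ?r) - (LINT x:S c n|lb. k x) = (LINT x:S c n|lb. h ?r - k x)"
   by (rule set_integral_diff(2)[symmetric, OF ci ki])
  also have "norm ... <= (LINT x:S c n|lb. norm (h ?r - k x))"
   by (rule set_integral_norm_bound[OF set_integral_diff(1)[OF ci ki]])
  also have "... <= (LINT x:S c n|lb. Lp * y + \<xi> * Ce)"
   by (rule set_integral_mono[OF set_integrable_norm[OF set_integral_diff(1)[OF ci ki]] cir]) (rule pt)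
  also have "... = measure lb (S c n) * ?L" using Ssets[of c n] Sm(2)[of c n] by (simp add: set_lebesgue_integral_def)
  also have "... <= 2 * y * ?L" using Sm(1)[of c n] Lp0 y0 \<xi> Ce0 by (intro mult_right_mono) auto
  finally show ?thesis .
 qed
 have bnd0: "2 * y * ?L >= 0" using Lp0 y0 \<xi> Ce0 by simp
 have "norm (cor (2 * y) * Wt d \<xi> M - (LINT x:{a..b}|lb. cor (Nc q d M y x) * k x))
  <= (\<Sum>c\<in>Bc q d M. \<Sum>n\<in>A c. 2 * y * ?L)"
  unfolding T1 T2 sum_subtractf[symmetric] by (intro sum_norm_le) (rule T3)
 also have "... <= (\<Sum>c\<in>Bc q d M. (real M * (b - a + 3)) * (2 * y * ?L))"
 proof (rule sum_mono)
  fix c assume c: "c : Bc q d M"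
  have c0: "real c >= 1" "real c <= real M" using c1[OF c] by auto
  have "real (card (A c)) <= real (card {n::int. real c * (a - y) <= of_int n & of_int n <= real c * (b + y)})"
   by (intro of_nat_mono card_mono finite_int_interval_card(1)) (auto simp: A_def)
  also have "... <= real c * (b + y) - real c * (a - y) + 1"
  proof (rule finite_int_interval_card(2))
   have "real c * (a - y) <= real c * (b + y)" using X01 y0 by (intro mult_left_mono) auto
   thus "real c * (a - y) <= real c * (b + y) + 1" by simp
  qed
  also have "... = real c * (b - a + 2 * y) + 1" by (simp add: algebra_simps)
  also have "... <= real M * (b - a + 2) + real M" using c0 X01 y0 y1 by (intro add_mono mult_mono) auto
  finally have "real (card (A c)) <= real M * (b - a + 3)" by (simp add: algebra_simps)
  thus "(\<Sum>n\<in>A c. 2 * y * ?L) <= (real M * (b - a + 3)) * (2 * y * ?L)"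
   unfolding sum_constant using bnd0 by (rule mult_right_mono)
 qed
 also have "... = real (card (Bc q d M)) * ((real M * (b - a + 3)) * (2 * y * ?L))" by (rule sum_constant)
 also have "... <= real M * ((real M * (b - a + 3)) * (2 * y * ?L))"
 proof (rule mult_right_mono)
  have "card (Bc q d M) <= card {1..M}" by (rule card_mono) (auto simp: Bc_def)
  thus "real (card (Bc q d M)) <= real M" by simp
 qed (use bnd0 X01 in simp)
 also have "... = 2 * ((real M)^2 * y) * (b - a + 3) * ?L" by (simp add: power2_eq_square)
 also have "(real M)^2 * y = R" using M by (simp add: ydef)
 finally show ?thesis unfolding k_def Ce_def .
qed

text \<open>In the smeared sum the count is replaced by its expectation \<open>\<kappa> R\<close>;
  since the other factor has modulus at most 1, the cost is the mean deviation of the count.\<close>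

lemma Wt_Phi:
 assumes R: "R >= 1" and M: "M >= 1" and ydef: "y = R / (real M)^2" and y1: "y <= 1" and \<xi>: "\<xi> >= 0"
  and L1: "(LINT x:{a..b}|lb. abs ((Nc q d M y x) - \<kappa> * R)) <= \<epsilon> * R"
 shows "norm (cor (2 * y) * Wt d \<xi> M - cor (\<kappa> * R) * Phi \<xi> y)
  <= \<epsilon> * R + 2 * R * (b - a + 3) * (Lp * y + \<xi> * (2 * pi * (2 * C + B * ln (2 * R))))"
proof -
 have y0: "y > 0" using R M by (simp add: ydef)
 have ab: "a <= b" using X01 by simp
 define k where "k = (%x. cor (\<psi> x) * u \<xi> (Cx x y))"
 define \<nu> where "\<nu> = (%x. \<Sum>c\<in>Bc q d M. real (ccount x y c))"
 have kc: "continuous_on T k" for T unfolding k_def by (rule psi_u_cont[OF y0])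
 have k1: "norm (k x) <= 1" for x using psi01[of x] by (simp add: k_def norm_mult)
 have ki: "set_integrable lb {a..b} k" by (rule borel_integrable_atLeastAtMost'[OF kc])
 have Ph: "Phi \<xi> y = (LINT x:{a..b}|lb. k x)"
  unfolding Phi_def hint_def using set_borel_integral_eq_integral(2)[OF ki] by (simp add: k_def)
 have ni: "set_integrable lb {a..b} \<nu>" unfolding \<nu>_def ccount_def
  by (rule set_integrable_sum'(1)) (rule card_set_integral(1)[OF _ ab less_imp_le[OF y0]], simp add: Bc_def)
 have ci: "set_integrable lb {a..b} (%_. w::real)" for w
  by (rule borel_integrable_atLeastAtMost') simp
 have kms: "k : BM" by (rule borel_measurable_continuous_onI[OF kc])
 have prod: "set_integrable lb {a..b} (%x. cor (v x) * k x)" if v: "set_integrable lb {a..b} v" for v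
 proof -
  have "integrable lb (%x. cor (ind {a..b} x * v x) * k x)"
  proof (rule Bochner_Integration.integrable_bound[of lb "%x. ind {a..b} x * v x"])
   show "integrable lb (%x. ind {a..b} x * v x)" using v by (simp add: set_integrable_def)
   hence "(%x. ind {a..b} x * v x) : borel_measurable lb" by (rule borel_measurable_integrable)
   thus "(%x. cor (ind {a..b} x * v x) * k x) : borel_measurable lb" using kms by measurable
   show "AE x in lb. norm (cor (ind {a..b} x * v x) * k x) <= norm (ind {a..b} x * v x)"
    unfolding norm_mult using k1 by (intro AE_I2) (simp add: mult_left_le abs_mult norm_mult del: of_real_mult)
  qed
  thus ?thesis by (simp add: set_integrable_def scaleR_conv_of_real mult.assoc)
 qed
 have "(LINT x:{a..b}|lb. cor (\<nu> x) * k x) - cor (\<kappa> * R) * (LINT x:{a..b}|lb. k x)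
  = (LINT x:{a..b}|lb. cor (\<nu> x) * k x) - (LINT x:{a..b}|lb. cor (\<kappa> * R) * k x)" by simp
 also have "... = (LINT x:{a..b}|lb. cor (\<nu> x) * k x - cor (\<kappa> * R) * k x)"
  by (rule set_integral_diff(2)[symmetric, OF prod[OF ni] prod[OF ci]])
 also have "... = (LINT x:{a..b}|lb. cor (\<nu> x - \<kappa> * R) * k x)" by (simp add: left_diff_distrib)
 also have "norm ... <= (LINT x:{a..b}|lb. norm (cor (\<nu> x - \<kappa> * R) * k x))"
  by (rule set_integral_norm_bound[OF prod[OF set_integral_diff(1)[OF ni ci]]])
 also have "... <= (LINT x:{a..b}|lb. abs (\<nu> x - \<kappa> * R))"
  by (rule set_integral_mono[OF set_integrable_norm[OF prod[OF set_integral_diff(1)[OF ni ci]]] set_integrable_abs[OF set_integral_diff(1)[OF ni ci]]])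
   (use k1 in \<open>simp add: norm_mult mult_left_le del: of_real_diff of_real_mult\<close>)
 also have "... <= \<epsilon> * R" using L1 by (simp add: \<nu>_def)
 finally have 1: "norm ((LINT x:{a..b}|lb. cor (\<nu> x) * k x) - cor (\<kappa> * R) * Phi \<xi> y) <= \<epsilon> * R" by (simp only: Ph)
 note 2 = Wt_integral[OF R M ydef y1 \<xi>, of d]
 have "norm (x - z) <= norm (x - w) + norm (w - z)" for x w z :: complex using norm_triangle_ineq[of "x - w" "w - z"] by simp
 from order_trans[OF this add_mono[OF 2 1[unfolded k_def \<nu>_def]]] show ?thesis by (simp add: add.commute)
qed

text \<open>The unknown density \<open>\<kappa>\<close> of the reduced fractions cancels in the comparison with the sum at frequency zero.\<close>
lemma Wt_asymp:
 assumes vol: "hyp_vol D > 0" and t: "t >= 0" and \<epsilon>: "\<epsilon> > 0"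
 shows "EV M. norm (Wt d (t / sqrt (ln (real M))) M - cor (exp (- 8 * pi^2 * V * t^2)) * Wt d 0 M) <= \<epsilon> * (real M)^2"
proof -
 have ab: "a <= b" using X01 by simp
 obtain \<kappa> R M0 where R: "R >= 1" and L1: "!!M. M >= M0 ==> (LINT x:{a..b}|lb. abs ((\<Sum>c\<in>Bc q d M. real (ccount x (R / (real M)^2) c)) - \<kappa> * R)) <= \<epsilon> / 4 * R"
  using coprime_L1[OF q1 ab, of "\<epsilon> / 4" d] \<epsilon> by auto
 \<comment> \<open>The error in \<open>Phi\<close> is multiplied by \<open>\<kappa>\<close>, whose
   size is known only after the previous choice; adding 1 covers
   \<open>\<kappa> = 0\<close>.\<close>
 define \<epsilon>2 where "\<epsilon>2 = \<epsilon> / (4 * (abs \<kappa> + 1))"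
 have \<epsilon>2: "\<epsilon>2 > 0" "abs \<kappa> * \<epsilon>2 <= \<epsilon> / 4"
 proof -
  have p: "4 * (abs \<kappa> + 1) > 0" by simp
  show "\<epsilon>2 > 0" using \<epsilon> p by (simp add: \<epsilon>2_def)
  have "abs \<kappa> * \<epsilon> <= (abs \<kappa> + 1) * \<epsilon>" using \<epsilon> by (intro mult_right_mono) auto
  hence "abs \<kappa> * \<epsilon> / (4 * (abs \<kappa> + 1)) <= ((abs \<kappa> + 1) * \<epsilon>) / (4 * (abs \<kappa> + 1))" using p by (intro divide_right_mono) auto
  also have "... = \<epsilon> / 4"
  proof -
   have w: "w * \<epsilon> / (4 * w) = \<epsilon> / 4" if "w ~= 0" for w using that by simp
   show ?thesis by (rule w) linarith
  qed
  finally show "abs \<kappa> * \<epsilon>2 <= \<epsilon> / 4" by (simp add: \<epsilon>2_def)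
 qed
 obtain \<delta> where \<delta>: "\<delta> > 0" and Ph: "!!\<xi> y. 0 <= \<xi> ==> \<xi> <= \<delta> ==> 0 < y ==> y <= 1 ==> \<xi>\<^sup>2 * ln (1 / y) <= 2 * t^2 ==>
   norm (Phi \<xi> y - cor (c0 * exp (- 4 * pi\<^sup>2 * V * (\<xi>\<^sup>2 * ln (1 / y))))) <= \<epsilon>2"
  using Phi_asymp[OF vol \<epsilon>2(1), of "2 * t^2"] by auto
 define Ce where "Ce = 2 * pi * (2 * C + B * ln (2 * R))"
 have Ce0: "Ce >= 0" using C0 B0 R by (simp add: Ce_def)
 define th where "th = (%M::nat. t / sqrt (ln (real M)))"
 define Y where "Y = (%M::nat. R / (real M)^2)"
 define E where "E = (%M. exp (- 4 * pi\<^sup>2 * V * ((th M)\<^sup>2 * ln (1 / Y M))))"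
 define E0 where "E0 = exp (- 8 * pi^2 * V * t^2)"
 have th0: "th \<longlonglongrightarrow> 0" unfolding th_def by real_asymp
 have Y0: "Y \<longlonglongrightarrow> 0" unfolding Y_def by real_asymp
 \<comment> \<open>Since \<open>1/y\<close> is about \<open>M\<^sup>2\<close>, the exponent
   \<open>\<xi>\<^sup>2 ln (1/y)\<close> tends to \<open>2 t\<^sup>2\<close>. This doubles the
   factor \<open>4 \<pi>\<^sup>2 V\<close> to \<open>8 \<pi>\<^sup>2 V\<close>.\<close>
 have lnY: "(th M)\<^sup>2 * ln (1 / Y M) = t^2 * (2 - ln R / ln (real M))" if "M >= 2" for M
 proof -
  have l: "ln (real M) > 0" using that by simp
  have "ln (1 / Y M) = 2 * ln (real M) - ln R" using R that by (simp add: Y_def ln_div ln_realpow)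
  moreover have "(th M)\<^sup>2 = t^2 / ln (real M)" using l by (simp add: th_def power_divide)
  ultimately have "(th M)\<^sup>2 * ln (1 / Y M) = t^2 / ln (real M) * (2 * ln (real M) - ln R)" by (simp only:)
  also have "... = t^2 * (2 - ln R / ln (real M))" using l by (simp add: field_simps)
  finally show ?thesis .
 qed
 have E_lim: "E \<longlonglongrightarrow> E0"
 proof -
  have "(%M::nat. 2 - ln R / ln (real M)) \<longlonglongrightarrow> 2" by real_asymp
  hence "(%M. exp (- 4 * pi\<^sup>2 * V * (t^2 * (2 - ln R / ln (real M))))) \<longlonglongrightarrow> exp (- 4 * pi\<^sup>2 * V * (t^2 * 2))"
   by (intro tendsto_intros)
  moreover have "EV M. exp (- 4 * pi\<^sup>2 * V * (t^2 * (2 - ln R / ln (real M)))) = E M"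
   using eventually_ge_at_top[of 2] by eventually_elim (simp add: E_def lnY)
  ultimately have "E \<longlonglongrightarrow> exp (- 4 * pi\<^sup>2 * V * (t^2 * 2))" by (rule Lim_transform_eventually)
  thus ?thesis by (simp add: E0_def mult_ac)
 qed
 define Q where "Q = (%M. (b - a + 3) * (Lp * Y M + th M * Ce))"
 have Q0: "Q \<longlonglongrightarrow> 0"
 proof -
  have "Q \<longlonglongrightarrow> (b - a + 3) * (Lp * 0 + 0 * Ce)" unfolding Q_def by (intro tendsto_intros Y0 th0)
  thus ?thesis by simp
 qed
 have K0: "(%M. abs \<kappa> * abs c0 * abs (E M - E0)) \<longlonglongrightarrow> 0"
 proof -
  have "(%M. abs \<kappa> * abs c0 * abs (E M - E0)) \<longlonglongrightarrow> abs \<kappa> * abs c0 * abs (E0 - E0)" by (intro tendsto_intros E_lim)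
  thus ?thesis by simp
 qed
 have ev: "EV M. Q M < \<epsilon> / 8" "EV M. abs \<kappa> * abs c0 * abs (E M - E0) < \<epsilon> / 4"
  "EV M. th M < \<delta>" "EV M. Y M < 1"
  using order_tendstoD(2)[OF Q0, of "\<epsilon> / 8"] order_tendstoD(2)[OF K0, of "\<epsilon> / 4"] order_tendstoD(2)[OF th0 \<delta>] order_tendstoD(2)[OF Y0, of 1] \<epsilon> by auto
 show ?thesis using ev eventually_ge_at_top[of "max M0 2"]
 proof eventually_elim
  case (elim M)
  have M: "M >= M0" "M >= 2" using elim by auto
  have l: "ln (real M) > 0" using M by simp
  have t0: "th M >= 0" using t l by (simp add: th_def)
  have y0: "Y M > 0" using R M by (simp add: Y_def)
  have y1: "Y M <= 1" using elim by simp
  have M1: "M >= 1" using M by simp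
  have L: "(LINT x:{a..b}|lb. abs ((\<Sum>c\<in>Bc q d M. real (ccount x (Y M) c)) - \<kappa> * R)) <= \<epsilon> / 4 * R" using L1[OF M(1)] by (simp add: Y_def)
  have YM: "Y M = R / (real M)^2" by (simp add: Y_def)
  have W: "norm (cor (2 * Y M) * Wt d \<xi> M - cor (\<kappa> * R * c0 * e')) <= \<epsilon> / 4 * R + R * (\<epsilon> / 4) + R * (\<epsilon> / 4)"
   if \<xi>: "0 <= \<xi>" "\<xi> <= th M" and P: "norm (Phi \<xi> (Y M) - cor (c0 * e')) <= \<epsilon>2" for \<xi> e'
  proof -
   have q8: "(b - a + 3) * (Lp * Y M + \<xi> * Ce) <= \<epsilon> / 8"
   proof -
    have "(b - a + 3) * (Lp * Y M + \<xi> * Ce) <= Q M" unfolding Q_def using \<xi> Ce0 X01 by (intro mult_left_mono add_left_mono mult_right_mono) auto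
    thus ?thesis using elim by linarith
   qed
   have A: "norm (cor (2 * Y M) * Wt d \<xi> M - cor (\<kappa> * R) * Phi \<xi> (Y M)) <= \<epsilon> / 4 * R + R * (\<epsilon> / 4)"
   proof -
    have "2 * R * (b - a + 3) * (Lp * Y M + \<xi> * Ce) = 2 * R * ((b - a + 3) * (Lp * Y M + \<xi> * Ce))" by simp
    also have "... <= 2 * R * (\<epsilon> / 8)" using q8 R by (intro mult_left_mono) auto
    finally have "2 * R * (b - a + 3) * (Lp * Y M + \<xi> * Ce) <= R * (\<epsilon> / 4)" by simp
    thus ?thesis using Wt_Phi[OF R M1 YM y1 \<xi>(1) L] unfolding Ce_def by linarith
   qed
   have "cor (\<kappa> * R) * Phi \<xi> (Y M) - cor (\<kappa> * R * c0 * e') = cor (\<kappa> * R) * (Phi \<xi> (Y M) - cor (c0 * e'))"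
    by (simp add: algebra_simps)
   also have "norm ... = R * (abs \<kappa> * norm (Phi \<xi> (Y M) - cor (c0 * e')))" using R by (simp add: norm_mult abs_mult)
   also have "... <= R * (abs \<kappa> * \<epsilon>2)" using P R by (intro mult_left_mono) auto
   also have "... <= R * (\<epsilon> / 4)" using \<epsilon>2(2) R by (intro mult_left_mono) auto
   finally have Bb: "norm (cor (\<kappa> * R) * Phi \<xi> (Y M) - cor (\<kappa> * R * c0 * e')) <= R * (\<epsilon> / 4)" .
   have "norm (x - z) <= norm (x - w) + norm (w - z)" for x w z :: complex using norm_triangle_ineq[of "x - w" "w - z"] by simp
   from order_trans[OF this add_mono[OF A Bb]] show ?thesis .
  qed
  have lnYt: "(th M)\<^sup>2 * ln (1 / Y M) <= 2 * t^2"
  proof -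
   have "ln R / ln (real M) >= 0" using R l by simp
   hence "t^2 * (2 - ln R / ln (real M)) <= t^2 * 2" by (intro mult_left_mono) auto
   thus ?thesis using lnY[OF M(2)] by simp
  qed
  have W1: "norm (cor (2 * Y M) * Wt d (th M) M - cor (\<kappa> * R * c0 * E M)) <= \<epsilon> / 4 * R + R * (\<epsilon> / 4) + R * (\<epsilon> / 4)"
   by (rule W[OF t0 order_refl]) (use Ph[OF t0 _ y0 y1 lnYt] elim in \<open>simp add: E_def\<close>)
  \<comment> \<open>At frequency zero the same estimate holds with main term
    \<open>\<kappa> R c0\<close>. Subtracting \<open>E0\<close> times it removes the main term of
    the frequency in question up to the difference of \<open>E M\<close> and
    \<open>E0\<close>.\<close>
  have W0: "norm (cor (2 * Y M) * Wt d 0 M - cor (\<kappa> * R * c0 * 1)) <= \<epsilon> / 4 * R + R * (\<epsilon> / 4) + R * (\<epsilon> / 4)"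
   by (rule W[OF order_refl t0]) (use Ph[of 0 "Y M"] \<delta> y0 y1 in simp)
  have E01: "0 < E0" "E0 <= 1" using V_nonneg by (auto simp: E0_def)
  let ?e = "\<epsilon> / 4 * R + R * (\<epsilon> / 4) + R * (\<epsilon> / 4)"
  have id: "cor (2 * Y M) * (Wt d (th M) M - cor E0 * Wt d 0 M)
   = (cor (2 * Y M) * Wt d (th M) M - cor (\<kappa> * R * c0 * E M))
    - cor E0 * (cor (2 * Y M) * Wt d 0 M - cor (\<kappa> * R * c0 * 1))
    + cor (\<kappa> * R * c0 * (E M - E0))"
   by (simp add: algebra_simps)
  have n3: "norm (cor (\<kappa> * R * c0 * (E M - E0))) <= R * (\<epsilon> / 4)"
  proof -
   have "norm (cor (\<kappa> * R * c0 * (E M - E0))) = R * (abs \<kappa> * abs c0 * abs (E M - E0))"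
    unfolding norm_of_real using R by (simp add: abs_mult mult_ac)
   also have "... <= R * (\<epsilon> / 4)" using elim R by (intro mult_left_mono) auto
   finally show ?thesis .
  qed
  have n2: "norm (cor E0 * (cor (2 * Y M) * Wt d 0 M - cor (\<kappa> * R * c0 * 1))) <= 1 * ?e"
   unfolding norm_mult[of "cor E0"] using E01 W0 \<epsilon> R by (intro mult_mono) auto
  have "norm (cor (2 * Y M) * (Wt d (th M) M - cor E0 * Wt d 0 M)) <= ?e + 1 * ?e + R * (\<epsilon> / 4)"
   unfolding id by (rule order_trans[OF norm_triangle_ineq add_mono[OF order_trans[OF norm_triangle_ineq4 add_mono[OF W1 n2]] n3]])
  hence "8 * (Y M * norm (Wt d (th M) M - cor E0 * Wt d 0 M)) <= 7 * (R * \<epsilon>)"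
   unfolding norm_mult using y0 by simp
  moreover have "R * \<epsilon> >= 0" using R \<epsilon> by simp
  ultimately have "2 * Y M * norm (Wt d (th M) M - cor E0 * Wt d 0 M) <= 2 * (R * \<epsilon>)" by linarith
  hence "R * norm (Wt d (th M) M - cor E0 * Wt d 0 M) <= R * (\<epsilon> * (real M)^2)"
   using M1 by (simp add: Y_def field_simps)
  hence "norm (Wt d (th M) M - cor E0 * Wt d 0 M) <= \<epsilon> * (real M)^2" using R by simp
  thus ?case by (simp only: th_def E0_def)
 qed
qed

end

section \<open>Counting reduced fractions in an interval\<close>

text \<open>Fractions as real numbers in an open interval, not yet reduced modulo 1, with
  denominator in the first component.\<close>

definition Sf :: "nat => nat => real => real => nat => (nat \<times> int) set" where
 "Sf q d x0 x1 M = {(c,n). c : Bc q d M & coprime n (int c) & real c * x0 < of_int n & of_int n < real c * x1}"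

lemma Sf_eq_Sigma: "Sf q d x0 x1 M = (SIGMA c:Bc q d M. {n. coprime n (int c) & real c * x0 < of_int n & of_int n < real c * x1})"
 by (auto simp: Sf_def)

lemma int_interval_open:
 fixes u v :: real
 shows "finite {n::int. P n & u < of_int n & of_int n < v}" "finite {n::int. P n & u <= of_int n & of_int n <= v}"
 by (rule finite_subset[OF _ finite_int_interval_card(1)[of u v]], force)+

lemma finite_Sf [simp]: "finite (Sf q d x0 x1 M)"
 unfolding Sf_eq_Sigma by (intro finite_SigmaI finite_Bc int_interval_open(1))

lemma card_Bc: "card (Bc q d M) <= M"
proof -
 have "card (Bc q d M) <= card {1..M}" by (rule card_mono) (auto simp: Bc_def)
 thus ?thesis by simp
qed

lemma card_interval_le:
 fixes u v :: real
 assumes "u <= v"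
 shows "real (card {n::int. P n & u <= of_int n & of_int n <= v}) <= v - u + 1"
proof -
 have "card {n::int. P n & u <= of_int n & of_int n <= v} <= card {n::int. u <= of_int n & of_int n <= v}"
  by (rule card_mono[OF finite_int_interval_card(1)]) auto
 also have "real ... <= v - u + 1" using assms by (intro finite_int_interval_card(2)) simp
 finally show ?thesis by simp
qed

lemma card_row_le:
 assumes c: "c : Bc q d M" and x: "x0 <= x1" "x1 - x0 <= 1"
 shows "real (card {n::int. P n & real c * x0 <= of_int n & of_int n <= real c * x1}) <= 2 * real M"
proof -
 have c1: "1 <= real c" "real c <= real M" using c by (auto simp: Bc_def)
 have "real c * x0 <= real c * x1" using x by (intro mult_left_mono) auto
 hence "real (card {n::int. P n & real c * x0 <= of_int n & of_int n <= real c * x1}) <= real c * x1 - real c * x0 + 1"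
  by (rule card_interval_le)
 also have "... = real c * (x1 - x0) + 1" by (simp add: algebra_simps)
 also have "... <= real c * 1 + 1" using x by (intro add_right_mono mult_left_mono) auto
 finally show ?thesis using c1 by simp
qed

lemma card_Sf_le:
 assumes x: "x0 <= x1" "x1 - x0 <= 1"
 shows "real (card (Sf q d x0 x1 M)) <= 2 * (real M)^2"
proof -
 have "real (card (Sf q d x0 x1 M)) = (\<Sum>c\<in>Bc q d M. real (card {n. coprime n (int c) & real c * x0 < of_int n & of_int n < real c * x1}))"
  unfolding Sf_eq_Sigma by (subst card_SigmaI) (auto intro: int_interval_open(1))
 also have "... <= (\<Sum>c\<in>Bc q d M. 2 * real M)"
 proof (rule sum_mono)
  fix c assume c: "c : Bc q d M"
  have "card {n. coprime n (int c) & real c * x0 < of_int n & of_int n < real c * x1} <= card {n. coprime n (int c) & real c * x0 <= of_int n & of_int n <= real c * x1}"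
   by (rule card_mono[OF int_interval_open(2)]) auto
  thus "real (card {n. coprime n (int c) & real c * x0 < of_int n & of_int n < real c * x1}) <= 2 * real M"
   using card_row_le[OF c x, of "%n. coprime n (int c)"] by linarith
 qed
 also have "... <= real M * (2 * real M)" using card_Bc[of q d M] by (simp add: mult_right_mono)
 finally show ?thesis by (simp add: power2_eq_square)
qed

lemma Sf_mono: "m <= M ==> card (Sf q d x0 x1 m) <= card (Sf q d x0 x1 M)"
 by (rule card_mono[OF finite_Sf]) (auto simp: Sf_def Bc_def)

text \<open>Dividing out common factors maps the pairs \<open>(dn, 1 + qj)\<close> with \<open>n \<equiv> 1\<close> modulo \<open>q\<close> injectively into
  reduced fractions, since \<open>1 + qj\<close> is prime to \<open>q\<close>.\<close>
lemma card_Sf_sum_lower: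
 assumes q: "q >= 1" and d: "d dvd q" and x: "x0 < x1" and M: "M >= 2 * d"
 shows "real d * (x1 - x0) / (6 * real q) * ((real M)^2 / (4 * (real d)^2 * real q) - 6 * real M - 6 * real q) - real M
  <= (\<Sum>g\<in>{1..M}. real (card (Sf q d x0 x1 (M div g))))"
proof -
 define L where "L = x1 - x0"
 have L: "L > 0" using x by (simp add: L_def)
 have d1: "d >= 1" using d q by (cases d) auto
 define m where "m = M div d"
 define r where "r = 1 mod q"
 have r: "r < q" using q by (simp add: r_def)
 \<comment> \<open>The bounds keep \<open>(1 + q j) / (d n)\<close> in the middle third of the
   interval, so strict inequalities follow. The range of \<open>j\<close> has length
   \<open>d n L / (3 q)\<close>.\<close>
 define lo where "lo = (%n::nat. (real (d * n) * (x0 + L / 3) - 1) / real q)"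
 define hi where "hi = (%n::nat. (real (d * n) * (x1 - L / 3) - 1) / real q)"
 define T where "T = (SIGMA n:Ac q r m. {j::int. lo n <= of_int j & of_int j <= hi n})"
 have finT: "finite T" unfolding T_def by (intro finite_SigmaI finite_Ac finite_int_interval_card(1))
 have "real d * L / (6 * real q) * ((real M)^2 / (4 * (real d)^2 * real q) - 6 * real M - 6 * real q) - real M <= real (card T)"
 proof -
  have "real (card T) = (\<Sum>n\<in>Ac q r m. real (card {j::int. lo n <= of_int j & of_int j <= hi n}))"
   unfolding T_def by (subst card_SigmaI) (auto intro: finite_int_interval_card(1))
  also have "... >= (\<Sum>n\<in>Ac q r m. (real d * L / (6 * real q)) * (2 * real n) - 1)"
  proof (rule sum_mono)
   fix n
   have "hi n - lo n = (real d * L / (6 * real q)) * (2 * real n)"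
    unfolding hi_def lo_def diff_divide_distrib[symmetric] using q by (simp add: L_def field_simps)
   thus "(real d * L / (6 * real q)) * (2 * real n) - 1 <= real (card {j::int. lo n <= of_int j & of_int j <= hi n})"
    using int_interval_card_lower[of "hi n" "lo n"] int_interval_card_lower[of "lo n" "hi n"] by linarith
  qed
  also have "(\<Sum>n\<in>Ac q r m. (real d * L / (6 * real q)) * (2 * real n) - 1) = real d * L / (6 * real q) * EA q r m - real (card (Ac q r m))"
   by (simp only: sum_subtractf sum_distrib_left[symmetric] EA_def) simp
  finally have 1: "real d * L / (6 * real q) * EA q r m - real (card (Ac q r m)) <= real (card T)" .
  have mM: "real m <= real M" by (simp add: m_def)
  have "real M / real d - 1 <= real m" unfolding m_def by (rule real_div_bounds(2))
  moreover have "1 <= real M / (2 * real d)" using M d1 by (simp add: le_divide_eq)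
  moreover have "real M / real d = real M / (2 * real d) + real M / (2 * real d)" using d1 by (simp add: field_simps)
  ultimately have "real M / (2 * real d) <= real m" by linarith
  hence "(real M / (2 * real d))^2 <= (real m)^2" by (intro power_mono) auto
  hence "(real M)^2 / (4 * (real d)^2) <= (real m)^2" by (simp add: power_divide power_mult_distrib)
  hence "(real M)^2 / (4 * (real d)^2) / real q <= (real m)^2 / real q" by (intro divide_right_mono) auto
  hence "(real M)^2 / (4 * (real d)^2 * real q) <= (real m)^2 / real q" by simp
  hence "(real M)^2 / (4 * (real d)^2 * real q) - 6 * real M - 6 * real q <= EA q r m" using EA_asymp[OF q r, of m] mM by linarith
  hence "real d * L / (6 * real q) * ((real M)^2 / (4 * (real d)^2 * real q) - 6 * real M - 6 * real q) <= real d * L / (6 * real q) * EA q r m"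
   using L by (intro mult_left_mono) auto
  moreover have "real (card (Ac q r m)) <= real M" using card_Ac[of q r m] mM by linarith
  ultimately show ?thesis using 1 by linarith
 qed
 also have "real (card T) <= real (card (SIGMA g:{1..M}. Sf q d x0 x1 (M div g)))"
 proof -
  define G where "G = (%(n::nat, j::int). nat (gcd (1 + int q * j) (int (d * n))))"
  define \<phi> where "\<phi> = (%(n::nat, j::int). (G (n,j), ((d * n) div G (n,j), (1 + int q * j) div int (G (n,j)))))"
  have prp: "G (n,j) >= 1" "G (n,j) dvd d * n" "int (G (n,j)) dvd 1 + int q * j" if "n >= 1" for n j
  proof -
   have "gcd (1 + int q * j) (int (d * n)) > 0" using that d1 by (simp add: gcd_pos_int)
   moreover have iG: "int (G (n,j)) = gcd (1 + int q * j) (int (d * n))" by (simp add: G_def)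
   ultimately show "G (n,j) >= 1" by linarith
   show "int (G (n,j)) dvd 1 + int q * j" unfolding iG by (rule gcd_dvd1)
   have "int (G (n,j)) dvd int (d * n)" unfolding iG by (rule gcd_dvd2)
   thus "G (n,j) dvd d * n" by (simp only: int_dvd_int_iff)
  qed
  have Tn: "n >= 1" "n <= m" "n mod q = r" "lo n <= of_int j" "of_int j <= hi n" if "(n,j) : T" for n j
   using that by (auto simp: T_def Ac_def)
  have "inj_on \<phi> T"
  proof (rule inj_onI)
   fix z w assume zw: "z : T" "w : T" "\<phi> z = \<phi> w"
   obtain n j n' j' where e: "z = (n,j)" "w = (n',j')" by (cases z; cases w) auto
   have nn: "n >= 1" "n' >= 1" using Tn zw e by auto
   have Geq: "G (n,j) = G (n',j')" and a: "(d * n) div G (n,j) = (d * n') div G (n,j)" and b: "(1 + int q * j) div int (G (n,j)) = (1 + int q * j') div int (G (n,j))"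
    using zw(3) unfolding e \<phi>_def by auto
   have "d * n = d * n'" using prp(2)[OF nn(1), of j] prp(2)[OF nn(2), of j'] a Geq by (metis dvd_div_mult_self)
   moreover have "1 + int q * j = 1 + int q * j'" using prp(3)[OF nn(1), of j] prp(3)[OF nn(2), of j'] b Geq by (metis dvd_div_mult_self)
   ultimately show "z = w" using d1 q by (simp add: e)
  qed
  moreover have "\<phi> ` T <= (SIGMA g:{1..M}. Sf q d x0 x1 (M div g))"
  proof
   fix w assume "w : \<phi> ` T"
   then obtain n j where nj: "(n,j) : T" and w: "w = \<phi> (n,j)" by auto
   note t = Tn[OF nj]
   define g where "g = G (n,j)"
   obtain c where c: "d * n = g * c" using prp(2)[OF t(1), of j] by (auto simp: g_def)
   obtain k where k: "1 + int q * j = int g * k" using prp(3)[OF t(1), of j] by (auto simp: g_def)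
   have g1: "g >= 1" using prp(1)[OF t(1)] by (simp add: g_def)
   have wk: "w = (g, (c, k))" unfolding w \<phi>_def using c k g1 by (simp add: g_def[symmetric])
   have dnM: "d * n <= M" using t(2) d1 unfolding m_def by (simp add: less_eq_div_iff_mult_less_eq mult.commute)
   have c1: "c >= 1" using c t(1) d1 by (cases c) auto
   have "g * c <= M" using dnM c by simp
   hence cM: "c <= M div g" using g1 by (simp add: less_eq_div_iff_mult_less_eq mult.commute)
   have "g * 1 <= g * c" using c1 by (intro mult_le_mono2)
   hence gM: "g <= M" using \<open>g * c <= M\<close> by linarith
   have cop: "coprime k (int c)"
   proof -
    have "gcd (int g * k) (int g * int c) = int g * gcd k (int c)" using gcd_mult_distrib_int[of "int g" k "int c"] by simp
    moreover have e: "int g * int c = int (d * n)" unfolding c by simp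
    have "gcd (int g * k) (int g * int c) = int g" unfolding k[symmetric] e by (simp add: g_def G_def)
    ultimately show ?thesis using g1 by (simp add: coprime_iff_gcd_eq_1)
   qed
   \<comment> \<open>The divisor \<open>g\<close> divides \<open>1 + q j\<close> and is therefore
     prime to \<open>q\<close>, and \<open>n\<close> is prime to \<open>q\<close> by its residue.
     Hence \<open>gcd c q = gcd (g c) q = gcd (d n) q = gcd d q\<close>.\<close>
   have cq: "gcd c q = d"
   proof -
    have "coprime (int g) (int q)"
    proof (rule coprimeI)
     fix u assume u: "u dvd int g" "u dvd int q"
     hence "u dvd 1 + int q * j" "u dvd int q * j" using k by auto
     hence "u dvd (1 + int q * j) - int q * j" by (rule dvd_diff)
     thus "is_unit u" by simp
    qed
    hence cgq: "coprime g q" by simp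
    have "gcd n q = gcd (n mod q) q" by (metis gcd.commute gcd_red_nat)
    also have "... = 1" unfolding t(3) r_def using gcd_red_nat[of 1 q] by (simp add: gcd.commute)
    finally have cnq: "coprime n q" by (simp add: coprime_iff_gcd_eq_1)
    have "gcd c q = gcd (g * c) q" using cgq by (simp add: gcd_mult_left_left_cancel coprime_commute)
    also have "... = gcd (d * n) q" by (simp add: c)
    also have "... = gcd d q" using cnq by (simp add: gcd_mult_left_right_cancel coprime_commute)
    also have "... = d" using d by (simp add: gcd_proj1_iff)
    finally show ?thesis .
   qed
   have q0: "real q > 0" using q by simp
   have g0: "real g > 0" using g1 by simp
   have dn0: "real (d * n) > 0" using d1 t(1) by simp
   have kr: "real g * of_int k = 1 + real q * of_int j"
    using k by (metis of_int_1 of_int_add of_int_mult of_int_of_nat_eq)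
   have dn: "real (d * n) = real g * real c" unfolding c by simp
   have lo': "real (d * n) * (x0 + L / 3) <= 1 + real q * of_int j" using t(4) q0 by (simp add: lo_def field_simps)
   have hi': "1 + real q * of_int j <= real (d * n) * (x1 - L / 3)" using t(5) q0 by (simp add: hi_def field_simps)
   have "real (d * n) * x0 < real (d * n) * (x0 + L / 3)" "real (d * n) * (x1 - L / 3) < real (d * n) * x1" using dn0 L by (auto intro!: mult_strict_left_mono)
   hence "real g * (real c * x0) < real g * of_int k" "real g * of_int k < real g * (real c * x1)" using lo' hi' unfolding kr dn by (simp_all add: mult.assoc)
   hence "real c * x0 < of_int k" "of_int k < real c * x1" using g0 by simp_all
   thus "w : (SIGMA g:{1..M}. Sf q d x0 x1 (M div g))" using g1 gM c1 cM cop cq by (simp add: wk Sf_def Bc_def)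
  qed
  ultimately have "card T <= card (SIGMA g:{1..M}. Sf q d x0 x1 (M div g))" by (rule card_inj_on_le) simp
  thus ?thesis by (rule of_nat_mono)
 qed
 also have "... = (\<Sum>g\<in>{1..M}. real (card (Sf q d x0 x1 (M div g))))" by (subst card_SigmaI) auto
 finally show ?thesis by (simp only: L_def)
qed

text \<open>In the lower bound for the sum over divisors \<open>g\<close>, large \<open>g\<close>
  contribute little by the trivial estimate, and each \<open>g <= G\<close> contributes at most the
  full count. A positive proportion of \<open>M\<^sup>2\<close> is left for the latter, which lets
  errors of size \<open>\<epsilon> M\<^sup>2\<close> be read as relative errors.\<close>

lemma card_Sf_lower:
 assumes q: "q >= 1" and d: "d dvd q" and x: "x0 < x1" "x1 - x0 <= 1"
 shows "EX \<kappa>>0. EV M. \<kappa> * (real M)^2 <= real (card (Sf q d x0 x1 M))"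
proof -
 have d1: "d >= 1" using d q by (cases d) auto
 define \<beta> where "\<beta> = real d * (x1 - x0) / (6 * real q)"
 define \<gamma> where "\<gamma> = 1 / (4 * (real d)^2 * real q)"
 have bg: "\<beta> > 0" "\<gamma> > 0" using d1 q x by (auto simp: \<beta>_def \<gamma>_def)
 define w where "w = \<beta> * \<gamma> / 4"
 have w0: "w > 0" using bg by (simp add: w_def)
 \<comment> \<open>The divisors beyond \<open>G\<close> contribute at most
   \<open>2 M\<^sup>2 / G\<close>, here at most a quarter of the leading term
   \<open>4 w M\<^sup>2\<close>.\<close>
 define G where "G = nat \<lceil>2 / w\<rceil> + 1"
 have G1: "G >= 1" by (simp add: G_def)
 have Gw: "2 / real G <= w"
 proof -
  have "2 / w <= real G" unfolding G_def by linarith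
  thus ?thesis using w0 G1 by (simp add: field_simps)
 qed
 have x': "x0 <= x1" using x by simp
 have ev: "EV M::nat. (6 * \<beta> + 1) * real M + 6 * real q * \<beta> <= w * (real M)^2" using w0 by real_asymp
 have "EV M. w / real G * (real M)^2 <= real (card (Sf q d x0 x1 M))"
  using ev eventually_ge_at_top[of "2 * d + G"]
 proof eventually_elim
  case (elim M)
  let ?n = "%g. real (card (Sf q d x0 x1 (M div g)))"
  have M: "M >= 2 * d" "M >= G" using elim by auto
  have "\<beta> * (\<gamma> * (real M)^2 - 6 * real M - 6 * real q) - real M <= (\<Sum>g\<in>{1..M}. ?n g)"
   using card_Sf_sum_lower[OF q d x(1) M(1)] by (simp add: \<beta>_def \<gamma>_def)
  also have "... = (\<Sum>g\<in>{1..G}. ?n g) + (\<Sum>g\<in>{G<..M}. ?n g)"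
  proof -
   have e: "{1..M} = {1..G} \<union> {G<..M}" using M by auto
   show ?thesis unfolding e by (rule sum.union_disjoint) auto
  qed
  also have "... <= real G * real (card (Sf q d x0 x1 M)) + 2 * (real M)^2 * (1 / real G)"
  proof (rule add_mono)
   have "(\<Sum>g\<in>{1..G}. ?n g) <= real (card {1..G}) * real (card (Sf q d x0 x1 M))"
    by (rule sum_bounded_above) (simp add: Sf_mono)
   thus "(\<Sum>g\<in>{1..G}. ?n g) <= real G * real (card (Sf q d x0 x1 M))" by simp
   have "(\<Sum>g\<in>{G<..M}. ?n g) <= (\<Sum>g\<in>{G<..M}. 2 * (real M)^2 * (1 / (real g)^2))"
   proof (rule sum_mono)
    fix g
    have "?n g <= 2 * (real (M div g))^2" by (rule card_Sf_le[OF x' x(2)])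
    also have "... <= 2 * (real M / real g)^2" using real_div_bounds(1)[of M g] by (intro mult_left_mono power_mono) auto
    finally show "?n g <= 2 * (real M)^2 * (1 / (real g)^2)" by (simp add: power_divide)
   qed
   also have "... = 2 * (real M)^2 * (\<Sum>g\<in>{G<..M}. 1 / (real g)^2)" by (rule sum_distrib_left[symmetric])
   also have "... <= 2 * (real M)^2 * (1 / real G)" by (intro mult_left_mono sum_inverse_squares_tail G1) auto
   finally show "(\<Sum>g\<in>{G<..M}. ?n g) <= 2 * (real M)^2 * (1 / real G)" .
  qed
  also have "2 * (real M)^2 * (1 / real G) = 2 / real G * (real M)^2" by simp
  also have "real G * real (card (Sf q d x0 x1 M)) + 2 / real G * (real M)^2 <= real G * real (card (Sf q d x0 x1 M)) + w * (real M)^2"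
   using Gw by (intro add_left_mono mult_right_mono) auto
  finally have "\<beta> * (\<gamma> * (real M)^2 - 6 * real M - 6 * real q) - real M <= real G * real (card (Sf q d x0 x1 M)) + w * (real M)^2" .
  moreover have "\<beta> * (\<gamma> * (real M)^2 - 6 * real M - 6 * real q) - real M = 4 * (w * (real M)^2) - ((6 * \<beta> + 1) * real M + 6 * real q * \<beta>)"
   by (simp add: w_def algebra_simps)
  moreover have "w * (real M)^2 >= 0" using w0 by simp
  ultimately have "w * (real M)^2 <= real G * real (card (Sf q d x0 x1 M))" using elim(1) by linarith
  thus ?case using G1 by (simp add: field_simps)
 qed
 thus ?thesis using w0 G1 by (intro exI[of _ "w / real G"]) auto
qed

section \<open>Removing the smooth weight\<close>

definition tp :: "nat => real => real" where "tp k x = (max x 0) ^ k"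

text \<open>The exponent is at least 2 because the truncated first power has a corner at 0; there
  the difference quotient of a higher power is bounded by a positive power of
  \<open>|h|\<close>.\<close>

lemma tp_deriv: "(tp (Suc (Suc k)) has_real_derivative real (Suc (Suc k)) * tp (Suc k) x) (at x)"
proof (cases "x = 0")
 case True
 have "((%h. (tp (Suc (Suc k)) (0 + h) - tp (Suc (Suc k)) 0) / h) \<longlongrightarrow> 0) (at 0)"
 proof (rule Lim_null_comparison)
  show "\<forall>\<^sub>F h in at 0. norm ((tp (Suc (Suc k)) (0 + h) - tp (Suc (Suc k)) 0) / h) <= abs h ^ Suc k"
  proof (intro always_eventually allI)
   fix h :: real
   show "norm ((tp (Suc (Suc k)) (0 + h) - tp (Suc (Suc k)) 0) / h) <= abs h ^ Suc k"
   proof (cases "h > 0")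
    case False
    hence "tp (Suc (Suc k)) (0 + h) = 0" "tp (Suc (Suc k)) 0 = 0" by (simp_all add: tp_def max_def)
    thus ?thesis by (simp del: power_Suc)
   qed (simp add: tp_def max_def)
  qed
  have "((%h::real. abs h ^ Suc k) \<longlongrightarrow> abs 0 ^ Suc k) (at 0)" by (intro tendsto_intros)
  thus "((%h::real. abs h ^ Suc k) \<longlongrightarrow> 0) (at 0)" by simp
 qed
 thus ?thesis using True by (simp add: DERIV_def tp_def)
next
 case False
 show ?thesis
 proof (cases "x > 0")
  case True
  have "((%x. x ^ Suc (Suc k)) has_real_derivative real (Suc (Suc k)) * tp (Suc k) x) (at x)"
   using DERIV_pow[of "Suc (Suc k)" x] True by (simp add: tp_def)
  thus ?thesis
  proof (rule has_field_derivative_transform_within_open[of _ _ _ "{0<..}"])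
   show "x' ^ Suc (Suc k) = tp (Suc (Suc k)) x'" if "x' : {0<..}" for x' :: real using that by (simp add: tp_def)
  qed (use True in auto)
 next
  case F2: False
  have "((%x. 0) has_real_derivative real (Suc (Suc k)) * tp (Suc k) x) (at x)"
   using False F2 by (auto simp: tp_def max_def)
  thus ?thesis
  proof (rule has_field_derivative_transform_within_open[of _ _ _ "{..<0}"])
   show "0 = tp (Suc (Suc k)) x'" if "x' : {..<0}" for x' :: real using that by (simp add: tp_def max_def)
  qed (use False F2 in auto)
 qed
qed

text \<open>Third binomial difference of truncated powers. \<open>spl 2\<close> is twice the
  quadratic B-spline on \<open>[0,3]\<close>, and \<open>spl 3\<close> is a smooth step rising from
  0 to 3! = 6 with derivative \<open>3 * spl 2\<close>.\<close>

definition spl :: "nat => real => real" where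
 "spl k t = tp k t - 3 * tp k (t - 1) + 3 * tp k (t - 2) - tp k (t - 3)"

lemma spl_cont: "continuous_on UNIV (spl k)"
proof -
 have t: "continuous_on UNIV (tp k)" unfolding tp_def[abs_def] by (intro continuous_intros)
 have "continuous_on UNIV (%x. tp k (x - s))" for s
  by (rule continuous_on_compose2[OF t]) (auto intro!: continuous_intros)
 thus ?thesis unfolding spl_def[abs_def] using t by (intro continuous_on_add continuous_on_diff continuous_on_mult continuous_on_const)
qed

lemma spl_deriv: "(spl (Suc (Suc k)) has_real_derivative real (Suc (Suc k)) * spl (Suc k) x) (at x)"
proof -
 have "((%x. tp (Suc (Suc k)) (x - s)) has_real_derivative real (Suc (Suc k)) * tp (Suc k) (x - s)) (at x)" for s
 proof -
  have "((%x. x - s) has_real_derivative 1) (at x)" by (auto intro!: derivative_eq_intros)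
  from DERIV_chain2[OF _ this, of "tp (Suc (Suc k))" "real (Suc (Suc k)) * tp (Suc k) (x - s)"] tp_deriv[of k "x - s"] show ?thesis by simp
 qed
 note this[of 0] this
 hence "((%t. tp (Suc (Suc k)) (t - 0) - 3 * tp (Suc (Suc k)) (t - 1) + 3 * tp (Suc (Suc k)) (t - 2) - tp (Suc (Suc k)) (t - 3)) has_real_derivative
  real (Suc (Suc k)) * tp (Suc k) (x - 0) - 3 * (real (Suc (Suc k)) * tp (Suc k) (x - 1)) + 3 * (real (Suc (Suc k)) * tp (Suc k) (x - 2)) - real (Suc (Suc k)) * tp (Suc k) (x - 3)) (at x)"
  by (intro DERIV_add DERIV_diff DERIV_cmult)
 thus ?thesis unfolding spl_def[abs_def] by (simp add: algebra_simps)
qed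

lemma spl_vals:
 "t <= 0 ==> k >= 1 ==> spl k t = 0" "t >= 3 ==> spl 3 t = 6" "t >= 3 ==> spl 2 t = 0" "t >= 3 ==> spl 1 t = 0" "spl 2 t >= 0"
proof -
 show "t <= 0 ==> k >= 1 ==> spl k t = 0" by (simp add: spl_def tp_def max_def)
 show "t >= 3 ==> spl 3 t = 6" by (simp add: spl_def tp_def max_def power3_eq_cube algebra_simps)
 show "t >= 3 ==> spl 2 t = 0" by (simp add: spl_def tp_def max_def power2_eq_square algebra_simps)
 show "t >= 3 ==> spl 1 t = 0" by (simp add: spl_def tp_def max_def)
 consider "t <= 0" | "0 < t" "t <= 1" | "1 < t" "t <= 2" | "2 < t" "t <= 3" | "3 < t" by linarith
 thus "spl 2 t >= 0"
 proof cases
  case 2 thus ?thesis by (simp add: spl_def tp_def max_def)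
 next
  case 3
  have "spl 2 t = 3 / 2 - 2 * (t - 3 / 2)^2" using 3 by (simp add: spl_def tp_def max_def power2_eq_square algebra_simps)
  moreover have "(t - 3 / 2)^2 <= (1 / 2)^2" using 3 power2_le_iff_abs_le[of "1 / 2" "t - 3 / 2"] by (simp add: abs_le_iff field_simps)
  ultimately show ?thesis by (simp add: power2_eq_square)
 next
  case 4
  have "spl 2 t = (3 - t)^2" using 4 by (simp add: spl_def tp_def max_def power2_eq_square algebra_simps)
  thus ?thesis by simp
 qed (simp_all add: spl_def tp_def max_def power2_eq_square algebra_simps)
qed

lemma spl3_mono:
 assumes "s <= t" shows "spl 3 s <= spl 3 t"
proof (rule DERIV_nonneg_imp_nondecreasing[OF assms])
 fix x show "EX y. (spl 3 has_real_derivative y) (at x) & 0 <= y"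
  using spl_deriv[of 1 x] spl_vals(5)[of x] by (intro exI[of _ "3 * spl 2 x"]) (simp add: numeral_3_eq_3 numeral_2_eq_2)
qed

text \<open>The weight is a difference of two spline steps, one rising just after \<open>x0\<close>,
  one just before \<open>x1\<close>. Two continuous derivatives are exactly what the cubic spline
  provides.\<close>

lemma bump_exists:
 fixes x0 x1 h :: real
 assumes h: "h > 0" "2 * h < x1 - x0"
 shows "EX \<psi> \<psi>1 \<psi>2 Lp Mp. bump \<psi> \<psi>1 \<psi>2 x0 x1 Lp Mp & (ALL x:{x0+h..x1-h}. \<psi> x = 1)"
proof -
 \<comment> \<open>Scales the step, which takes length 3, to length \<open>h\<close>.\<close>
 define w where "w = 3 / h"
 have w0: "w > 0" using h by (simp add: w_def)
 define A where "A = (%x. w * (x - x0))"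
 define E where "E = (%x. w * (x - (x1 - h)))"
 define \<psi> where "\<psi> = (%x. (spl 3 (A x) - spl 3 (E x)) / 6)"
 define \<psi>1 where "\<psi>1 = (%x. w * (spl 2 (A x) - spl 2 (E x)) / 2)"
 define \<psi>2 where "\<psi>2 = (%x. w^2 * (spl 1 (A x) - spl 1 (E x)))"
 have wh: "w * h = 3" using h by (simp add: w_def)
 have A3: "A x >= 3" if "x >= x0 + h" for x
 proof -
  have "w * h <= w * (x - x0)" using that w0 by (intro mult_left_mono) auto
  thus ?thesis by (simp add: wh A_def)
 qed
 have E3: "E x >= 3" if "x >= x1" for x
 proof -
  have "w * h <= w * (x - (x1 - h))" using that w0 by (intro mult_left_mono) auto
  thus ?thesis by (simp add: wh E_def)
 qed
 have A0: "A x <= 0" if "x <= x0" for x using that w0 by (simp add: A_def mult_nonneg_nonpos)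
 have E0: "E x <= 0" if "x <= x1 - h" for x using that w0 by (simp add: E_def mult_nonneg_nonpos)
 have ch: "((%x. spl (Suc (Suc k)) (w * (x - s))) has_real_derivative (real (Suc (Suc k)) * spl (Suc k) (w * (x - s))) * w) (at x)" for k s x
  by (rule DERIV_chain2[OF spl_deriv]) (auto intro!: derivative_eq_intros)
 have d1: "(\<psi> has_real_derivative \<psi>1 x) (at x)" for x
 proof -
  have "(\<psi> has_real_derivative ((real 3 * spl 2 (A x)) * w - (real 3 * spl 2 (E x)) * w) / 6) (at x)"
   unfolding \<psi>_def A_def E_def using ch[of 1] by (intro DERIV_cdivide DERIV_diff) (simp_all add: numeral_3_eq_3 numeral_2_eq_2)
  thus ?thesis by (simp add: \<psi>1_def algebra_simps diff_divide_distrib)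
 qed
 have d2: "(\<psi>1 has_real_derivative \<psi>2 x) (at x)" for x
 proof -
  have "(\<psi>1 has_real_derivative w * ((real 2 * spl 1 (A x)) * w - (real 2 * spl 1 (E x)) * w) / 2) (at x)"
   unfolding \<psi>1_def A_def E_def using ch[of 0] by (intro DERIV_cdivide DERIV_cmult DERIV_diff) (simp_all add: numeral_2_eq_2)
  moreover have "w * ((real 2 * spl 1 (A x)) * w - (real 2 * spl 1 (E x)) * w) / 2 = \<psi>2 x" by (simp add: \<psi>2_def power2_eq_square field_simps)
  ultimately show ?thesis by simp
 qed
 have c2: "continuous_on UNIV \<psi>2"
 proof -
  have "continuous_on UNIV (%x. spl 1 (w * (x - s)))" for s
   by (rule continuous_on_compose2[OF spl_cont]) (auto intro!: continuous_intros)
  from continuous_on_mult[OF continuous_on_const continuous_on_diff[OF this this]] show ?thesis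
   unfolding \<psi>2_def A_def E_def by blast
 qed
 have c1: "continuous_on UNIV \<psi>1" using d2 by (meson DERIV_isCont continuous_at_imp_continuous_on)
 have out: "\<psi> x = 0" "\<psi>1 x = 0" "\<psi>2 x = 0" if "x \<notin> {x0..x1}" for x
 proof -
  have "\<psi> x = 0 & \<psi>1 x = 0 & \<psi>2 x = 0"
  proof (cases "x < x0")
   case True
   have "A x <= 0" by (rule A0) (use True in simp)
   moreover have "E x <= 0" by (rule E0) (use True h in simp)
   ultimately show ?thesis by (simp add: \<psi>_def \<psi>1_def \<psi>2_def spl_vals(1))
  next
   case False
   have "A x >= 3" by (rule A3) (use False that h in simp)
   moreover have "E x >= 3" by (rule E3) (use False that in simp)
   ultimately show ?thesis unfolding \<psi>_def \<psi>1_def \<psi>2_def by (simp only: spl_vals(2-4)) simp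
  qed
  thus "\<psi> x = 0" "\<psi>1 x = 0" "\<psi>2 x = 0" by auto
 qed
 have bd: "EX L. ALL x. abs (g x) <= L" if g: "continuous_on UNIV g" "!!x. x \<notin> {x0..x1} ==> g x = 0" for g :: "real => real"
 proof -
  have "compact (g ` {x0..x1})" using continuous_on_subset[OF g(1)] by (intro compact_continuous_image) auto
  then obtain L where L: "ALL y:g ` {x0..x1}. norm y <= L" using compact_imp_bounded bounded_iff by blast
  have "abs (g x) <= max L 0" for x by (cases "x : {x0..x1}") (use L g(2) in \<open>auto simp: le_max_iff_disj\<close>)
  thus ?thesis by blast
 qed
 obtain Lp where Lp: "!!x. abs (\<psi>1 x) <= Lp" using bd[OF c1 out(2)] by blast
 obtain Mp where Mp: "!!x. abs (\<psi>2 x) <= Mp" using bd[OF c2 out(3)] by blast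
 have rng: "0 <= \<psi> x & \<psi> x <= 1" for x
 proof -
  have "E x <= A x" unfolding E_def A_def using w0 h by (intro mult_left_mono) auto
  hence "spl 3 (E x) <= spl 3 (A x)" by (rule spl3_mono)
  moreover have "spl 3 (min t 0) = 0" "spl 3 (max t 3) = 6" for t by (auto intro: spl_vals)
  hence "0 <= spl 3 t" "spl 3 t <= 6" for t using spl3_mono[of "min t 0" t] spl3_mono[of t "max t 3"] by auto
  hence "spl 3 (A x) <= 6" "0 <= spl 3 (E x)" by blast+
  ultimately have "0 <= spl 3 (A x) - spl 3 (E x)" "spl 3 (A x) - spl 3 (E x) <= 6" by linarith+
  thus ?thesis by (simp add: \<psi>_def)
 qed
 have "bump \<psi> \<psi>1 \<psi>2 x0 x1 Lp Mp"
  by unfold_locales (use h d1 d2 c2 out rng Lp Mp in auto)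
 moreover have "\<psi> x = 1" if "x : {x0+h..x1-h}" for x
  using that A3[of x] E0[of x] by (simp add: \<psi>_def spl_vals)
 ultimately show ?thesis by blast
qed

context cdata
begin

text \<open>At height \<open>1 / c\<^sup>2\<close> above the fraction, \<open>F\<close> is within
  O(1) of the symbol and is itself O(\<open>1 + ln c\<close>).\<close>

lemma Fr_bound:
 assumes "coprime n (int c)" "c >= 1"
 shows "abs (Fr f (of_int n / real c)) <= 2 * pi * (4 * C + 2 * B * (ln (real c) + 1))"
proof -
 define z where "z = Cx (of_int n / real c) (1 / (real c)^2)"
 have c1: "real c >= 1" using assms by simp
 have z: "0 < Im z" "Im z <= 1" using c1 by (auto simp: z_def divide_le_eq)
 have nz: "z - cor (roi n / roi (int c)) = \<i> * cor (1 / (real c)^2)"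
  by (auto simp: z_def complex_eq_iff)
 have "abs (F z - Fr f (roi n / roi (int c))) <= 2 * pi * (2 * C + B * ln (1 / (1 / 2)))"
 proof (rule F_near_rational[OF assms(1)])
  show "z : UHP" using z by (simp add: UHP_def)
  show "1 / 2 * ((roi (int c))^2 * (norm (z - cor (roi n / roi (int c))))^2) <= Im z"
   unfolding nz norm_mult norm_of_real using c1 by (simp add: z_def power2_eq_square field_simps)
 qed (use assms in auto)
 moreover have "abs (F z) <= 2 * pi * (2 * C + B * (ln (1 / Im z) + 1))" using z by (rule F_bound)
 moreover have "ln (1 / Im z) = 2 * ln (real c)" using c1 by (simp add: z_def ln_realpow)
 moreover have "2 * pi * (2 * C + B * ln 2) <= 2 * pi * (2 * C + B * 1)"
  using B0 ln_le_minus_one[of 2] by (intro mult_left_mono add_left_mono) auto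
 moreover have "ln (1 / (1 / 2)) = ln (2::real)" by simp
 ultimately have "abs (Fr f (of_int n / real c)) <= 2 * pi * (2 * C + B * (2 * ln (real c) + 1)) + 2 * pi * (2 * C + B * 1)"
  unfolding of_int_of_nat_eq by (smt (verit))
 thus ?thesis by (simp add: algebra_simps)
qed

end

context cbump
begin

text \<open>Three differences are estimated: the weight differs from 1 only within \<open>h\<close>
  of the end points; denominators up to \<open>h M\<close> are few; and for larger ones
  \<open>sqrt (ln c)\<close> may be exchanged for \<open>sqrt (ln M)\<close>, since the symbol is
  O(\<open>ln M\<close>) while the reciprocals differ by a multiple of (ln M)^(-3/2).\<close>

lemma Sf_vs_Wt:
 assumes h: "h > 0" "h < 1" and one: "ALL x:{X0 + h..X1 - h}. \<psi> x = 1" and L1: "X1 - X0 <= 1" and hL: "2 * h < X1 - X0" and \<tau>: "\<tau> >= 0"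
 shows "EV M. norm ((\<Sum>(c,n)\<in>Sf q d X0 X1 M. cis (\<tau> / sqrt (ln (real c)) * Fr f (of_int n / real c))) - Wt d (\<tau> / sqrt (ln (real M))) M) <= 11 * h * (real M)^2"
proof -
 have lim: "(%M::nat. \<tau> * (2 * pi * (4 * C + 2 * B * (ln (real M) + 1))) * (1 / sqrt (ln (h * real M)) - 1 / sqrt (ln (real M)))) \<longlonglongrightarrow> 0"
  using h by real_asymp
 have e1: "EV M::nat. \<tau> * (2 * pi * (4 * C + 2 * B * (ln (real M) + 1))) * (1 / sqrt (ln (h * real M)) - 1 / sqrt (ln (real M))) < h"
  by (rule order_tendstoD(2)[OF lim h(1)])
 have e2: "EV M::nat. h * real M > 2" using h by real_asymp
 have e3: "EV M::nat. 4 * real M <= h * (real M)^2" using h by real_asymp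
 show ?thesis using e1 e2 e3
 proof eventually_elim
  case (elim M)
  have M1: "real M >= 1"
  proof -
   have "h * real M <= 1 * real M" using h by (intro mult_right_mono) auto
   thus ?thesis using elim(2) by linarith
  qed
  define I where "I = (%c::nat. {n::int. coprime n (int c) & real c * X0 <= of_int n & of_int n <= real c * X1})"
  define I1 where "I1 = (%c::nat. {n::int. coprime n (int c) & real c * X0 < of_int n & of_int n < real c * X1})"
  define E where "E = (%c::nat. {n::int. True & real c * X0 <= of_int n & of_int n <= real c * (X0 + h)} \<union> {n::int. True & real c * (X1 - h) <= of_int n & of_int n <= real c * X1})"
  define s where "s = (%c (n::int). cis (\<tau> / sqrt (ln (real c)) * Fr f (of_int n / real c)))"
  define v where "v = (%c (n::int). cor (\<psi> (of_int n / real c)) * cis (\<tau> / sqrt (ln (real M)) * Fr f (of_int n / real c)))"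
  have fI: "finite (I c)" "finite (I1 c)" "finite (E c)" for c unfolding I_def I1_def E_def by (intro int_interval_open finite_UnI)+
  have "(\<Sum>(c,n)\<in>Sf q d X0 X1 M. s c n) = (\<Sum>c\<in>Bc q d M. \<Sum>n\<in>I1 c. s c n)"
   unfolding Sf_eq_Sigma I1_def[symmetric] by (rule sum.Sigma[symmetric]) (auto simp: fI)
  also have "... = (\<Sum>c\<in>Bc q d M. \<Sum>n\<in>I c. if n : I1 c then s c n else 0)"
   using fI by (intro sum.cong refl sum.mono_neutral_cong_left) (auto simp: I_def I1_def)
  finally have S1: "(\<Sum>(c,n)\<in>Sf q d X0 X1 M. s c n) = (\<Sum>c\<in>Bc q d M. \<Sum>n\<in>I c. if n : I1 c then s c n else 0)" .
  have S2: "Wt d (\<tau> / sqrt (ln (real M))) M = (\<Sum>c\<in>Bc q d M. \<Sum>n\<in>I c. v c n)" unfolding Wt_def v_def I_def ..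
  have nv: "norm (v c n) <= 1" for c n using psi01[of "of_int n / real c"] by (simp add: v_def norm_mult)
  have ns: "norm (if n : I1 c then s c n else 0) <= 1" for c n by (simp add: s_def)
  have pt: "norm ((if n : I1 c then s c n else 0) - v c n) <= 2 * ind (E c) n + (if real c <= h * real M then 2 else 0) + h"
   if c: "c : Bc q d M" and n: "n : I c" for c n
  proof -
   have two: "norm ((if n : I1 c then s c n else 0) - v c n) <= 2" using norm_triangle_ineq4[of "if n : I1 c then s c n else 0" "v c n"] nv[of c n] ns[of n c] by linarith
   have c1: "c >= 1" "c <= M" using c by (auto simp: Bc_def)
   have c0: "real c > 0" using c1 by simp
   show ?thesis
   proof (cases "n : E c \<or> real c <= h * real M")
    case True
    thus ?thesis using two h by (auto simp: indicator_def)
   next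
    case False
    hence nE: "real c * (X0 + h) < of_int n" "of_int n < real c * (X1 - h)" and hc: "h * real M < real c" using n by (auto simp: E_def I_def)
    have "real c * X0 < real c * (X0 + h)" "real c * (X1 - h) < real c * X1" using c0 h by (auto intro!: mult_strict_left_mono)
    hence n1: "n : I1 c" using n nE by (auto simp: I_def I1_def)
    have "of_int n / real c : {X0 + h..X1 - h}" using nE c0 by (auto simp: field_simps)
    hence \<psi>n: "\<psi> (of_int n / real c) = 1" using one by blast
    have l: "0 < ln (h * real M)" "ln (h * real M) <= ln (real c)" "ln (real c) <= ln (real M)"
     using elim(2) hc c0 c1 by auto
    have r1: "0 <= 1 / sqrt (ln (real c)) - 1 / sqrt (ln (real M))" using l by (simp add: frac_le)
    have r2: "1 / sqrt (ln (real c)) - 1 / sqrt (ln (real M)) <= 1 / sqrt (ln (h * real M)) - 1 / sqrt (ln (real M))" using l by (simp add: frac_le)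
    have "norm (s c n - v c n) <= abs (\<tau> / sqrt (ln (real c)) * Fr f (of_int n / real c) - \<tau> / sqrt (ln (real M)) * Fr f (of_int n / real c))"
     unfolding s_def v_def \<psi>n of_real_1 mult_1 by (rule norm_cis_diff)
    also have "... = \<tau> * abs (Fr f (of_int n / real c)) * (1 / sqrt (ln (real c)) - 1 / sqrt (ln (real M)))"
    proof -
     have "\<tau> / sqrt (ln (real c)) * Fr f (of_int n / real c) - \<tau> / sqrt (ln (real M)) * Fr f (of_int n / real c) = \<tau> * Fr f (of_int n / real c) * (1 / sqrt (ln (real c)) - 1 / sqrt (ln (real M)))"
      by (simp add: right_diff_distrib)
     thus ?thesis using \<tau> by (simp only: abs_mult abs_of_nonneg[OF r1] abs_of_nonneg[OF \<tau>])
    qed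
    also have "... <= \<tau> * (2 * pi * (4 * C + 2 * B * (ln (real M) + 1))) * (1 / sqrt (ln (h * real M)) - 1 / sqrt (ln (real M)))"
    proof (rule mult_mono[OF mult_left_mono[OF _ \<tau>] r2])
     have "abs (Fr f (of_int n / real c)) <= 2 * pi * (4 * C + 2 * B * (ln (real c) + 1))" using n c1 by (intro Fr_bound) (auto simp: I_def)
     also have "... <= 2 * pi * (4 * C + 2 * B * (ln (real M) + 1))" using l B0 by (intro mult_left_mono add_left_mono add_right_mono) auto
     finally show "abs (Fr f (of_int n / real c)) <= 2 * pi * (4 * C + 2 * B * (ln (real M) + 1))" .
     show "0 <= \<tau> * (2 * pi * (4 * C + 2 * B * (ln (real M) + 1)))" using \<tau> C0 B0 l by (intro mult_nonneg_nonneg add_nonneg_nonneg) auto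
    qed (use r1 in auto)
    also have "... <= h" using elim(1) by simp
    finally show ?thesis using n1 by (simp add: indicator_def)
   qed
  qed
  have cardI: "real (card (I c)) <= 2 * real M" if "c : Bc q d M" for c unfolding I_def by (rule card_row_le[OF that X01 L1])
  have row: "(\<Sum>n\<in>I c. 2 * ind (E c) n + (if real c <= h * real M then 2 else 0) + h) <= 2 * (2 * (h * real M + 1)) + (if real c <= h * real M then 2 else 0) * (2 * real M) + h * (2 * real M)"
   if c: "c : Bc q d M" for c
  proof -
   have c1: "real c <= real M" using c by (auto simp: Bc_def)
   have cE: "real (card (E c)) <= 2 * (h * real M + 1)"
   proof -
    have s: "real c * X0 <= real c * (X0 + h)" "real c * (X1 - h) <= real c * X1" using h by (auto intro!: mult_left_mono)
    have "real c * h <= h * real M" using mult_left_mono[OF c1, of h] h by (simp add: mult.commute)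
    moreover have "card (E c) <= card {n::int. True & real c * X0 <= of_int n & of_int n <= real c * (X0 + h)} + card {n::int. True & real c * (X1 - h) <= of_int n & of_int n <= real c * X1}"
     unfolding E_def by (rule card_Un_le)
    ultimately show ?thesis using card_interval_le[OF s(1), of "%_. True"] card_interval_le[OF s(2), of "%_. True"] by (simp add: algebra_simps)
   qed
   have "(\<Sum>n\<in>I c. ind (E c) n :: real) = real (card (I c \<inter> E c))" using fI by (simp add: indicator_def sum.If_cases)
   also have "... <= real (card (E c))" using fI by (intro of_nat_mono card_mono) auto
   finally have e: "(\<Sum>n\<in>I c. ind (E c) n :: real) <= 2 * (h * real M + 1)" using cE by linarith
   have "(\<Sum>n\<in>I c. 2 * ind (E c) n + (if real c <= h * real M then 2 else 0) + h)
    = 2 * (\<Sum>n\<in>I c. ind (E c) n) + (if real c <= h * real M then 2 else 0) * real (card (I c)) + h * real (card (I c))"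
    by (simp add: sum.distrib sum_distrib_left)
   also have "... <= 2 * (2 * (h * real M + 1)) + (if real c <= h * real M then 2 else 0) * (2 * real M) + h * (2 * real M)"
    using e cardI[OF c] h by (intro add_mono mult_left_mono) auto
   finally show ?thesis .
  qed
  have "norm ((\<Sum>(c,n)\<in>Sf q d X0 X1 M. s c n) - Wt d (\<tau> / sqrt (ln (real M))) M) <= (\<Sum>c\<in>Bc q d M. \<Sum>n\<in>I c. 2 * ind (E c) n + (if real c <= h * real M then 2 else 0) + h)"
   unfolding S1 S2 sum_subtractf[symmetric] by (intro sum_norm_le) (rule pt)
  also have "... <= (\<Sum>c\<in>Bc q d M. 2 * (2 * (h * real M + 1)) + (if real c <= h * real M then 2 else 0) * (2 * real M) + h * (2 * real M))"
   by (rule sum_mono) (rule row)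
  \<comment> \<open>Per denominator, \<open>4 h M\<close> and the constant 4 come from the edges and
    \<open>2 h M\<close> from the phases. Small denominators are collected separately because the
    bound for them is only useful through their number.\<close>
  also have "... = (\<Sum>c\<in>Bc q d M. (6 * h * real M + 4)) + (\<Sum>c\<in>Bc q d M. if real c <= h * real M then 4 * real M else 0)"
   unfolding sum.distrib[symmetric] by (rule sum.cong) auto
  also have "... <= real M * (6 * h * real M + 4) + h * real M * (4 * real M)"
  proof (rule add_mono)
   show "(\<Sum>c\<in>Bc q d M. (6 * h * real M + 4)) <= real M * (6 * h * real M + 4)"
    unfolding sum_constant using card_Bc[of q d M] h by (intro mult_right_mono) auto
   have "(\<Sum>c\<in>Bc q d M. if real c <= h * real M then 4 * real M else 0) = real (card (Bc q d M \<inter> {c. real c <= h * real M})) * (4 * real M)"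
    by (simp add: sum.If_cases)
   also have "... <= h * real M * (4 * real M)"
   proof (rule mult_right_mono)
    have "card (Bc q d M \<inter> {c. real c <= h * real M}) <= card {1..nat \<lfloor>h * real M\<rfloor>}"
     by (rule card_mono) (auto simp: Bc_def le_nat_floor)
    thus "real (card (Bc q d M \<inter> {c. real c <= h * real M})) <= h * real M" using elim(2) by simp linarith
   qed simp
   finally show "(\<Sum>c\<in>Bc q d M. if real c <= h * real M then 4 * real M else 0) <= h * real M * (4 * real M)" .
  qed
  also have "... = 10 * h * (real M)^2 + 4 * real M" by (simp add: power2_eq_square algebra_simps)
  also have "... <= 11 * h * (real M)^2" using elim(3) by simp
  finally show ?case by (simp only: s_def)
 qed
qed

end

section \<open>Convergence in distribution\<close>

lemma (in cusp) Fr_periodic: "Fr f (r + of_int k) = Fr f r"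
proof -
 have g: "(1,k,0,1) : Gamma0 q" by (simp add: Gamma0_def SL2Z_def)
 have per: "f (z + of_int k) = f z" if "z : UHP" for z
 proof -
  have "f (moeb (1,k,0,1) z) = (jfac (1,k,0,1) z)^2 * f z" using cf g that unfolding cusp_form2_def by blast
  thus ?thesis by (simp add: moeb_def jfac_def)
 qed
 have "Im (f (cor (r + of_int k) + \<i> * cor t)) = Im (f (cor r + \<i> * cor t))" if "t : {0<..}" for t
  using per[of "cor r + \<i> * cor t"] that by (simp add: UHP_def algebra_simps)
 hence "(LINT t:{0<..}|lb. Im (f (cor (r + of_int k) + \<i> * cor t))) = (LINT t:{0<..}|lb. Im (f (cor r + \<i> * cor t)))"
  by (intro set_lebesgue_integral_cong) auto
 thus ?thesis by (simp add: Fr_def)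
qed

definition redfrac :: "nat \<times> int => int \<times> int" where "redfrac = (%(c,n). (n mod int c, int c))"

lemma finite_QdI: "finite (QdI q d J M)"
 by (rule finite_subset[of _ "{0..int M} \<times> {0..int M}"]) (auto simp: QdI_def)

text \<open>An open interval of length at most 1 contains no two points differing by a nonzero
  integer, so reduction modulo 1 is injective. It misses only fractions at the two end points, at
  most one per denominator and end point.\<close>

lemma QdI_redfrac:
 assumes x: "x0 < x1" "x1 - x0 <= 1" and J: "{x0<..<x1} <= J" "J <= {x0..x1}"
 shows "inj_on redfrac (Sf q d x0 x1 M)" "redfrac ` Sf q d x0 x1 M <= QdI q d J M"
  and "card (QdI q d J M - redfrac ` Sf q d x0 x1 M) <= 2 * M"
proof -
 have res: "n = n'" if "abs (n - n') < c" "n mod c = n' mod c" for n n' c :: int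
 proof (rule ccontr)
  assume "n ~= n'"
  moreover have "c dvd n - n'" using that(2) by (simp add: mod_eq_dvd_iff)
  ultimately have "abs c <= abs (n - n')" using dvd_imp_le_int by simp
  thus False using that(1) by linarith
 qed
 show "inj_on redfrac (Sf q d x0 x1 M)"
 proof (rule inj_onI)
  fix z w assume zw: "z : Sf q d x0 x1 M" "w : Sf q d x0 x1 M" "redfrac z = redfrac w"
  obtain c n c' n' where e: "z = (c,n)" "w = (c',n')" by (cases z; cases w) auto
  have cc: "c = c'" and md: "n mod int c = n' mod int c" using zw(3) by (auto simp: e redfrac_def)
  have b: "real c * x0 < of_int n" "of_int n < real c * x1" "real c * x0 < of_int n'" "of_int n' < real c * x1"
   using zw(1,2) by (auto simp: e cc Sf_def)
  have "real c * (x1 - x0) <= real c * 1" using x by (intro mult_left_mono) auto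
  hence "real c * x1 - real c * x0 <= real c" by (simp add: algebra_simps)
  hence "abs (of_int n - of_int n') < real c" using b by linarith
  hence "roi (abs (n - n')) < roi (int c)" by simp
  hence "abs (n - n') < int c" by (simp only: of_int_less_iff)
  from res[OF this md] show "z = w" by (simp add: e cc)
 qed
 show "redfrac ` Sf q d x0 x1 M <= QdI q d J M"
 proof
  fix w assume "w : redfrac ` Sf q d x0 x1 M"
  then obtain c n where cn: "(c,n) : Sf q d x0 x1 M" and w: "w = (n mod int c, int c)" by (auto simp: redfrac_def)
  have c: "1 <= c" "c <= M" "gcd c q = d" "coprime n (int c)" "real c * x0 < of_int n" "of_int n < real c * x1" using cn by (auto simp: Sf_def Bc_def)
  have "of_int n / real c : {x0<..<x1}" using c by (auto simp: field_simps)
  moreover have "roi (n mod int c) / roi (int c) + roi (n div int c) = of_int n / real c"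
  proof -
   have "roi n = roi (n div int c) * real c + roi (n mod int c)"
    by (metis div_mult_mod_eq of_int_add of_int_mult of_int_of_nat_eq)
   thus ?thesis using c(1) by (simp add: field_simps)
  qed
  ultimately have "EX k::int. roi (n mod int c) / roi (int c) + roi k : J" using J(1) by (metis subsetD)
  moreover have "gcd (n mod int c) (int c) = 1" using c(4) by (metis coprime_iff_gcd_eq_1 gcd.commute gcd_red_int)
  moreover have "gcd (int c) (int q) = int d" using c(3) by simp
  ultimately show "w : QdI q d J M" using c(1,2) by (simp add: w QdI_def)
 qed
 define E where "E = (%x::real. {(a,c) : QdI q d J M. EX k::int. roi a / roi c + roi k = x})"
 have cE: "card (E x) <= M" for x
 proof -
  have "inj_on snd (E x)"
  proof (rule inj_onI)
   fix z w assume zw: "z : E x" "w : E x" "snd z = snd w"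
   obtain a c a' where e: "z = (a,c)" "w = (a',c)" using zw(3) by (cases z; cases w) auto
   have c: "1 <= c" "0 <= a" "a < c" "0 <= a'" "a' < c" using zw(1,2) by (auto simp: e E_def QdI_def)
   obtain k k' :: int where "roi a / roi c + roi k = x" "roi a' / roi c + roi k' = x"
    using zw(1,2) by (auto simp: e E_def)
   hence "roi a / roi c + roi k = roi a' / roi c + roi k'" by simp
   hence "roi (a + k * c) = roi (a' + k' * c)" using c(1) by (simp add: field_simps)
   hence "a + k * c = a' + k' * c" by (simp only: of_int_eq_iff)
   hence "(a + k * c) mod c = (a' + k' * c) mod c" by simp
   hence "a = a'" using c by simp
   thus "z = w" by (simp add: e)
  qed
  moreover have "snd ` E x <= {1..int M}" by (auto simp: E_def QdI_def)
  ultimately have "card (E x) <= card {1..int M}" by (rule card_inj_on_le) simp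
  thus ?thesis by simp
 qed
 have "QdI q d J M - redfrac ` Sf q d x0 x1 M <= E x0 \<union> E x1"
 proof
  fix w assume w: "w : QdI q d J M - redfrac ` Sf q d x0 x1 M"
  obtain a c where wac: "w = (a,c)" by (cases w)
  have ac: "1 <= c" "c <= int M" "0 <= a" "a < c" "gcd a c = 1" "gcd c (int q) = int d" using w by (auto simp: wac QdI_def)
  obtain k :: int where k: "roi a / roi c + roi k : J" using w by (auto simp: wac QdI_def)
  let ?x = "roi a / roi c + roi k"
  have "?x = x0 \<or> ?x = x1"
  proof (rule ccontr)
   assume "~ (?x = x0 \<or> ?x = x1)"
   moreover have "?x : {x0..x1}" using k J(2) by blast
   ultimately have xx: "x0 < ?x" "?x < x1" by auto
   define m where "m = nat c"
   have cm: "c = int m" using ac by (simp add: m_def)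
   have rx: "?x = (roi (a + k * c)) / real m" using ac(1) by (simp add: cm field_simps)
   have m0: "real m > 0" using ac(1) by (simp add: cm)
   have "gcd (a + k * c) c = 1" using ac(5) by (metis gcd.commute gcd_add_mult add.commute mult.commute)
   hence "coprime (a + k * c) (int m)" by (simp add: cm coprime_iff_gcd_eq_1)
   moreover have "gcd m q = d" using ac(6) unfolding cm by simp
   moreover have "real m * x0 < of_int (a + k * c)" "of_int (a + k * c) < real m * x1" using xx unfolding rx using m0 by (simp_all add: field_simps)
   ultimately have "(m, a + k * c) : Sf q d x0 x1 M" using ac(1,2) by (simp add: Sf_def Bc_def cm)
   moreover have "redfrac (m, a + k * c) = w" using ac by (simp add: redfrac_def wac cm[symmetric])
   ultimately show False using w by (metis DiffD2 image_eqI)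
  qed
  thus "w : E x0 \<union> E x1" using w wac by (auto simp: E_def)
 qed
 moreover have "finite (E x)" for x by (rule finite_subset[OF _ finite_QdI]) (auto simp: E_def)
 ultimately have "card (QdI q d J M - redfrac ` Sf q d x0 x1 M) <= card (E x0 \<union> E x1)" by (intro card_mono) auto
 also have "... <= card (E x0) + card (E x1)" by (rule card_Un_le)
 finally show "card (QdI q d J M - redfrac ` Sf q d x0 x1 M) <= 2 * M" using cE[of x0] cE[of x1] by linarith
qed

context cdata
begin

text \<open>The unweighted sum is approximated by the smooth one at frequency \<open>\<tau>\<close>,
  then by \<open>E0\<close> times the smooth one at frequency zero, then by \<open>E0\<close> times
  the number of fractions. Each error is a multiple of \<open>h M\<^sup>2\<close>, and the number of
  fractions is at least a multiple of \<open>M\<^sup>2\<close>.\<close>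

lemma exp_sum_asymp:
 assumes pet: "petersson_sq D f > 0" and vol: "hyp_vol D > 0" and d: "d dvd q"
  and x: "x0 < x1" "x1 - x0 <= 1" and J: "{x0<..<x1} <= J" "J <= {x0..x1}" and t: "t >= 0"
 shows "(%M. (\<Sum>(a,c)\<in>QdI q d J M. cis (t * normalized_symbol (C_const D f) f (roi a / roi c) c)) / of_nat (card (QdI q d J M)))
  \<longlonglongrightarrow> cor (exp (- (t^2) / 2))"
proof -
 define K where "K = abs (C_const D f)"
 have Kv: "K = 16 * pi^2 * (petersson_sq D f / hyp_vol D)" using pet vol by (simp add: K_def C_const_def abs_mult)
 have K0: "K > 0" using pet vol by (simp add: Kv)
 \<comment> \<open>Since \<open>|C_f| = 16 \<pi>\<^sup>2 V\<close>, this normalisation turns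
   \<open>8 \<pi>\<^sup>2 V \<tau>\<^sup>2\<close> into \<open>t\<^sup>2 / 2\<close>.\<close>
 define \<tau> where "\<tau> = t / sqrt K"
 have \<tau>0: "\<tau> >= 0" using t K0 by (simp add: \<tau>_def)
 define g where "g = (%(a,c). cis (t * normalized_symbol (C_const D f) f (roi a / roi c) c))"
 define E0 where "E0 = exp (- (t^2) / 2)"
 have E0: "0 <= E0" "E0 <= 1" by (auto simp: E0_def)
 define s where "s = (%\<tau> (c::nat,n::int). cis (\<tau> / sqrt (ln (real c)) * Fr f (of_int n / real c)))"
 have gs: "g (redfrac (c,n)) = s \<tau> (c,n)" if "(c,n) : Sf q d x0 x1 M" for c n M
 proof -
  have c1: "c >= 1" using that by (auto simp: Sf_def Bc_def)
  have "roi n = roi (n div int c) * real c + roi (n mod int c)"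
   by (metis div_mult_mod_eq of_int_add of_int_mult of_int_of_nat_eq)
  hence "of_int n / real c = roi (n mod int c) / real c + of_int (n div int c)" using c1 by (simp add: field_simps)
  hence "Fr f (of_int n / real c) = Fr f (roi (n mod int c) / real c)" by (simp only: Fr_periodic)
  thus ?thesis by (simp add: g_def s_def redfrac_def normalized_symbol_Fr K_def[symmetric] \<tau>_def real_sqrt_mult)
 qed
 obtain \<kappa> where \<kappa>: "\<kappa> > 0" "EV M. \<kappa> * (real M)^2 <= real (card (Sf q d x0 x1 M))"
  using card_Sf_lower[OF q1 d x] by blast
 have main: "EV M. norm (sum g (QdI q d J M) - cor E0 * of_nat (card (QdI q d J M))) <= \<epsilon> * real (card (QdI q d J M)) & QdI q d J M ~= {}"
  if \<epsilon>: "\<epsilon> > 0" for \<epsilon>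
 proof -
  \<comment> \<open>The first two bounds make room for the bump. The third pays for errors of 11, 1
    and 11 times \<open>h M\<^sup>2\<close>, and one more for the end points and their effect on the
    cardinality.\<close>
  define h where "h = min (1 / 2) (min ((x1 - x0) / 3) (\<epsilon> * \<kappa> / 24))"
  have h: "h > 0" "h < 1" "2 * h < x1 - x0" "24 * h <= \<epsilon> * \<kappa>" using x \<epsilon> \<kappa> by (auto simp: h_def min_def)
  obtain \<psi> \<psi>1 \<psi>2 Lp Mp where b: "bump \<psi> \<psi>1 \<psi>2 x0 x1 Lp Mp" and one: "ALL x:{x0+h..x1-h}. \<psi> x = 1"
   using bump_exists[OF h(1,3)] by blast
  interpret cbump q D f G B C \<psi> \<psi>1 \<psi>2 x0 x1 Lp Mp
   using b by (intro cbump.intro cdata_axioms)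
  have ex: "exp (- 8 * pi^2 * V * \<tau>^2) = E0"
  proof -
   have "\<tau>^2 = t^2 / K" using K0 by (simp add: \<tau>_def power_divide)
   moreover have "V = K / (16 * pi^2)" by (simp add: Kv V_def)
   ultimately have "V * \<tau>^2 = t^2 / (16 * pi^2)" using K0 by simp
   hence "- 8 * pi^2 * V * \<tau>^2 = - 8 * pi^2 * (t^2 / (16 * pi^2))" by (simp only: mult.assoc)
   also have "... = - (t^2) / 2" by simp
   finally have "- 8 * pi^2 * V * \<tau>^2 = - (t^2) / 2" .
   thus ?thesis by (simp add: E0_def)
  qed
  note e1 = Wt_asymp[OF vol \<tau>0 h(1), of d, unfolded ex]
  note e2 = Sf_vs_Wt[OF h(1,2) one x(2) h(3) \<tau>0, of d]
  note e3 = Sf_vs_Wt[OF h(1,2) one x(2) h(3) order_refl, of d]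
  have e4: "EV M::nat. 4 * real M <= h * (real M)^2" using h(1) by real_asymp
  show ?thesis using e1 e2 e3 e4 \<kappa>(2) eventually_ge_at_top[of 1]
  proof eventually_elim
   case (elim M)
   let ?Q = "QdI q d J M" and ?S = "Sf q d x0 x1 M" and ?W = "Wt d (\<tau> / sqrt (ln (real M))) M" and ?Z = "Wt d 0 M"
   note R = QdI_redfrac[OF x J, of q d M]
   have cS: "card (redfrac ` ?S) = card ?S" by (rule card_image[OF R(1)])
   have split: "?Q = redfrac ` ?S \<union> (?Q - redfrac ` ?S)" using R(2) by blast
   have cQ: "card ?Q = card ?S + card (?Q - redfrac ` ?S)"
    using card_Un_disjoint[of "redfrac ` ?S" "?Q - redfrac ` ?S"] finite_QdI[of q d J M] split cS by simp
   have "sum g ?Q = sum g (redfrac ` ?S) + sum g (?Q - redfrac ` ?S)"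
    using sum.union_disjoint[of "redfrac ` ?S" "?Q - redfrac ` ?S" g] finite_QdI[of q d J M] split by simp
   moreover have "sum g (redfrac ` ?S) = (\<Sum>z\<in>?S. g (redfrac z))" by (simp add: sum.reindex[OF R(1)])
   moreover have "(\<Sum>z\<in>?S. g (redfrac z)) = sum (s \<tau>) ?S" by (rule sum.cong) (use gs in auto)
   ultimately have sQ: "sum g ?Q - sum (s \<tau>) ?S = sum g (?Q - redfrac ` ?S)" by simp
   have "norm (sum g (?Q - redfrac ` ?S)) <= of_nat (card (?Q - redfrac ` ?S)) * 1"
    by (rule sum_norm_bound) (auto simp: g_def)
   hence n1: "norm (sum g ?Q - sum (s \<tau>) ?S) <= 2 * real M" unfolding sQ using R(3) by simp
   have n2: "norm (sum (s \<tau>) ?S - ?W) <= 11 * h * (real M)^2" using elim(2) by (simp add: s_def)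
   have n3: "norm (?W - cor E0 * ?Z) <= h * (real M)^2" using elim(1) by simp
   have n4: "norm (?Z - of_nat (card ?S)) <= 11 * h * (real M)^2" using elim(3) by (simp add: norm_minus_commute case_prod_unfold)
   have n5: "norm (of_nat (card ?S) - of_nat (card ?Q) :: complex) <= 2 * real M"
   proof -
    have "(of_nat (card ?S) - of_nat (card ?Q) :: complex) = - of_nat (card (?Q - redfrac ` ?S))" by (simp add: cQ)
    hence "norm (of_nat (card ?S) - of_nat (card ?Q) :: complex) = real (card (?Q - redfrac ` ?S))" by simp
    thus ?thesis using R(3) by simp
   qed
   have sc: "norm (cor E0 * w) <= r" if "norm w <= r" for w r
    unfolding norm_mult norm_of_real using E0 that mult_mono[of E0 1 "norm w" r] by simp
   have "sum g ?Q - cor E0 * of_nat (card ?Q) = (sum g ?Q - sum (s \<tau>) ?S) + (sum (s \<tau>) ?S - ?W) + (?W - cor E0 * ?Z)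
     + cor E0 * (?Z - of_nat (card ?S)) + cor E0 * (of_nat (card ?S) - of_nat (card ?Q))" by (simp add: algebra_simps)
   also have "norm ... <= 2 * real M + 11 * h * (real M)^2 + h * (real M)^2 + 11 * h * (real M)^2 + 2 * real M"
    by (intro norm_triangle_le[OF add_mono] n1 n2 n3 sc n4 n5)
   also have "... <= 24 * h * (real M)^2" using elim(4) by simp
   also have "... <= (\<epsilon> * \<kappa>) * (real M)^2" using h(4) by (intro mult_right_mono) auto
   also have "... <= \<epsilon> * real (card ?S)" using elim(5) \<epsilon> by (simp add: mult.assoc)
   also have "... <= \<epsilon> * real (card ?Q)" using cQ \<epsilon> by simp
   finally have "norm (sum g ?Q - cor E0 * of_nat (card ?Q)) <= \<epsilon> * real (card ?Q)" .
   moreover have "?Q ~= {}"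
   proof
    assume "?Q = {}"
    hence "card ?S = 0" using cQ by simp
    moreover have "\<kappa> * (real M)^2 > 0" using \<kappa>(1) elim(6) by simp
    ultimately show False using elim(5) by simp
   qed
   ultimately show ?case by blast
  qed
 qed
 show ?thesis unfolding g_def[symmetric] E0_def[symmetric]
 proof (rule tendstoI)
  fix \<epsilon> :: real assume \<epsilon>: "\<epsilon> > 0"
  have "EV M. norm (sum g (QdI q d J M) - cor E0 * of_nat (card (QdI q d J M))) <= \<epsilon> / 2 * real (card (QdI q d J M)) & QdI q d J M ~= {}"
   using \<epsilon> by (intro main) simp
  thus "EV M. dist (sum g (QdI q d J M) / of_nat (card (QdI q d J M))) (cor E0) < \<epsilon>"
  proof eventually_elim
   case (elim M)
   define N where "N = real (card (QdI q d J M))"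
   have N: "N > 0" using elim finite_QdI[of q d J M] by (simp add: N_def card_gt_0_iff)
   have "sum g (QdI q d J M) / of_nat (card (QdI q d J M)) - cor E0 = (sum g (QdI q d J M) - cor E0 * of_nat (card (QdI q d J M))) / cor N"
    using N by (simp add: N_def field_simps)
   hence "dist (sum g (QdI q d J M) / of_nat (card (QdI q d J M))) (cor E0) = norm (sum g (QdI q d J M) - cor E0 * of_nat (card (QdI q d J M))) / N"
    using N by (simp add: dist_norm norm_divide)
   also have "... <= \<epsilon> / 2 * N / N" using elim N by (intro divide_right_mono) (auto simp: N_def)
   also have "... < \<epsilon>" using N \<epsilon> by simp
   finally show ?case .
  qed
 qed
qed

end

text \<open>The inclusion also covers infinite end points, which \<open>real_of_ereal\<close> sends
  to 0: they add no frontier point, and the set on the right remains finite.\<close>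

lemma frontier_ereal_interval:
 fixes a0 b0 :: ereal
 defines "A \<equiv> {t::real. a0 <= ereal t & ereal t <= b0}"
 shows "A : sets borel" "frontier A <= {real_of_ereal a0, real_of_ereal b0}"
proof -
 have "closed A" unfolding A_def by (intro closed_Collect_conj closed_Collect_le continuous_intros)
 thus "A : sets borel" by (rule borel_closed)
 have "open {t::real. a0 < ereal t & ereal t < b0}" by (intro open_Collect_conj open_Collect_less continuous_intros)
 moreover have "{t::real. a0 < ereal t & ereal t < b0} <= A" by (auto simp: A_def)
 ultimately have i: "{t::real. a0 < ereal t & ereal t < b0} <= interior A" by (rule interior_maximal[rotated])
 show "frontier A <= {real_of_ereal a0, real_of_ereal b0}"
 proof
  fix t assume "t : frontier A"
  hence t: "t : A" "t \<notin> interior A" using \<open>closed A\<close> by (auto simp: frontier_def)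
  hence "~ (a0 < ereal t & ereal t < b0)" using i by blast
  hence "a0 = ereal t \<or> b0 = ereal t" using t(1) by (auto simp: A_def)
  thus "t : {real_of_ereal a0, real_of_ereal b0}" by auto
 qed
qed

lemma std_normal_null: "finite S ==> emeasure std_normal_distribution S = 0"
 by (simp add: emeasure_density finite_imp_null_set_lborel nn_integral_null_set borel_closed finite_imp_closed)

lemma std_normal_measure:
 assumes [measurable]: "A : sets borel"
 shows "measure std_normal_distribution A = (LINT t:A|lb. exp (- (t\<^sup>2) / 2)) / sqrt (2 * pi)"
proof -
 interpret real_distribution std_normal_distribution by (rule real_dist_normal_dist)
 have "measure std_normal_distribution A = (LINT x|std_normal_distribution. ind A x)" by simp
 also have "... = (LINT x|lb. std_normal_density x * ind A x)"
  by (subst integral_density) auto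
 also have "... = (LINT x|lb. (ind A x *\<^sub>R exp (- (x\<^sup>2) / 2)) / sqrt (2 * pi))"
  by (rule Bochner_Integration.integral_cong) (simp_all add: std_normal_density_def)
 finally show ?thesis by (simp add: set_lebesgue_integral_def)
qed

theorem theorem1p6:
  fixes q d :: nat and f :: "complex \<Rightarrow> complex" and D :: "complex set"
    and J :: "real set" and x0 x1 :: real and a0 b0 :: ereal
  assumes "q \<ge> 1" and "squarefree q"
    and "cusp_form2 q f" and "\<exists>z\<in>UHP. f z \<noteq> 0"
    and "fund_domain q D"
    and "d dvd q"
    and "x0 < x1" and "x1 - x0 \<le> 1" and "{x0<..<x1} \<subseteq> J" and "J \<subseteq> {x0..x1}"
    and "a0 \<le> b0"
  shows "(\<lambda>M. real (card {(a,c) \<in> QdI q d J M.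
                 ereal (normalized_symbol (C_const D f) f (real_of_int a / real_of_int c) c) \<in> {a0..b0}})
              / real (card (QdI q d J M)))
         \<longlonglongrightarrow> (LINT t:{t. a0 \<le> ereal t \<and> ereal t \<le> b0}|lborel. (exp (- (t\<^sup>2) / 2))) / sqrt (2 * pi)"
proof -
 interpret fdom q D using assms by (simp add: fdom_def)
 interpret cusp q f using assms by (simp add: cusp_def)
 from cusp_data obtain G B C where gbc: "C >= 0" "B >= 0"
  "ALL z:UHP. (G has_field_derivative f z) (at z)" "ALL z:UHP. Im z * norm (f z) <= B"
  "ALL s:SL2Z. EX L. ALL z. Im z >= 1/2 --> norm (G (moeb s z) - L) <= C / Im z"
  "ALL z. Im z >= 1/2 --> norm (G z) <= C / Im z"
  "ALL s:SL2Z. ALL z. Im z >= 1/2 --> norm (fs f s z) <= C / (Im z)^2"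
  by blast
 interpret cdata q D f G B C
  by unfold_locales (use gbc in blast)+
 have pos: "petersson_sq D f > 0" "hyp_vol D > 0" using petersson_pos assms(4) by auto
 define X where "X = (%(a,c). normalized_symbol (C_const D f) f (roi a / roi c) c)"
 define Q where "Q = QdI q d J"
 have finQ: "finite (Q M)" for M by (simp add: Q_def finite_QdI)
 define \<mu> where "\<mu> = (%M. distr (measure_pmf (pmf_of_set (Q M))) borel X)"
 have lim: "(%M. (\<Sum>p\<in>Q M. cis (t * X p)) / of_nat (card (Q M))) \<longlonglongrightarrow> cor (exp (- (t^2) / 2))" if "t >= 0" for t
  using exp_sum_asymp[OF pos assms(6-10) that] by (simp add: Q_def X_def case_prod_unfold)
 have lim': "(%M. (\<Sum>p\<in>Q M. cis (t * X p)) / of_nat (card (Q M))) \<longlonglongrightarrow> cor (exp (- (t^2) / 2))" for t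
 proof (cases "t >= 0")
  case False
  \<comment> \<open>Negative frequencies follow by complex conjugation, as the limit is real and
    even.\<close>
  have "(%M. cnj ((\<Sum>p\<in>Q M. cis (- t * X p)) / of_nat (card (Q M)))) \<longlonglongrightarrow> cnj (cor (exp (- ((- t)^2) / 2)))"
   using False by (intro tendsto_cnj lim) simp
  thus ?thesis by (simp add: cis_cnj)
 qed (rule lim)
 \<comment> \<open>At frequency 0 the quotient tends to 1, whereas for an empty set it is 0 by the
   convention for division by zero.\<close>
 have ne: "EV M. Q M ~= {}"
 proof -
  have "(%M. (\<Sum>p\<in>Q M. cis (0 * X p)) / of_nat (card (Q M))) \<longlonglongrightarrow> 1" using lim'[of 0] by simp
  hence "EV M. (\<Sum>p\<in>Q M. cis (0 * X p)) / of_nat (card (Q M)) ~= 0"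
   by (rule tendsto_imp_eventually_ne) simp
  thus ?thesis by eventually_elim auto
 qed
 have char: "char (\<mu> M) t = (\<Sum>p\<in>Q M. cis (t * X p)) / of_nat (card (Q M))" if "Q M ~= {}" for M t
 proof -
  have "char (\<mu> M) t = (CLINT p|measure_pmf (pmf_of_set (Q M)). cis (t * X p))"
   unfolding char_def \<mu>_def by (subst integral_distr) (auto simp: cis_conv_exp)
  also have "... = (\<Sum>p\<in>Q M. pmf (pmf_of_set (Q M)) p *\<^sub>R cis (t * X p))"
   by (rule integral_measure_pmf[OF finQ]) (use that finQ in \<open>simp add: set_pmf_of_set\<close>)
  also have "... = (\<Sum>p\<in>Q M. cis (t * X p) / of_nat (card (Q M)))"
   by (rule sum.cong) (use that finQ in \<open>auto simp: pmf_of_set scaleR_conv_of_real\<close>)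
  finally show ?thesis by (simp add: sum_divide_distrib)
 qed
 have dist: "real_distribution (\<mu> M)" for M
  unfolding \<mu>_def real_distribution_def real_distribution_axioms_def by (auto intro!: measure_pmf.prob_space_distr)
 have wc: "weak_conv_m \<mu> std_normal_distribution"
 proof (rule levy_continuity[OF dist real_dist_normal_dist])
  fix t
  have "EV M. (\<Sum>p\<in>Q M. cis (t * X p)) / of_nat (card (Q M)) = char (\<mu> M) t"
   using ne by eventually_elim (simp add: char)
  with lim'[of t] show "(%M. char (\<mu> M) t) \<longlonglongrightarrow> char std_normal_distribution t"
   unfolding char_std_normal_distribution by (rule Lim_transform_eventually)
 qed
 define A where "A = {t::real. a0 <= ereal t & ereal t <= b0}"
 have Am: "A : sets borel" unfolding A_def by (rule frontier_ereal_interval)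
 \<comment> \<open>The limit law gives no mass to the end points, so the interval is a continuity
   set and weak convergence yields convergence of its probabilities.\<close>
 have "emeasure std_normal_distribution (frontier A) = 0"
  unfolding A_def by (rule std_normal_null, rule finite_subset[OF frontier_ereal_interval(2)]) simp
 hence "(%M. measure (\<mu> M) A) \<longlonglongrightarrow> measure std_normal_distribution A"
  by (intro weak_conv_imp_continuity_set_conv[OF dist real_dist_normal_dist wc Am])
 moreover have "EV M. measure (\<mu> M) A = real (card {(a,c) : QdI q d J M.
        ereal (normalized_symbol (C_const D f) f (roi a / roi c) c) : {a0..b0}})
       / real (card (QdI q d J M))"
  using ne
 proof eventually_elim
  case (elim M)
  have "measure (\<mu> M) A = measure (measure_pmf (pmf_of_set (Q M))) (X -` A)"
   unfolding \<mu>_def using Am by (subst measure_distr) auto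
  also have "... = real (card (Q M \<inter> X -` A)) / real (card (Q M))" by (rule measure_pmf_of_set[OF elim finQ])
  also have "Q M \<inter> X -` A = {(a,c) : QdI q d J M. ereal (normalized_symbol (C_const D f) f (roi a / roi c) c) : {a0..b0}}"
   by (auto simp: Q_def X_def A_def)
  finally show ?case by (simp only: Q_def)
 qed
 ultimately show ?thesis unfolding std_normal_measure[OF Am] unfolding A_def by (rule Lim_transform_eventually)
qed

end
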